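(* Let $A$ be an associative unital algebra over a field $\mathbf{k}$, let $(P,\mu_P)$ be an $A^e$-projective resolution of $A$ with a left contracting homotopy $(t_P,\eta_P)$, and let $t_L$, $\eta_L$, $\mu_R$ and $S=(1_{P\otimes_AP}+t_Ld_R)^{-1}$ be the maps defined in the context. Then the map $$-Tr(\mu_RSt_L)\,\sigma_{P,P}\,Tr\big((1_P\otimes(\mu_RS\eta_L)^2)S\eta_L\big):Tr(P)\to Tr(P[1])$$ induces the Connes' differential on the Hochschild homology $\mathrm{HH}_*(A)$.
   Context: Complexes. $A^e=A\otimes_{\mathbf{k}}A^{op}$, $\otimes=\otimes_{\mathbf{k}}$ for vector spaces. An $A^e$-complex is a $\mathbb{Z}$-graded $A$-bimodule $P=\bigoplus_n P_n$ with a bimodule differential $d_P$ of degree $-1$. $P[t]$ is the complex with $P[t]_n=P_{t+n}$ and $d_{P[t]}=(-1)^td_P$. Maps of complexes are degree-preserving bimodule homomorphisms (not necessarily commuting with differentials). For $f:P\to P'[n]$, $g:Q\to Q'[m]$, the map $f\otimes g:P\otimes_AQ\to (P'\otimes_AQ')[n+m]$ is $(f\otimes g)(x\otimes y)=(-1)^{im}f(x)\otimes g(y)$ for $x\in P_i$. $P\otimes_AA$ and $A\otimes_AP$ are identified with $P$. An $A^e$-projective resolution $(P,\mu_P)$ of $A$ is an $A^e$-complex $P$ of projective bimodules with $P_n=0$ for $n<0$, $H_n(P)=0$ for $n>0$, and a bimodule map $\mu_P:P_0\to A$ inducing $H_0(P)\cong A$ ($\mu_P$ is extended by zero to $P$).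 A left contracting homotopy for $(P,\mu_P)$ is a pair $(t_P,\eta_P)$ of left $A$-module homomorphisms $t_P:P\to P$, $\eta_P:A\to P$ with $t_P(P_i)\subset P_{i+1}$, $\eta_P(A)\subset P_0$, $d_Pt_P+t_Pd_P+\eta_P\mu_P=1_P$ and $t_P(t_P+\eta_P)=0$. Let $\pi:A\otimes P\to P$, $\pi(a\otimes x)=ax$, and let $\iota:P\to A\otimes P$ be a fixed graded $A$-bimodule homomorphism with $\pi\iota=1_P$. Identifying $P\otimes_A(A\otimes P)$ with $P\otimes P$, define $t_L=(1_P\otimes\pi)(t_P\otimes1_P)(1_P\otimes\iota):P\otimes_AP\to(P\otimes_AP)[1]$, $\eta_L=(1_P\otimes\pi)(\eta_P\otimes1_P)\iota:P\to P\otimes_AP$, $d_R=1_P\otimes d_P:P\otimes_AP\to(P\otimes_AP)[-1]$ (so $d_R(x\otimes y)=(-1)^ix\otimes d_P(y)$ for $x\in P_i$), $\mu_R=1_P\otimes\mu_P:P\otimes_AP\to P$. The map $t_Ld_R$ is locally nilpotent, so $1_{P\otimes_AP}+t_Ld_R$ is invertible; $S$ is its inverse. Trace. $Tr=A\otimes_{A^e}-$, and $\sigma_{P,Q}:Tr(P\otimes_AQ)\to Tr(Q\otimes_AP)$ is the isomorphism $\sigma_{P,Q}(1\otimes x\otimes y)=(-1)^{ij}\,1\otimes y\otimes x$ for $x\in P_i$, $y\in Q_j$. Hochschild homology. $\mathrm{HH}_*(A)$ is the homology of $Tr(\mathrm{Bar}(A))$, $\mathrm{Bar}(A)$ being the bar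 resolution ($\mathrm{Bar}_n(A)=A^{\otimes(n+2)}$, $d(a_0\otimes\cdots\otimes a_{n+1})=\sum_{i=0}^n(-1)^ia_0\otimes\cdots\otimes a_ia_{i+1}\otimes\cdots\otimes a_{n+1}$); for any projective bimodule resolution $P$ it is identified with $H_*(Tr(P))$ via the isomorphism induced by comparison chain maps over $A$. With $Tr(\mathrm{Bar}_n(A))\cong A^{\otimes(n+1)}$, the Connes' differential $\mathcal{B}:\mathrm{HH}_n(A)\to\mathrm{HH}_{n+1}(A)$ is induced by $$a_0\otimes\cdots\otimes a_n\mapsto\sum_{i=0}^n(-1)^{in}1\otimes a_i\otimes\cdots\otimes a_n\otimes a_0\otimes\cdots\otimes a_{i-1}+\sum_{i=0}^n(-1)^{in}a_i\otimes1\otimes a_{i+1}\otimes\cdots\otimes a_n\otimes a_0\otimes\cdots\otimes a_{i-1}.$$ *)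

theory Defs
  imports "HOL-Algebra.Free_Abelian_Groups" "HOL-Algebra.AbelCoset" "HOL-Algebra.Module"
begin

section \<open>Abelian groups given by generators and relations\<close>

text \<open>
  As in the abelian group theory of HOL-Algebra, abelian groups are additive and live in the
  record \<^type>\<open>ring\<close>; the multiplicative fields are irrelevant.
\<close>

definition pres_group :: "'x set \<Rightarrow> ('x \<Rightarrow>\<^sub>0 int) set \<Rightarrow> ('x \<Rightarrow>\<^sub>0 int) set ring" where
  "pres_group X R =
     (let F = free_Abelian_group X; Q = F Mod generate F R
      in \<lparr>carrier = carrier Q, mult = undefined, one = undefined, zero = one Q, add = mult Q\<rparr>)"

definition pres_gen :: "'x set \<Rightarrow> ('x \<Rightarrow>\<^sub>0 int) set \<Rightarrow> 'x \<Rightarrow> ('x \<Rightarrow>\<^sub>0 int) set" where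
  "pres_gen X R x = generate (free_Abelian_group X) R #>\<^bsub>free_Abelian_group X\<^esub> frag_of x"

text \<open>
  The homomorphism to \<open>G\<close> with prescribed values \<open>b x\<close> on the generators. It is computed on a
  representative of the coset, so it is meaningful only when \<open>b\<close> respects the relations.
\<close>

definition pres_lift :: "('g, 'z) ring_scheme \<Rightarrow> ('x \<Rightarrow> 'g) \<Rightarrow> ('x \<Rightarrow>\<^sub>0 int) set \<Rightarrow> 'g" where
  "pres_lift G b C =
     (let z = (SOME z. z \<in> C)
      in finsum G (\<lambda>x. add_pow G (Poly_Mapping.lookup z x) (b x)) (Poly_Mapping.keys z))"

definition sgn_elt :: "('g, 'z) ring_scheme \<Rightarrow> int \<Rightarrow> 'g \<Rightarrow> 'g" where
  "sgn_elt G k x = (if even k then x else \<ominus>\<^bsub>G\<^esub> x)"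


section \<open>Algebras, bimodules and graded bimodules\<close>

locale assoc_algebra =
  K?: field K + A?: ring A + KA?: module K A for K (structure) and A (structure) +
  assumes smult_mult_left:
      "\<lbrakk>c \<in> carrier K; a \<in> carrier A; b \<in> carrier A\<rbrakk>
        \<Longrightarrow> (c \<odot>\<^bsub>A\<^esub> a) \<otimes>\<^bsub>A\<^esub> b = c \<odot>\<^bsub>A\<^esub> (a \<otimes>\<^bsub>A\<^esub> b)"
    and smult_mult_right:
      "\<lbrakk>c \<in> carrier K; a \<in> carrier A; b \<in> carrier A\<rbrakk>
        \<Longrightarrow> a \<otimes>\<^bsub>A\<^esub> (c \<odot>\<^bsub>A\<^esub> b) = c \<odot>\<^bsub>A\<^esub> (a \<otimes>\<^bsub>A\<^esub> b)"

text \<open>The left action of a bimodule is the field \<^const>\<open>smult\<close>, the right action is \<open>ract\<close>.\<close>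

record ('a, 'm) bimodule = "('a, 'm) module" +
  ract :: "'m \<Rightarrow> 'a \<Rightarrow> 'm" (infixl \<open>\<triangleleft>\<index>\<close> 70)

record ('a, 'm) graded_bimodule = "('a, 'm) bimodule" +
  grade :: "int \<Rightarrow> 'm set"

record ('a, 'm) bimodule_complex = "('a, 'm) graded_bimodule" +
  diff :: "'m \<Rightarrow> 'm"

text \<open>
  Bimodules over \<open>A\<close> are modules over the enveloping algebra; the two actions of \<open>K\<close> (through
  the unit of \<open>A\<close>) coincide.
\<close>

locale bimodule = abelian_group M for K and A and M (structure) +
  assumes left_closed: "\<lbrakk>a \<in> carrier A; x \<in> carrier M\<rbrakk> \<Longrightarrow> a \<odot> x \<in> carrier M"
    and left_distrib_ring: "\<lbrakk>a \<in> carrier A; b \<in> carrier A; x \<in> carrier M\<rbrakk>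
        \<Longrightarrow> (a \<oplus>\<^bsub>A\<^esub> b) \<odot> x = a \<odot> x \<oplus> b \<odot> x"
    and left_distrib: "\<lbrakk>a \<in> carrier A; x \<in> carrier M; y \<in> carrier M\<rbrakk>
        \<Longrightarrow> a \<odot> (x \<oplus> y) = a \<odot> x \<oplus> a \<odot> y"
    and left_assoc: "\<lbrakk>a \<in> carrier A; b \<in> carrier A; x \<in> carrier M\<rbrakk>
        \<Longrightarrow> (a \<otimes>\<^bsub>A\<^esub> b) \<odot> x = a \<odot> (b \<odot> x)"
    and left_one: "x \<in> carrier M \<Longrightarrow> \<one>\<^bsub>A\<^esub> \<odot> x = x"
    and right_closed: "\<lbrakk>a \<in> carrier A; x \<in> carrier M\<rbrakk> \<Longrightarrow> x \<triangleleft> a \<in> carrier M"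
    and right_distrib_ring: "\<lbrakk>a \<in> carrier A; b \<in> carrier A; x \<in> carrier M\<rbrakk>
        \<Longrightarrow> x \<triangleleft> (a \<oplus>\<^bsub>A\<^esub> b) = x \<triangleleft> a \<oplus> x \<triangleleft> b"
    and right_distrib: "\<lbrakk>a \<in> carrier A; x \<in> carrier M; y \<in> carrier M\<rbrakk>
        \<Longrightarrow> (x \<oplus> y) \<triangleleft> a = x \<triangleleft> a \<oplus> y \<triangleleft> a"
    and right_assoc: "\<lbrakk>a \<in> carrier A; b \<in> carrier A; x \<in> carrier M\<rbrakk>
        \<Longrightarrow> x \<triangleleft> (a \<otimes>\<^bsub>A\<^esub> b) = (x \<triangleleft> a) \<triangleleft> b"
    and right_one: "x \<in> carrier M \<Longrightarrow> x \<triangleleft> \<one>\<^bsub>A\<^esub> = x"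
    and left_right: "\<lbrakk>a \<in> carrier A; b \<in> carrier A; x \<in> carrier M\<rbrakk>
        \<Longrightarrow> (a \<odot> x) \<triangleleft> b = a \<odot> (x \<triangleleft> b)"
    and scalars_central: "\<lbrakk>c \<in> carrier K; x \<in> carrier M\<rbrakk>
        \<Longrightarrow> (c \<odot>\<^bsub>A\<^esub> \<one>\<^bsub>A\<^esub>) \<odot> x = x \<triangleleft> (c \<odot>\<^bsub>A\<^esub> \<one>\<^bsub>A\<^esub>)"

definition left_hom ::
  "('k, 'a, 'z) module_scheme \<Rightarrow> ('a, 'm, 'y) bimodule_scheme \<Rightarrow> ('a, 'n, 'x) bimodule_scheme
    \<Rightarrow> ('m \<Rightarrow> 'n) set" where
  "left_hom A M N = {f \<in> hom (add_monoid M) (add_monoid N).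
     \<forall>a \<in> carrier A. \<forall>x \<in> carrier M. f (a \<odot>\<^bsub>M\<^esub> x) = a \<odot>\<^bsub>N\<^esub> f x}"

definition bimod_hom ::
  "('k, 'a, 'z) module_scheme \<Rightarrow> ('a, 'm, 'y) bimodule_scheme \<Rightarrow> ('a, 'n, 'x) bimodule_scheme
    \<Rightarrow> ('m \<Rightarrow> 'n) set" where
  "bimod_hom A M N = {f \<in> left_hom A M N.
     \<forall>a \<in> carrier A. \<forall>x \<in> carrier M. f (x \<triangleleft>\<^bsub>M\<^esub> a) = f x \<triangleleft>\<^bsub>N\<^esub> a}"

text \<open>\<open>M\<close> is the internal direct sum of the subbimodules \<open>grade M n\<close>.\<close>

definition is_decomposition ::
  "('a, 'm, 'z) graded_bimodule_scheme \<Rightarrow> 'm \<Rightarrow> (int \<Rightarrow> 'm) \<Rightarrow> bool" where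
  "is_decomposition M x c \<longleftrightarrow>
     (\<forall>n. c n \<in> grade M n) \<and> finite {n. c n \<noteq> \<zero>\<^bsub>M\<^esub>} \<and>
     x = (\<Oplus>\<^bsub>M\<^esub>n \<in> {n. c n \<noteq> \<zero>\<^bsub>M\<^esub>}. c n)"

locale graded_bimodule = bimodule K A M for K and A and M (structure) +
  assumes grade_subgroup: "subgroup (grade M n) (add_monoid M)"
    and grade_left: "\<lbrakk>a \<in> carrier A; x \<in> grade M n\<rbrakk> \<Longrightarrow> a \<odot> x \<in> grade M n"
    and grade_right: "\<lbrakk>a \<in> carrier A; x \<in> grade M n\<rbrakk> \<Longrightarrow> x \<triangleleft> a \<in> grade M n"
    and ex1_decomposition: "x \<in> carrier M \<Longrightarrow> \<exists>!c. is_decomposition M x c"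

definition component :: "('a, 'm, 'z) graded_bimodule_scheme \<Rightarrow> 'm \<Rightarrow> int \<Rightarrow> 'm" where
  "component M x = (THE c. is_decomposition M x c)"

definition support :: "('a, 'm, 'z) graded_bimodule_scheme \<Rightarrow> 'm \<Rightarrow> int set" where
  "support M x = {n. component M x n \<noteq> \<zero>\<^bsub>M\<^esub>}"

text \<open>The Koszul twist: \<open>x \<mapsto> (-1)\<^bsup>im\<^esup> x\<close> for \<open>x\<close> of degree \<open>i\<close>.\<close>

definition twist :: "('a, 'm, 'z) graded_bimodule_scheme \<Rightarrow> int \<Rightarrow> 'm \<Rightarrow> 'm" where
  "twist M m x = (\<Oplus>\<^bsub>M\<^esub>i \<in> support M x. sgn_elt M (i * m) (component M x i))"

definition regular :: "('k, 'a, 'z) module_scheme \<Rightarrow> ('a, 'a) graded_bimodule" where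
  "regular A = \<lparr>carrier = carrier A, mult = mult A, one = one A, zero = zero A, add = add A,
     smult = mult A, ract = mult A, grade = (\<lambda>n. if n = 0 then carrier A else {\<zero>\<^bsub>A\<^esub>})\<rparr>"

definition base_scalars :: "('k, 'c) ring_scheme \<Rightarrow> ('k, 'a, 'z) module_scheme \<Rightarrow> 'a set" where
  "base_scalars K A = {c \<odot>\<^bsub>A\<^esub> \<one>\<^bsub>A\<^esub> | c. c \<in> carrier K}"


section \<open>Projective bimodules\<close>

text \<open>The free bimodule on \<open>X\<close>: one copy of \<open>A \<otimes>\<^sub>K A\<close> for every element of \<open>X\<close>.\<close>

definition free_gens :: "('k, 'a, 'z) module_scheme \<Rightarrow> 'x set \<Rightarrow> ('a \<times> 'x \<times> 'a) set" where
  "free_gens A X = carrier A \<times> X \<times> carrier A"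

definition free_rels ::
  "('k, 'c) ring_scheme \<Rightarrow> ('k, 'a, 'z) module_scheme \<Rightarrow> 'x set
    \<Rightarrow> ('a \<times> 'x \<times> 'a \<Rightarrow>\<^sub>0 int) set" where
  "free_rels K A X =
     {frag_of (a \<oplus>\<^bsub>A\<^esub> a', x, b) - frag_of (a, x, b) - frag_of (a', x, b) | a a' x b.
        a \<in> carrier A \<and> a' \<in> carrier A \<and> x \<in> X \<and> b \<in> carrier A} \<union>
     {frag_of (a, x, b \<oplus>\<^bsub>A\<^esub> b') - frag_of (a, x, b) - frag_of (a, x, b') | a x b b'.
        a \<in> carrier A \<and> x \<in> X \<and> b \<in> carrier A \<and> b' \<in> carrier A} \<union>
     {frag_of (c \<odot>\<^bsub>A\<^esub> a, x, b) - frag_of (a, x, c \<odot>\<^bsub>A\<^esub> b) | c a x b.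
        c \<in> carrier K \<and> a \<in> carrier A \<and> x \<in> X \<and> b \<in> carrier A}"

definition free_bimodule ::
  "('k, 'c) ring_scheme \<Rightarrow> ('k, 'a, 'z) module_scheme \<Rightarrow> 'x set
    \<Rightarrow> ('a, ('a \<times> 'x \<times> 'a \<Rightarrow>\<^sub>0 int) set) bimodule" where
  "free_bimodule K A X =
     (let G = pres_group (free_gens A X) (free_rels K A X);
          e = pres_gen (free_gens A X) (free_rels K A X)
      in \<lparr>carrier = carrier G, mult = mult G, one = one G, zero = zero G, add = add G,
          smult = (\<lambda>c. pres_lift G (\<lambda>(a, x, b). e (c \<otimes>\<^bsub>A\<^esub> a, x, b))),
          ract = (\<lambda>u c. pres_lift G (\<lambda>(a, x, b). e (a, x, b \<otimes>\<^bsub>A\<^esub> c)) u)\<rparr>)"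

text \<open>
  Projective means: direct summand of a free bimodule. It is no loss that the basis is taken from
  the type of \<open>M\<close>, because \<open>M\<close> is a quotient of the free bimodule on its own elements.
\<close>

definition projective_bimodule ::
  "('k, 'c) ring_scheme \<Rightarrow> ('k, 'a, 'z) module_scheme \<Rightarrow> ('a, 'm, 'y) bimodule_scheme
    \<Rightarrow> bool" where
  "projective_bimodule K A M \<longleftrightarrow> bimodule K A M \<and>
     (\<exists>(X :: 'm set) i r. i \<in> bimod_hom A M (free_bimodule K A X) \<and>
        r \<in> bimod_hom A (free_bimodule K A X) M \<and> (\<forall>x \<in> carrier M. r (i x) = x))"


section \<open>Homology\<close>

definition cycles ::
  "('m, 'z) ring_scheme \<Rightarrow> (int \<Rightarrow> 'm set) \<Rightarrow> ('m \<Rightarrow> 'm) \<Rightarrow> int \<Rightarrow> 'm set" where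
  "cycles G C d n = {x \<in> C n. d x = \<zero>\<^bsub>G\<^esub>}"

definition boundaries :: "(int \<Rightarrow> 'm set) \<Rightarrow> ('m \<Rightarrow> 'm) \<Rightarrow> int \<Rightarrow> 'm set" where
  "boundaries C d n = d ` C (n + 1)"

definition homology ::
  "('m, 'z) ring_scheme \<Rightarrow> (int \<Rightarrow> 'm set) \<Rightarrow> ('m \<Rightarrow> 'm) \<Rightarrow> int \<Rightarrow> 'm set monoid" where
  "homology G C d n = add_monoid (G\<lparr>carrier := cycles G C d n\<rparr>) Mod boundaries C d n"

definition induces_on_homology ::
  "('m, 'z) ring_scheme \<Rightarrow> (int \<Rightarrow> 'm set) \<Rightarrow> ('m \<Rightarrow> 'm)
    \<Rightarrow> ('n, 'y) ring_scheme \<Rightarrow> (int \<Rightarrow> 'n set) \<Rightarrow> ('n \<Rightarrow> 'n) \<Rightarrow> ('m \<Rightarrow> 'n) \<Rightarrow> bool" where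
  "induces_on_homology G C d G' C' d' f \<longleftrightarrow>
     f \<in> hom (add_monoid G) (add_monoid G') \<and>
     (\<forall>n. f ` C n \<subseteq> C' n \<and> f ` cycles G C d n \<subseteq> cycles G' C' d' n \<and>
          f ` boundaries C d n \<subseteq> boundaries C' d' n)"

text \<open>
  The map on homology in degree \<open>n\<close> of the target, computed on a representative of the class.
\<close>

definition homology_map ::
  "('n, 'y) ring_scheme \<Rightarrow> (int \<Rightarrow> 'n set) \<Rightarrow> ('n \<Rightarrow> 'n) \<Rightarrow> int \<Rightarrow> ('m \<Rightarrow> 'n)
    \<Rightarrow> 'm set \<Rightarrow> 'n set" where
  "homology_map G' C' d' n f X = boundaries C' d' n +>\<^bsub>G'\<^esub> f (SOME z. z \<in> X)"


section \<open>Complexes, resolutions and contracting homotopies\<close>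

definition bimodule_complex ::
  "('k, 'c) ring_scheme \<Rightarrow> ('k, 'a, 'z) module_scheme \<Rightarrow> ('a, 'm, 'y) bimodule_complex_scheme
    \<Rightarrow> bool" where
  "bimodule_complex K A P \<longleftrightarrow> graded_bimodule K A P \<and> diff P \<in> bimod_hom A P P \<and>
     (\<forall>n. diff P ` grade P n \<subseteq> grade P (n - 1)) \<and>
     (\<forall>x \<in> carrier P. diff P (diff P x) = \<zero>\<^bsub>P\<^esub>)"

text \<open>
  The homology of \<open>shift 1 P\<close> in degree \<open>n\<close> is literally that of \<open>P\<close> in degree \<open>n + 1\<close>: the
  sign of the differential changes neither its kernel nor its image.
\<close>

definition shift ::
  "int \<Rightarrow> ('a, 'm, 'y) bimodule_complex_scheme \<Rightarrow> ('a, 'm, 'y) bimodule_complex_scheme" where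
  "shift t P = P\<lparr>grade := (\<lambda>n. grade P (t + n)), diff := (\<lambda>x. sgn_elt P t (diff P x))\<rparr>"

text \<open>The augmentation \<open>\<mu>\<close> is given as a map on all of \<open>P\<close> that vanishes outside degree 0.\<close>

definition projective_resolution ::
  "('k, 'c) ring_scheme \<Rightarrow> ('k, 'a, 'z) module_scheme \<Rightarrow> ('a, 'm, 'y) bimodule_complex_scheme
    \<Rightarrow> ('m \<Rightarrow> 'a) \<Rightarrow> bool" where
  "projective_resolution K A P \<mu> \<longleftrightarrow> bimodule_complex K A P \<and>
     (\<forall>n. projective_bimodule K A (P\<lparr>carrier := grade P n\<rparr>)) \<and>
     (\<forall>n < 0. grade P n = {\<zero>\<^bsub>P\<^esub>}) \<and>
     (\<forall>n > 0. carrier (homology P (grade P) (diff P) n) = {\<one>\<^bsub>homology P (grade P) (diff P) n\<^esub>}) \<and>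
     \<mu> \<in> bimod_hom A P (regular A) \<and>
     (\<forall>n. n \<noteq> 0 \<longrightarrow> (\<forall>x \<in> grade P n. \<mu> x = \<zero>\<^bsub>A\<^esub>)) \<and>
     (\<forall>x \<in> grade P 1. \<mu> (diff P x) = \<zero>\<^bsub>A\<^esub>) \<and>
     (\<lambda>X. the_elem (\<mu> ` X)) \<in> iso (homology P (grade P) (diff P) 0) (add_monoid A)"

definition left_contracting_homotopy ::
  "('k, 'a, 'z) module_scheme \<Rightarrow> ('a, 'm, 'y) bimodule_complex_scheme
    \<Rightarrow> ('m \<Rightarrow> 'a) \<Rightarrow> ('m \<Rightarrow> 'm) \<Rightarrow> ('a \<Rightarrow> 'm) \<Rightarrow> bool" where
  "left_contracting_homotopy A P \<mu> t \<eta> \<longleftrightarrow>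
     t \<in> left_hom A P P \<and> \<eta> \<in> left_hom A (regular A) P \<and>
     (\<forall>n. t ` grade P n \<subseteq> grade P (n + 1)) \<and> \<eta> ` carrier A \<subseteq> grade P 0 \<and>
     (\<forall>x \<in> carrier P. diff P (t x) \<oplus>\<^bsub>P\<^esub> t (diff P x) \<oplus>\<^bsub>P\<^esub> \<eta> (\<mu> x) = x) \<and>
     (\<forall>x \<in> carrier P. \<forall>a \<in> carrier A. t (t x \<oplus>\<^bsub>P\<^esub> \<eta> a) = \<zero>\<^bsub>P\<^esub>)"


section \<open>Tensor products\<close>

text \<open>
  Bilinear relations together with the balancing relations \<open>(x \<cdot> i, y) \<sim> (x, i \<cdot> y)\<close>, where
  \<open>i\<close> ranges over a set \<open>I\<close> of operators acting on \<open>M\<close> by \<open>r\<close> and on \<open>N\<close> by \<open>l\<close>.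
\<close>

definition tensor_rels ::
  "'i set \<Rightarrow> ('m \<Rightarrow> 'i \<Rightarrow> 'm) \<Rightarrow> ('i \<Rightarrow> 'n \<Rightarrow> 'n) \<Rightarrow> ('m, 'y) ring_scheme \<Rightarrow> ('n, 'z) ring_scheme
    \<Rightarrow> ('m \<times> 'n \<Rightarrow>\<^sub>0 int) set" where
  "tensor_rels I r l M N =
     {frag_of (x \<oplus>\<^bsub>M\<^esub> x', y) - frag_of (x, y) - frag_of (x', y) | x x' y.
        x \<in> carrier M \<and> x' \<in> carrier M \<and> y \<in> carrier N} \<union>
     {frag_of (x, y \<oplus>\<^bsub>N\<^esub> y') - frag_of (x, y) - frag_of (x, y') | x y y'.
        x \<in> carrier M \<and> y \<in> carrier N \<and> y' \<in> carrier N} \<union>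
     {frag_of (r x i, y) - frag_of (x, l i y) | x i y.
        x \<in> carrier M \<and> i \<in> I \<and> y \<in> carrier N}"

text \<open>
  \<open>tensor S M N\<close> is the tensor product over the subring \<open>S\<close> of \<open>A\<close>: it is \<open>M \<otimes>\<^sub>A N\<close> for
  \<open>S = carrier A\<close> and \<open>M \<otimes>\<^sub>K N\<close> for \<open>S = base_scalars K A\<close>.
\<close>

definition tens ::
  "'a set \<Rightarrow> ('a, 'm, 'y) bimodule_scheme \<Rightarrow> ('a, 'n, 'z) bimodule_scheme
    \<Rightarrow> 'm \<Rightarrow> 'n \<Rightarrow> ('m \<times> 'n \<Rightarrow>\<^sub>0 int) set" where
  "tens S M N x y =
     pres_gen (carrier M \<times> carrier N) (tensor_rels S (ract M) (smult N) M N) (x, y)"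

definition tensor ::
  "'a set \<Rightarrow> ('a, 'm, 'y) graded_bimodule_scheme \<Rightarrow> ('a, 'n, 'z) graded_bimodule_scheme
    \<Rightarrow> ('a, ('m \<times> 'n \<Rightarrow>\<^sub>0 int) set) graded_bimodule" where
  "tensor S M N =
     (let G = pres_group (carrier M \<times> carrier N) (tensor_rels S (ract M) (smult N) M N)
      in \<lparr>carrier = carrier G, mult = mult G, one = one G, zero = zero G, add = add G,
          smult = (\<lambda>a. pres_lift G (\<lambda>(x, y). tens S M N (a \<odot>\<^bsub>M\<^esub> x) y)),
          ract = (\<lambda>u a. pres_lift G (\<lambda>(x, y). tens S M N x (y \<triangleleft>\<^bsub>N\<^esub> a)) u),
          grade = (\<lambda>n. generate (add_monoid G)
            {tens S M N x y | x y i j. x \<in> grade M i \<and> y \<in> grade N j \<and> i + j = n})\<rparr>)"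

text \<open>
  \<open>tensor_map S M M' N' m f g\<close> is \<open>f \<otimes> g : M \<otimes> N \<rightarrow> M' \<otimes> N'\<close> for \<open>f\<close> defined on \<open>M\<close> and
  \<open>g\<close> of degree \<open>m\<close>, including the Koszul sign.
\<close>

definition tensor_map ::
  "'a set \<Rightarrow> ('a, 'm, 'y) graded_bimodule_scheme \<Rightarrow> ('a, 'm1, 'y1) graded_bimodule_scheme
    \<Rightarrow> ('a, 'n1, 'z1) graded_bimodule_scheme \<Rightarrow> int \<Rightarrow> ('m \<Rightarrow> 'm1) \<Rightarrow> ('n \<Rightarrow> 'n1)
    \<Rightarrow> ('m \<times> 'n \<Rightarrow>\<^sub>0 int) set \<Rightarrow> ('m1 \<times> 'n1 \<Rightarrow>\<^sub>0 int) set" where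
  "tensor_map S M M' N' m f g =
     pres_lift (tensor S M' N') (\<lambda>(x, y). tens S M' N' (f (twist M m x)) (g y))"


section \<open>The trace\<close>

text \<open>
  \<open>Tr A M\<close> is \<open>A \<otimes> M\<close> over the enveloping algebra. The pair \<open>(a, b)\<close> stands for the element
  \<open>a \<otimes> b\<close> of the enveloping algebra, acting on \<open>A\<close> from the right by \<open>x \<mapsto> b x a\<close> and on \<open>M\<close>
  from the left by \<open>m \<mapsto> a m b\<close>; such elements span additively, so balancing over them suffices.
\<close>

definition tr_rels ::
  "('k, 'a, 'z) module_scheme \<Rightarrow> ('a, 'm, 'y) bimodule_scheme \<Rightarrow> ('a \<times> 'm \<Rightarrow>\<^sub>0 int) set" where
  "tr_rels A M = tensor_rels (carrier A \<times> carrier A)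
     (\<lambda>x (a, b). b \<otimes>\<^bsub>A\<^esub> x \<otimes>\<^bsub>A\<^esub> a) (\<lambda>(a, b) m. (a \<odot>\<^bsub>M\<^esub> m) \<triangleleft>\<^bsub>M\<^esub> b) A M"

definition Tr ::
  "('k, 'a, 'z) module_scheme \<Rightarrow> ('a, 'm, 'y) bimodule_scheme \<Rightarrow> ('a \<times> 'm \<Rightarrow>\<^sub>0 int) set ring" where
  "Tr A M = pres_group (carrier A \<times> carrier M) (tr_rels A M)"

definition tr_gen ::
  "('k, 'a, 'z) module_scheme \<Rightarrow> ('a, 'm, 'y) bimodule_scheme
    \<Rightarrow> 'a \<Rightarrow> 'm \<Rightarrow> ('a \<times> 'm \<Rightarrow>\<^sub>0 int) set" where
  "tr_gen A M a x = pres_gen (carrier A \<times> carrier M) (tr_rels A M) (a, x)"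

definition Tr_map ::
  "('k, 'a, 'z) module_scheme \<Rightarrow> ('a, 'n, 'y) bimodule_scheme \<Rightarrow> ('m \<Rightarrow> 'n)
    \<Rightarrow> ('a \<times> 'm \<Rightarrow>\<^sub>0 int) set \<Rightarrow> ('a \<times> 'n \<Rightarrow>\<^sub>0 int) set" where
  "Tr_map A N f = pres_lift (Tr A N) (\<lambda>(a, x). tr_gen A N a (f x))"

definition Tr_grade ::
  "('k, 'a, 'z) module_scheme \<Rightarrow> ('a, 'm, 'y) graded_bimodule_scheme
    \<Rightarrow> int \<Rightarrow> ('a \<times> 'm \<Rightarrow>\<^sub>0 int) set set" where
  "Tr_grade A M n =
     generate (add_monoid (Tr A M)) {tr_gen A M a x | a x. a \<in> carrier A \<and> x \<in> grade M n}"

definition Tr_diff ::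
  "('k, 'a, 'z) module_scheme \<Rightarrow> ('a, 'm, 'y) bimodule_complex_scheme
    \<Rightarrow> ('a \<times> 'm \<Rightarrow>\<^sub>0 int) set \<Rightarrow> ('a \<times> 'm \<Rightarrow>\<^sub>0 int) set" where
  "Tr_diff A P = Tr_map A P (diff P)"

definition Tr_homology ::
  "('k, 'a, 'z) module_scheme \<Rightarrow> ('a, 'm, 'y) bimodule_complex_scheme
    \<Rightarrow> int \<Rightarrow> ('a \<times> 'm \<Rightarrow>\<^sub>0 int) set set monoid" where
  "Tr_homology A P = homology (Tr A P) (Tr_grade A P) (Tr_diff A P)"

definition Tr_homology_map ::
  "('k, 'a, 'z) module_scheme \<Rightarrow> ('a, 'n, 'y) bimodule_complex_scheme \<Rightarrow> int
    \<Rightarrow> (('a \<times> 'm \<Rightarrow>\<^sub>0 int) set \<Rightarrow> ('a \<times> 'n \<Rightarrow>\<^sub>0 int) set)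
    \<Rightarrow> ('a \<times> 'm \<Rightarrow>\<^sub>0 int) set set \<Rightarrow> ('a \<times> 'n \<Rightarrow>\<^sub>0 int) set set" where
  "Tr_homology_map A P = homology_map (Tr A P) (Tr_grade A P) (Tr_diff A P)"

text \<open>
  \<open>1 \<otimes> x \<otimes> y \<mapsto> (-1)\<^bsup>ij\<^esup> 1 \<otimes> y \<otimes> x\<close> for \<open>x\<close>, \<open>y\<close> of degrees \<open>i\<close>, \<open>j\<close>; a general generator
  \<open>b \<otimes> u\<close> is first rewritten as \<open>1 \<otimes> b u\<close>.
\<close>

definition tr_swap ::
  "('k, 'a, 'z) module_scheme \<Rightarrow> ('a, 'm, 'y) graded_bimodule_scheme
    \<Rightarrow> ('a, 'n, 'x) graded_bimodule_scheme
    \<Rightarrow> ('a \<times> ('m \<times> 'n \<Rightarrow>\<^sub>0 int) set \<Rightarrow>\<^sub>0 int) set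
    \<Rightarrow> ('a \<times> ('n \<times> 'm \<Rightarrow>\<^sub>0 int) set \<Rightarrow>\<^sub>0 int) set" where
  "tr_swap A P Q =
     (let PQ = tensor (carrier A) P Q; QP = tensor (carrier A) Q P;
          swap = (\<lambda>(x, y). \<Oplus>\<^bsub>Tr A QP\<^esub>i \<in> support P x.
                    tr_gen A QP \<one>\<^bsub>A\<^esub> (tens (carrier A) Q P (twist Q i y) (component P x i)))
      in pres_lift (Tr A QP) (\<lambda>(b, u). pres_lift (Tr A QP) swap (b \<odot>\<^bsub>PQ\<^esub> u)))"


section \<open>The maps attached to a left contracting homotopy\<close>

abbreviation tensorA where "tensorA A \<equiv> tensor (carrier A)"
abbreviation tensorK where "tensorK K A \<equiv> tensor (base_scalars K A)"

definition act_map ::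
  "('a, 'm, 'y) graded_bimodule_scheme \<Rightarrow> ('a \<times> 'm \<Rightarrow>\<^sub>0 int) set \<Rightarrow> 'm" where
  "act_map P = pres_lift P (\<lambda>(a, x). a \<odot>\<^bsub>P\<^esub> x)"

text \<open>The identification of \<open>P \<otimes>\<^sub>A (A \<otimes>\<^sub>K P)\<close> with \<open>P \<otimes>\<^sub>K P\<close> and its inverse.\<close>

definition collapse_mid ::
  "('k, 'c) ring_scheme \<Rightarrow> ('k, 'a, 'z) module_scheme \<Rightarrow> ('a, 'm, 'y) graded_bimodule_scheme
    \<Rightarrow> ('m \<times> ('a \<times> 'm \<Rightarrow>\<^sub>0 int) set \<Rightarrow>\<^sub>0 int) set \<Rightarrow> ('m \<times> 'm \<Rightarrow>\<^sub>0 int) set" where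
  "collapse_mid K A P =
     pres_lift (tensorK K A P P) (\<lambda>(x, u). pres_lift (tensorK K A P P)
       (\<lambda>(a, y). tens (base_scalars K A) P P (x \<triangleleft>\<^bsub>P\<^esub> a) y) u)"

definition expand_mid ::
  "('k, 'c) ring_scheme \<Rightarrow> ('k, 'a, 'z) module_scheme \<Rightarrow> ('a, 'm, 'y) graded_bimodule_scheme
    \<Rightarrow> ('m \<times> 'm \<Rightarrow>\<^sub>0 int) set \<Rightarrow> ('m \<times> ('a \<times> 'm \<Rightarrow>\<^sub>0 int) set \<Rightarrow>\<^sub>0 int) set" where
  "expand_mid K A P =
     (let AP = tensorK K A (regular A) P
      in pres_lift (tensorA A P AP) (\<lambda>(x, y).
           tens (carrier A) P AP x (tens (base_scalars K A) (regular A) P \<one>\<^bsub>A\<^esub> y)))"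

definition t_L ::
  "('k, 'c) ring_scheme \<Rightarrow> ('k, 'a, 'z) module_scheme \<Rightarrow> ('a, 'm, 'y) graded_bimodule_scheme
    \<Rightarrow> ('m \<Rightarrow> ('a \<times> 'm \<Rightarrow>\<^sub>0 int) set) \<Rightarrow> ('m \<Rightarrow> 'm)
    \<Rightarrow> ('m \<times> 'm \<Rightarrow>\<^sub>0 int) set \<Rightarrow> ('m \<times> 'm \<Rightarrow>\<^sub>0 int) set" where
  "t_L K A P \<iota> t =
     tensor_map (carrier A) P P P 0 id (act_map P) \<circ>
     expand_mid K A P \<circ> tensor_map (base_scalars K A) P P P 0 t id \<circ> collapse_mid K A P \<circ>
     tensor_map (carrier A) P P (tensorK K A (regular A) P) 0 id \<iota>"

definition eta_L ::
  "('k, 'c) ring_scheme \<Rightarrow> ('k, 'a, 'z) module_scheme \<Rightarrow> ('a, 'm, 'y) graded_bimodule_scheme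
    \<Rightarrow> ('m \<Rightarrow> ('a \<times> 'm \<Rightarrow>\<^sub>0 int) set) \<Rightarrow> ('a \<Rightarrow> 'm) \<Rightarrow> 'm \<Rightarrow> ('m \<times> 'm \<Rightarrow>\<^sub>0 int) set" where
  "eta_L K A P \<iota> \<eta> =
     tensor_map (carrier A) P P P 0 id (act_map P) \<circ>
     expand_mid K A P \<circ> tensor_map (base_scalars K A) (regular A) P P 0 \<eta> id \<circ> \<iota>"

definition d_R ::
  "('k, 'a, 'z) module_scheme \<Rightarrow> ('a, 'm, 'y) bimodule_complex_scheme
    \<Rightarrow> ('m \<times> 'm \<Rightarrow>\<^sub>0 int) set \<Rightarrow> ('m \<times> 'm \<Rightarrow>\<^sub>0 int) set" where
  "d_R A P = tensor_map (carrier A) P P P (- 1) id (diff P)"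

definition mu_R ::
  "('k, 'a, 'z) module_scheme \<Rightarrow> ('a, 'm, 'y) graded_bimodule_scheme \<Rightarrow> ('m \<Rightarrow> 'a)
    \<Rightarrow> ('m \<times> 'm \<Rightarrow>\<^sub>0 int) set \<Rightarrow> 'm" where
  "mu_R A P \<mu> =
     pres_lift P (\<lambda>(x, a). x \<triangleleft>\<^bsub>P\<^esub> a) \<circ> tensor_map (carrier A) P P (regular A) 0 id \<mu>"

definition S_map ::
  "('k, 'c) ring_scheme \<Rightarrow> ('k, 'a, 'z) module_scheme \<Rightarrow> ('a, 'm, 'y) bimodule_complex_scheme
    \<Rightarrow> ('m \<Rightarrow> ('a \<times> 'm \<Rightarrow>\<^sub>0 int) set) \<Rightarrow> ('m \<Rightarrow> 'm)
    \<Rightarrow> ('m \<times> 'm \<Rightarrow>\<^sub>0 int) set \<Rightarrow> ('m \<times> 'm \<Rightarrow>\<^sub>0 int) set" where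
  "S_map K A P \<iota> t =
     inv_into (carrier (tensorA A P P))
       (\<lambda>u. u \<oplus>\<^bsub>tensorA A P P\<^esub> t_L K A P \<iota> t (d_R A P u))"

definition trace_connes ::
  "('k, 'c) ring_scheme \<Rightarrow> ('k, 'a, 'z) module_scheme \<Rightarrow> ('a, 'm, 'y) bimodule_complex_scheme
    \<Rightarrow> ('m \<Rightarrow> 'a) \<Rightarrow> ('m \<Rightarrow> 'm) \<Rightarrow> ('a \<Rightarrow> 'm) \<Rightarrow> ('m \<Rightarrow> ('a \<times> 'm \<Rightarrow>\<^sub>0 int) set)
    \<Rightarrow> ('a \<times> 'm \<Rightarrow>\<^sub>0 int) set \<Rightarrow> ('a \<times> 'm \<Rightarrow>\<^sub>0 int) set" where
  "trace_connes K A P \<mu> t \<eta> \<iota> =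
     (let PP = tensorA A P P; S = S_map K A P \<iota> t; tL = t_L K A P \<iota> t; \<eta>L = eta_L K A P \<iota> \<eta>;
          \<mu>R = mu_R A P \<mu>; f = \<mu>R \<circ> S \<circ> \<eta>L;
          F = Tr_map A P (\<mu>R \<circ> S \<circ> tL) \<circ> tr_swap A P P \<circ>
              Tr_map A PP (tensor_map (carrier A) P P P 0 id (f \<circ> f) \<circ> S \<circ> \<eta>L)
      in (\<lambda>u. \<ominus>\<^bsub>Tr A P\<^esub> F u))"


section \<open>The bar resolution and Hochschild homology\<close>

text \<open>
  \<open>words K A l\<close> is the direct sum of the tensor powers of \<open>A\<close> over \<open>K\<close> with at least \<open>l\<close>
  factors: the list \<open>[a\<^sub>1, \<dots>, a\<^sub>m]\<close> represents \<open>a\<^sub>1 \<otimes> \<dots> \<otimes> a\<^sub>m\<close>.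
\<close>

definition word_gens :: "('k, 'a, 'z) module_scheme \<Rightarrow> nat \<Rightarrow> 'a list set" where
  "word_gens A l = {as \<in> lists (carrier A). l \<le> length as}"

definition word_rels ::
  "('k, 'c) ring_scheme \<Rightarrow> ('k, 'a, 'z) module_scheme \<Rightarrow> nat \<Rightarrow> ('a list \<Rightarrow>\<^sub>0 int) set" where
  "word_rels K A l =
     {frag_of (us @ [a \<oplus>\<^bsub>A\<^esub> b] @ vs) - frag_of (us @ [a] @ vs) - frag_of (us @ [b] @ vs)
       | us a b vs. us @ [a] @ vs \<in> word_gens A l \<and> b \<in> carrier A} \<union>
     {frag_of (us @ [c \<odot>\<^bsub>A\<^esub> a] @ vs @ [b] @ ws) - frag_of (us @ [a] @ vs @ [c \<odot>\<^bsub>A\<^esub> b] @ ws)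
       | us a vs b ws c. us @ [a] @ vs @ [b] @ ws \<in> word_gens A l \<and> c \<in> carrier K}"

definition words ::
  "('k, 'c) ring_scheme \<Rightarrow> ('k, 'a, 'z) module_scheme \<Rightarrow> nat \<Rightarrow> ('a list \<Rightarrow>\<^sub>0 int) set ring" where
  "words K A l = pres_group (word_gens A l) (word_rels K A l)"

definition word ::
  "('k, 'c) ring_scheme \<Rightarrow> ('k, 'a, 'z) module_scheme \<Rightarrow> nat
    \<Rightarrow> 'a list \<Rightarrow> ('a list \<Rightarrow>\<^sub>0 int) set" where
  "word K A l as = pres_gen (word_gens A l) (word_rels K A l) as"

text \<open>The differential vanishes in degree 0, that is, on words with two letters.\<close>

definition Bar ::
  "('k, 'c) ring_scheme \<Rightarrow> ('k, 'a, 'z) module_scheme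
    \<Rightarrow> ('a, ('a list \<Rightarrow>\<^sub>0 int) set) bimodule_complex" where
  "Bar K A =
     (let G = words K A 2
      in \<lparr>carrier = carrier G, mult = mult G, one = one G, zero = zero G, add = add G,
          smult = (\<lambda>b. pres_lift G (\<lambda>as. word K A 2 ((b \<otimes>\<^bsub>A\<^esub> hd as) # tl as))),
          ract = (\<lambda>u b. pres_lift G (\<lambda>as. word K A 2 (butlast as @ [last as \<otimes>\<^bsub>A\<^esub> b])) u),
          grade = (\<lambda>n. generate (add_monoid G)
            {word K A 2 as | as. as \<in> word_gens A 2 \<and> int (length as) = n + 2}),
          diff = pres_lift G (\<lambda>as. if length as = 2 then \<zero>\<^bsub>G\<^esub> else
            (\<Oplus>\<^bsub>G\<^esub>i \<in> {..<length as - 1}. sgn_elt G (int i)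
              (word K A 2 (take i as @ [as ! i \<otimes>\<^bsub>A\<^esub> as ! Suc i] @ drop (i + 2) as))))\<rparr>)"

definition bar_aug ::
  "('k, 'a, 'z) module_scheme \<Rightarrow> ('a list \<Rightarrow>\<^sub>0 int) set \<Rightarrow> 'a" where
  "bar_aug A = pres_lift A
     (\<lambda>as. if length as = 2 then as ! 0 \<otimes>\<^bsub>A\<^esub> as ! 1 else \<zero>\<^bsub>A\<^esub>)"

definition HH ::
  "('k, 'c) ring_scheme \<Rightarrow> ('k, 'a, 'z) module_scheme
    \<Rightarrow> int \<Rightarrow> ('a \<times> ('a list \<Rightarrow>\<^sub>0 int) set \<Rightarrow>\<^sub>0 int) set set monoid" where
  "HH K A = Tr_homology A (Bar K A)"

definition comparison_map ::
  "('k, 'a, 'z) module_scheme \<Rightarrow> ('a, 'm, 'y) bimodule_complex_scheme \<Rightarrow> ('m \<Rightarrow> 'a)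
    \<Rightarrow> ('a, 'n, 'x) bimodule_complex_scheme \<Rightarrow> ('n \<Rightarrow> 'a) \<Rightarrow> ('m \<Rightarrow> 'n) \<Rightarrow> bool" where
  "comparison_map A Q \<mu> P \<nu> \<phi> \<longleftrightarrow> \<phi> \<in> bimod_hom A Q P \<and>
     (\<forall>n. \<phi> ` grade Q n \<subseteq> grade P n) \<and>
     (\<forall>x \<in> carrier Q. \<phi> (diff Q x) = diff P (\<phi> x) \<and> \<nu> (\<phi> x) = \<mu> x)"

text \<open>
  The identification of \<open>Tr (Bar\<^sub>n)\<close> with the tensor power of \<open>A\<close> with \<open>n + 1\<close> factors:
  \<open>b \<otimes> (a\<^sub>0 \<otimes> \<dots> \<otimes> a\<^sub>n\<^sub>+\<^sub>1) \<mapsto> a\<^sub>n\<^sub>+\<^sub>1 b a\<^sub>0 \<otimes> a\<^sub>1 \<otimes> \<dots> \<otimes> a\<^sub>n\<close>.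
\<close>

definition tr_bar_to_words ::
  "('k, 'c) ring_scheme \<Rightarrow> ('k, 'a, 'z) module_scheme
    \<Rightarrow> ('a \<times> ('a list \<Rightarrow>\<^sub>0 int) set \<Rightarrow>\<^sub>0 int) set \<Rightarrow> ('a list \<Rightarrow>\<^sub>0 int) set" where
  "tr_bar_to_words K A =
     pres_lift (words K A 1) (\<lambda>(b, u). pres_lift (words K A 1)
       (\<lambda>as. word K A 1 ((last as \<otimes>\<^bsub>A\<^esub> b \<otimes>\<^bsub>A\<^esub> hd as) # butlast (tl as))) u)"

definition words_to_tr_bar ::
  "('k, 'c) ring_scheme \<Rightarrow> ('k, 'a, 'z) module_scheme
    \<Rightarrow> ('a list \<Rightarrow>\<^sub>0 int) set \<Rightarrow> ('a \<times> ('a list \<Rightarrow>\<^sub>0 int) set \<Rightarrow>\<^sub>0 int) set" where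
  "words_to_tr_bar K A =
     pres_lift (Tr A (Bar K A)) (\<lambda>as. tr_gen A (Bar K A) \<one>\<^bsub>A\<^esub> (word K A 2 (as @ [\<one>\<^bsub>A\<^esub>])))"

text \<open>With \<open>as = [a\<^sub>0, \<dots>, a\<^sub>n]\<close>, the list \<open>rotate i as\<close> is \<open>[a\<^sub>i, \<dots>, a\<^sub>n, a\<^sub>0, \<dots>, a\<^sub>i\<^sub>-\<^sub>1]\<close>.\<close>

definition connes_words ::
  "('k, 'c) ring_scheme \<Rightarrow> ('k, 'a, 'z) module_scheme
    \<Rightarrow> ('a list \<Rightarrow>\<^sub>0 int) set \<Rightarrow> ('a list \<Rightarrow>\<^sub>0 int) set" where
  "connes_words K A =
     (let W = words K A 1
      in pres_lift W (\<lambda>as. let n = length as - 1 in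
           (\<Oplus>\<^bsub>W\<^esub>i \<in> {..n}. sgn_elt W (int (i * n)) (word K A 1 (\<one>\<^bsub>A\<^esub> # rotate i as))) \<oplus>\<^bsub>W\<^esub>
           (\<Oplus>\<^bsub>W\<^esub>i \<in> {..n}. sgn_elt W (int (i * n))
              (word K A 1 (hd (rotate i as) # \<one>\<^bsub>A\<^esub> # tl (rotate i as))))))"

definition connes_bar ::
  "('k, 'c) ring_scheme \<Rightarrow> ('k, 'a, 'z) module_scheme
    \<Rightarrow> ('a \<times> ('a list \<Rightarrow>\<^sub>0 int) set \<Rightarrow>\<^sub>0 int) set
    \<Rightarrow> ('a \<times> ('a list \<Rightarrow>\<^sub>0 int) set \<Rightarrow>\<^sub>0 int) set" where
  "connes_bar K A = words_to_tr_bar K A \<circ> connes_words K A \<circ> tr_bar_to_words K A"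

definition connes_HH ::
  "('k, 'c) ring_scheme \<Rightarrow> ('k, 'a, 'z) module_scheme \<Rightarrow> int
    \<Rightarrow> ('a \<times> ('a list \<Rightarrow>\<^sub>0 int) set \<Rightarrow>\<^sub>0 int) set set
    \<Rightarrow> ('a \<times> ('a list \<Rightarrow>\<^sub>0 int) set \<Rightarrow>\<^sub>0 int) set set" where
  "connes_HH K A n = Tr_homology_map A (Bar K A) (n + 1) (connes_bar K A)"

end

(*
  Write D for the total differential of P (x)_A P and put phi = mu_R S t_L, f = mu_R S eta_L.
  Perturbing the left contraction gives D S t_L + S t_L D + S eta_L mu_L = 1, hence
  d phi + phi D = mu_R - f mu_L. The given map sends the class of x to that of - phi (sigma Delta' x)
  with Delta' = (1 (x) f^2) S eta_L, and the square f^2 makes the two terms of its anticommutator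
  with the differential cancel.

  For a comparison map psi from the bar resolution, the deconcatenation coproduct followed by
  psi (x) psi is a chain map gamma with mu_L gamma = mu_R gamma = psi, so Delta' psi - gamma is null
  homotopic. This replaces Delta' psi by gamma, at the cost of a term K1 with
  d K1 + K1 d = f psi - psi. On words cut at a place m, the map theta(m, w), the sum of
  phi (psi x (x) psi y), of +-psi w and, for m = 1, of K1, is closed, multilinear and determined by its
  inner letters; applying t_P to the inner letters and inducting on the length shows that theta is a
  boundary. Summing over all rotations of a word transports this to Tr Bar and turns +-psi w into the
  first half of the Connes differential; the second half is null homotopic.
*)
theory Submission
  imports Defs
begin

text \<open>The obstacle is that \<open>t\<close> is linear on one side only, whereas homotopies on
  the trace have to respect both actions. All homotopies are therefore explicit functions of lists.
  Faces, cuts and rotations are formal combinations of lists, where identities such as d^2 = 0 hold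
  before any relation is imposed; they are evaluated in a group only afterwards. Lifting along P
  meets no obstruction: a nondegenerate cut word has at least three letters, so \<open>theta\<close>
  takes its values in degree length - 2 > 0, where the augmentation vanishes. \<open>K1\<close> is
  not just some homotopy from f psi to psi. It is the one whose trace is left over when sigma
  exchanges mu_L and mu_R at the null homotopy of Delta' psi - gamma, so the same term arises in
  both halves of the argument and cancels. The sign of +-psi w is (-1)^(m+1): it makes all faces of
  w carry a uniform sign, and the Koszul sign of exchanging the two tensor factors turns it into the
  sign (-1)^(in) of Connes' formula.\<close>

section \<open>Additive homomorphisms, signs and generated subgroups\<close>

definition ahom :: "('g, 'y) ring_scheme => ('h, 'z) ring_scheme => ('g => 'h) set" where
 "ahom G H = hom (add_monoid G) (add_monoid H)"

definition asubgroup :: "'g set => ('g, 'y) ring_scheme => bool" where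
 "asubgroup S G \<longleftrightarrow> subgroup S (add_monoid G)"

definition agenerate :: "('g, 'y) ring_scheme => 'g set => 'g set" where
 "agenerate G X = generate (add_monoid G) X"

lemma ahomI:
 "[|!!x. x \<in> carrier G ==> f x \<in> carrier H;
  !!x y. [|x \<in> carrier G; y \<in> carrier G|] ==> f (x \<oplus>\<^bsub>G\<^esub> y) = f x \<oplus>\<^bsub>H\<^esub> f y|] ==> f \<in> ahom G H"
 by (auto simp: ahom_def hom_def)

lemma ahom_closed: "[|f \<in> ahom G H; x \<in> carrier G|] ==> f x \<in> carrier H"
 by (auto simp: ahom_def hom_def)

lemma ahom_add:
 "[|f \<in> ahom G H; x \<in> carrier G; y \<in> carrier G|] ==> f (x \<oplus>\<^bsub>G\<^esub> y) = f x \<oplus>\<^bsub>H\<^esub> f y"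
 by (auto simp: ahom_def hom_def)

lemma ahom_id: "(%x. x) \<in> ahom G G" "id \<in> ahom G G"
 by (auto simp: ahom_def hom_def)

lemma ahom_comp: "[|f \<in> ahom G H; g \<in> ahom H L|] ==> (%x. g (f x)) \<in> ahom G L"
 by (auto simp: ahom_def hom_def Pi_def)

text \<open>Closure of the carrier under addition is what lets the pointwise equality be applied at
  a sum; hence the group assumption on the source only.\<close>

lemma ahom_cong:
 assumes "f \<in> ahom G H" "!!x. x \<in> carrier G ==> f x = g x" "abelian_group G"
 shows "g \<in> ahom G H"
proof -
 interpret abelian_group G by fact
 show ?thesis using assms(1,2) by (auto simp: ahom_def hom_def Pi_def)
qed

context
 fixes G :: "('g, 'y) ring_scheme" and H :: "('h, 'z) ring_scheme"
 assumes G: "abelian_group G" and H: "abelian_group H"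
begin

interpretation G: abelian_group G by (rule G)
interpretation H: abelian_group H by (rule H)

lemma ahom_zero: "f \<in> ahom G H ==> f \<zero>\<^bsub>G\<^esub> = \<zero>\<^bsub>H\<^esub>"
 using hom_one[of f "add_monoid G" "add_monoid H"] G.a_group H.a_group by (simp add: ahom_def)

lemma ahom_neg: "[|f \<in> ahom G H; x \<in> carrier G|] ==> f (\<ominus>\<^bsub>G\<^esub> x) = \<ominus>\<^bsub>H\<^esub> f x"
 using group_hom.hom_inv[of "add_monoid G" "add_monoid H" f x] G.a_group H.a_group
 by (simp add: group_hom_def group_hom_axioms_def ahom_def a_inv_def)

lemma ahom_minus:
 "[|f \<in> ahom G H; x \<in> carrier G; y \<in> carrier G|] ==> f (x \<ominus>\<^bsub>G\<^esub> y) = f x \<ominus>\<^bsub>H\<^esub> f y"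
 by (simp add: a_minus_def ahom_add ahom_neg)

lemma ahom_sgn: "[|f \<in> ahom G H; x \<in> carrier G|] ==> f (sgn_elt G k x) = sgn_elt H k (f x)"
 by (simp add: sgn_elt_def ahom_neg)

lemma ahom_finsum:
 assumes "f \<in> ahom G H" "g \<in> I \<rightarrow> carrier G"
 shows "f (finsum G g I) = finsum H (%i. f (g i)) I"
 using assms(2)
proof (induction I rule: infinite_finite_induct)
 case (insert i I)
 thus ?case
  using assms(1) by (simp add: Pi_def ahom_add ahom_closed)
qed (simp_all add: ahom_zero[OF assms(1)])

lemma ahom_plus:
 "[|f \<in> ahom G H; g \<in> ahom G H|] ==> (%x. f x \<oplus>\<^bsub>H\<^esub> g x) \<in> ahom G H"
 by (rule ahomI) (simp_all add: ahom_closed ahom_add H.a_ac)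

lemma ahom_uminus: "f \<in> ahom G H ==> (%x. \<ominus>\<^bsub>H\<^esub> f x) \<in> ahom G H"
 by (rule ahomI) (simp_all add: ahom_closed ahom_add H.minus_add)

lemma ahom_sgn_elt: "f \<in> ahom G H ==> (%x. sgn_elt H k (f x)) \<in> ahom G H"
 by (cases "even k") (simp_all add: sgn_elt_def ahom_uminus)

lemma ahom_const_zero: "(%x. \<zero>\<^bsub>H\<^esub>) \<in> ahom G H"
 by (rule ahomI) simp_all

lemma ahom_sum:
 assumes "!!i. i \<in> I ==> f i \<in> ahom G H"
 shows "(%x. finsum H (%i. f i x) I) \<in> ahom G H"
 using assms
proof (induction I rule: infinite_finite_induct)
 case (insert i I)
 hence "(%x. f i x \<oplus>\<^bsub>H\<^esub> finsum H (%i. f i x) I) \<in> ahom G H"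
  by (intro ahom_plus) auto
 moreover have "f i x \<oplus>\<^bsub>H\<^esub> finsum H (%i. f i x) I = finsum H (%i. f i x) (insert i I)"
  if "x \<in> carrier G" for x
 proof -
  have "(%i. f i x) \<in> I \<rightarrow> carrier H" "f i x \<in> carrier H"
   using insert.prems that by (auto intro: ahom_closed)
  thus ?thesis using insert.hyps by simp
 qed
 ultimately show ?case by (rule ahom_cong) (simp_all add: G)
qed (simp_all add: ahom_const_zero)

end

context abelian_group
begin

lemmas ag = abelian_group_axioms

lemma sgn_elt_closed [simp]: "x \<in> carrier G ==> sgn_elt G k x \<in> carrier G"
 by (simp add: sgn_elt_def)

lemma sgn_elt_add: "[|x \<in> carrier G; y \<in> carrier G|] ==> sgn_elt G k (x \<oplus> y) = sgn_elt G k x \<oplus> sgn_elt G k y"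
 by (simp add: sgn_elt_def minus_add)

lemma sgn_elt_zero [simp]: "sgn_elt G k \<zero> = \<zero>"
 by (simp add: sgn_elt_def)

lemma sgn_elt_sgn_elt: "x \<in> carrier G ==> sgn_elt G k (sgn_elt G l x) = sgn_elt G (k + l) x"
 by (auto simp: sgn_elt_def)

lemma sgn_elt_0 [simp]: "sgn_elt G 0 x = x"
 by (simp add: sgn_elt_def)

lemma sgn_elt_finsum: "g \<in> I \<rightarrow> carrier G ==> sgn_elt G k (finsum G g I) = (\<Oplus>i\<in>I. sgn_elt G k (g i))"
 by (rule ahom_finsum[OF ag ag])
   (rule ahom_sgn_elt[OF ag ag ahom_id(1)])

lemmas group_simps = a_ac minus_add minus_minus r_neg l_neg r_neg1 r_neg2 minus_eq

lemma subgroup_minus: "[|asubgroup S G; x \<in> S|] ==> \<ominus> x \<in> S"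
 using subgroup.m_inv_closed[of S "add_monoid G" x] by (simp add: asubgroup_def a_inv_def)

lemma subgroup_plus: "[|asubgroup S G; x \<in> S; y \<in> S|] ==> x \<oplus> y \<in> S"
 using subgroup.m_closed[of S "add_monoid G" x y] by (simp add: asubgroup_def)

lemma subgroup_zero: "asubgroup S G ==> \<zero> \<in> S"
 using subgroup.one_closed[of S "add_monoid G"] by (simp add: asubgroup_def)

lemma subgroup_sgn: "[|asubgroup S G; x \<in> S|] ==> sgn_elt G k x \<in> S"
 by (simp add: sgn_elt_def subgroup_minus)

lemma asubgroup_carrier: "[|asubgroup S G; x \<in> S|] ==> x \<in> carrier G"
 using subgroup.subset unfolding asubgroup_def by fastforce

lemma subgroup_finsum:
 assumes "asubgroup S G" "!!i. i \<in> I ==> g i \<in> S"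
 shows "finsum G g I \<in> S"
 using assms(2)
proof (induction I rule: infinite_finite_induct)
 case (insert i I)
 thus ?case
  using asubgroup_carrier[OF assms(1)] by (simp add: Pi_def subgroup_plus[OF assms(1)])
qed (simp_all add: subgroup_zero[OF assms(1)])

lemma add_subgroupI:
 assumes "S <= carrier G" "\<zero> \<in> S" "!!x y. [|x \<in> S; y \<in> S|] ==> x \<oplus> y \<in> S" "!!x. x \<in> S ==> \<ominus> x \<in> S"
 shows "asubgroup S G"
 using assms unfolding asubgroup_def by (intro add.subgroupI) auto

lemma generate_subset:
 assumes "asubgroup S G" "X <= S"
 shows "agenerate G X <= S"
 using add.generate_subgroup_incl[OF assms(2) assms(1)[unfolded asubgroup_def]] by (simp add: agenerate_def)

lemma generate_subgroup: "X <= carrier G ==> asubgroup (agenerate G X) G"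
 unfolding asubgroup_def agenerate_def by (rule add.generate_is_subgroup) auto

lemma subgroup_vimage:
 assumes "f \<in> ahom G H" "abelian_group H" "asubgroup S H"
 shows "asubgroup {x \<in> carrier G. f x \<in> S} G"
proof -
 interpret H: abelian_group H by fact
 show ?thesis
  by (rule add_subgroupI)
   (auto simp: ahom_zero[OF ag assms(2,1)]
    ahom_neg[OF ag assms(2,1)] ahom_add[OF assms(1)]
    H.subgroup_zero[OF assms(3)] H.subgroup_plus[OF assms(3)] H.subgroup_minus[OF assms(3)])
qed

lemma singleton_zero_subgroup: "asubgroup {\<zero>} G"
 by (rule add_subgroupI) auto

lemma carrier_subgroup: "asubgroup (carrier G) G"
 by (rule add_subgroupI) auto

text \<open>The equalizer of two homomorphisms is a subgroup. Specialized to presentations, tensor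
  products and the bar complex, this is the standard way in which identities of maps are reduced to
  generators.\<close>

lemma generate_hom_eq:
 assumes "f \<in> ahom G H" "g \<in> ahom G H" "abelian_group H" "X <= carrier G"
  and eq: "!!x. x \<in> X ==> f x = g x" and u: "u \<in> agenerate G X"
 shows "f u = g u"
proof -
 interpret H: abelian_group H by fact
 have "asubgroup {x \<in> carrier G. f x = g x} G"
  by (rule add_subgroupI)
   (auto simp: ahom_zero[OF ag assms(3,1)] ahom_zero[OF ag assms(3,2)]
    ahom_neg[OF ag assms(3,1)] ahom_neg[OF ag assms(3,2)]
    ahom_add[OF assms(1)] ahom_add[OF assms(2)])
 from generate_subset[OF this, of X] eq assms(4) u show ?thesis by auto
qed

lemma generate_image_subset:
 assumes "f \<in> ahom G H" "abelian_group H" "asubgroup S H" "X <= carrier G"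
  "!!x. x \<in> X ==> f x \<in> S" "u \<in> agenerate G X"
 shows "f u \<in> S"
 using generate_subset[OF subgroup_vimage[OF assms(1-3)], of X] assms(4-6) by auto

end

text \<open>Presented groups, tensor products and the bar complex are records of different types
  with the same additive fields; this moves the group structure between them.\<close>

lemma abelian_group_cong:
 assumes "abelian_group G" "carrier H = carrier G" "add H = add G" "zero H = zero G"
 shows "abelian_group H"
proof -
 interpret abelian_group G by fact
 show ?thesis
 proof (rule abelian_groupI)
  fix x assume "x \<in> carrier H"
  thus "\<exists>y\<in>carrier H. y \<oplus>\<^bsub>H\<^esub> x = \<zero>\<^bsub>H\<^esub>"
   using l_neg[of x] a_inv_closed[of x] unfolding assms(2-4) by blast
 qed (simp_all add: assms(2-4) a_ac)
qed

lemma a_inv_cong: "[|carrier H = carrier G; add H = add G; zero H = zero G|] ==> a_inv H = a_inv G"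
 by (rule ext) (simp add: a_inv_def m_inv_def)

section \<open>Groups given by generators and relations\<close>

text \<open>What remains of \<open>pres_lift\<close> once the choice of a representative is removed.
  Additivity can be proved for it before any relation is considered.\<close>

definition frag_lift :: "('g, 'z) ring_scheme => ('x => 'g) => ('x \<Rightarrow>\<^sub>0 int) => 'g" where
 "frag_lift G b z = finsum G (%x. add_pow G (Poly_Mapping.lookup z x) (b x)) (Poly_Mapping.keys z)"

lemma pres_lift_frag_lift: "pres_lift G b C = frag_lift G b (SOME z. z \<in> C)"
 by (simp add: pres_lift_def frag_lift_def Let_def)

context abelian_group
begin

text \<open>Coefficients outside the support are 0 and contribute nothing, so two combinations with
  different supports can be summed over a common finite set.\<close>

lemma frag_lift_superset:
 assumes "finite Y" "Poly_Mapping.keys z <= Y" "!!x. x \<in> Y ==> b x \<in> carrier G"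
 shows "frag_lift G b z = finsum G (%x. add_pow G (Poly_Mapping.lookup z x) (b x)) Y"
proof -
 have 0: "add_pow G (0::int) y = \<zero>" for y
  by (simp add: add_pow_def int_pow_def)
 show ?thesis
  unfolding frag_lift_def
  by (rule add.finprod_mono_neutral_cong_left)
    (use assms in \<open>auto simp: in_keys_iff 0 add.int_pow_closed\<close>)
qed

lemma frag_lift_closed:
 "(!!x. x \<in> Poly_Mapping.keys z ==> b x \<in> carrier G) ==> frag_lift G b z \<in> carrier G"
 unfolding frag_lift_def by (rule finsum_closed) (auto intro!: add.int_pow_closed)

lemma frag_lift_0 [simp]: "frag_lift G b 0 = \<zero>"
 by (simp add: frag_lift_def)

lemma frag_lift_of [simp]: "b x \<in> carrier G ==> frag_lift G b (frag_of x) = b x"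
 by (simp add: frag_lift_def)

lemma frag_lift_add:
 assumes "!!x. x \<in> Poly_Mapping.keys z ==> b x \<in> carrier G"
  "!!x. x \<in> Poly_Mapping.keys w ==> b x \<in> carrier G"
 shows "frag_lift G b (z + w) = frag_lift G b z \<oplus> frag_lift G b w"
proof -
 let ?Y = "Poly_Mapping.keys z \<union> Poly_Mapping.keys w"
 have b: "x \<in> ?Y ==> b x \<in> carrier G" for x using assms by auto
 have "frag_lift G b (z + w) = finsum G (%x. add_pow G (Poly_Mapping.lookup (z + w) x) (b x)) ?Y"
  by (rule frag_lift_superset) (use keys_add[of z w] b in auto)
 also have "... = finsum G (%x. add_pow G (Poly_Mapping.lookup z x) (b x) \<oplus>
   add_pow G (Poly_Mapping.lookup w x) (b x)) ?Y"
  by (rule finsum_cong') (use b in \<open>auto simp: lookup_add add.int_pow_mult intro!: add.int_pow_closed\<close>)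
 also have "... = finsum G (%x. add_pow G (Poly_Mapping.lookup z x) (b x)) ?Y \<oplus>
   finsum G (%x. add_pow G (Poly_Mapping.lookup w x) (b x)) ?Y"
  by (rule finsum_addf) (use b in \<open>auto intro!: add.int_pow_closed\<close>)
 also have "... = frag_lift G b z \<oplus> frag_lift G b w"
 proof -
  have "frag_lift G b z = finsum G (%x. add_pow G (Poly_Mapping.lookup z x) (b x)) ?Y"
   by (rule frag_lift_superset) (use b in auto)
  moreover have "frag_lift G b w = finsum G (%x. add_pow G (Poly_Mapping.lookup w x) (b x)) ?Y"
   by (rule frag_lift_superset) (use b in auto)
  ultimately show ?thesis by (simp only:)
 qed
 finally show ?thesis .
qed

lemma frag_lift_uminus:
 assumes b: "!!x. x \<in> Poly_Mapping.keys z ==> b x \<in> carrier G"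
 shows "frag_lift G b (- z) = \<ominus> frag_lift G b z"
proof -
 have b': "!!x. x \<in> Poly_Mapping.keys (- z) ==> b x \<in> carrier G" using b by simp
 have "frag_lift G b (- z) \<oplus> frag_lift G b z = frag_lift G b (- z + z)"
  by (rule frag_lift_add[symmetric, OF b' b])
 thus ?thesis
  using minus_equality[of "frag_lift G b (- z)" "frag_lift G b z"] frag_lift_closed[of z b, OF b]
   frag_lift_closed[of "- z" b, OF b'] by simp
qed

lemma frag_lift_diff:
 assumes "!!x. x \<in> Poly_Mapping.keys z ==> b x \<in> carrier G"
  "!!x. x \<in> Poly_Mapping.keys w ==> b x \<in> carrier G"
 shows "frag_lift G b (z - w) = frag_lift G b z \<ominus> frag_lift G b w"
proof -
 have "frag_lift G b (z + - w) = frag_lift G b z \<oplus> frag_lift G b (- w)"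
  by (rule frag_lift_add) (use assms in auto)
 thus ?thesis by (simp only: a_minus_def add_uminus_conv_diff frag_lift_uminus[OF assms(2)])
qed

lemma frag_lift_sum:
 assumes "!!i x. [|i \<in> I; x \<in> Poly_Mapping.keys (z i)|] ==> b x \<in> carrier G" "finite I"
 shows "frag_lift G b (\<Sum>i\<in>I. z i) = (\<Oplus>i\<in>I. frag_lift G b (z i))"
 using assms(2,1)
proof (induction I)
 case (insert i I)
 have "Poly_Mapping.keys (sum z I) <= (\<Union>i\<in>I. Poly_Mapping.keys (z i))"
  by (rule keys_sum)
 hence "frag_lift G b (z i + sum z I) = frag_lift G b (z i) \<oplus> frag_lift G b (sum z I)"
  by (intro frag_lift_add) (use insert.prems in blast)+
 moreover have "frag_lift G b (sum z I) = (\<Oplus>i\<in>I. frag_lift G b (z i))"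
  using insert by blast
 moreover have "(%i. frag_lift G b (z i)) \<in> I \<rightarrow> carrier G" "frag_lift G b (z i) \<in> carrier G"
  using insert.prems by (auto intro!: frag_lift_closed)
 ultimately show ?case
  using insert.hyps by simp
qed simp

lemma frag_lift_neg_sign:
 assumes "!!x. x \<in> Poly_Mapping.keys z ==> b x \<in> carrier G"
 shows "frag_lift G b (frag_cmul ((- 1) ^ k) z) = sgn_elt G (int k) (frag_lift G b z)"
proof (cases "even k")
 case False
 thus ?thesis using frag_lift_uminus[OF assms] by (simp add: sgn_elt_def)
qed (simp add: sgn_elt_def)

end

lemma frag_subset_induct [consumes 1]:
 assumes "Poly_Mapping.keys x <= S" "P 0"
  "!!x y. [|Poly_Mapping.keys x <= S; Poly_Mapping.keys y <= S; P x; P y|] ==> P (x - y)"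
  "!!a. a \<in> S ==> P (frag_of a)"
 shows "P x"
 by (rule free_Abelian_group_induct[of x S P]) (use assms in auto)

locale presentation =
 fixes X :: "'x set" and R :: "('x \<Rightarrow>\<^sub>0 int) set"
 assumes rels: "!!r. r \<in> R ==> Poly_Mapping.keys r <= X"
begin

lemma normal_rels: "normal (generate (free_Abelian_group X) R) (free_Abelian_group X)"
proof -
 interpret comm_group "free_Abelian_group X" by (rule abelian_free_Abelian_group)
 show ?thesis
  by (rule subgroup_imp_normal, rule generate_is_subgroup) (use rels in auto)
qed

lemma add_monoid_pres: "add_monoid (pres_group X R) = free_Abelian_group X Mod generate (free_Abelian_group X) R"
 by (simp add: pres_group_def Let_def)

lemma ag_pres: "abelian_group (pres_group X R)"
proof (rule comm_group_abelian_groupI)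
 show "comm_group (add_monoid (pres_group X R))"
  unfolding add_monoid_pres
  by (rule comm_group.abelian_FactGroup[OF abelian_free_Abelian_group normal_imp_subgroup[OF normal_rels]])
qed

abbreviation "coset z == generate (free_Abelian_group X) R #>\<^bsub>free_Abelian_group X\<^esub> z"

lemma coset_hom: "coset \<in> hom (free_Abelian_group X) (add_monoid (pres_group X R))"
 unfolding add_monoid_pres by (rule normal.r_coset_hom_Mod[OF normal_rels])

lemma carrier_pres: "u \<in> carrier (pres_group X R) \<longleftrightarrow> (\<exists>z. Poly_Mapping.keys z <= X & u = coset z)"
proof -
 have "carrier (pres_group X R) = carrier (add_monoid (pres_group X R))" by simp
 also have "... = rcosets\<^bsub>free_Abelian_group X\<^esub> generate (free_Abelian_group X) R"
  unfolding add_monoid_pres by (simp add: FactGroup_def)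
 finally show ?thesis
  by (simp add: RCOSETS_def) (simp only: carrier_free_Abelian_group_iff[symmetric] Bex_def conj_commute)
qed

lemma pres_gen_closed: "x \<in> X ==> pres_gen X R x \<in> carrier (pres_group X R)"
 by (auto simp: carrier_pres pres_gen_def intro!: exI[of _ "frag_of x"])

text \<open>Turns a coset into an integral combination of the classes of generators, so that later
  arguments do not have to mention cosets.\<close>

lemma coset_frag_lift:
 assumes "Poly_Mapping.keys z <= X"
 shows "coset z = frag_lift (pres_group X R) (pres_gen X R) z"
proof -
 interpret abelian_group "pres_group X R" by (rule ag_pres)
 show ?thesis
  using assms
 proof (induction rule: frag_subset_induct)
  case 1
  thus ?case
   using hom_one[OF coset_hom] a_group by simp
 next
  case (2 x y)
  have "coset (x + - y) = coset x \<oplus>\<^bsub>pres_group X R\<^esub> coset (- y)"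
   using hom_mult[OF coset_hom, of x "- y"] 2 by simp
  moreover have "coset (- y) = \<ominus>\<^bsub>pres_group X R\<^esub> coset y"
   using group_hom.hom_inv[OF group_hom.intro[OF group_free_Abelian_group a_group
      group_hom_axioms.intro[OF coset_hom]], of y] 2
   by (simp add: a_inv_def)
  ultimately show ?case
   using 2 by (simp add: frag_lift_diff subsetD pres_gen_closed a_minus_def)
 next
  case (3 a)
  thus ?case using pres_gen_closed by (simp add: pres_gen_def[symmetric])
 qed
qed

lemma frag_lift_rel:
 assumes "r \<in> R" shows "frag_lift (pres_group X R) (pres_gen X R) r = \<zero>\<^bsub>pres_group X R\<^esub>"
proof -
 have g: "subgroup (generate (free_Abelian_group X) R) (free_Abelian_group X)"
  by (rule normal_imp_subgroup[OF normal_rels])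
 have "coset r = generate (free_Abelian_group X) R"
  by (rule subgroup.rcos_const[OF g]) (auto intro: generate.incl assms)
 moreover have "\<zero>\<^bsub>pres_group X R\<^esub> = \<one>\<^bsub>add_monoid (pres_group X R)\<^esub>" by simp
 moreover have "... = generate (free_Abelian_group X) R"
  unfolding add_monoid_pres by (simp add: FactGroup_def)
 ultimately show ?thesis using coset_frag_lift[of r] rels[OF assms] by simp
qed

lemma pres_cases:
 assumes "u \<in> carrier (pres_group X R)"
 obtains z where "Poly_Mapping.keys z <= X" "u = frag_lift (pres_group X R) (pres_gen X R) z"
 using assms coset_frag_lift by (auto simp: carrier_pres)

lemma carrier_pres_generate:
 "carrier (pres_group X R) = agenerate (pres_group X R) (pres_gen X R ` X)"
  (is "_ = ?S")
proof -
 interpret abelian_group "pres_group X R" by (rule ag_pres)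
 have S: "asubgroup ?S (pres_group X R)"
  by (rule generate_subgroup) (auto intro: pres_gen_closed)
 have "frag_lift (pres_group X R) (pres_gen X R) z \<in> ?S" if "Poly_Mapping.keys z <= X" for z
  using that
 proof (induction rule: frag_subset_induct)
  case 1 show ?case by (simp add: subgroup_zero[OF S])
 next
  case (2 x y)
  thus ?case
   by (simp add: frag_lift_diff subsetD pres_gen_closed a_minus_def subgroup_plus[OF S] subgroup_minus[OF S])
 next
  case (3 a)
  thus ?case by (simp add: pres_gen_closed generate.incl agenerate_def)
 qed
 thus ?thesis
  using asubgroup_carrier[OF S] by (auto elim!: pres_cases)
qed

lemma pres_induct [consumes 1, case_names zero gen add minus]:
 assumes "u \<in> carrier (pres_group X R)" "P \<zero>\<^bsub>pres_group X R\<^esub>" "!!x. x \<in> X ==> P (pres_gen X R x)"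
  "!!u v. [|u \<in> carrier (pres_group X R); v \<in> carrier (pres_group X R); P u; P v|]
   ==> P (u \<oplus>\<^bsub>pres_group X R\<^esub> v)"
  "!!u. [|u \<in> carrier (pres_group X R); P u|] ==> P (\<ominus>\<^bsub>pres_group X R\<^esub> u)"
 shows "P u"
proof -
 interpret abelian_group "pres_group X R" by (rule ag_pres)
 have "asubgroup {u \<in> carrier (pres_group X R). P u} (pres_group X R)"
  by (rule add_subgroupI) (use assms in auto)
 from generate_subset[OF this, of "pres_gen X R ` X"]
 have "carrier (pres_group X R) <= {u \<in> carrier (pres_group X R). P u}"
  unfolding carrier_pres_generate[symmetric] using assms(3) pres_gen_closed by blast
 thus ?thesis using assms(1) by blast
qed

lemma pres_hom_eq:
 assumes "f \<in> ahom (pres_group X R) G" "g \<in> ahom (pres_group X R) G" "abelian_group G"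
  "!!x. x \<in> X ==> f (pres_gen X R x) = g (pres_gen X R x)" "u \<in> carrier (pres_group X R)"
 shows "f u = g u"
proof -
 interpret abelian_group "pres_group X R" by (rule ag_pres)
 show ?thesis
  by (rule generate_hom_eq[OF assms(1-3), of "pres_gen X R ` X"])
    (use assms(4,5) carrier_pres_generate in \<open>auto intro: pres_gen_closed\<close>)
qed

context
 fixes G :: "('g, 'z) ring_scheme" and b :: "'x => 'g"
 assumes G: "abelian_group G" and b: "!!x. x \<in> X ==> b x \<in> carrier G"
  and kills: "!!r. r \<in> R ==> frag_lift G b r = \<zero>\<^bsub>G\<^esub>"
begin

interpretation G: abelian_group G by (rule G)

text \<open>The support condition is carried along in the induction because additivity of
  \<open>frag_lift\<close> is available only where \<open>b\<close> takes values in
  \<open>G\<close>.\<close>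

lemma frag_lift_generate:
 assumes "z \<in> generate (free_Abelian_group X) R"
 shows "frag_lift G b z = \<zero>\<^bsub>G\<^esub> & Poly_Mapping.keys z <= X"
 using assms
proof (induction rule: generate.induct)
 case one show ?case by simp
next
 case (incl h) thus ?case using kills rels by auto
next
 case (inv h)
 thus ?case using kills[OF inv] rels[OF inv] b by (simp add: G.frag_lift_uminus subsetD)
next
 case (eng h1 h2)
 thus ?case using keys_add[of h1 h2] b by (auto simp: G.frag_lift_add subsetD)
qed

lemma pres_lift_coset:
 assumes z: "Poly_Mapping.keys z <= X"
 shows "pres_lift G b (coset z) = frag_lift G b z"
proof -
 let ?w = "SOME w. w \<in> coset z"
 have "coset z ~= {}"
  using subgroup.one_closed[OF normal_imp_subgroup[OF normal_rels]] by (auto simp: r_coset_def)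
 hence "?w \<in> coset z" by (simp add: some_in_eq)
 \<comment> \<open>Nothing is known about the representative picked by \<open>SOME\<close> except
   that it differs from \<open>z\<close> by an element \<open>h\<close> of the relation subgroup, on
   which the lift vanishes.\<close>
 then obtain h where h: "h \<in> generate (free_Abelian_group X) R" "?w = h + z"
  by (auto simp: r_coset_def)
 have "frag_lift G b (h + z) = frag_lift G b h \<oplus>\<^bsub>G\<^esub> frag_lift G b z"
  by (rule G.frag_lift_add) (use frag_lift_generate[OF h(1)] z b in auto)
 also have "... = frag_lift G b z"
  using frag_lift_generate[OF h(1)] b z by (simp add: subsetD G.frag_lift_closed)
 finally show ?thesis by (simp add: pres_lift_frag_lift h(2))
qed

lemma pres_lift_gen: "x \<in> X ==> pres_lift G b (pres_gen X R x) = b x"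
 by (simp add: pres_gen_def pres_lift_coset b)

lemma pres_lift_hom: "pres_lift G b \<in> ahom (pres_group X R) G"
proof (rule ahomI)
 fix u v assume "u \<in> carrier (pres_group X R)" "v \<in> carrier (pres_group X R)"
 then obtain z w where z: "Poly_Mapping.keys z <= X" "u = coset z" and w: "Poly_Mapping.keys w <= X" "v = coset w"
  by (auto simp: carrier_pres)
 have "coset (z + w) = u \<oplus>\<^bsub>pres_group X R\<^esub> v"
  using hom_mult[OF coset_hom, of z w] z w by simp
 moreover have "Poly_Mapping.keys (z + w) <= X" using keys_add[of z w] z w by auto
 ultimately show "pres_lift G b (u \<oplus>\<^bsub>pres_group X R\<^esub> v) = pres_lift G b u \<oplus>\<^bsub>G\<^esub> pres_lift G b v"
  using z w b pres_lift_coset[of "z + w"] by (simp add: pres_lift_coset G.frag_lift_add subsetD)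
next
 fix u assume "u \<in> carrier (pres_group X R)"
 thus "pres_lift G b u \<in> carrier G"
  using b by (auto simp: carrier_pres pres_lift_coset subsetD intro!: G.frag_lift_closed)
qed

end

end

lemma (in abelian_group) minus_eq_zeroD:
 assumes "x \<ominus> y = \<zero>" "x \<in> carrier G" "y \<in> carrier G" shows "x = y"
 using assms minus_equality[of x "\<ominus> y"] by (simp add: minus_eq)

text \<open>The relations of tensor products, traces and words have only two shapes: a difference of
  two generators (balancing, moving a scalar) and the three-term additivity relation treated
  next.\<close>

lemma (in abelian_group) frag_lift_rel2:
 assumes "b x \<in> carrier G" "b y \<in> carrier G"
 shows "frag_lift G b (frag_of x - frag_of y) = b x \<ominus> b y"
proof -
 have "frag_lift G b (frag_of x - frag_of y) = frag_lift G b (frag_of x) \<ominus> frag_lift G b (frag_of y)"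
  by (rule frag_lift_diff) (use assms in simp_all)
 thus ?thesis using assms by simp
qed

lemma (in abelian_group) frag_lift_rel3:
 assumes "b x \<in> carrier G" "b y \<in> carrier G" "b z \<in> carrier G"
 shows "frag_lift G b (frag_of x - frag_of y - frag_of z) = b x \<ominus> b y \<ominus> b z"
proof -
 have "frag_lift G b (frag_of x - frag_of y - frag_of z)
   = frag_lift G b (frag_of x - frag_of y) \<ominus> frag_lift G b (frag_of z)"
 proof (rule frag_lift_diff)
  fix w assume "w \<in> Poly_Mapping.keys (frag_of x - frag_of y)"
  hence "w = x \<or> w = y" using keys_diff[of "frag_of x" "frag_of y"] by auto
  thus "b w \<in> carrier G" using assms by auto
 qed (use assms in simp_all)
 thus ?thesis using assms by (simp add: frag_lift_rel2)
qed

context presentation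
begin

interpretation Q: abelian_group "pres_group X R" by (rule ag_pres)

lemma rel2:
 assumes "frag_of x - frag_of y \<in> R" "x \<in> X" "y \<in> X"
 shows "pres_gen X R x = pres_gen X R y"
 by (rule Q.minus_eq_zeroD)
   (simp_all add: pres_gen_closed assms Q.frag_lift_rel2[symmetric] frag_lift_rel)

lemma rel3:
 assumes "frag_of x - frag_of y - frag_of z \<in> R" "x \<in> X" "y \<in> X" "z \<in> X"
 shows "pres_gen X R x = pres_gen X R y \<oplus>\<^bsub>pres_group X R\<^esub> pres_gen X R z"
proof (rule Q.minus_eq_zeroD)
 have "pres_gen X R x \<ominus>\<^bsub>pres_group X R\<^esub> pres_gen X R y \<ominus>\<^bsub>pres_group X R\<^esub> pres_gen X R z = \<zero>\<^bsub>pres_group X R\<^esub>"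
  using frag_lift_rel[OF assms(1)] assms(2-) by (simp only: Q.frag_lift_rel3 pres_gen_closed)
 thus "pres_gen X R x \<ominus>\<^bsub>pres_group X R\<^esub> (pres_gen X R y \<oplus>\<^bsub>pres_group X R\<^esub> pres_gen X R z) = \<zero>\<^bsub>pres_group X R\<^esub>"
  using assms(2-) by (simp add: Q.minus_eq Q.minus_add Q.a_assoc pres_gen_closed)
qed (use assms(2-) in \<open>simp_all add: pres_gen_closed\<close>)

end

section \<open>Tensor products of bimodules\<close>

text \<open>Biadditivity is expressed through the two partial maps being in \<open>ahom\<close>, so
  that it is inherited by composition.\<close>

definition balanced ::
 "'i set => ('m => 'i => 'm) => ('i => 'n => 'n) => ('m, 'y) ring_scheme => ('n, 'z) ring_scheme
  => ('g, 'w) ring_scheme => ('m => 'n => 'g) => bool" where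
 "balanced I r l M N G b \<longleftrightarrow>
   (\<forall>x\<in>carrier M. b x \<in> ahom N G) & (\<forall>y\<in>carrier N. (%x. b x y) \<in> ahom M G) &
   (\<forall>x\<in>carrier M. \<forall>i\<in>I. \<forall>y\<in>carrier N. b (r x i) y = b x (l i y))"

text \<open>The operators are an abstract set acting by \<open>r\<close> and \<open>l\<close>. A
  subring of A gives the tensor product over that subring, and pairs from A acting on both sides
  give the trace, so one universal property serves all of them.\<close>

locale tensor_group =
 M: abelian_group M + N: abelian_group N
 for I :: "'i set" and r :: "'m => 'i => 'm" and l :: "'i => 'n => 'n"
  and M :: "('m, 'y) ring_scheme" and N :: "('n, 'z) ring_scheme" +
 assumes r_closed: "[|x \<in> carrier M; i \<in> I|] ==> r x i \<in> carrier M"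
  and l_closed: "[|i \<in> I; y \<in> carrier N|] ==> l i y \<in> carrier N"
begin

sublocale presentation "carrier M \<times> carrier N" "tensor_rels I r l M N"
proof
 have 2: "Poly_Mapping.keys (frag_of p - frag_of q) <= carrier M \<times> carrier N"
  if "p \<in> carrier M \<times> carrier N" "q \<in> carrier M \<times> carrier N" for p q
  using that keys_diff[of "frag_of p" "frag_of q"] by fastforce
 have 3: "Poly_Mapping.keys (frag_of p - frag_of q - frag_of s) <= carrier M \<times> carrier N"
  if "p \<in> carrier M \<times> carrier N" "q \<in> carrier M \<times> carrier N" "s \<in> carrier M \<times> carrier N" for p q s
  using that keys_diff[of "frag_of p - frag_of q" "frag_of s"] 2[OF that(1,2)] by fastforce
 fix z assume "z \<in> tensor_rels I r l M N"
 thus "Poly_Mapping.keys z <= carrier M \<times> carrier N"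
  unfolding tensor_rels_def
  by (elim UnE CollectE exE conjE; hypsubst; intro 2 3) (simp_all add: r_closed l_closed)
qed

abbreviation "TG == pres_group (carrier M \<times> carrier N) (tensor_rels I r l M N)"
abbreviation "tg x y == pres_gen (carrier M \<times> carrier N) (tensor_rels I r l M N) (x, y)"

lemma tg_closed: "[|x \<in> carrier M; y \<in> carrier N|] ==> tg x y \<in> carrier TG"
 by (rule pres_gen_closed) simp

interpretation TG: abelian_group TG by (rule ag_pres)

lemma tg_balanced: "balanced I r l M N TG tg"
 unfolding balanced_def
proof (intro conjI ballI)
 fix x assume x: "x \<in> carrier M"
 show "tg x \<in> ahom N TG"
 proof (rule ahomI)
  fix y z assume "y \<in> carrier N" "z \<in> carrier N"
  thus "tg x (y \<oplus>\<^bsub>N\<^esub> z) = tg x y \<oplus>\<^bsub>TG\<^esub> tg x z"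
   using x by (intro rel3, unfold tensor_rels_def) (blast, simp_all)
 qed (simp add: x tg_closed)
next
 fix y assume y: "y \<in> carrier N"
 show "(%x. tg x y) \<in> ahom M TG"
 proof (rule ahomI)
  fix x z assume "x \<in> carrier M" "z \<in> carrier M"
  thus "tg (x \<oplus>\<^bsub>M\<^esub> z) y = tg x y \<oplus>\<^bsub>TG\<^esub> tg z y"
   using y by (intro rel3, unfold tensor_rels_def) (blast, simp_all)
 qed (simp add: y tg_closed)
next
 fix x i y assume "x \<in> carrier M" "i \<in> I" "y \<in> carrier N"
 thus "tg (r x i) y = tg x (l i y)"
  by (intro rel2, unfold tensor_rels_def) (blast, simp_all add: r_closed l_closed)
qed

context
 fixes G :: "('g, 'w) ring_scheme" and b
 assumes G: "abelian_group G" and b: "balanced I r l M N G b"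
begin

interpretation G: abelian_group G by (rule G)

lemma balanced_kills:
 assumes "z \<in> tensor_rels I r l M N" shows "frag_lift G (%(x, y). b x y) z = \<zero>\<^bsub>G\<^esub>"
proof -
 let ?L = "frag_lift G (%(x, y). b x y)"
 have c: "b x y \<in> carrier G" if "x \<in> carrier M" "y \<in> carrier N" for x y
  using b that by (auto simp: balanced_def intro: ahom_closed)
 have 3: "?L (frag_of (x, y) - frag_of (x', y') - frag_of (x'', y'')) = b x y \<ominus>\<^bsub>G\<^esub> b x' y' \<ominus>\<^bsub>G\<^esub> b x'' y''"
  if "x \<in> carrier M" "x' \<in> carrier M" "x'' \<in> carrier M" "y \<in> carrier N" "y' \<in> carrier N" "y'' \<in> carrier N" for x x' x'' y y' y''
  using G.frag_lift_rel3[of "%(x, y). b x y" "(x, y)" "(x', y')" "(x'', y'')"] that c by simp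
 have 2: "?L (frag_of (x, y) - frag_of (x', y')) = b x y \<ominus>\<^bsub>G\<^esub> b x' y'"
  if "x \<in> carrier M" "x' \<in> carrier M" "y \<in> carrier N" "y' \<in> carrier N" for x x' y y'
  using G.frag_lift_rel2[of "%(x, y). b x y" "(x, y)" "(x', y')"] that c by simp
 consider x x' y where "z = frag_of (x \<oplus>\<^bsub>M\<^esub> x', y) - frag_of (x, y) - frag_of (x', y)"
    "x \<in> carrier M" "x' \<in> carrier M" "y \<in> carrier N"
  | x y y' where "z = frag_of (x, y \<oplus>\<^bsub>N\<^esub> y') - frag_of (x, y) - frag_of (x, y')"
    "x \<in> carrier M" "y \<in> carrier N" "y' \<in> carrier N"
  | x i y where "z = frag_of (r x i, y) - frag_of (x, l i y)" "x \<in> carrier M" "i \<in> I" "y \<in> carrier N"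
  using assms unfolding tensor_rels_def by blast
 thus ?thesis
 proof cases
  case 1
  hence "b (x \<oplus>\<^bsub>M\<^esub> x') y = b x y \<oplus>\<^bsub>G\<^esub> b x' y"
   using b ahom_add[of "%x. b x y" M G x x'] by (simp add: balanced_def)
  thus ?thesis using 1 c by (simp add: 3 G.group_simps)
 next
  case 2
  hence "b x (y \<oplus>\<^bsub>N\<^esub> y') = b x y \<oplus>\<^bsub>G\<^esub> b x y'"
   using b ahom_add[of "b x" N G y y'] by (simp add: balanced_def)
  thus ?thesis using 2 c by (simp add: 3 G.group_simps)
 next
  case 3
  hence "b (r x i) y = b x (l i y)" using b by (simp add: balanced_def)
  thus ?thesis using 3 c[of x "l i y"] l_closed[of i y] r_closed[of x i]
   by (simp add: 2 G.r_neg G.minus_eq)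
 qed
qed

lemma tensor_lift_hom: "pres_lift G (%(x, y). b x y) \<in> ahom TG G"
 by (rule pres_lift_hom[OF G]) (use b balanced_kills in \<open>auto simp: balanced_def intro: ahom_closed\<close>)

lemma tensor_lift_gen:
 assumes "x \<in> carrier M" "y \<in> carrier N"
 shows "pres_lift G (%(x, y). b x y) (tg x y) = b x y"
proof -
 have "pres_lift G (%(x, y). b x y) (tg x y) = (%(x, y). b x y) (x, y)"
  by (rule pres_lift_gen[OF G]) (use b balanced_kills assms in \<open>auto simp: balanced_def intro: ahom_closed\<close>)
 thus ?thesis by simp
qed

end

lemma tensor_hom_eq:
 assumes "f \<in> ahom TG G" "g \<in> ahom TG G" "abelian_group G"
  "!!x y. [|x \<in> carrier M; y \<in> carrier N|] ==> f (tg x y) = g (tg x y)" "u \<in> carrier TG"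
 shows "f u = g u"
 by (rule pres_hom_eq[OF assms(1-3)]) (use assms(4,5) in auto)

end

lemma balancedI:
 assumes "!!x y. [|x \<in> carrier M; y \<in> carrier N|] ==> b x y \<in> carrier G"
  "!!x x' y. [|x \<in> carrier M; x' \<in> carrier M; y \<in> carrier N|] ==> b (x \<oplus>\<^bsub>M\<^esub> x') y = b x y \<oplus>\<^bsub>G\<^esub> b x' y"
  "!!x y y'. [|x \<in> carrier M; y \<in> carrier N; y' \<in> carrier N|] ==> b x (y \<oplus>\<^bsub>N\<^esub> y') = b x y \<oplus>\<^bsub>G\<^esub> b x y'"
  "!!x i y. [|x \<in> carrier M; i \<in> I; y \<in> carrier N|] ==> b (r x i) y = b x (l i y)"
 shows "balanced I r l M N G b"
 unfolding balanced_def by (auto intro!: ahomI simp: assms)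

lemma left_hom_ahom: "f \<in> left_hom A M N ==> f \<in> ahom M N"
 by (simp add: left_hom_def ahom_def)

lemma bimod_hom_left: "f \<in> bimod_hom A M N ==> f \<in> left_hom A M N"
 by (simp add: bimod_hom_def)

lemma bimod_hom_ahom: "f \<in> bimod_hom A M N ==> f \<in> ahom M N"
 by (rule left_hom_ahom[OF bimod_hom_left])

lemma left_hom_smult:
 "[|f \<in> left_hom A M N; a \<in> carrier A; x \<in> carrier M|] ==> f (a \<odot>\<^bsub>M\<^esub> x) = a \<odot>\<^bsub>N\<^esub> f x"
 by (simp add: left_hom_def)

lemma bimod_hom_ract:
 "[|f \<in> bimod_hom A M N; a \<in> carrier A; x \<in> carrier M|] ==> f (x \<triangleleft>\<^bsub>M\<^esub> a) = f x \<triangleleft>\<^bsub>N\<^esub> a"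
 by (simp add: bimod_hom_def)

lemma left_homI:
 "[|f \<in> ahom M N; !!a x. [|a \<in> carrier A; x \<in> carrier M|] ==> f (a \<odot>\<^bsub>M\<^esub> x) = a \<odot>\<^bsub>N\<^esub> f x|] ==> f \<in> left_hom A M N"
 by (simp add: left_hom_def ahom_def)

lemma bimod_homI:
 "[|f \<in> ahom M N; !!a x. [|a \<in> carrier A; x \<in> carrier M|] ==> f (a \<odot>\<^bsub>M\<^esub> x) = a \<odot>\<^bsub>N\<^esub> f x;
  !!a x. [|a \<in> carrier A; x \<in> carrier M|] ==> f (x \<triangleleft>\<^bsub>M\<^esub> a) = f x \<triangleleft>\<^bsub>N\<^esub> a|] ==> f \<in> bimod_hom A M N"
 by (simp add: bimod_hom_def left_homI)

lemma bimod_hom_comp: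
 assumes "f \<in> bimod_hom A M N" "g \<in> bimod_hom A N L"
 shows "(%x. g (f x)) \<in> bimod_hom A M L"
 by (rule bimod_homI[OF ahom_comp[OF bimod_hom_ahom[OF assms(1)] bimod_hom_ahom[OF assms(2)]]])
   (simp_all add: left_hom_smult[OF bimod_hom_left[OF assms(1)]] left_hom_smult[OF bimod_hom_left[OF assms(2)]]
    bimod_hom_ract[OF assms(1)] bimod_hom_ract[OF assms(2)] ahom_closed[OF bimod_hom_ahom[OF assms(1)]])

context bimodule
begin

lemma smult_ahom: "a \<in> carrier A ==> (%x. a \<odot> x) \<in> ahom M M"
 by (auto simp: left_closed left_distrib intro!: ahomI)

lemma ract_ahom: "a \<in> carrier A ==> (%x. x \<triangleleft> a) \<in> ahom M M"
 by (auto simp: right_closed right_distrib intro!: ahomI)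

lemmas smult_zero = ahom_zero[OF ag ag smult_ahom]
lemmas smult_minus = ahom_neg[OF ag ag smult_ahom]
lemmas smult_sgn = ahom_sgn[OF ag ag smult_ahom]
lemmas smult_finsum = ahom_finsum[OF ag ag smult_ahom]
lemmas ract_zero = ahom_zero[OF ag ag ract_ahom]
lemmas ract_minus = ahom_neg[OF ag ag ract_ahom]
lemmas ract_sgn = ahom_sgn[OF ag ag ract_ahom]
lemmas ract_finsum = ahom_finsum[OF ag ag ract_ahom]

end

lemma (in assoc_algebra) base_scalars_closed: "base_scalars K A <= carrier A"
 by (auto simp: base_scalars_def)

lemma agenerate_cong:
 fixes G :: "('g, 'y) ring_scheme" and H :: "('g, 'z) ring_scheme"
 assumes "carrier H = carrier G" "add H = add G" "zero H = zero G"
 shows "agenerate H X = agenerate G X"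
proof -
 have *: "x \<in> agenerate H X" if "x \<in> agenerate G X" "add H = add G" "zero H = zero G" "a_inv H = a_inv G"
  for x and G :: "('g, 'y1) ring_scheme" and H :: "('g, 'z1) ring_scheme"
  using that(1) unfolding agenerate_def
 proof (induction rule: generate.induct)
  case one
  show ?case using generate.one[of "add_monoid H" X] by (simp add: that(2-4))
 next
  case (incl h)
  thus ?case by (rule generate.incl)
 next
  case (inv h)
  thus ?case using generate.inv[of h X "add_monoid H"] that(4) by (simp add: a_inv_def fun_eq_iff)
 next
  case (eng h1 h2)
  thus ?case using generate.eng[of h1 "add_monoid H" X h2] by (simp add: that(2-4))
 qed
 show ?thesis
  using *[of _ G H] *[of _ H G] assms a_inv_cong[of H G] by auto
qed

text \<open>The inclusion \<open>base_S\<close> is what makes the result a bimodule over K: a scalar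
  has to cross the tensor sign for its two actions to agree.\<close>

locale tensor_bimodule =
 assoc_algebra K A + M: bimodule K A M + N: bimodule K A N
 for K :: "('k, 'kz) ring_scheme" and A :: "('k, 'a, 'az) module_scheme" and S :: "'a set"
  and M :: "('a, 'm, 'y) graded_bimodule_scheme" and N :: "('a, 'n, 'z) graded_bimodule_scheme" +
 assumes S_subset: "S <= carrier A" and base_S: "base_scalars K A <= S"
begin

sublocale TT: tensor_group S "ract M" "smult N" M N
 by unfold_locales (use S_subset in \<open>auto simp: M.right_closed N.left_closed\<close>)

abbreviation "T == tensor S M N"
abbreviation "tn == tens S M N"

lemma carrier_tensor: "carrier T = carrier TT.TG"
 and add_tensor: "add T = add TT.TG"
 and zero_tensor: "zero T = zero TT.TG"
 by (simp_all add: tensor_def Let_def)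

lemma smult_tensor: "a \<odot>\<^bsub>T\<^esub> u = pres_lift TT.TG (%(x, y). tn (a \<odot>\<^bsub>M\<^esub> x) y) u"
 and ract_tensor: "u \<triangleleft>\<^bsub>T\<^esub> a = pres_lift TT.TG (%(x, y). tn x (y \<triangleleft>\<^bsub>N\<^esub> a)) u"
 by (simp_all add: tensor_def Let_def)

lemma ahom_tensor: "ahom T G = ahom TT.TG G" "ahom H T = ahom H TT.TG"
 by (simp_all add: ahom_def hom_def carrier_tensor add_tensor)

lemma ag_tensor: "abelian_group T"
 by (rule abelian_group_cong[OF TT.ag_pres]) (simp_all add: carrier_tensor add_tensor zero_tensor)

sublocale T: abelian_group T by (rule ag_tensor)

lemma tens_tg: "tn x y = TT.tg x y"
 by (simp add: tens_def)

lemma tens_balanced: "balanced S (ract M) (smult N) M N T tn"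
 using TT.tg_balanced unfolding balanced_def ahom_tensor tens_tg tens_def[abs_def] by simp

lemma tens_closed [simp]: "[|x \<in> carrier M; y \<in> carrier N|] ==> tn x y \<in> carrier T"
 using tens_balanced by (auto simp: balanced_def intro: ahom_closed)

lemma tens_left_ahom: "y \<in> carrier N ==> (%x. tn x y) \<in> ahom M T"
 and tens_right_ahom: "x \<in> carrier M ==> (%y. tn x y) \<in> ahom N T"
 using tens_balanced by (auto simp: balanced_def)

lemma tens_bal: "[|x \<in> carrier M; s \<in> S; y \<in> carrier N|] ==> tn (x \<triangleleft>\<^bsub>M\<^esub> s) y = tn x (s \<odot>\<^bsub>N\<^esub> y)"
 using tens_balanced by (auto simp: balanced_def)

lemmas tens_add_left = ahom_add[OF tens_left_ahom]
lemmas tens_add_right = ahom_add[OF tens_right_ahom]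
lemmas tens_zero_left = ahom_zero[OF M.ag T.ag tens_left_ahom]
lemmas tens_zero_right = ahom_zero[OF N.ag T.ag tens_right_ahom]
lemmas tens_sgn_left = ahom_sgn[OF M.ag T.ag tens_left_ahom]
lemmas tens_sgn_right = ahom_sgn[OF N.ag T.ag tens_right_ahom]

lemma lift_hom: "[|abelian_group G; balanced S (ract M) (smult N) M N G b|] ==> pres_lift G (%(x, y). b x y) \<in> ahom T G"
 unfolding ahom_tensor by (rule TT.tensor_lift_hom)

lemma lift_tens: "[|abelian_group G; balanced S (ract M) (smult N) M N G b; x \<in> carrier M; y \<in> carrier N|]
  ==> pres_lift G (%(x, y). b x y) (tn x y) = b x y"
 unfolding tens_tg by (rule TT.tensor_lift_gen)

lemma hom_eq:
 assumes "f \<in> ahom T G" "g \<in> ahom T G" "abelian_group G"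
  "!!x y. [|x \<in> carrier M; y \<in> carrier N|] ==> f (tn x y) = g (tn x y)" "u \<in> carrier T"
 shows "f u = g u"
 by (rule TT.tensor_hom_eq[OF _ _ assms(3)])
   (use assms in \<open>auto simp: tens_tg ahom_tensor carrier_tensor\<close>)

lemma tensor_carrier_generate: "carrier T = agenerate T {tn x y | x y. x \<in> carrier M & y \<in> carrier N}"
proof -
 have "{tn x y | x y. x \<in> carrier M & y \<in> carrier N} = pres_gen (carrier M \<times> carrier N) (tensor_rels S (ract M) (smult N) M N) ` (carrier M \<times> carrier N)"
  by (auto simp: tens_tg)
 moreover have "agenerate T = agenerate TT.TG"
  by (rule ext) (rule agenerate_cong, simp_all only: carrier_tensor add_tensor zero_tensor)
 ultimately show ?thesis
  using TT.carrier_pres_generate by (simp add: carrier_tensor)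
qed

lemma smult_balanced: "a \<in> carrier A ==> balanced S (ract M) (smult N) M N TT.TG (%x y. tn (a \<odot>\<^bsub>M\<^esub> x) y)"
 using tens_balanced S_subset
 by (auto simp: balanced_def ahom_tensor M.left_closed M.left_right[symmetric] subsetD
   intro: ahom_comp[OF M.smult_ahom])

lemma ract_balanced: "a \<in> carrier A ==> balanced S (ract M) (smult N) M N TT.TG (%x y. tn x (y \<triangleleft>\<^bsub>N\<^esub> a))"
 using tens_balanced S_subset
 by (auto simp: balanced_def ahom_tensor N.right_closed N.left_right subsetD
   intro: ahom_comp[OF N.ract_ahom])

lemma smult_tensor_ahom: "a \<in> carrier A ==> (%u. a \<odot>\<^bsub>T\<^esub> u) \<in> ahom T T"
 using lift_hom[OF TT.ag_pres smult_balanced] unfolding ahom_tensor(2) by (simp add: smult_tensor)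

lemma ract_tensor_ahom: "a \<in> carrier A ==> (%u. u \<triangleleft>\<^bsub>T\<^esub> a) \<in> ahom T T"
 using lift_hom[OF TT.ag_pres ract_balanced] unfolding ahom_tensor(2) by (simp add: ract_tensor)

lemma smult_tens: "[|a \<in> carrier A; x \<in> carrier M; y \<in> carrier N|] ==> a \<odot>\<^bsub>T\<^esub> tn x y = tn (a \<odot>\<^bsub>M\<^esub> x) y"
 using lift_tens[OF TT.ag_pres smult_balanced] by (simp add: smult_tensor)

lemma ract_tens: "[|a \<in> carrier A; x \<in> carrier M; y \<in> carrier N|] ==> tn x y \<triangleleft>\<^bsub>T\<^esub> a = tn x (y \<triangleleft>\<^bsub>N\<^esub> a)"
 using lift_tens[OF TT.ag_pres ract_balanced] by (simp add: ract_tensor)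

lemma bimodule_tensor: "bimodule K A T"
proof -
 note E = hom_eq[OF _ _ ag_tensor]
 note sm = smult_tensor_ahom and ra = ract_tensor_ahom
 note si = smult_tens ract_tens M.left_closed N.right_closed
 note pl = ahom_plus[OF ag_tensor ag_tensor]
 have c: "c \<odot>\<^bsub>A\<^esub> \<one>\<^bsub>A\<^esub> \<in> S" "c \<odot>\<^bsub>A\<^esub> \<one>\<^bsub>A\<^esub> \<in> carrier A" if "c \<in> carrier K" for c
  using that base_S by (auto simp: base_scalars_def)
 show ?thesis
 proof (unfold_locales, goal_cases)
  case (1 a x) thus ?case by (simp add: ahom_closed[OF sm])
 next
  case (2 a b x)
  show ?case
   by (rule E[of _ _ x]) (use 2 in \<open>auto intro: sm pl simp: si M.left_distrib_ring tens_add_left\<close>)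
 next
  case (3 a x y) thus ?case by (simp add: ahom_add[OF sm])
 next
  case (4 a b x)
  show ?case
   by (rule E[of _ _ x]) (use 4 in \<open>auto intro!: sm ahom_comp[OF sm] simp: si M.left_assoc\<close>)
 next
  case (5 x)
  show ?case
   by (rule E[of _ _ x]) (use 5 in \<open>auto intro: sm ahom_id simp: si M.left_one\<close>)
 next
  case (6 a x) thus ?case by (simp add: ahom_closed[OF ra])
 next
  case (7 a b x)
  show ?case
   by (rule E[of _ _ x]) (use 7 in \<open>auto intro: ra pl simp: si N.right_distrib_ring tens_add_right\<close>)
 next
  case (8 a x y) thus ?case by (simp add: ahom_add[OF ra])
 next
  case (9 a b x)
  show ?case
   by (rule E[of _ _ x]) (use 9 in \<open>auto intro!: ra ahom_comp[OF ra] simp: si N.right_assoc\<close>)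
 next
  case (10 x)
  show ?case
   by (rule E[of _ _ x]) (use 10 in \<open>auto intro: ra ahom_id simp: si N.right_one\<close>)
 next
  case (11 a b x)
  show ?case
   by (rule E[of _ _ x]) (use 11 in \<open>auto intro!: ahom_comp[OF sm ra] ahom_comp[OF ra sm] simp: si\<close>)
 next
  case (12 k x)
  \<comment> \<open>The scalar acts on the left of the first factor, hence also on its right; it
    crosses the tensor sign because it lies in \<open>S\<close>, and it is central on the second
    factor.\<close>
  have "tn ((k \<odot>\<^bsub>A\<^esub> \<one>\<^bsub>A\<^esub>) \<odot>\<^bsub>M\<^esub> y) z = tn y (z \<triangleleft>\<^bsub>N\<^esub> (k \<odot>\<^bsub>A\<^esub> \<one>\<^bsub>A\<^esub>))" if "y \<in> carrier M" "z \<in> carrier N" for y z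
   using M.scalars_central[OF 12(1) that(1)] N.scalars_central[OF 12(1) that(2)]
    tens_bal[OF that(1) c(1)[OF 12(1)] that(2)] by (simp only:)
  thus ?case
   by (intro E[OF sm ra, of "k \<odot>\<^bsub>A\<^esub> \<one>\<^bsub>A\<^esub>" "k \<odot>\<^bsub>A\<^esub> \<one>\<^bsub>A\<^esub>" x])
     (simp_all only: smult_tens ract_tens c(2)[OF 12(1)] 12(2))
 qed
qed

sublocale T: bimodule K A T by (rule bimodule_tensor)

end

section \<open>Gradings and Koszul twists\<close>

context graded_bimodule
begin

lemma grade_asubgroup: "asubgroup (grade M n) M"
 using grade_subgroup by (simp add: asubgroup_def)

lemma grade_closed: "x \<in> grade M n ==> x \<in> carrier M"
 by (rule asubgroup_carrier[OF grade_asubgroup])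

lemma grade_zero: "\<zero> \<in> grade M n"
 by (rule subgroup_zero[OF grade_asubgroup])

lemma decompositionI:
 assumes "finite Y" "!!n. c n \<in> grade M n" "!!n. n \<notin> Y ==> c n = \<zero>" "x = (\<Oplus>n\<in>Y. c n)"
 shows "is_decomposition M x c"
proof -
 have "{n. c n ~= \<zero>} <= Y" using assms(3) by auto
 moreover have "(\<Oplus>n\<in>{n. c n ~= \<zero>}. c n) = (\<Oplus>n\<in>Y. c n)"
  by (rule add.finprod_mono_neutral_cong_left) (use assms(1,3) grade_closed[OF assms(2)] in auto)
 ultimately show ?thesis
  using assms finite_subset by (auto simp: is_decomposition_def)
qed

lemma component_decomposition: "x \<in> carrier M ==> is_decomposition M x (component M x)"
 unfolding component_def by (rule theI'[OF ex1_decomposition])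

lemma component_eq:
 "[|is_decomposition M x c; x \<in> carrier M|] ==> component M x = c"
 using ex1_decomposition component_decomposition by blast

lemma component_grade: "x \<in> carrier M ==> component M x n \<in> grade M n"
 using component_decomposition by (simp add: is_decomposition_def)

lemma component_closed: "x \<in> carrier M ==> component M x n \<in> carrier M"
 by (rule grade_closed[OF component_grade])

lemma finite_support: "x \<in> carrier M ==> finite (support M x)"
 using component_decomposition by (simp add: is_decomposition_def support_def)

lemma sum_support: "x \<in> carrier M ==> (\<Oplus>n\<in>support M x. component M x n) = x"
 using component_decomposition by (simp add: is_decomposition_def support_def)

lemma sum_components:
 assumes "x \<in> carrier M" "finite Y" "support M x <= Y"
 shows "(\<Oplus>n\<in>Y. component M x n) = x"
proof -
 have "(\<Oplus>n\<in>support M x. component M x n) = (\<Oplus>n\<in>Y. component M x n)"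
  by (rule add.finprod_mono_neutral_cong_left)
    (use assms component_closed in \<open>auto simp: support_def\<close>)
 thus ?thesis using sum_support[OF assms(1)] by simp
qed

lemma component_add:
 assumes "x \<in> carrier M" "y \<in> carrier M"
 shows "component M (x \<oplus> y) n = component M x n \<oplus> component M y n"
proof -
 let ?Y = "support M x \<union> support M y"
 have fin: "finite ?Y" using finite_support assms by simp
 have c: "component M x i \<in> carrier M" "component M y i \<in> carrier M" for i
  using assms by (simp_all add: component_closed)
 have "is_decomposition M (x \<oplus> y) (%n. component M x n \<oplus> component M y n)"
 proof (rule decompositionI[OF fin])
  show "x \<oplus> y = (\<Oplus>n\<in>?Y. component M x n \<oplus> component M y n)"
   using sum_components[OF assms(1) fin] sum_components[OF assms(2) fin] c by (simp add: finsum_addf)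
 qed (use component_grade assms c in \<open>auto simp: support_def intro: subgroup_plus[OF grade_asubgroup]\<close>)
 thus ?thesis using component_eq assms by simp
qed

lemma component_homogeneous:
 assumes "x \<in> grade M i" shows "component M x n = (if n = i then x else \<zero>)"
proof -
 have "is_decomposition M x (%n. if n = i then x else \<zero>)"
  by (rule decompositionI[of "{i}"]) (use assms grade_closed grade_zero in auto)
 thus ?thesis using component_eq assms grade_closed by simp
qed

lemma support_homogeneous: "x \<in> grade M i ==> support M x = (if x = \<zero> then {} else {i})"
 by (auto simp: support_def component_homogeneous)

text \<open>Every element is a finite sum of its components. Signs are given degreewise, so this is
  how maps containing signs are compared.\<close>

lemma graded_hom_eq:
 assumes "f \<in> ahom M G" "g \<in> ahom M G" "abelian_group G"
  "!!n x. x \<in> grade M n ==> f x = g x" "x \<in> carrier M"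
 shows "f x = g x"
proof -
 have "f x = f (\<Oplus>n\<in>support M x. component M x n)" by (simp add: sum_support assms(5))
 also have "... = finsum G (%n. f (component M x n)) (support M x)"
  by (rule ahom_finsum[OF ag assms(3,1)]) (use assms(5) component_closed in auto)
 also have "... = finsum G (%n. g (component M x n)) (support M x)"
  using assms(4)[OF component_grade[OF assms(5)]] by simp
 also have "... = g (\<Oplus>n\<in>support M x. component M x n)"
  by (rule ahom_finsum[OF ag assms(3,2), symmetric]) (use assms(5) component_closed in auto)
 finally show ?thesis by (simp add: sum_support assms(5))
qed

text \<open>Glues one homomorphism per degree into a single one; both the Koszul twist and the swap
  arise in this way. For additivity the sums for x, y and their sum are compared over the union of
  the three supports, where the extra terms are zero.\<close>

lemma graded_lift:
 assumes G: "abelian_group G" and h: "!!i. h i \<in> ahom M G"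
 shows graded_lift_hom: "(%x. finsum G (%i. h i (component M x i)) (support M x)) \<in> ahom M G"
  and graded_lift_homogeneous: "x \<in> grade M n ==> finsum G (%i. h i (component M x i)) (support M x) = h n x"
proof -
 interpret G: abelian_group G by fact
 have z: "h i \<zero> = \<zero>\<^bsub>G\<^esub>" for i by (rule ahom_zero[OF ag G h])
 have c: "h i (component M x i) \<in> carrier G" if "x \<in> carrier M" for i x
  by (rule ahom_closed[OF h component_closed[OF that]])
 have ext: "finsum G (%i. h i (component M x i)) (support M x) = finsum G (%i. h i (component M x i)) Y"
  if "x \<in> carrier M" "finite Y" "support M x <= Y" for x Y
  by (rule G.add.finprod_mono_neutral_cong_left) (use that c z in \<open>auto simp: support_def\<close>)
 show "(%x. finsum G (%i. h i (component M x i)) (support M x)) \<in> ahom M G"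
 proof (rule ahomI)
  fix x y assume xy: "x \<in> carrier M" "y \<in> carrier M"
  let ?Y = "support M x \<union> support M y \<union> support M (x \<oplus> y)"
  have fin: "finite ?Y" using finite_support xy by simp
  have "finsum G (%i. h i (component M (x \<oplus> y) i)) (support M (x \<oplus> y)) = finsum G (%i. h i (component M (x \<oplus> y) i)) ?Y"
   by (rule ext) (use xy fin in auto)
  also have "... = finsum G (%i. h i (component M x i) \<oplus>\<^bsub>G\<^esub> h i (component M y i)) ?Y"
   using xy by (simp add: component_add ahom_add[OF h] component_closed)
  also have "... = finsum G (%i. h i (component M x i)) ?Y \<oplus>\<^bsub>G\<^esub> finsum G (%i. h i (component M y i)) ?Y"
   by (rule G.finsum_addf) (use c xy in auto)
  finally show "finsum G (%i. h i (component M (x \<oplus> y) i)) (support M (x \<oplus> y)) =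
    finsum G (%i. h i (component M x i)) (support M x) \<oplus>\<^bsub>G\<^esub> finsum G (%i. h i (component M y i)) (support M y)"
   using ext[OF xy(1) fin] ext[OF xy(2) fin] by (simp add: le_supI1)
 qed (auto intro!: G.finsum_closed c)
 assume x: "x \<in> grade M n"
 have "finsum G (%i. h i (component M x i)) (support M x) = finsum G (%i. h i (component M x i)) {n}"
  by (rule ext) (use x grade_closed in \<open>auto simp: support_homogeneous\<close>)
 thus "finsum G (%i. h i (component M x i)) (support M x) = h n x"
  using x c[OF grade_closed[OF x], of n] by (simp add: component_homogeneous)
qed

lemma twist_ahom: "twist M m \<in> ahom M M"
 unfolding twist_def[abs_def]
 by (rule graded_lift_hom[OF ag ahom_sgn_elt[OF ag ag ahom_id(1)]])

lemma twist_homogeneous: "x \<in> grade M n ==> twist M m x = sgn_elt M (n * m) x"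
 unfolding twist_def
 by (rule graded_lift_homogeneous[OF ag ahom_sgn_elt[OF ag ag ahom_id(1)]])

lemma twist_closed: "x \<in> carrier M ==> twist M m x \<in> carrier M"
 by (rule ahom_closed[OF twist_ahom])

lemma twist_0: "x \<in> carrier M ==> twist M 0 x = x"
 by (rule graded_hom_eq[OF twist_ahom ahom_id(1) ag]) (simp_all add: twist_homogeneous)

lemma twist_smult: "[|a \<in> carrier A; x \<in> carrier M|] ==> twist M m (a \<odot> x) = a \<odot> twist M m x"
 by (rule graded_hom_eq[OF ahom_comp[OF smult_ahom twist_ahom] ahom_comp[OF twist_ahom smult_ahom] ag])
   (simp_all add: twist_homogeneous grade_left smult_sgn grade_closed)

lemma twist_ract: "[|a \<in> carrier A; x \<in> carrier M|] ==> twist M m (x \<triangleleft> a) = twist M m x \<triangleleft> a"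
 by (rule graded_hom_eq[OF ahom_comp[OF ract_ahom twist_ahom] ahom_comp[OF twist_ahom ract_ahom] ag])
   (simp_all add: twist_homogeneous grade_right ract_sgn grade_closed)

end

context tensor_bimodule
begin

definition "homogeneous_tens n = {tn x y | x y i j. x \<in> grade M i & y \<in> grade N j & i + j = n}"

lemma grade_tensor: "grade T n = agenerate T (homogeneous_tens n)"
proof -
 have "grade T n = agenerate TT.TG (homogeneous_tens n)"
  by (simp add: tensor_def Let_def agenerate_def homogeneous_tens_def)
 also have "... = agenerate T (homogeneous_tens n)"
  by (rule agenerate_cong[symmetric]) (simp_all only: carrier_tensor add_tensor zero_tensor)
 finally show ?thesis .
qed

end

locale tensor_graded = tensor_bimodule K A S M N + M: graded_bimodule K A M + N: graded_bimodule K A N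
 for K :: "('k, 'kz) ring_scheme" and A :: "('k, 'a, 'az) module_scheme" and S :: "'a set"
  and M :: "('a, 'm, 'y) graded_bimodule_scheme" and N :: "('a, 'n, 'z) graded_bimodule_scheme"
begin

lemma homogeneous_tens_closed: "homogeneous_tens n <= carrier T"
 by (auto simp: homogeneous_tens_def M.grade_closed N.grade_closed)

lemma grade_tensor_asubgroup: "asubgroup (grade T n) T"
 unfolding grade_tensor by (rule T.generate_subgroup[OF homogeneous_tens_closed])

lemma tens_grade: "[|x \<in> grade M i; y \<in> grade N j; i + j = n|] ==> tn x y \<in> grade T n"
 unfolding grade_tensor agenerate_def by (rule generate.incl) (auto simp: homogeneous_tens_def)

lemma grade_tensor_image:
 assumes "f \<in> ahom T G" "abelian_group G" "asubgroup C G"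
  "!!x y i j. [|x \<in> grade M i; y \<in> grade N j; i + j = n|] ==> f (tn x y) \<in> C" "u \<in> grade T n"
 shows "f u \<in> C"
 by (rule T.generate_image_subset[OF assms(1-3) homogeneous_tens_closed _ assms(5)[unfolded grade_tensor]])
   (auto simp: homogeneous_tens_def assms(4))

lemma graded_tensor_hom_eq:
 assumes "f \<in> ahom T G" "g \<in> ahom T G" "abelian_group G"
  "!!x y i j. [|x \<in> grade M i; y \<in> grade N j|] ==> f (tn x y) = g (tn x y)" "u \<in> carrier T"
 shows "f u = g u"
proof (rule hom_eq[OF assms(1-3) _ assms(5)])
 fix x y assume x: "x \<in> carrier M" and y: "y \<in> carrier N"
 show "f (tn x y) = g (tn x y)"
 proof (rule M.graded_hom_eq[OF ahom_comp[OF tens_left_ahom[OF y] assms(1)] ahom_comp[OF tens_left_ahom[OF y] assms(2)] assms(3) _ x])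
  fix i x' assume x': "x' \<in> grade M i"
  show "f (tn x' y) = g (tn x' y)"
   by (rule N.graded_hom_eq[OF ahom_comp[OF tens_right_ahom assms(1)] ahom_comp[OF tens_right_ahom assms(2)] assms(3) _ y])
     (use x' M.grade_closed assms(4) in auto)
 qed
qed

end

text \<open>Only right linearity of \<open>f\<close> and left linearity of \<open>g\<close> over
  \<open>S\<close> are asked for. With \<open>S\<close> the base scalars this admits the homotopy
  \<open>t\<close>, which is not right linear over A.\<close>

lemma tensor_map_hom:
 fixes M :: "('a, 'm, 'y) graded_bimodule_scheme" and N :: "('a, 'n, 'z) graded_bimodule_scheme"
  and M' :: "('a, 'm1, 'y1) graded_bimodule_scheme" and N' :: "('a, 'n1, 'z1) graded_bimodule_scheme"
 assumes T: "tensor_bimodule K A S M N" and T': "tensor_bimodule K A S M' N'" and M: "graded_bimodule K A M"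
  and f: "f \<in> ahom M M'" "!!x s. [|x \<in> carrier M; s \<in> S|] ==> f (x \<triangleleft>\<^bsub>M\<^esub> s) = f x \<triangleleft>\<^bsub>M'\<^esub> s"
  and g: "g \<in> ahom N N'" "!!y s. [|y \<in> carrier N; s \<in> S|] ==> g (s \<odot>\<^bsub>N\<^esub> y) = s \<odot>\<^bsub>N'\<^esub> g y"
 shows tensor_map_ahom: "tensor_map S M M' N' m f g \<in> ahom (tensor S M N) (tensor S M' N')"
  and tensor_map_tens: "[|x \<in> carrier M; y \<in> carrier N|] ==>
   tensor_map S M M' N' m f g (tens S M N x y) = tens S M' N' (f (twist M m x)) (g y)"
proof -
 interpret T: tensor_bimodule K A S M N by fact
 interpret T': tensor_bimodule K A S M' N' by fact
 interpret M: graded_bimodule K A M by fact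
 have fg: "f (twist M m x) \<in> carrier M'" "g y \<in> carrier N'" if "x \<in> carrier M" "y \<in> carrier N" for x y
  using that f(1) g(1) by (auto intro: ahom_closed M.twist_closed)
 have b: "balanced S (ract M) (smult N) M N (tensor S M' N') (%x y. tens S M' N' (f (twist M m x)) (g y))"
  unfolding balanced_def
 proof (intro conjI ballI)
  fix x assume "x \<in> carrier M"
  hence "f (twist M m x) \<in> carrier M'" by (rule ahom_closed[OF f(1) M.twist_closed])
  from ahom_comp[OF g(1) T'.tens_right_ahom[OF this]]
  show "(%y. tens S M' N' (f (twist M m x)) (g y)) \<in> ahom N (tensor S M' N')" .
 next
  fix y assume "y \<in> carrier N"
  from ahom_comp[OF ahom_comp[OF M.twist_ahom f(1)] T'.tens_left_ahom[OF ahom_closed[OF g(1) this]]]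
  show "(%x. tens S M' N' (f (twist M m x)) (g y)) \<in> ahom M (tensor S M' N')" .
 next
  fix x s y assume a: "x \<in> carrier M" "s \<in> S" "y \<in> carrier N"
  have "f (twist M m (x \<triangleleft>\<^bsub>M\<^esub> s)) = f (twist M m x) \<triangleleft>\<^bsub>M'\<^esub> s"
   using a T.S_subset by (simp add: M.twist_ract subsetD f(2) M.twist_closed)
  thus "tens S M' N' (f (twist M m (x \<triangleleft>\<^bsub>M\<^esub> s))) (g y) = tens S M' N' (f (twist M m x)) (g (s \<odot>\<^bsub>N\<^esub> y))"
   using a fg by (simp add: g(2) T'.tens_bal)
 qed
 show "tensor_map S M M' N' m f g \<in> ahom (tensor S M N) (tensor S M' N')"
  unfolding tensor_map_def by (rule T.lift_hom[OF T'.ag_tensor b])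
 show "tensor_map S M M' N' m f g (tens S M N x y) = tens S M' N' (f (twist M m x)) (g y)"
  if "x \<in> carrier M" "y \<in> carrier N"
  unfolding tensor_map_def by (rule T.lift_tens[OF T'.ag_tensor b that])
qed

section \<open>The trace and the swap of tensor factors\<close>

locale trace_group = assoc_algebra K A + M: bimodule K A M
 for K :: "('k, 'kz) ring_scheme" and A :: "('k, 'a, 'az) module_scheme" and M :: "('a, 'm, 'y) bimodule_scheme"
begin

sublocale TR: tensor_group "carrier A \<times> carrier A" "%x (a, b). b \<otimes>\<^bsub>A\<^esub> x \<otimes>\<^bsub>A\<^esub> a"
  "%(a, b) m. (a \<odot>\<^bsub>M\<^esub> m) \<triangleleft>\<^bsub>M\<^esub> b" A M
 by unfold_locales (auto simp: M.left_closed M.right_closed)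

lemma Tr_TG: "Tr A M = TR.TG"
 by (simp add: Tr_def tr_rels_def)

lemma tr_gen_tg: "tr_gen A M a x = TR.tg a x"
 by (simp add: tr_gen_def tr_rels_def)

lemma ag_Tr: "abelian_group (Tr A M)"
 unfolding Tr_TG by (rule TR.ag_pres)

sublocale Tr: abelian_group "Tr A M" by (rule ag_Tr)

abbreviation "tr x == tr_gen A M \<one>\<^bsub>A\<^esub> x"

lemma tr_ahom: "tr_gen A M a \<in> ahom M (Tr A M)" if "a \<in> carrier A"
 using TR.tg_balanced that unfolding balanced_def Tr_TG tr_gen_def tr_rels_def by auto

lemma tr_gen_balanced:
 assumes "x \<in> carrier A" "a \<in> carrier A" "b \<in> carrier A" "m \<in> carrier M"
 shows "tr_gen A M (b \<otimes>\<^bsub>A\<^esub> x \<otimes>\<^bsub>A\<^esub> a) m = tr_gen A M x ((a \<odot>\<^bsub>M\<^esub> m) \<triangleleft>\<^bsub>M\<^esub> b)"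
proof -
 have "\<forall>x\<in>carrier A. \<forall>i\<in>carrier A \<times> carrier A. \<forall>y\<in>carrier M.
  TR.tg ((%(a, b). b \<otimes>\<^bsub>A\<^esub> x \<otimes>\<^bsub>A\<^esub> a) i) y = TR.tg x ((%(a, b) m. (a \<odot>\<^bsub>M\<^esub> m) \<triangleleft>\<^bsub>M\<^esub> b) i y)"
  using TR.tg_balanced unfolding balanced_def by blast
 from this[rule_format, of x "(a, b)" m] show ?thesis using assms by (simp add: tr_gen_tg)
qed

text \<open>Balancing over the pair (a, 1) moves the coefficient into the bimodule, after which only
  coefficient one has to be considered.\<close>

lemma tr_gen_eq: "[|a \<in> carrier A; x \<in> carrier M|] ==> tr_gen A M a x = tr (a \<odot>\<^bsub>M\<^esub> x)"
 using tr_gen_balanced[of "\<one>\<^bsub>A\<^esub>" a "\<one>\<^bsub>A\<^esub>" x] by (simp add: M.left_closed M.right_one)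

lemma tr_cyclic: "[|a \<in> carrier A; x \<in> carrier M|] ==> tr (a \<odot>\<^bsub>M\<^esub> x) = tr (x \<triangleleft>\<^bsub>M\<^esub> a)"
 using tr_gen_balanced[of "\<one>\<^bsub>A\<^esub>" "\<one>\<^bsub>A\<^esub>" a x] tr_gen_eq[of a x] by (simp add: M.left_one)

lemmas tr_add = ahom_add[OF tr_ahom[OF A.one_closed]]
lemmas tr_closed = ahom_closed[OF tr_ahom[OF A.one_closed]]
lemmas tr_zero = ahom_zero[OF M.ag ag_Tr tr_ahom[OF A.one_closed]]
lemmas tr_minus = ahom_neg[OF M.ag ag_Tr tr_ahom[OF A.one_closed]]
lemmas tr_sgn = ahom_sgn[OF M.ag ag_Tr tr_ahom[OF A.one_closed]]

lemma tr_image_subgroup: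
 assumes "asubgroup C M" shows "asubgroup ((%x. tr x) ` C) (Tr A M)"
proof (rule Tr.add_subgroupI)
 note c = M.asubgroup_carrier[OF assms]
 show "(%x. tr x) ` C <= carrier (Tr A M)" using c tr_closed by blast
 show "\<zero>\<^bsub>Tr A M\<^esub> \<in> (%x. tr x) ` C" using M.subgroup_zero[OF assms] tr_zero by force
 show "u \<oplus>\<^bsub>Tr A M\<^esub> v \<in> (%x. tr x) ` C" if "u \<in> (%x. tr x) ` C" "v \<in> (%x. tr x) ` C" for u v
  using that c M.subgroup_plus[OF assms] by (auto simp: tr_add[symmetric])
 show "\<ominus>\<^bsub>Tr A M\<^esub> u \<in> (%x. tr x) ` C" if "u \<in> (%x. tr x) ` C" for u
  using that c M.subgroup_minus[OF assms] by (auto simp: tr_minus[symmetric])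
qed

text \<open>Since \<open>tr\<close> is additive, its image is already a subgroup, and it contains
  all generators: an element of the trace is a single \<open>tr x\<close>, not merely a sum of such
  elements.\<close>

lemma Tr_carrier: "carrier (Tr A M) = (%x. tr x) ` carrier M"
proof
 show "carrier (Tr A M) <= (%x. tr x) ` carrier M"
  unfolding Tr_TG TR.carrier_pres_generate
  by (rule Tr.generate_subset[OF tr_image_subgroup[OF M.carrier_subgroup], unfolded Tr_TG])
    (auto simp: tr_gen_tg[symmetric] tr_gen_eq M.left_closed)
 show "(%x. tr x) ` carrier M <= carrier (Tr A M)" using tr_closed by auto
qed

text \<open>A homomorphism out of the trace is a homomorphism \<open>\<beta>\<close> with \<open>\<beta> (a x) = \<beta> (x a)\<close>.\<close>

lemma Tr_lift:
 assumes G: "abelian_group G" and \<beta>: "\<beta> \<in> ahom M G"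
  and cyc: "!!a x. [|a \<in> carrier A; x \<in> carrier M|] ==> \<beta> (a \<odot>\<^bsub>M\<^esub> x) = \<beta> (x \<triangleleft>\<^bsub>M\<^esub> a)"
  and b: "!!a x. [|a \<in> carrier A; x \<in> carrier M|] ==> b a x = \<beta> (a \<odot>\<^bsub>M\<^esub> x)"
 shows Tr_lift_hom: "pres_lift G (%(a, x). b a x) \<in> ahom (Tr A M) G"
  and Tr_lift_tr: "x \<in> carrier M ==> pres_lift G (%(a, x). b a x) (tr x) = \<beta> x"
proof -
 have bal: "balanced (carrier A \<times> carrier A) (%x (a, b). b \<otimes>\<^bsub>A\<^esub> x \<otimes>\<^bsub>A\<^esub> a) (%(a, b) m. (a \<odot>\<^bsub>M\<^esub> m) \<triangleleft>\<^bsub>M\<^esub> b) A M G b"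
 proof (rule balancedI)
  fix x i y assume a: "x \<in> carrier A" "i \<in> carrier A \<times> carrier A" "y \<in> carrier M"
  obtain c d where i: "i = (c, d)" by (cases i)
  with a have cd: "c \<in> carrier A" "d \<in> carrier A" by auto
  have "\<beta> ((d \<otimes>\<^bsub>A\<^esub> x \<otimes>\<^bsub>A\<^esub> c) \<odot>\<^bsub>M\<^esub> y) = \<beta> (d \<odot>\<^bsub>M\<^esub> (x \<odot>\<^bsub>M\<^esub> (c \<odot>\<^bsub>M\<^esub> y)))"
   using a cd by (simp add: M.left_assoc M.left_closed)
  also have "... = \<beta> ((x \<odot>\<^bsub>M\<^esub> (c \<odot>\<^bsub>M\<^esub> y)) \<triangleleft>\<^bsub>M\<^esub> d)"
   using a cd by (simp add: cyc M.left_closed)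
  finally show "b (case i of (a, b) => b \<otimes>\<^bsub>A\<^esub> x \<otimes>\<^bsub>A\<^esub> a) y = b x ((case i of (a, b) => %m. (a \<odot>\<^bsub>M\<^esub> m) \<triangleleft>\<^bsub>M\<^esub> b) y)"
   using a cd i by (simp add: b M.left_closed M.right_closed M.left_right)
 qed (simp_all add: b M.left_closed M.left_distrib_ring M.left_distrib ahom_add[OF \<beta>] ahom_closed[OF \<beta>])
 show "pres_lift G (%(a, x). b a x) \<in> ahom (Tr A M) G"
  unfolding Tr_TG by (rule TR.tensor_lift_hom[OF G bal])
 show "pres_lift G (%(a, x). b a x) (tr x) = \<beta> x" if "x \<in> carrier M"
  unfolding tr_gen_tg using TR.tensor_lift_gen[OF G bal _ that, of "\<one>\<^bsub>A\<^esub>"] that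
  by (simp add: b M.left_one)
qed

end

lemma Tr_map:
 assumes "trace_group K A M" "trace_group K A N" "f \<in> bimod_hom A M N"
 shows Tr_map_hom: "Tr_map A N f \<in> ahom (Tr A M) (Tr A N)"
  and Tr_map_tr: "x \<in> carrier M ==> Tr_map A N f (tr_gen A M \<one>\<^bsub>A\<^esub> x) = tr_gen A N \<one>\<^bsub>A\<^esub> (f x)"
proof -
 interpret M: trace_group K A M by fact
 interpret N: trace_group K A N by fact
 note f = bimod_hom_ahom[OF assms(3)]
 have h: "(%x. N.tr (f x)) \<in> ahom M (Tr A N)" by (rule ahom_comp[OF f N.tr_ahom]) simp
 have cyc: "N.tr (f (a \<odot>\<^bsub>M\<^esub> x)) = N.tr (f (x \<triangleleft>\<^bsub>M\<^esub> a))" if "a \<in> carrier A" "x \<in> carrier M" for a x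
  using that by (simp add: left_hom_smult[OF bimod_hom_left[OF assms(3)]] bimod_hom_ract[OF assms(3)] N.tr_cyclic ahom_closed[OF f])
 have b: "tr_gen A N a (f x) = N.tr (f (a \<odot>\<^bsub>M\<^esub> x))" if "a \<in> carrier A" "x \<in> carrier M" for a x
  using that by (simp add: left_hom_smult[OF bimod_hom_left[OF assms(3)]] N.tr_gen_eq ahom_closed[OF f])
 show "Tr_map A N f \<in> ahom (Tr A M) (Tr A N)"
  unfolding Tr_map_def by (rule M.Tr_lift_hom[OF N.ag_Tr h cyc b])
 show "Tr_map A N f (M.tr x) = N.tr (f x)" if "x \<in> carrier M"
  unfolding Tr_map_def by (rule M.Tr_lift_tr[OF N.ag_Tr h cyc b that])
qed

lemma Tr_grade_eq:
 assumes "assoc_algebra K A" "graded_bimodule K A M"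
 shows "Tr_grade A M n = (%x. tr_gen A M \<one>\<^bsub>A\<^esub> x) ` grade M n"
proof -
 interpret M: graded_bimodule K A M by fact
 interpret assoc_algebra K A by fact
 interpret trace_group K A M by unfold_locales
 have "agenerate (Tr A M) {tr_gen A M a x |a x. a \<in> carrier A & x \<in> grade M n} <= (%x. tr x) ` grade M n"
 proof (rule Tr.generate_subset[OF tr_image_subgroup[OF M.grade_asubgroup]], clarify)
  fix a x assume ax: "a \<in> carrier A" "x \<in> grade M n"
  thus "tr_gen A M a x \<in> (%x. tr x) ` grade M n"
   unfolding tr_gen_eq[OF ax(1) M.grade_closed[OF ax(2)]] by (intro imageI M.grade_left)
 qed
 moreover have "(%x. tr x) ` grade M n <= agenerate (Tr A M) {tr_gen A M a x |a x. a \<in> carrier A & x \<in> grade M n}"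
  by (auto simp: agenerate_def intro!: generate.incl)
 ultimately show ?thesis by (auto simp: Tr_grade_def agenerate_def)
qed

locale trace_swap = assoc_algebra K A + P: graded_bimodule K A P + Q: graded_bimodule K A Q
 for K :: "('k, 'kz) ring_scheme" and A :: "('k, 'a, 'az) module_scheme"
  and P :: "('a, 'm, 'y) graded_bimodule_scheme" and Q :: "('a, 'n, 'z) graded_bimodule_scheme"
begin

sublocale PQ: tensor_graded K A "carrier A" P Q
 by unfold_locales (use base_scalars_closed in auto)

sublocale QP: tensor_graded K A "carrier A" Q P
 by unfold_locales (use base_scalars_closed in auto)

sublocale TPQ: trace_group K A "tensorA A P Q"
 by unfold_locales

sublocale TQP: trace_group K A "tensorA A Q P"
 by unfold_locales

text \<open>Agrees with the inner function of \<open>tr_swap\<close>. The degree of each component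
  of x is put as a twist on y, so the sign (-1)^(ij) appears even when y is not homogeneous.\<close>

definition "swap_pair x y =
 (\<Oplus>\<^bsub>Tr A (tensorA A Q P)\<^esub>i \<in> support P x. TQP.tr (QP.tn (twist Q i y) (component P x i)))"

definition "swap_tensor = pres_lift (Tr A (tensorA A Q P)) (%(x, y). swap_pair x y)"

lemma tr_tens_ahom:
 shows "y \<in> carrier Q ==> (%x. TQP.tr (QP.tn (twist Q i y) x)) \<in> ahom P (Tr A (tensorA A Q P))"
  and "x \<in> carrier P ==> (%y. TQP.tr (QP.tn (twist Q i y) x)) \<in> ahom Q (Tr A (tensorA A Q P))"
 by (rule ahom_comp[OF QP.tens_right_ahom[OF Q.twist_closed] TQP.tr_ahom[OF A.one_closed]], assumption)
   (rule ahom_comp[OF ahom_comp[OF Q.twist_ahom QP.tens_left_ahom] TQP.tr_ahom[OF A.one_closed]], assumption)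

lemma swap_pair_left: "y \<in> carrier Q ==> (%x. swap_pair x y) \<in> ahom P (Tr A (tensorA A Q P))"
 unfolding swap_pair_def by (rule P.graded_lift_hom[OF TQP.ag_Tr tr_tens_ahom(1)])

lemma swap_pair_homogeneous:
 "[|x \<in> grade P i; y \<in> carrier Q|] ==> swap_pair x y = TQP.tr (QP.tn (twist Q i y) x)"
 unfolding swap_pair_def by (rule P.graded_lift_homogeneous[OF TQP.ag_Tr tr_tens_ahom(1)])

lemma swap_pair_right:
 assumes "x \<in> carrier P" shows "swap_pair x \<in> ahom Q (Tr A (tensorA A Q P))"
 unfolding swap_pair_def[abs_def]
 by (rule ahom_sum[OF Q.ag TQP.ag_Tr tr_tens_ahom(2)[OF P.component_closed[OF assms]]])

text \<open>Balancing holds only after taking the trace: y (x) xa is the right action of a on y (x)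
  x, and cyclicity turns it into the left action, which is ay (x) x.\<close>

lemma swap_pair_balanced: "balanced (carrier A) (ract P) (smult Q) P Q (Tr A (tensorA A Q P)) swap_pair"
 unfolding balanced_def
proof (intro conjI ballI)
 fix x a y assume x: "x \<in> carrier P" and a: "a \<in> carrier A" and y: "y \<in> carrier Q"
 show "swap_pair (x \<triangleleft>\<^bsub>P\<^esub> a) y = swap_pair x (a \<odot>\<^bsub>Q\<^esub> y)"
 proof (rule P.graded_hom_eq[OF ahom_comp[OF P.ract_ahom[OF a] swap_pair_left[OF y]]
    swap_pair_left[OF Q.left_closed[OF a y]] TQP.ag_Tr _ x])
  fix i x assume x: "x \<in> grade P i"
  hence xc: "x \<in> carrier P" by (rule P.grade_closed)
  have "swap_pair (x \<triangleleft>\<^bsub>P\<^esub> a) y = TQP.tr (QP.tn (twist Q i y) x \<triangleleft>\<^bsub>tensorA A Q P\<^esub> a)"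
   using x xc a y by (simp add: swap_pair_homogeneous P.grade_right QP.ract_tens Q.twist_closed)
  also have "... = TQP.tr (a \<odot>\<^bsub>tensorA A Q P\<^esub> QP.tn (twist Q i y) x)"
   using xc a y by (simp add: TQP.tr_cyclic Q.twist_closed)
  also have "... = swap_pair x (a \<odot>\<^bsub>Q\<^esub> y)"
   using x xc a y by (simp add: swap_pair_homogeneous QP.smult_tens Q.twist_closed Q.twist_smult Q.left_closed)
  finally show "swap_pair (x \<triangleleft>\<^bsub>P\<^esub> a) y = swap_pair x (a \<odot>\<^bsub>Q\<^esub> y)" .
 qed
qed (simp_all add: swap_pair_left swap_pair_right)

lemma swap_tensor_ahom: "swap_tensor \<in> ahom (tensorA A P Q) (Tr A (tensorA A Q P))"
 unfolding swap_tensor_def by (rule PQ.lift_hom[OF TQP.ag_Tr swap_pair_balanced])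

lemma swap_tensor_tens:
 assumes "x \<in> grade P i" "y \<in> grade Q j"
 shows "swap_tensor (PQ.tn x y) = TQP.tr (QP.tn (sgn_elt Q (j * i) y) x)"
proof -
 have "swap_tensor (PQ.tn x y) = swap_pair x y"
  unfolding swap_tensor_def
  by (rule PQ.lift_tens[OF TQP.ag_Tr swap_pair_balanced P.grade_closed[OF assms(1)] Q.grade_closed[OF assms(2)]])
 thus ?thesis
  by (simp add: swap_pair_homogeneous[OF assms(1) Q.grade_closed[OF assms(2)]] Q.twist_homogeneous[OF assms(2)])
qed

text \<open>The roles are reversed here: cyclicity on the source becomes the balancing relation
  between the exchanged factors on the target.\<close>

lemma swap_tensor_cyclic:
 assumes a: "a \<in> carrier A" and u: "u \<in> carrier (tensorA A P Q)"
 shows "swap_tensor (a \<odot>\<^bsub>tensorA A P Q\<^esub> u) = swap_tensor (u \<triangleleft>\<^bsub>tensorA A P Q\<^esub> a)"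
proof (rule PQ.graded_tensor_hom_eq[OF ahom_comp[OF PQ.T.smult_ahom[OF a] swap_tensor_ahom]
   ahom_comp[OF PQ.T.ract_ahom[OF a] swap_tensor_ahom] TQP.ag_Tr _ u])
 fix x y i j assume xy: "x \<in> grade P i" "y \<in> grade Q j"
 note c = P.grade_closed[OF xy(1)] Q.grade_closed[OF xy(2)]
 have "swap_tensor (a \<odot>\<^bsub>tensorA A P Q\<^esub> PQ.tn x y) = TQP.tr (QP.tn (sgn_elt Q (j * i) y) (a \<odot>\<^bsub>P\<^esub> x))"
  using swap_tensor_tens[OF P.grade_left[OF a xy(1)] xy(2)] a c by (simp add: PQ.smult_tens)
 also have "... = TQP.tr (QP.tn (sgn_elt Q (j * i) (y \<triangleleft>\<^bsub>Q\<^esub> a)) x)"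
  using a c by (simp add: QP.tens_bal[symmetric] Q.ract_sgn)
 also have "... = swap_tensor (PQ.tn x y \<triangleleft>\<^bsub>tensorA A P Q\<^esub> a)"
  using swap_tensor_tens[OF xy(1) Q.grade_right[OF a xy(2)]] a c by (simp add: PQ.ract_tens)
 finally show "swap_tensor (a \<odot>\<^bsub>tensorA A P Q\<^esub> PQ.tn x y) = swap_tensor (PQ.tn x y \<triangleleft>\<^bsub>tensorA A P Q\<^esub> a)" .
qed

lemma tr_swap_eq: "tr_swap A P Q = pres_lift (Tr A (tensorA A Q P)) (%(b, u). swap_tensor (b \<odot>\<^bsub>tensorA A P Q\<^esub> u))"
 by (simp add: tr_swap_def swap_tensor_def swap_pair_def Let_def)

lemma tr_swap_ahom: "tr_swap A P Q \<in> ahom (Tr A (tensorA A P Q)) (Tr A (tensorA A Q P))"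
 unfolding tr_swap_eq
 by (rule TPQ.Tr_lift_hom[OF TQP.ag_Tr swap_tensor_ahom swap_tensor_cyclic refl])

lemma tr_swap_tr: "u \<in> carrier (tensorA A P Q) ==> tr_swap A P Q (TPQ.tr u) = swap_tensor u"
 unfolding tr_swap_eq
 by (rule TPQ.Tr_lift_tr[OF TQP.ag_Tr swap_tensor_ahom swap_tensor_cyclic refl])

end

section \<open>The identifications behind \<open>t_L\<close> and \<open>eta_L\<close>\<close>

context assoc_algebra
begin

lemma regular_simps [simp]:
 "carrier (regular A) = carrier A" "add (regular A) = add A" "zero (regular A) = zero A"
 "smult (regular A) = mult A" "ract (regular A) = mult A"
 "grade (regular A) n = (if n = 0 then carrier A else {\<zero>\<^bsub>A\<^esub>})"
 by (simp_all add: regular_def)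

lemma abelian_group_regular: "abelian_group (regular A)"
 by (rule abelian_group_cong[OF A.ag]) simp_all

lemma bimodule_regular: "bimodule K A (regular A)"
proof -
 interpret R: abelian_group "regular A" by (rule abelian_group_regular)
 show ?thesis
  by unfold_locales
    (auto simp: A.l_distr A.r_distr A.m_assoc smult_mult_left smult_mult_right)
qed

lemma graded_bimodule_regular: "graded_bimodule K A (regular A)"
proof -
 interpret R: bimodule K A "regular A" by (rule bimodule_regular)
 have dec: "is_decomposition (regular A) x c \<longleftrightarrow> c = (%n. if n = 0 then x else \<zero>\<^bsub>A\<^esub>)"
  if x: "x \<in> carrier A" for x c
 proof
  assume d: "is_decomposition (regular A) x c"
  hence g: "c n \<in> (if n = 0 then carrier A else {\<zero>\<^bsub>A\<^esub>})" for n
   by (simp add: is_decomposition_def)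
  have z: "c n = \<zero>\<^bsub>A\<^esub>" if "n ~= 0" for n using g[of n] that by simp
  have c0: "c 0 \<in> carrier A" using g[of 0] by simp
  have "x = (\<Oplus>\<^bsub>regular A\<^esub>n\<in>{n. c n ~= \<zero>\<^bsub>A\<^esub>}. c n)" using d by (simp add: is_decomposition_def)
  also have "... = (\<Oplus>\<^bsub>regular A\<^esub>n\<in>{0}. c n)"
   by (rule R.add.finprod_mono_neutral_cong_left) (use z c0 in auto)
  also have "... = c 0" using c0 by simp
  finally show "c = (%n. if n = 0 then x else \<zero>\<^bsub>A\<^esub>)" using z by auto
 next
  assume c: "c = (%n. if n = 0 then x else \<zero>\<^bsub>A\<^esub>)"
  have "{n::int. c n ~= \<zero>\<^bsub>A\<^esub>} = (if x = \<zero>\<^bsub>A\<^esub> then {} else {0})" by (auto simp: c)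
  thus "is_decomposition (regular A) x c"
   using x by (simp add: is_decomposition_def c)
 qed
 show ?thesis
 proof (intro graded_bimodule.intro graded_bimodule_axioms.intro R.bimodule_axioms)
  fix n :: int
  show "subgroup (grade (regular A) n) (add_monoid (regular A))"
   using R.carrier_subgroup R.singleton_zero_subgroup by (simp add: asubgroup_def)
 next
  fix x assume "x \<in> carrier (regular A)"
  thus "\<exists>!c. is_decomposition (regular A) x c" using dec by simp
 qed (auto split: if_splits)
qed

lemma base_scalar_central:
 assumes "bimodule K A M" "s \<in> base_scalars K A" "x \<in> carrier M"
 shows "s \<odot>\<^bsub>M\<^esub> x = x \<triangleleft>\<^bsub>M\<^esub> s"
 using assms bimodule.scalars_central by (fastforce simp: base_scalars_def)

end

locale half_tensor = assoc_algebra K A + P: graded_bimodule K A P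
 for K :: "('k, 'kz) ring_scheme" and A :: "('k, 'a, 'az) module_scheme"
  and P :: "('a, 'p, 'z) graded_bimodule_scheme"
begin

abbreviation "R == regular A"
abbreviation "AP == tensorK K A R P"
abbreviation "PK == tensorK K A P P"
abbreviation "PP == tensorA A P P"

sublocale trace_swap K A P P by unfold_locales
sublocale R: graded_bimodule K A R by (rule graded_bimodule_regular)
sublocale AP: tensor_graded K A "base_scalars K A" R P
 by unfold_locales (use base_scalars_closed in auto)
sublocale PK: tensor_graded K A "base_scalars K A" P P
 by unfold_locales (use base_scalars_closed in auto)
sublocale PA: tensor_bimodule K A "carrier A" P AP
 by unfold_locales (use base_scalars_closed in auto)
sublocale PR: tensor_bimodule K A "carrier A" P R
 by unfold_locales (use base_scalars_closed in auto)

abbreviation "tp == tens (carrier A) P P"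
abbreviation "ta == tens (base_scalars K A) R P"
abbreviation "tk == tens (base_scalars K A) P P"

lemma act_balanced: "balanced (base_scalars K A) (ract R) (smult P) R P P (smult P)"
 using base_scalars_closed
 by (intro balancedI) (auto simp: P.left_closed P.left_distrib P.left_distrib_ring P.left_assoc)

lemma act_map_ahom: "act_map P \<in> ahom AP P"
 unfolding act_map_def by (rule AP.lift_hom[OF P.ag act_balanced])

lemma act_map_tens: "[|a \<in> carrier A; y \<in> carrier P|] ==> act_map P (ta a y) = a \<odot>\<^bsub>P\<^esub> y"
 unfolding act_map_def using AP.lift_tens[OF P.ag act_balanced] by simp

lemma act_map_smult: "[|a \<in> carrier A; u \<in> carrier AP|] ==> act_map P (a \<odot>\<^bsub>AP\<^esub> u) = a \<odot>\<^bsub>P\<^esub> act_map P u"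
 by (rule AP.hom_eq[OF ahom_comp[OF AP.T.smult_ahom act_map_ahom] ahom_comp[OF act_map_ahom P.smult_ahom] P.ag])
   (simp_all add: AP.smult_tens act_map_tens P.left_assoc)

end

text \<open>
 For a left linear \<open>g : M \<rightarrow> P\<close> and \<open>u = \<Sum> a\<^sub>k \<otimes> y\<^sub>k\<close>, the element \<open>half g x u\<close> is
 \<open>\<Sum> g (x a\<^sub>k) \<otimes> y\<^sub>k\<close>; with \<open>u = \<iota> y\<close> this gives both \<open>t\<^sub>L\<close> and \<open>\<eta>\<^sub>L\<close>.
\<close>

locale half_map = half_tensor K A P + M: bimodule K A M
 for K :: "('k, 'kz) ring_scheme" and A :: "('k, 'a, 'az) module_scheme"
  and P :: "('a, 'p, 'z) graded_bimodule_scheme" and M :: "('a, 'm, 'y) bimodule_scheme"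
begin

definition half :: "('m => 'p) => 'm => ('a \<times> 'p \<Rightarrow>\<^sub>0 int) set => ('p \<times> 'p \<Rightarrow>\<^sub>0 int) set" where
 "half g x = pres_lift PP (%(a, y). tp (g (x \<triangleleft>\<^bsub>M\<^esub> a)) y)"

context
 fixes g assumes g: "g \<in> left_hom A M P"
begin

text \<open>\<open>g\<close> is left linear only, but a base scalar on the right of its argument can
  be moved to the left, through \<open>g\<close>, and back to the right.\<close>

lemma half_balanced:
 assumes x: "x \<in> carrier M"
 shows "balanced (base_scalars K A) (ract R) (smult P) R P PP (%a y. tp (g (x \<triangleleft>\<^bsub>M\<^esub> a)) y)"
proof -
 note gc = ahom_closed[OF left_hom_ahom[OF g]]
 show ?thesis
 proof (rule balancedI)
  fix a s y assume a: "a \<in> carrier R" "s \<in> base_scalars K A" "y \<in> carrier P"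
  hence a': "a \<in> carrier A" "s \<in> carrier A" using base_scalars_closed by auto
  have "g (x \<triangleleft>\<^bsub>M\<^esub> (a \<otimes>\<^bsub>A\<^esub> s)) = g ((x \<triangleleft>\<^bsub>M\<^esub> a) \<triangleleft>\<^bsub>M\<^esub> s)"
   using a' x by (simp add: M.right_assoc)
  also have "... = g (s \<odot>\<^bsub>M\<^esub> (x \<triangleleft>\<^bsub>M\<^esub> a))"
   using base_scalar_central[OF M.bimodule_axioms a(2) M.right_closed[OF a'(1) x]] by simp
  also have "... = s \<odot>\<^bsub>P\<^esub> g (x \<triangleleft>\<^bsub>M\<^esub> a)"
   using a' x by (simp add: left_hom_smult[OF g] M.right_closed)
  also have "... = g (x \<triangleleft>\<^bsub>M\<^esub> a) \<triangleleft>\<^bsub>P\<^esub> s"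
   using base_scalar_central[OF P.bimodule_axioms a(2) gc[OF M.right_closed[OF a'(1) x]]] .
  finally show "tp (g (x \<triangleleft>\<^bsub>M\<^esub> (a \<triangleleft>\<^bsub>R\<^esub> s))) y = tp (g (x \<triangleleft>\<^bsub>M\<^esub> a)) (s \<odot>\<^bsub>P\<^esub> y)"
   using a a' x by (simp add: PQ.tens_bal gc M.right_closed)
 qed (use x in \<open>simp_all add: gc M.right_closed M.right_distrib_ring ahom_add[OF left_hom_ahom[OF g]]
   PQ.tens_add_left PQ.tens_add_right\<close>)
qed

lemma half_ahom: "x \<in> carrier M ==> half g x \<in> ahom AP PP"
 unfolding half_def by (rule AP.lift_hom[OF PQ.ag_tensor half_balanced])

lemma half_tens: "[|x \<in> carrier M; a \<in> carrier A; y \<in> carrier P|] ==> half g x (ta a y) = tp (g (x \<triangleleft>\<^bsub>M\<^esub> a)) y"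
 unfolding half_def using AP.lift_tens[OF PQ.ag_tensor half_balanced] by simp

lemma g_closed: "x \<in> carrier M ==> g x \<in> carrier P"
 by (rule ahom_closed[OF left_hom_ahom[OF g]])

lemma half_ract:
 "[|x \<in> carrier M; a \<in> carrier A; u \<in> carrier AP|] ==> half g (x \<triangleleft>\<^bsub>M\<^esub> a) u = half g x (a \<odot>\<^bsub>AP\<^esub> u)"
 by (rule AP.hom_eq[OF half_ahom ahom_comp[OF AP.T.smult_ahom half_ahom] PQ.ag_tensor])
   (simp_all add: AP.smult_tens half_tens M.right_closed M.right_assoc)

lemma half_ract_right:
 "[|x \<in> carrier M; a \<in> carrier A; u \<in> carrier AP|] ==> half g x (u \<triangleleft>\<^bsub>AP\<^esub> a) = half g x u \<triangleleft>\<^bsub>PP\<^esub> a"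
 by (rule AP.hom_eq[OF ahom_comp[OF AP.T.ract_ahom half_ahom] ahom_comp[OF half_ahom PQ.T.ract_ahom] PQ.ag_tensor])
   (simp_all add: AP.ract_tens half_tens M.right_closed P.right_closed g_closed PQ.ract_tens)

lemma half_smult:
 "[|x \<in> carrier M; a \<in> carrier A; u \<in> carrier AP|] ==> half g (a \<odot>\<^bsub>M\<^esub> x) u = a \<odot>\<^bsub>PP\<^esub> half g x u"
 by (rule AP.hom_eq[OF half_ahom ahom_comp[OF half_ahom PQ.T.smult_ahom] PQ.ag_tensor])
   (simp_all add: half_tens M.left_closed M.right_closed g_closed PQ.smult_tens M.left_right left_hom_smult[OF g])

end

end

context half_tensor
begin

sublocale HP: half_map K A P P by unfold_locales
sublocale HR: half_map K A P R by unfold_locales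

definition "collapse_inner x = pres_lift PK (%(a, y). tk (x \<triangleleft>\<^bsub>P\<^esub> a) y)"

lemma collapse_inner_balanced:
 assumes x: "x \<in> carrier P"
 shows "balanced (base_scalars K A) (ract R) (smult P) R P PK (%a y. tk (x \<triangleleft>\<^bsub>P\<^esub> a) y)"
proof (rule balancedI)
 fix a s y assume a: "a \<in> carrier R" "s \<in> base_scalars K A" "y \<in> carrier P"
 hence a': "a \<in> carrier A" "s \<in> carrier A" using base_scalars_closed by auto
 show "tk (x \<triangleleft>\<^bsub>P\<^esub> (a \<triangleleft>\<^bsub>R\<^esub> s)) y = tk (x \<triangleleft>\<^bsub>P\<^esub> a) (s \<odot>\<^bsub>P\<^esub> y)"
  using a a' x PK.tens_bal[of "x \<triangleleft>\<^bsub>P\<^esub> a" s y] by (simp add: P.right_assoc P.right_closed)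
qed (use x in \<open>simp_all add: P.right_closed P.right_distrib_ring PK.tens_add_left PK.tens_add_right\<close>)

lemma collapse_inner_ahom: "x \<in> carrier P ==> collapse_inner x \<in> ahom AP PK"
 unfolding collapse_inner_def by (rule AP.lift_hom[OF PK.ag_tensor collapse_inner_balanced])

lemma collapse_inner_tens:
 "[|x \<in> carrier P; a \<in> carrier A; y \<in> carrier P|] ==> collapse_inner x (ta a y) = tk (x \<triangleleft>\<^bsub>P\<^esub> a) y"
 unfolding collapse_inner_def using AP.lift_tens[OF PK.ag_tensor collapse_inner_balanced] by simp

lemma collapse_outer_balanced: "balanced (carrier A) (ract P) (smult AP) P AP PK collapse_inner"
proof (rule balancedI)
 fix x y u assume a: "x \<in> carrier P" "y \<in> carrier P" "u \<in> carrier AP"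
 show "collapse_inner (x \<oplus>\<^bsub>P\<^esub> y) u = collapse_inner x u \<oplus>\<^bsub>PK\<^esub> collapse_inner y u"
  by (rule AP.hom_eq[OF collapse_inner_ahom ahom_plus[OF AP.ag_tensor PK.ag_tensor collapse_inner_ahom collapse_inner_ahom] PK.ag_tensor])
    (use a in \<open>simp_all add: collapse_inner_tens P.right_closed P.right_distrib PK.tens_add_left\<close>)
next
 fix x a u assume a: "x \<in> carrier P" "a \<in> carrier A" "u \<in> carrier AP"
 show "collapse_inner (x \<triangleleft>\<^bsub>P\<^esub> a) u = collapse_inner x (a \<odot>\<^bsub>AP\<^esub> u)"
  by (rule AP.hom_eq[OF collapse_inner_ahom ahom_comp[OF AP.T.smult_ahom collapse_inner_ahom] PK.ag_tensor])
    (use a in \<open>simp_all add: AP.smult_tens collapse_inner_tens P.right_closed P.right_assoc\<close>)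
qed (simp_all add: ahom_closed[OF collapse_inner_ahom] ahom_add[OF collapse_inner_ahom])

lemma collapse_mid_eq: "collapse_mid K A P = pres_lift PK (%(x, u). collapse_inner x u)"
 by (simp add: collapse_mid_def collapse_inner_def)

lemma collapse_mid_ahom: "collapse_mid K A P \<in> ahom (tensorA A P AP) PK"
 unfolding collapse_mid_eq by (rule PA.lift_hom[OF PK.ag_tensor collapse_outer_balanced])

lemma collapse_mid_tens: "[|x \<in> carrier P; u \<in> carrier AP|] ==> collapse_mid K A P (PA.tn x u) = collapse_inner x u"
 unfolding collapse_mid_eq by (rule PA.lift_tens[OF PK.ag_tensor collapse_outer_balanced])

lemma expand_balanced:
 "balanced (base_scalars K A) (ract P) (smult P) P P (tensorA A P AP) (%x y. PA.tn x (ta \<one>\<^bsub>A\<^esub> y))"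
proof (rule balancedI)
 fix x s y assume a: "x \<in> carrier P" "s \<in> base_scalars K A" "y \<in> carrier P"
 hence s: "s \<in> carrier A" using base_scalars_closed by auto
 have "ta \<one>\<^bsub>A\<^esub> (s \<odot>\<^bsub>P\<^esub> y) = ta (\<one>\<^bsub>A\<^esub> \<triangleleft>\<^bsub>R\<^esub> s) y" using AP.tens_bal[of "\<one>\<^bsub>A\<^esub>" s y] a by simp
 also have "... = s \<odot>\<^bsub>AP\<^esub> ta \<one>\<^bsub>A\<^esub> y" using a s by (simp add: AP.smult_tens)
 finally show "PA.tn (x \<triangleleft>\<^bsub>P\<^esub> s) (ta \<one>\<^bsub>A\<^esub> y) = PA.tn x (ta \<one>\<^bsub>A\<^esub> (s \<odot>\<^bsub>P\<^esub> y))"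
  using a s by (simp add: PA.tens_bal)
qed (simp_all add: AP.tens_add_right PA.tens_add_left PA.tens_add_right)

lemma expand_mid_ahom: "expand_mid K A P \<in> ahom PK (tensorA A P AP)"
 unfolding expand_mid_def Let_def by (rule PK.lift_hom[OF PA.ag_tensor expand_balanced])

lemma expand_mid_tens: "[|x \<in> carrier P; y \<in> carrier P|] ==> expand_mid K A P (tk x y) = PA.tn x (ta \<one>\<^bsub>A\<^esub> y)"
 unfolding expand_mid_def Let_def by (rule PK.lift_tens[OF PA.ag_tensor expand_balanced])

abbreviation "contract_right == tensor_map (carrier A) P P P 0 id (act_map P)"

lemma contract_right_ahom: "contract_right \<in> ahom (tensorA A P AP) PP"
 and contract_right_tens: "[|x \<in> carrier P; u \<in> carrier AP|] ==> contract_right (PA.tn x u) = tp x (act_map P u)"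
proof -
 note tm = tensor_map_hom[OF PA.tensor_bimodule_axioms PQ.tensor_bimodule_axioms P.graded_bimodule_axioms
   ahom_id(2) _ act_map_ahom]
 show "contract_right \<in> ahom (tensorA A P AP) PP"
  by (rule tm(1)) (simp_all add: act_map_smult)
 show "contract_right (PA.tn x u) = tp x (act_map P u)" if "x \<in> carrier P" "u \<in> carrier AP"
  by (subst tm(2)) (simp_all add: act_map_smult P.twist_0 that)
qed

text \<open>Base scalars act in the same way from both sides, so left linearity already gives right
  linearity over them. This is what allows \<open>t\<close> and \<open>\<eta>\<close> to be tensored
  over the field with an identity on their right.\<close>

lemma right_linear_central:
 assumes "f \<in> left_hom A M P" "bimodule K A M" "x \<in> carrier M" "s \<in> base_scalars K A"
 shows "f (x \<triangleleft>\<^bsub>M\<^esub> s) = f x \<triangleleft>\<^bsub>P\<^esub> s"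
proof -
 have "s \<in> carrier A" using assms(4) base_scalars_closed by auto
 thus ?thesis
  using assms base_scalar_central[OF assms(2,4,3)] base_scalar_central[OF P.bimodule_axioms assms(4), of "f x"]
   ahom_closed[OF left_hom_ahom[OF assms(1)], of x] left_hom_smult[OF assms(1), of s x] by simp
qed

context
 fixes \<iota> assumes \<iota>: "\<iota> \<in> bimod_hom A P AP"
begin

text \<open>The five maps composing \<open>t_L\<close> are evaluated one after the other, the middle
  ones first on an arbitrary \<open>u\<close> and only then at \<open>\<iota> y\<close>, since
  generators of A (x) P are available but values of the section are not such generators.\<close>

lemma t_L:
 assumes t: "t \<in> left_hom A P P"
 shows t_L_ahom: "t_L K A P \<iota> t \<in> ahom PP PP"
  and t_L_tens: "[|x \<in> carrier P; y \<in> carrier P|] ==> t_L K A P \<iota> t (tp x y) = HP.half t x (\<iota> y)"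
proof -
 let ?I = "tensor_map (carrier A) P P AP 0 id \<iota>"
 let ?T = "tensor_map (base_scalars K A) P P P 0 t id"
 note ia = bimod_hom_ahom[OF \<iota>]
 have I: "?I \<in> ahom PP (tensorA A P AP)" "!!x y. [|x \<in> carrier P; y \<in> carrier P|] ==> ?I (tp x y) = PA.tn x (\<iota> y)"
  using tensor_map_hom[OF PQ.tensor_bimodule_axioms PA.tensor_bimodule_axioms P.graded_bimodule_axioms ahom_id(2) _ ia, where m = 0]
  by (simp_all add: left_hom_smult[OF bimod_hom_left[OF \<iota>]] P.twist_0)
 have T: "?T \<in> ahom PK PK" "!!x y. [|x \<in> carrier P; y \<in> carrier P|] ==> ?T (tk x y) = tk (t x) y"
  using tensor_map_hom[OF PK.tensor_bimodule_axioms PK.tensor_bimodule_axioms P.graded_bimodule_axioms left_hom_ahom[OF t] _ ahom_id(2), where m = 0]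
   right_linear_central[OF t P.bimodule_axioms]
  by (simp_all add: P.twist_0)
 note tail = ahom_comp[OF ahom_comp[OF T(1) expand_mid_ahom] contract_right_ahom]
 have eq: "t_L K A P \<iota> t = (%u. contract_right (expand_mid K A P (?T (collapse_mid K A P (?I u)))))"
  by (simp add: t_L_def comp_def)
 show "t_L K A P \<iota> t \<in> ahom PP PP"
  unfolding eq by (rule ahom_comp[OF ahom_comp[OF I(1) collapse_mid_ahom] tail])
 assume x: "x \<in> carrier P" and y: "y \<in> carrier P"
 have iy: "\<iota> y \<in> carrier AP" using ia y by (rule ahom_closed)
 have "contract_right (expand_mid K A P (?T (collapse_inner x u))) = HP.half t x u" if u: "u \<in> carrier AP" for u
  by (rule AP.hom_eq[OF ahom_comp[OF collapse_inner_ahom[OF x] tail] HP.half_ahom[OF t x] PQ.ag_tensor _ u])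
    (use x in \<open>simp add: collapse_inner_tens T expand_mid_tens contract_right_tens HP.half_tens[OF t] P.right_closed
     ahom_closed[OF left_hom_ahom[OF t]] act_map_tens P.left_one\<close>)
 with iy show "t_L K A P \<iota> t (tp x y) = HP.half t x (\<iota> y)"
  unfolding eq by (simp add: I(2)[OF x y] collapse_mid_tens x)
qed

lemma eta_L_eq:
 assumes \<eta>: "\<eta> \<in> left_hom A R P" and y: "y \<in> carrier P"
 shows "eta_L K A P \<iota> \<eta> y = HR.half \<eta> \<one>\<^bsub>A\<^esub> (\<iota> y)"
proof -
 let ?T = "tensor_map (base_scalars K A) R P P 0 \<eta> id"
 have T: "?T \<in> ahom AP PK" "!!x y. [|x \<in> carrier A; y \<in> carrier P|] ==> ?T (ta x y) = tk (\<eta> x) y"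
  using tensor_map_hom[OF AP.tensor_bimodule_axioms PK.tensor_bimodule_axioms R.graded_bimodule_axioms left_hom_ahom[OF \<eta>] _ ahom_id(2), where m = 0]
   right_linear_central[OF \<eta> R.bimodule_axioms] R.twist_0
  by simp_all
 have "contract_right (expand_mid K A P (?T u)) = HR.half \<eta> \<one>\<^bsub>A\<^esub> u" if u: "u \<in> carrier AP" for u
  by (rule AP.hom_eq[OF ahom_comp[OF ahom_comp[OF T(1) expand_mid_ahom] contract_right_ahom] HR.half_ahom[OF \<eta>] PQ.ag_tensor _ u])
    (use ahom_closed[OF left_hom_ahom[OF \<eta>]] in \<open>simp_all add: T expand_mid_tens contract_right_tens HR.half_tens[OF \<eta>] act_map_tens P.left_one\<close>)
 thus ?thesis
  using ahom_closed[OF bimod_hom_ahom[OF \<iota>] y] by (simp add: eta_L_def)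
qed

end

end

section \<open>Bimodule homomorphisms with a degree\<close>

text \<open>A map into a shifted complex is recorded by its degree \<open>k\<close>, which avoids
  shifted copies of the complexes and the sign carried by their differentials.\<close>

definition deg_hom ::
 "('k, 'a, 'z) module_scheme => ('a, 'm, 'y) graded_bimodule_scheme => ('a, 'n, 'x) graded_bimodule_scheme
  => int => ('m => 'n) => bool" where
 "deg_hom A M N k f \<longleftrightarrow> f \<in> bimod_hom A M N & (\<forall>n. \<forall>x\<in>grade M n. f x \<in> grade N (n + k))"

lemma deg_homD:
 assumes "deg_hom A M N k f"
 shows deg_hom_bimod: "f \<in> bimod_hom A M N"
  and deg_hom_ahom: "f \<in> ahom M N"
  and deg_hom_closed: "x \<in> carrier M ==> f x \<in> carrier N"
  and deg_hom_add: "[|x \<in> carrier M; y \<in> carrier M|] ==> f (x \<oplus>\<^bsub>M\<^esub> y) = f x \<oplus>\<^bsub>N\<^esub> f y"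
  and deg_hom_smult: "[|a \<in> carrier A; x \<in> carrier M|] ==> f (a \<odot>\<^bsub>M\<^esub> x) = a \<odot>\<^bsub>N\<^esub> f x"
  and deg_hom_ract: "[|a \<in> carrier A; x \<in> carrier M|] ==> f (x \<triangleleft>\<^bsub>M\<^esub> a) = f x \<triangleleft>\<^bsub>N\<^esub> a"
  and deg_hom_grade: "[|x \<in> grade M n; n + k = m|] ==> f x \<in> grade N m"
proof -
 show b: "f \<in> bimod_hom A M N" using assms by (simp add: deg_hom_def)
 show h: "f \<in> ahom M N" by (rule bimod_hom_ahom[OF b])
 show "x \<in> carrier M ==> f x \<in> carrier N" by (rule ahom_closed[OF h])
 show "[|x \<in> carrier M; y \<in> carrier M|] ==> f (x \<oplus>\<^bsub>M\<^esub> y) = f x \<oplus>\<^bsub>N\<^esub> f y" by (rule ahom_add[OF h])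
 show "[|a \<in> carrier A; x \<in> carrier M|] ==> f (a \<odot>\<^bsub>M\<^esub> x) = a \<odot>\<^bsub>N\<^esub> f x"
  by (rule left_hom_smult[OF bimod_hom_left[OF b]])
 show "[|a \<in> carrier A; x \<in> carrier M|] ==> f (x \<triangleleft>\<^bsub>M\<^esub> a) = f x \<triangleleft>\<^bsub>N\<^esub> a"
  by (rule bimod_hom_ract[OF b])
 show "[|x \<in> grade M n; n + k = m|] ==> f x \<in> grade N m" using assms by (auto simp: deg_hom_def)
qed

lemma deg_homI:
 assumes "f \<in> ahom M N"
  "!!a x. [|a \<in> carrier A; x \<in> carrier M|] ==> f (a \<odot>\<^bsub>M\<^esub> x) = a \<odot>\<^bsub>N\<^esub> f x"
  "!!a x. [|a \<in> carrier A; x \<in> carrier M|] ==> f (x \<triangleleft>\<^bsub>M\<^esub> a) = f x \<triangleleft>\<^bsub>N\<^esub> a"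
  "!!n x. x \<in> grade M n ==> f x \<in> grade N (n + k)"
 shows "deg_hom A M N k f"
 using assms by (simp add: deg_hom_def bimod_homI)

lemma deg_hom_comp:
 assumes "deg_hom A M N k f" "deg_hom A N L l g" "k + l = m"
 shows "deg_hom A M L m (%x. g (f x))"
 using bimod_hom_comp[OF deg_hom_bimod[OF assms(1)] deg_hom_bimod[OF assms(2)]] assms
 by (fastforce simp: deg_hom_def algebra_simps)

lemma deg_hom_plus:
 assumes f: "deg_hom A M N k f" and g: "deg_hom A M N k g" and M: "abelian_group M" and N: "bimodule K A N"
  and gr: "!!n. asubgroup (grade N n) N"
 shows "deg_hom A M N k (%x. f x \<oplus>\<^bsub>N\<^esub> g x)"
proof -
 interpret N: bimodule K A N by fact
 show ?thesis
  by (rule deg_homI[OF ahom_plus[OF M N.ag deg_hom_ahom[OF f] deg_hom_ahom[OF g]]])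
    (simp_all add: deg_hom_smult[OF f] deg_hom_smult[OF g] deg_hom_ract[OF f] deg_hom_ract[OF g]
     deg_hom_closed[OF f] deg_hom_closed[OF g] N.left_distrib N.right_distrib
     N.subgroup_plus[OF gr] deg_hom_grade[OF f] deg_hom_grade[OF g])
qed

lemma deg_hom_uminus:
 assumes f: "deg_hom A M N k f" and M: "abelian_group M" and N: "bimodule K A N"
  and gr: "!!n. asubgroup (grade N n) N"
 shows "deg_hom A M N k (%x. \<ominus>\<^bsub>N\<^esub> f x)"
proof -
 interpret N: bimodule K A N by fact
 show ?thesis
  by (rule deg_homI[OF ahom_uminus[OF M N.ag deg_hom_ahom[OF f]]])
    (simp_all add: deg_hom_smult[OF f] deg_hom_ract[OF f] deg_hom_closed[OF f] N.smult_minus N.ract_minus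
     N.subgroup_minus[OF gr] deg_hom_grade[OF f])
qed

section \<open>Inverting 1 + N for locally nilpotent N\<close>

locale locally_nilpotent = abelian_group G for G (structure) +
 fixes N
 assumes N: "N \<in> ahom G G" and nilpotent: "x \<in> carrier G ==> \<exists>k. (N ^^ k) x = \<zero>"
begin

lemmas N_closed = ahom_closed[OF N]
lemmas N_minus = ahom_neg[OF ag ag N]
lemmas N_zero = ahom_zero[OF ag ag N]

lemma one_plus_ahom: "(%x. x \<oplus> N x) \<in> ahom G G"
 by (rule ahom_plus[OF ag ag ahom_id(1) N])

text \<open>From N x = -x one gets that the k-th power of N sends x to x or -x, and some power kills
  x.\<close>

lemma one_plus_kernel:
 assumes x: "x \<in> carrier G" "x \<oplus> N x = \<zero>" shows "x = \<zero>"
proof -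
 have Nx: "N x = \<ominus> x"
  using x minus_equality[of "N x" x] N_closed[OF x(1)] by (simp add: a_comm)
 have "(N ^^ k) x = sgn_elt G (int k) x" for k
 proof (induction k)
  case (Suc k)
  thus ?case
   using x(1) Nx by (auto simp: sgn_elt_def N_minus)
 qed simp
 moreover obtain k where "(N ^^ k) x = \<zero>" using nilpotent[OF x(1)] by blast
 ultimately show ?thesis
  using x(1) minus_minus[of x] by (auto simp: sgn_elt_def split: if_splits)
qed

lemma one_plus_inj: "inj_on (%x. x \<oplus> N x) (carrier G)"
proof (rule inj_onI)
 fix x y assume xy: "x \<in> carrier G" "y \<in> carrier G" "x \<oplus> N x = y \<oplus> N y"
 have "(x \<ominus> y) \<oplus> N (x \<ominus> y) = (x \<oplus> N x) \<ominus> (y \<oplus> N y)"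
  using xy(1,2) ahom_minus[OF ag ag N xy(1,2)]
  by (simp add: N_closed minus_eq minus_add a_ac)
 also have "... = \<zero>" using xy by (simp add: N_closed r_neg minus_eq)
 finally have "x \<ominus> y = \<zero>" using one_plus_kernel xy by blast
 thus "x = y" using xy minus_eq_zeroD by blast
qed

text \<open>Induction on the exponent killing x: N x needs one power less, so y + N y = N x is
  solvable, and then x - y is mapped to x. A stable subgroup is allowed in place of the whole group
  so that the inverse can be seen to preserve degrees.\<close>

lemma one_plus_surj:
 assumes S: "asubgroup S G" and NS: "!!x. x \<in> S ==> N x \<in> S" and x: "x \<in> S"
 shows "\<exists>y\<in>S. y \<oplus> N y = x"
proof -
 have "(N ^^ k) x = \<zero> ==> x \<in> S ==> \<exists>y\<in>S. y \<oplus> N y = x" for k x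
 proof (induction k arbitrary: x)
  case 0
  thus ?case using subgroup_zero[OF S] N_zero by (auto intro!: bexI[of _ "\<zero>"])
 next
  case (Suc k)
  then obtain y where y: "y \<in> S" "y \<oplus> N y = N x"
   using NS by (auto simp: funpow_swap1)
  have c: "x \<in> carrier G" "y \<in> carrier G" using Suc.prems y asubgroup_carrier[OF S] by auto
  have "(x \<ominus> y) \<oplus> N (x \<ominus> y) = x \<oplus> (N x \<ominus> (y \<oplus> N y))"
   using c ahom_minus[OF ag ag N c]
   by (simp add: N_closed minus_eq minus_add a_ac)
  also have "... = x" using c y(2) by (simp add: N_closed r_neg minus_eq)
  finally show ?case
   using y(1) Suc.prems subgroup_plus[OF S] subgroup_minus[OF S] by (auto simp: minus_eq intro!: bexI[of _ "x \<ominus> y"])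
 qed
 thus ?thesis using nilpotent[OF asubgroup_carrier[OF S x]] x by blast
qed

definition "inverse_map = inv_into (carrier G) (%x. x \<oplus> N x)"

lemma inverse_map:
 assumes "x \<in> carrier G"
 shows inverse_map_closed: "inverse_map x \<in> carrier G"
  and inverse_map_right: "inverse_map x \<oplus> N (inverse_map x) = x"
  and inverse_map_left: "inverse_map (x \<oplus> N x) = x"
proof -
 have im: "x \<in> (%x. x \<oplus> N x) ` carrier G"
  using one_plus_surj[OF carrier_subgroup N_closed assms] by force
 show "inverse_map x \<in> carrier G" unfolding inverse_map_def by (rule inv_into_into[OF im])
 show "inverse_map x \<oplus> N (inverse_map x) = x" unfolding inverse_map_def by (rule f_inv_into_f[OF im])
 show "inverse_map (x \<oplus> N x) = x" unfolding inverse_map_def by (rule inv_into_f_f[OF one_plus_inj assms])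
qed

lemma inverse_map_eqI: "[|y \<in> carrier G; y \<oplus> N y = x|] ==> inverse_map x = y"
 using inverse_map_left by blast

lemma inverse_map_ahom: "inverse_map \<in> ahom G G"
proof (rule ahomI)
 fix x y assume "x \<in> carrier G" "y \<in> carrier G"
 thus "inverse_map (x \<oplus> y) = inverse_map x \<oplus> inverse_map y"
  using inverse_map_right[of x] inverse_map_right[of y]
  by (intro inverse_map_eqI)
    (simp_all add: inverse_map_closed ahom_add[OF one_plus_ahom, of "inverse_map x" "inverse_map y"])
qed (rule inverse_map_closed)

lemma inverse_map_subgroup:
 assumes S: "asubgroup S G" and NS: "!!x. x \<in> S ==> N x \<in> S" and x: "x \<in> S"
 shows "inverse_map x \<in> S"
proof -
 obtain y where y: "y \<in> S" "y \<oplus> N y = x" using one_plus_surj[OF assms] by blast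
 thus ?thesis using inverse_map_eqI[OF asubgroup_carrier[OF S y(1)] y(2)] by simp
qed

end

context assoc_algebra
begin

abbreviation A_one ("\<one>\<^sub>A") where "\<one>\<^sub>A == \<one>\<^bsub>A\<^esub>"
abbreviation A_zero ("\<zero>\<^sub>A") where "\<zero>\<^sub>A == \<zero>\<^bsub>A\<^esub>"
abbreviation A_smult (infixl "\<odot>\<^sub>A" 70) where "c \<odot>\<^sub>A a == c \<odot>\<^bsub>A\<^esub> a"
abbreviation A_mult (infixl "\<otimes>\<^sub>A" 70) where "a \<otimes>\<^sub>A b == a \<otimes>\<^bsub>A\<^esub> b"
abbreviation "A_lists == lists (carrier A)"

end

section \<open>The resolution with its contraction, and the maps on P (x) P\<close>

locale contraction = assoc_algebra K A
 for K :: "'k ring" and A :: "('k, 'a) module" +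
 fixes P :: "('a, 'p) bimodule_complex"
  and \<mu> :: "'p => 'a" and t :: "'p => 'p" and \<eta> :: "'a => 'p"
  and \<iota> :: "'p => ('a \<times> 'p \<Rightarrow>\<^sub>0 int) set"
 assumes resolution: "projective_resolution K A P \<mu>"
  and homotopy: "left_contracting_homotopy A P \<mu> t \<eta>"
  and section_hom: "\<iota> \<in> bimod_hom A P (tensorK K A (regular A) P)"
  and section_grade: "\<forall>n. \<iota> ` grade P n <= grade (tensorK K A (regular A) P) n"
  and section_act: "\<forall>x \<in> carrier P. act_map P (\<iota> x) = x"
begin

abbreviation "d == diff P"

lemma complex: "bimodule_complex K A P"
 using resolution by (simp add: projective_resolution_def)

sublocale P: graded_bimodule K A P
 using complex by (simp add: bimodule_complex_def)

sublocale half_tensor K A P by unfold_locales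

lemma d_hom: "deg_hom A P P (- 1) d"
 using complex by (auto simp: bimodule_complex_def deg_hom_def image_subset_iff)

lemmas d_closed [simp] = deg_hom_closed[OF d_hom]

lemma d_d [simp]: "x \<in> carrier P ==> d (d x) = \<zero>\<^bsub>P\<^esub>"
 using complex by (auto simp: bimodule_complex_def)

lemma grade_negative: "[|n < 0; x \<in> grade P n|] ==> x = \<zero>\<^bsub>P\<^esub>"
 using resolution by (auto simp: projective_resolution_def)

lemma mu_degree: "[|n ~= 0; x \<in> grade P n|] ==> \<mu> x = \<zero>\<^bsub>A\<^esub>"
 using resolution by (auto simp: projective_resolution_def)

lemma mu_hom: "deg_hom A P R 0 \<mu>"
proof -
 have h: "\<mu> \<in> bimod_hom A P R" using resolution by (simp add: projective_resolution_def)
 have "\<mu> x \<in> grade R (n + 0)" if "x \<in> grade P n" for n x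
  using mu_degree[of n x] ahom_closed[OF bimod_hom_ahom[OF h] P.grade_closed[OF that]] that by auto
 thus ?thesis using h by (simp add: deg_hom_def)
qed

lemmas mu_closed [simp] = deg_hom_closed[OF mu_hom, simplified]
lemmas mu_ahom = deg_hom_ahom[OF mu_hom]
lemmas mu_zero = ahom_zero[OF P.ag R.ag mu_ahom, simplified]
lemmas d_zero = ahom_zero[OF P.ag P.ag deg_hom_ahom[OF d_hom]]

lemma mu_d [simp]: "x \<in> carrier P ==> \<mu> (d x) = \<zero>\<^bsub>A\<^esub>"
proof -
 have *: "\<mu> (d x) = \<zero>\<^bsub>A\<^esub>" if "x \<in> grade P n" for n x
 proof (cases "n = 1")
  case True
  thus ?thesis using resolution that by (simp add: projective_resolution_def)
 next
  case False
  thus ?thesis using mu_degree[of "n - 1" "d x"] deg_hom_grade[OF d_hom that] by simp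
 qed
 show "x \<in> carrier P ==> \<mu> (d x) = \<zero>\<^bsub>A\<^esub>"
  by (rule P.graded_hom_eq[OF ahom_comp[OF deg_hom_ahom[OF d_hom] mu_ahom]
     ahom_const_zero[OF P.ag R.ag] R.ag, simplified]) (simp add: *)
qed

lemma t_hom: "t \<in> left_hom A P P" and eta_hom: "\<eta> \<in> left_hom A R P"
 and t_grade: "x \<in> grade P n ==> t x \<in> grade P (n + 1)"
 and eta_grade: "a \<in> carrier A ==> \<eta> a \<in> grade P 0"
 and contract: "x \<in> carrier P ==> d (t x) \<oplus>\<^bsub>P\<^esub> t (d x) \<oplus>\<^bsub>P\<^esub> \<eta> (\<mu> x) = x"
 using homotopy by (auto simp: left_contracting_homotopy_def)

lemmas t_closed [simp] = ahom_closed[OF left_hom_ahom[OF t_hom]]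

lemma eta_closed [simp]: "a \<in> carrier A ==> \<eta> a \<in> carrier P"
 using P.grade_closed[OF eta_grade] .

lemma mu_t [simp]: "x \<in> carrier P ==> \<mu> (t x) = \<zero>\<^bsub>A\<^esub>"
proof (rule P.graded_hom_eq[OF ahom_comp[OF left_hom_ahom[OF t_hom] mu_ahom]
   ahom_const_zero[OF P.ag R.ag] R.ag, simplified])
 fix n x assume x: "x \<in> grade P n"
 show "\<mu> (t x) = \<zero>\<^bsub>A\<^esub>"
 proof (cases "n < 0")
  case True
  hence "x = \<zero>\<^bsub>P\<^esub>" using grade_negative x by simp
  thus ?thesis
   using ahom_zero[OF P.ag P.ag left_hom_ahom[OF t_hom]] by (simp add: mu_zero)
 next
  case False
  thus ?thesis using mu_degree[OF _ t_grade[OF x]] by simp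
 qed
qed

lemma mu_surj:
 assumes a: "a \<in> carrier A" obtains x where "x \<in> carrier P" "\<mu> x = a"
proof -
 have "(%X. the_elem (\<mu> ` X)) \<in> iso (homology P (grade P) d 0) (add_monoid A)"
  using resolution by (simp add: projective_resolution_def)
 hence "(%X. the_elem (\<mu> ` X)) ` carrier (homology P (grade P) d 0) = carrier A"
  by (simp add: iso_def bij_betw_def)
 with a have "a \<in> (%X. the_elem (\<mu> ` X)) ` carrier (homology P (grade P) d 0)" by (simp only:)
 then obtain X where X: "X \<in> carrier (homology P (grade P) d 0)" "the_elem (\<mu> ` X) = a" by blast
 then obtain z where z: "z \<in> cycles P (grade P) d 0"
   "X = (\<Union>h\<in>boundaries (grade P) d 0. {h \<oplus>\<^bsub>P\<^esub> z})"
  by (auto simp: homology_def FactGroup_def RCOSETS_def r_coset_def)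
 have zc: "z \<in> carrier P" using z(1) P.grade_closed by (auto simp: cycles_def)
 \<comment> \<open>The augmentation kills boundaries, so it is constant on the class
   \<open>X\<close>, and \<open>the_elem\<close> returns this constant.\<close>
 have "\<mu> (h \<oplus>\<^bsub>P\<^esub> z) = \<mu> z" if "h \<in> boundaries (grade P) d 0" for h
  using that zc by (auto simp: boundaries_def ahom_add[OF mu_ahom] P.grade_closed)
 moreover have "\<zero>\<^bsub>P\<^esub> \<in> boundaries (grade P) d 0"
  using P.grade_zero d_zero by (force simp: boundaries_def)
 ultimately have "\<mu> ` X = {\<mu> z}"
  unfolding z(2) by (auto intro!: image_eqI[of _ _ "\<zero>\<^bsub>P\<^esub> \<oplus>\<^bsub>P\<^esub> z"])
 thus thesis using that zc X(2) by simp
qed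

text \<open>Apply \<open>\<mu>\<close> to the contraction identity at a preimage of a: the terms
  with \<open>t\<close> lie in its kernel, and what remains compares \<open>\<mu> (\<eta> a)\<close>
  with a.\<close>

lemma mu_eta [simp]: assumes a: "a \<in> carrier A" shows "\<mu> (\<eta> a) = a"
proof -
 obtain x where x: "x \<in> carrier P" "\<mu> x = a" using mu_surj[OF a] .
 have "\<mu> (d (t x) \<oplus>\<^bsub>P\<^esub> t (d x) \<oplus>\<^bsub>P\<^esub> \<eta> (\<mu> x)) = \<mu> (\<eta> (\<mu> x))"
  using x(1) by (simp add: ahom_add[OF mu_ahom])
 thus ?thesis using contract[OF x(1)] x(2) by simp
qed

lemma d_eta [simp]: "a \<in> carrier A ==> d (\<eta> a) = \<zero>\<^bsub>P\<^esub>"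
 using grade_negative[of "- 1" "d (\<eta> a)"] deg_hom_grade[OF d_hom eta_grade, of a "- 1"] by simp

end

context contraction
begin

abbreviation P_zero ("\<zero>\<^sub>P") where "\<zero>\<^sub>P == \<zero>\<^bsub>P\<^esub>"
abbreviation P_add (infixl "\<oplus>\<^sub>P" 65) where "x \<oplus>\<^sub>P y == x \<oplus>\<^bsub>P\<^esub> y"
abbreviation P_minus (infixl "\<ominus>\<^sub>P" 65) where "x \<ominus>\<^sub>P y == x \<ominus>\<^bsub>P\<^esub> y"
abbreviation P_uminus ("\<ominus>\<^sub>P _" [81] 80) where "\<ominus>\<^sub>P x == \<ominus>\<^bsub>P\<^esub> x"
abbreviation P_smult (infixl "\<odot>\<^sub>P" 70) where "a \<odot>\<^sub>P x == a \<odot>\<^bsub>P\<^esub> x"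
abbreviation P_ract (infixl "\<triangleleft>\<^sub>P" 70) where "x \<triangleleft>\<^sub>P a == x \<triangleleft>\<^bsub>P\<^esub> a"
abbreviation T_zero ("\<zero>\<^sub>T") where "\<zero>\<^sub>T == \<zero>\<^bsub>Tr A P\<^esub>"
abbreviation T_add (infixl "\<oplus>\<^sub>T" 65) where "x \<oplus>\<^sub>T y == x \<oplus>\<^bsub>Tr A P\<^esub> y"
abbreviation T_minus (infixl "\<ominus>\<^sub>T" 65) where "x \<ominus>\<^sub>T y == x \<ominus>\<^bsub>Tr A P\<^esub> y"
abbreviation T_uminus ("\<ominus>\<^sub>T _" [81] 80) where "\<ominus>\<^sub>T x == \<ominus>\<^bsub>Tr A P\<^esub> x"

abbreviation PPadd (infixl "\<oplus>\<^sub>2" 65) where "u \<oplus>\<^sub>2 v == u \<oplus>\<^bsub>PP\<^esub> v"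

definition "dL = tensor_map (carrier A) P P P 0 d id"
definition "dR = d_R A P"
definition "D u = dL u \<oplus>\<^bsub>PP\<^esub> dR u"
definition "tL = t_L K A P \<iota> t"
definition "etaL = eta_L K A P \<iota> \<eta>"
definition "muR = mu_R A P \<mu>"
definition "muL = pres_lift P (%(x, y). \<mu> x \<odot>\<^sub>P y)"

lemmas PP_simps = PQ.smult_tens PQ.ract_tens P.left_closed P.right_closed
lemmas iota_ahom = bimod_hom_ahom[OF section_hom]
lemmas iota_closed = ahom_closed[OF iota_ahom]

lemma iota_grade: "x \<in> grade P n ==> \<iota> x \<in> grade AP n"
 using section_grade by auto

text \<open>Bimodule homomorphisms out of \<open>P \<otimes>\<^sub>A P\<close> need only be understood on homogeneous tensors.\<close>

lemma PP_deg_homI: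
 assumes f: "f \<in> ahom PP N" and N: "bimodule K A N" and gr: "!!n. asubgroup (grade N n) N"
  and "!!a x y i j. [|a \<in> carrier A; x \<in> grade P i; y \<in> grade P j|] ==> f (tp (a \<odot>\<^sub>P x) y) = a \<odot>\<^bsub>N\<^esub> f (tp x y)"
  and "!!a x y i j. [|a \<in> carrier A; x \<in> grade P i; y \<in> grade P j|] ==> f (tp x (y \<triangleleft>\<^sub>P a)) = f (tp x y) \<triangleleft>\<^bsub>N\<^esub> a"
  and "!!x y i j. [|x \<in> grade P i; y \<in> grade P j|] ==> f (tp x y) \<in> grade N (i + j + k)"
 shows "deg_hom A PP N k f"
proof -
 interpret N: bimodule K A N by fact
 show ?thesis
 proof (rule deg_homI[OF f])
  fix a u assume a: "a \<in> carrier A" and u: "u \<in> carrier PP"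
  show "f (a \<odot>\<^bsub>PP\<^esub> u) = a \<odot>\<^bsub>N\<^esub> f u"
   by (rule PQ.graded_tensor_hom_eq[OF ahom_comp[OF PQ.T.smult_ahom[OF a] f] ahom_comp[OF f N.smult_ahom[OF a]] N.ag _ u])
     (use a assms(4) in \<open>simp add: PQ.smult_tens P.grade_closed\<close>)
  show "f (u \<triangleleft>\<^bsub>PP\<^esub> a) = f u \<triangleleft>\<^bsub>N\<^esub> a"
   by (rule PQ.graded_tensor_hom_eq[OF ahom_comp[OF PQ.T.ract_ahom[OF a] f] ahom_comp[OF f N.ract_ahom[OF a]] N.ag _ u])
     (use a assms(5) in \<open>simp add: PQ.ract_tens P.grade_closed\<close>)
 next
  fix n u assume "u \<in> grade PP n"
  show "f u \<in> grade N (n + k)"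
   by (rule PQ.grade_tensor_image[OF f N.ag gr _ \<open>u \<in> grade PP n\<close>]) (use assms(6) in auto)
 qed
qed

lemma dL_tens: "[|x \<in> carrier P; y \<in> carrier P|] ==> dL (tp x y) = tp (d x) y"
 and dL_hom: "deg_hom A PP PP (- 1) dL"
proof -
 note tm = tensor_map_hom[OF PQ.tensor_bimodule_axioms PQ.tensor_bimodule_axioms P.graded_bimodule_axioms
   deg_hom_ahom[OF d_hom] _ ahom_id(2)]
 show t: "dL (tp x y) = tp (d x) y" if "x \<in> carrier P" "y \<in> carrier P" for x y
  unfolding dL_def by (subst tm(2)) (simp_all add: that P.twist_0 deg_hom_ract[OF d_hom])
 show "deg_hom A PP PP (- 1) dL"
 proof (rule PP_deg_homI[OF _ PQ.bimodule_tensor PQ.grade_tensor_asubgroup])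
  show "dL \<in> ahom PP PP" unfolding dL_def by (rule tm(1)) (simp_all add: deg_hom_ract[OF d_hom])
 qed (auto simp: t P.grade_closed PP_simps deg_hom_smult[OF d_hom]
    intro!: PQ.tens_grade deg_hom_grade[OF d_hom])
qed

lemma dR_tens: "[|x \<in> grade P i; y \<in> carrier P|] ==> dR (tp x y) = sgn_elt PP i (tp x (d y))"
 and dR_hom: "deg_hom A PP PP (- 1) dR"
proof -
 note tm = tensor_map_hom[OF PQ.tensor_bimodule_axioms PQ.tensor_bimodule_axioms P.graded_bimodule_axioms
   ahom_id(2) _ deg_hom_ahom[OF d_hom], where m = "- 1"]
 \<comment> \<open>The Koszul exponent for a map of degree -1 is -i, which has the parity of
   i.\<close>
 have s: "sgn_elt P (- i) x = sgn_elt P i x" for i x by (simp add: sgn_elt_def)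
 show t: "dR (tp x y) = sgn_elt PP i (tp x (d y))" if "x \<in> grade P i" "y \<in> carrier P" for x y i
  unfolding dR_def d_R_def using that P.grade_closed[OF that(1)]
  by (subst tm(2)) (simp_all add: P.twist_homogeneous deg_hom_smult[OF d_hom] s PQ.tens_sgn_left)
 show "deg_hom A PP PP (- 1) dR"
 proof (rule PP_deg_homI[OF _ PQ.bimodule_tensor PQ.grade_tensor_asubgroup])
  show "dR \<in> ahom PP PP" unfolding dR_def d_R_def by (rule tm(1)) (simp_all add: deg_hom_smult[OF d_hom])
 qed (auto simp: t P.grade_closed PP_simps P.grade_left deg_hom_ract[OF d_hom] PQ.T.smult_sgn PQ.T.ract_sgn
    intro!: PQ.T.subgroup_sgn[OF PQ.grade_tensor_asubgroup] PQ.tens_grade deg_hom_grade[OF d_hom])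
qed

lemma muL_balanced: "balanced (carrier A) (ract P) (smult P) P P P (%x y. \<mu> x \<odot>\<^sub>P y)"
 by (rule balancedI)
   (simp_all add: P.left_closed P.left_distrib P.left_distrib_ring P.left_assoc ahom_add[OF mu_ahom] deg_hom_ract[OF mu_hom])

lemma muL_tens: "[|x \<in> carrier P; y \<in> carrier P|] ==> muL (tp x y) = \<mu> x \<odot>\<^sub>P y"
 unfolding muL_def by (rule PQ.lift_tens[OF P.ag muL_balanced])

lemma zero_smult [simp]: "y \<in> carrier P ==> \<zero>\<^sub>A \<odot>\<^sub>P y = \<zero>\<^sub>P"
 using P.left_distrib_ring[of "\<zero>\<^sub>A" "\<zero>\<^sub>A" y] P.left_closed[of "\<zero>\<^sub>A" y] by simp

lemma ract_zero' [simp]: "x \<in> carrier P ==> x \<triangleleft>\<^sub>P \<zero>\<^sub>A = \<zero>\<^sub>P"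
 using P.right_distrib_ring[of "\<zero>\<^sub>A" "\<zero>\<^sub>A" x] P.right_closed[of "\<zero>\<^sub>A" x] by simp

lemma mu_smult_grade: "[|x \<in> grade P i; y \<in> grade P j|] ==> \<mu> x \<odot>\<^sub>P y \<in> grade P (i + j)"
 using mu_degree[of i x] by (cases "i = 0") (simp_all add: P.grade_left P.grade_closed P.grade_zero)

lemma muL_ahom: "muL \<in> ahom PP P"
 unfolding muL_def by (rule PQ.lift_hom[OF P.ag muL_balanced])

lemma muL_hom: "deg_hom A PP P 0 muL"
 by (rule PP_deg_homI[OF muL_ahom P.bimodule_axioms P.grade_asubgroup])
   (simp_all add: muL_tens P.grade_closed PP_simps P.left_right P.left_assoc deg_hom_smult[OF mu_hom]
    mu_smult_grade)

lemma act_right_balanced: "balanced (carrier A) (ract P) (smult R) P R P (ract P)"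
 by (rule balancedI) (simp_all add: P.right_closed P.right_distrib P.right_distrib_ring P.right_assoc)

lemma muR_tens: "[|x \<in> carrier P; y \<in> carrier P|] ==> muR (tp x y) = x \<triangleleft>\<^sub>P \<mu> y"
 and muR_hom: "deg_hom A PP P 0 muR"
proof -
 let ?r = "pres_lift P (%(x, a). x \<triangleleft>\<^sub>P a)"
 note tm = tensor_map_hom[OF PQ.tensor_bimodule_axioms PR.tensor_bimodule_axioms P.graded_bimodule_axioms
   ahom_id(2) _ mu_ahom, where m = 0]
 have r: "?r \<in> ahom (tensorA A P R) P" "!!x a. [|x \<in> carrier P; a \<in> carrier A|] ==> ?r (PR.tn x a) = x \<triangleleft>\<^sub>P a"
  using PR.lift_hom[OF P.ag act_right_balanced] PR.lift_tens[OF P.ag act_right_balanced]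
  by simp_all
 show t: "muR (tp x y) = x \<triangleleft>\<^sub>P \<mu> y" if "x \<in> carrier P" "y \<in> carrier P" for x y
  unfolding muR_def mu_R_def o_def
  by (subst tm(2)) (simp_all add: that P.twist_0 deg_hom_smult[OF mu_hom] r)
 have g: "x \<triangleleft>\<^sub>P \<mu> y \<in> grade P (i + j)" if "x \<in> grade P i" "y \<in> grade P j" for x y i j
 proof (cases "j = 0")
  case False
  thus ?thesis
   using mu_degree[OF False that(2)] P.grade_closed[OF that(1)] by (simp add: P.grade_zero)
 qed (use that in \<open>simp add: P.grade_right P.grade_closed\<close>)
 show "deg_hom A PP P 0 muR"
 proof (rule PP_deg_homI[OF _ P.bimodule_axioms P.grade_asubgroup])
  have "tensor_map (carrier A) P P R 0 id \<mu> \<in> ahom PP (tensorA A P R)"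
   by (rule tm(1)) (simp_all add: deg_hom_smult[OF mu_hom])
  from ahom_comp[OF this r(1)] show "muR \<in> ahom PP P" by (simp add: muR_def mu_R_def o_def)
 qed (auto simp: t g P.grade_closed PP_simps P.left_right P.right_assoc deg_hom_ract[OF mu_hom])
qed

lemma half_grade:
 assumes "x \<in> grade P i" "u \<in> grade AP j"
 shows "HP.half t x u \<in> grade PP (i + j + 1)"
proof (rule AP.grade_tensor_image[OF HP.half_ahom[OF t_hom P.grade_closed[OF assms(1)]] PQ.ag_tensor
   PQ.grade_tensor_asubgroup _ assms(2)])
 fix a y k l assume a: "a \<in> grade R k" "y \<in> grade P l" "k + l = j"
 have ac: "a \<in> carrier A" using a(1) by (simp split: if_splits)
 have xc: "x \<in> carrier P" using assms P.grade_closed by simp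
 show "HP.half t x (ta a y) \<in> grade PP (i + j + 1)"
 proof (cases "k = 0")
  case True
  thus ?thesis
   using a ac xc assms(1) by (auto simp: HP.half_tens[OF t_hom] P.grade_closed intro!: PQ.tens_grade t_grade P.grade_right)
 next
  \<comment> \<open>The regular bimodule is concentrated in degree 0, so in any other degree the
    element \<open>a\<close> is zero and so is the tensor.\<close>
  case False
  hence "ta a y = \<zero>\<^bsub>AP\<^esub>" using a AP.tens_zero_left P.grade_closed[OF a(2)] by simp
  thus ?thesis
   using PQ.T.subgroup_zero[OF PQ.grade_tensor_asubgroup]
    ahom_zero[OF AP.ag_tensor PQ.ag_tensor HP.half_ahom[OF t_hom xc]] by simp
 qed
qed

lemma half_eta_grade:
 assumes "u \<in> grade AP j"
 shows "HR.half \<eta> \<one>\<^sub>A u \<in> grade PP j"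
proof (rule AP.grade_tensor_image[OF HR.half_ahom[OF eta_hom] PQ.ag_tensor
   PQ.grade_tensor_asubgroup _ assms])
 fix a y k l assume a: "a \<in> grade R k" "y \<in> grade P l" "k + l = j"
 have ac: "a \<in> carrier A" using a(1) by (simp split: if_splits)
 show "HR.half \<eta> \<one>\<^sub>A (ta a y) \<in> grade PP j"
 proof (cases "k = 0")
  case True
  thus ?thesis
   using a ac by (auto simp: HR.half_tens[OF eta_hom] P.grade_closed intro!: PQ.tens_grade eta_grade)
 next
  case False
  hence "ta a y = \<zero>\<^bsub>AP\<^esub>" using a AP.tens_zero_left P.grade_closed[OF a(2)] by simp
  thus ?thesis
   using PQ.T.subgroup_zero[OF PQ.grade_tensor_asubgroup]
    ahom_zero[OF AP.ag_tensor PQ.ag_tensor HR.half_ahom[OF eta_hom]] by simp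
 qed
qed simp

lemma tL_tens: "[|x \<in> carrier P; y \<in> carrier P|] ==> tL (tp x y) = HP.half t x (\<iota> y)"
 unfolding tL_def by (rule t_L_tens[OF section_hom t_hom])

lemma tL_ahom: "tL \<in> ahom PP PP"
 unfolding tL_def by (rule t_L_ahom[OF section_hom t_hom])

lemma tL_hom: "deg_hom A PP PP 1 tL"
 by (rule PP_deg_homI[OF tL_ahom PQ.bimodule_tensor PQ.grade_tensor_asubgroup])
   (simp_all add: tL_tens P.grade_closed PP_simps HP.half_smult[OF t_hom] iota_closed HP.half_ract_right[OF t_hom]
    bimod_hom_ract[OF section_hom] half_grade iota_grade)

lemma etaL_eq: "y \<in> carrier P ==> etaL y = HR.half \<eta> \<one>\<^sub>A (\<iota> y)"
 unfolding etaL_def by (rule eta_L_eq[OF section_hom eta_hom])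

lemma etaL_hom: "deg_hom A P PP 0 etaL"
proof (rule deg_homI)
 have "(%y. HR.half \<eta> \<one>\<^sub>A (\<iota> y)) \<in> ahom P PP"
  by (rule ahom_comp[OF iota_ahom HR.half_ahom[OF eta_hom]]) simp
 thus "etaL \<in> ahom P PP"
  by (rule ahom_cong) (simp_all add: etaL_eq P.ag)
next
 fix a x assume a: "a \<in> carrier A" "x \<in> carrier P"
 have "HR.half \<eta> \<one>\<^sub>A (a \<odot>\<^bsub>AP\<^esub> \<iota> x) = HR.half \<eta> (\<one>\<^sub>A \<triangleleft>\<^bsub>R\<^esub> a) (\<iota> x)"
  by (rule HR.half_ract[OF eta_hom, symmetric]) (use a iota_closed in simp_all)
 also have "... = HR.half \<eta> (a \<odot>\<^bsub>R\<^esub> \<one>\<^sub>A) (\<iota> x)" using a by simp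
 also have "... = a \<odot>\<^bsub>PP\<^esub> HR.half \<eta> \<one>\<^sub>A (\<iota> x)"
  by (rule HR.half_smult[OF eta_hom]) (use a iota_closed in simp_all)
 finally show "etaL (a \<odot>\<^sub>P x) = a \<odot>\<^bsub>PP\<^esub> etaL x"
  using a by (simp add: etaL_eq P.left_closed left_hom_smult[OF bimod_hom_left[OF section_hom]])
 show "etaL (x \<triangleleft>\<^sub>P a) = etaL x \<triangleleft>\<^bsub>PP\<^esub> a"
  using a by (simp add: etaL_eq P.right_closed bimod_hom_ract[OF section_hom] HR.half_ract_right[OF eta_hom] iota_closed)
next
 fix n x assume "x \<in> grade P n"
 thus "etaL x \<in> grade PP (n + 0)"
  by (simp add: etaL_eq P.grade_closed half_eta_grade iota_grade)
qed

lemmas op_closed [simp] = deg_hom_closed[OF dL_hom] deg_hom_closed[OF dR_hom] deg_hom_closed[OF muL_hom]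
 deg_hom_closed[OF muR_hom] deg_hom_closed[OF tL_hom] deg_hom_closed[OF etaL_hom]
lemmas op_ahom = deg_hom_ahom[OF dL_hom] deg_hom_ahom[OF dR_hom] deg_hom_ahom[OF muL_hom]
 deg_hom_ahom[OF muR_hom] deg_hom_ahom[OF tL_hom] deg_hom_ahom[OF etaL_hom] deg_hom_ahom[OF d_hom]
lemmas op_add = op_ahom[THEN ahom_add]

lemmas PP_eq = PQ.graded_tensor_hom_eq

lemma dR_dR: "u \<in> carrier PP ==> dR (dR u) = \<zero>\<^bsub>PP\<^esub>"
proof (rule PP_eq[OF ahom_comp[OF op_ahom(2) op_ahom(2)] ahom_const_zero[OF PQ.ag_tensor PQ.ag_tensor] PQ.ag_tensor])
 fix x y i j assume xy: "x \<in> grade P i" "y \<in> grade P j"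
 thus "dR (dR (tp x y)) = \<zero>\<^bsub>PP\<^esub>"
  by (simp add: dR_tens P.grade_closed ahom_sgn[OF PQ.ag_tensor PQ.ag_tensor op_ahom(2)]
   PQ.tens_zero_right)
qed

lemma dL_dR: "u \<in> carrier PP ==> dL (dR u) \<oplus>\<^sub>2 dR (dL u) = \<zero>\<^bsub>PP\<^esub>"
proof (rule PP_eq[OF ahom_plus[OF PQ.ag_tensor PQ.ag_tensor ahom_comp[OF op_ahom(2) op_ahom(1)]
   ahom_comp[OF op_ahom(1) op_ahom(2)]] ahom_const_zero[OF PQ.ag_tensor PQ.ag_tensor] PQ.ag_tensor])
 fix x y i j assume xy: "x \<in> grade P i" "y \<in> grade P j"
 note c = xy[THEN P.grade_closed]
 have "dR (tp (d x) y) = sgn_elt PP (i - 1) (tp (d x) (d y))"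
  by (rule dR_tens[OF deg_hom_grade[OF d_hom xy(1)] c(2)]) simp
 thus "dL (dR (tp x y)) \<oplus>\<^sub>2 dR (dL (tp x y)) = \<zero>\<^bsub>PP\<^esub>"
  using xy c ahom_neg[OF PQ.ag_tensor PQ.ag_tensor op_ahom(1), of "tp x (d y)"]
  by (cases "even i") (simp_all add: dR_tens dL_tens sgn_elt_def PQ.T.l_neg PQ.T.r_neg)
qed

text \<open>The contraction identity of P at x a, applied in front of each tensor a (x) y. It is
  stated for arbitrary \<open>u\<close> because such tensors generate, so the identity can be
  checked on them.\<close>

lemma half_contract:
 assumes x: "x \<in> carrier P" and u: "u \<in> carrier AP"
 shows "dL (HP.half t x u) \<oplus>\<^sub>2 HP.half t (d x) u \<oplus>\<^sub>2 HR.half \<eta> (\<mu> x) u = tp x (act_map P u)"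
proof (rule AP.hom_eq[OF _ ahom_comp[OF act_map_ahom PQ.tens_right_ahom[OF x]] PQ.ag_tensor _ u])
 show "(%u. dL (HP.half t x u) \<oplus>\<^sub>2 HP.half t (d x) u \<oplus>\<^sub>2 HR.half \<eta> (\<mu> x) u) \<in> ahom AP PP"
  by (intro ahom_plus[OF AP.ag_tensor PQ.ag_tensor] ahom_comp[OF _ op_ahom(1)]
    HP.half_ahom[OF t_hom] HR.half_ahom[OF eta_hom]) (use x in simp_all)
 fix a y assume a: "a \<in> carrier R" "y \<in> carrier P"
 hence ac: "a \<in> carrier A" by simp
 let ?x = "x \<triangleleft>\<^sub>P a"
 have xc: "?x \<in> carrier P" using x ac by (rule P.right_closed[rotated])
 have e: "d x \<triangleleft>\<^sub>P a = d ?x" "\<mu> x \<otimes>\<^sub>A a = \<mu> ?x"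
  using x ac deg_hom_ract[OF d_hom ac x] deg_hom_ract[OF mu_hom ac x] by simp_all
 have "dL (HP.half t x (ta a y)) \<oplus>\<^sub>2 HP.half t (d x) (ta a y) \<oplus>\<^sub>2 HR.half \<eta> (\<mu> x) (ta a y)
   = tp (d (t ?x)) y \<oplus>\<^sub>2 tp (t (d ?x)) y \<oplus>\<^sub>2 tp (\<eta> (\<mu> ?x)) y"
  using x xc a ac by (simp add: HP.half_tens[OF t_hom] HR.half_tens[OF eta_hom] dL_tens e)
 also have "... = tp ?x y"
  using contract[OF xc] xc a by (simp add: PQ.tens_add_left[symmetric])
 also have "... = tp x (act_map P (ta a y))"
  using x a ac by (simp add: act_map_tens PQ.tens_bal)
 finally show "dL (HP.half t x (ta a y)) \<oplus>\<^sub>2 HP.half t (d x) (ta a y) \<oplus>\<^sub>2 HR.half \<eta> (\<mu> x) (ta a y)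
   = tp x (act_map P (ta a y))" .
qed

text \<open>The previous identity at \<open>u = \<iota> y\<close>, where the section property turns
  the right-hand side into x (x) y; left linearity rewrites the last term through
  \<open>muL\<close>. This is the unperturbed contraction, for d_L alone.\<close>

lemma left_contract: "u \<in> carrier PP ==> dL (tL u) \<oplus>\<^sub>2 tL (dL u) \<oplus>\<^sub>2 etaL (muL u) = u"
proof (rule PP_eq[OF _ ahom_id(1) PQ.ag_tensor])
 show "(%u. dL (tL u) \<oplus>\<^sub>2 tL (dL u) \<oplus>\<^sub>2 etaL (muL u)) \<in> ahom PP PP"
  by (intro ahom_plus[OF PQ.ag_tensor PQ.ag_tensor] ahom_comp[OF op_ahom(5) op_ahom(1)]
    ahom_comp[OF op_ahom(1) op_ahom(5)] ahom_comp[OF op_ahom(3) op_ahom(6)])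
 fix x y i j assume "x \<in> grade P i" "y \<in> grade P j"
 hence c: "x \<in> carrier P" "y \<in> carrier P" by (simp_all add: P.grade_closed)
 have "etaL (muL (tp x y)) = \<mu> x \<odot>\<^bsub>PP\<^esub> etaL y"
  using c by (simp add: muL_tens deg_hom_smult[OF etaL_hom])
 also have "... = HR.half \<eta> (\<mu> x) (\<iota> y)"
  using c HR.half_smult[OF eta_hom, of "\<one>\<^sub>A" "\<mu> x" "\<iota> y"] by (simp add: etaL_eq iota_closed)
 finally show "dL (tL (tp x y)) \<oplus>\<^sub>2 tL (dL (tp x y)) \<oplus>\<^sub>2 etaL (muL (tp x y)) = tp x y"
  using c half_contract[OF c(1) iota_closed[OF c(2)]] section_act by (simp add: tL_tens dL_tens)
qed

lemma muL_tL: "u \<in> carrier PP ==> muL (tL u) = \<zero>\<^sub>P"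
proof (rule PP_eq[OF ahom_comp[OF op_ahom(5) op_ahom(3)] ahom_const_zero[OF PQ.ag_tensor P.ag] P.ag])
 fix x y i j assume "x \<in> grade P i" "y \<in> grade P j"
 hence c: "x \<in> carrier P" "y \<in> carrier P" by (simp_all add: P.grade_closed)
 have "muL (HP.half t x u) = \<zero>\<^sub>P" if u: "u \<in> carrier AP" for u
  by (rule AP.hom_eq[OF ahom_comp[OF HP.half_ahom[OF t_hom c(1)] op_ahom(3)]
     ahom_const_zero[OF AP.ag_tensor P.ag] P.ag _ u])
    (use c in \<open>simp add: HP.half_tens[OF t_hom] muL_tens P.right_closed\<close>)
 thus "muL (tL (tp x y)) = \<zero>\<^sub>P" using c by (simp add: tL_tens iota_closed)
qed

lemma muL_etaL: assumes y: "y \<in> carrier P" shows "muL (etaL y) = y"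
proof -
 have "muL (HR.half \<eta> \<one>\<^sub>A u) = act_map P u" if u: "u \<in> carrier AP" for u
  by (rule AP.hom_eq[OF ahom_comp[OF HR.half_ahom[OF eta_hom] op_ahom(3)] act_map_ahom P.ag _ u])
    (simp_all add: HR.half_tens[OF eta_hom] muL_tens act_map_tens)
 thus ?thesis using y section_act by (simp add: etaL_eq iota_closed)
qed

lemma dL_etaL: assumes y: "y \<in> carrier P" shows "dL (etaL y) = \<zero>\<^bsub>PP\<^esub>"
proof -
 have "dL (HR.half \<eta> \<one>\<^sub>A u) = \<zero>\<^bsub>PP\<^esub>" if u: "u \<in> carrier AP" for u
  by (rule AP.hom_eq[OF ahom_comp[OF HR.half_ahom[OF eta_hom] op_ahom(1)]
     ahom_const_zero[OF AP.ag_tensor PQ.ag_tensor] PQ.ag_tensor _ u])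
    (simp_all add: HR.half_tens[OF eta_hom] dL_tens PQ.tens_zero_left)
 thus ?thesis using y by (simp add: etaL_eq iota_closed)
qed

lemma muL_dL: "u \<in> carrier PP ==> muL (dL u) = \<zero>\<^sub>P"
proof (rule PP_eq[OF ahom_comp[OF op_ahom(1) op_ahom(3)] ahom_const_zero[OF PQ.ag_tensor P.ag] P.ag])
 fix x y i j assume "x \<in> grade P i" "y \<in> grade P j"
 hence c: "x \<in> carrier P" "y \<in> carrier P" by (simp_all add: P.grade_closed)
 thus "muL (dL (tp x y)) = \<zero>\<^sub>P"
  by (simp add: dL_tens muL_tens)
qed

lemma muL_dR: "u \<in> carrier PP ==> muL (dR u) = d (muL u)"
proof (rule PP_eq[OF ahom_comp[OF op_ahom(2) op_ahom(3)] ahom_comp[OF op_ahom(3) op_ahom(7)] P.ag])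
 fix x y i j assume xy: "x \<in> grade P i" "y \<in> grade P j"
 hence c: "x \<in> carrier P" "y \<in> carrier P" by (simp_all add: P.grade_closed)
 \<comment> \<open>\<open>\<mu> x\<close> can be nonzero only for x of degree 0, where the Koszul
   sign of d_R is trivial.\<close>
 have "sgn_elt P i (\<mu> x \<odot>\<^sub>P d y) = \<mu> x \<odot>\<^sub>P d y"
  using mu_degree[of i x] xy(1) c by (cases "i = 0") simp_all
 thus "muL (dR (tp x y)) = d (muL (tp x y))"
  using xy(1) c by (simp add: dR_tens muL_tens ahom_sgn[OF PQ.ag_tensor P.ag op_ahom(3)]
    deg_hom_smult[OF d_hom])
qed

lemma muR_dL: "u \<in> carrier PP ==> muR (dL u) = d (muR u)"
 by (rule PP_eq[OF ahom_comp[OF op_ahom(1) op_ahom(4)] ahom_comp[OF op_ahom(4) op_ahom(7)] P.ag])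
   (simp_all add: P.grade_closed dL_tens muR_tens deg_hom_ract[OF d_hom])

lemma muR_dR: "u \<in> carrier PP ==> muR (dR u) = \<zero>\<^sub>P"
proof (rule PP_eq[OF ahom_comp[OF op_ahom(2) op_ahom(4)] ahom_const_zero[OF PQ.ag_tensor P.ag] P.ag])
 fix x y i j assume xy: "x \<in> grade P i" "y \<in> grade P j"
 hence c: "x \<in> carrier P" "y \<in> carrier P" by (simp_all add: P.grade_closed)
 thus "muR (dR (tp x y)) = \<zero>\<^sub>P"
  using xy c by (simp add: dR_tens muR_tens ahom_sgn[OF PQ.ag_tensor P.ag op_ahom(4)])
qed

lemma mu_muL: "u \<in> carrier PP ==> \<mu> (muL u) = \<mu> (muR u)"
 by (rule PP_eq[OF ahom_comp[OF op_ahom(3) mu_ahom] ahom_comp[OF op_ahom(4) mu_ahom] R.ag])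
   (simp_all add: P.grade_closed muL_tens muR_tens deg_hom_ract[OF mu_hom] deg_hom_smult[OF mu_hom])

end

section \<open>The perturbed contraction and the maps \<open>S\<close>, \<open>Delta\<close>,
  \<open>f\<close>, \<open>phi\<close>\<close>

context contraction
begin

lemmas grPP = PQ.grade_tensor_asubgroup
lemmas PPg = PQ.ag_tensor
lemmas Pg = P.ag

lemma D_hom: "deg_hom A PP PP (- 1) D"
 unfolding D_def[abs_def] by (rule deg_hom_plus[OF dL_hom dR_hom PPg PQ.bimodule_tensor grPP])

lemmas D_closed [simp] = deg_hom_closed[OF D_hom]
lemmas D_ahom = deg_hom_ahom[OF D_hom]

lemma shift_hom: "deg_hom A PP PP 0 (%u. tL (dR u))"
 by (rule deg_hom_comp[OF dR_hom tL_hom]) simp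

abbreviation "shift_right u == tL (dR u)"

text \<open>Each application lowers the degree of the right tensor factor: d_R replaces y by d y,
  and the section spreads this as a sum of a (x) y' with y' in the same lower degree, while
  \<open>t\<close> acts on the left factor only. As P vanishes in negative degrees, the process
  stops on every tensor.\<close>

lemma shift_right_nilpotent:
 assumes u: "u \<in> carrier PP" shows "\<exists>k. ((%u. shift_right u) ^^ k) u = \<zero>\<^bsub>PP\<^esub>"
proof -
 let ?N = "%u. shift_right u"
 note h = deg_hom_ahom[OF shift_hom]
 have pow: "(?N ^^ k) \<in> ahom PP PP" for k
 proof (induction k)
  case 0 thus ?case using ahom_id(1) by (simp add: id_def)
 next
  case (Suc k) thus ?case using ahom_comp[OF Suc h] by (simp add: comp_def)
 qed
 note z = ahom_zero[OF PPg PPg pow]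
 define G where "G = {u \<in> carrier PP. \<exists>k. (?N ^^ k) u = \<zero>\<^bsub>PP\<^esub>}"
 have more: "(?N ^^ (k + l)) u = \<zero>\<^bsub>PP\<^esub>" if "(?N ^^ k) u = \<zero>\<^bsub>PP\<^esub>" for k l u
  using that z[of l] by (simp add: add.commute[of k] funpow_add del: funpow.simps)
 have G: "asubgroup G PP"
 proof (rule PQ.T.add_subgroupI)
  show "\<zero>\<^bsub>PP\<^esub> \<in> G" using z[of 0] by (auto simp: G_def intro!: exI[of _ 0])
  fix x y assume "x \<in> G" "y \<in> G"
  then obtain k l where k: "(?N ^^ k) x = \<zero>\<^bsub>PP\<^esub>" "(?N ^^ l) y = \<zero>\<^bsub>PP\<^esub>" "x \<in> carrier PP" "y \<in> carrier PP"
   by (auto simp: G_def)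
  \<comment> \<open>Different elements need different exponents; k + l works for both, since once an
    iterate is zero all later ones are.\<close>
  have e: "(?N ^^ (k + l)) x = \<zero>\<^bsub>PP\<^esub>" "(?N ^^ (k + l)) y = \<zero>\<^bsub>PP\<^esub>"
   using more[OF k(1), of l] more[OF k(2), of k] by (simp_all only: add.commute[of l k])
  have "(?N ^^ (k + l)) (x \<oplus>\<^sub>2 y) = \<zero>\<^bsub>PP\<^esub>"
   unfolding ahom_add[OF pow k(3,4)] e by simp
  with k(3,4) show "x \<oplus>\<^sub>2 y \<in> G" unfolding G_def by blast
 next
  fix x assume "x \<in> G"
  then obtain k where k: "(?N ^^ k) x = \<zero>\<^bsub>PP\<^esub>" "x \<in> carrier PP" by (auto simp: G_def)
  have "(?N ^^ k) (\<ominus>\<^bsub>PP\<^esub> x) = \<zero>\<^bsub>PP\<^esub>"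
   unfolding ahom_neg[OF PPg PPg pow k(2)] k(1) by simp
  with k(2) show "\<ominus>\<^bsub>PP\<^esub> x \<in> G" unfolding G_def by auto
 qed (auto simp: G_def)
 have step: "u \<in> G" if u: "u \<in> carrier PP" "?N u \<in> G" for u
 proof -
  obtain k where "(?N ^^ k) (?N u) = \<zero>\<^bsub>PP\<^esub>" using u by (auto simp: G_def)
  hence "(?N ^^ Suc k) u = \<zero>\<^bsub>PP\<^esub>" by (simp only: funpow_Suc_right comp_apply)
  thus ?thesis using u(1) unfolding G_def by blast
 qed
 \<comment> \<open>The induction variable is a strict upper bound for the degree of the right
   factor; at bound 0 that factor is zero.\<close>
 have tens: "tp x y \<in> G" if "x \<in> carrier P" "y \<in> grade P j" "j < int n" for x y n j
  using that
 proof (induction n arbitrary: x y j)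
  case 0
  hence "y = \<zero>\<^sub>P" using grade_negative by simp
  thus ?case using 0 PQ.T.subgroup_zero[OF G] by (simp add: PQ.tens_zero_right)
 next
  case (Suc n)
  have y: "y \<in> carrier P" using Suc.prems P.grade_closed by simp
  have inner: "HP.half t x u \<in> G" if "x \<in> carrier P" "u \<in> grade AP (j - 1)" for x u
  proof (rule AP.grade_tensor_image[OF HP.half_ahom[OF t_hom that(1)] PPg G _ that(2)])
   fix a y' k l assume a: "a \<in> grade R k" "y' \<in> grade P l" "k + l = j - 1"
   have ac: "a \<in> carrier A" using a(1) by (simp split: if_splits)
   have y': "y' \<in> carrier P" using P.grade_closed[OF a(2)] .
   show "HP.half t x (ta a y') \<in> G"
   proof (cases "k = 0")
    case True
    thus ?thesis
     using Suc.IH[of "t (x \<triangleleft>\<^sub>P a)" y' l] a Suc.prems(3) that(1) ac y'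
     by (simp add: HP.half_tens[OF t_hom] P.right_closed)
   next
    case False
    hence "ta a y' = \<zero>\<^bsub>AP\<^esub>" using a AP.tens_zero_left y' by simp
    thus ?thesis
     using PQ.T.subgroup_zero[OF G] ahom_zero[OF AP.ag_tensor PPg HP.half_ahom[OF t_hom that(1)]] by simp
   qed
  qed
  have hom: "?N (tp x y) \<in> G" if x: "x \<in> grade P i" for x i
  proof -
   have "?N (tp x y) = sgn_elt PP i (HP.half t x (\<iota> (d y)))"
    using x y P.grade_closed[OF x] by (simp add: dR_tens ahom_sgn[OF PPg PPg op_ahom(5)] tL_tens)
   moreover have "HP.half t x (\<iota> (d y)) \<in> G"
    by (rule inner[OF P.grade_closed[OF x] iota_grade[OF deg_hom_grade[OF d_hom Suc.prems(2)]]]) simp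
   ultimately show ?thesis by (simp add: PQ.T.subgroup_sgn[OF G])
  qed
  have "(%x. ?N (tp x y)) \<in> ahom P PP" by (rule ahom_comp[OF PQ.tens_left_ahom[OF y] h])
  from P.subgroup_vimage[OF this PPg G] have sub: "asubgroup {x \<in> carrier P. ?N (tp x y) \<in> G} P" .
  have "(\<Oplus>\<^bsub>P\<^esub>i\<in>support P x. component P x i) \<in> {x \<in> carrier P. ?N (tp x y) \<in> G}"
   by (rule P.subgroup_finsum[OF sub]) (use hom P.component_grade P.component_closed Suc.prems(1) in auto)
  from this[unfolded P.sum_support[OF Suc.prems(1)]] have "?N (tp x y) \<in> G" by blast
  thus ?case by (rule step[OF PQ.tens_closed[OF Suc.prems(1) y]])
 qed
 have "{tp x y | x y. x \<in> carrier P & y \<in> carrier P} <= G"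
 proof clarify
  fix x y assume x: "x \<in> carrier P" and y: "y \<in> carrier P"
  from P.subgroup_vimage[OF PQ.tens_right_ahom[OF x] PPg G]
  have sub: "asubgroup {y \<in> carrier P. tp x y \<in> G} P" .
  \<comment> \<open>The bound \<open>nat (j + 1)\<close> exceeds j for negative j as well, where it
    equals 0.\<close>
  have "tp x (component P y j) \<in> G" for j
   by (rule tens[OF x P.component_grade[OF y], of j "nat (j + 1)"]) simp
  hence "(\<Oplus>\<^bsub>P\<^esub>i\<in>support P y. component P y i) \<in> {y \<in> carrier P. tp x y \<in> G}"
   by (intro P.subgroup_finsum[OF sub]) (use P.component_closed y in auto)
  from this[unfolded P.sum_support[OF y]] show "tp x y \<in> G" by blast
 qed
 from PQ.T.generate_subset[OF G this] u show ?thesis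
  unfolding PQ.tensor_carrier_generate[symmetric] by (auto simp: G_def)
qed

sublocale LN: locally_nilpotent PP "%u. shift_right u"
 by unfold_locales (auto intro: deg_hom_ahom[OF shift_hom] shift_right_nilpotent)

abbreviation "S == LN.inverse_map"

lemma S_map_eq: "S_map K A P \<iota> t = S"
 by (simp only: S_map_def LN.inverse_map_def tL_def[symmetric] dR_def[symmetric])

lemma S_hom: "deg_hom A PP PP 0 S"
proof (rule deg_homI[OF LN.inverse_map_ahom])
 fix a u assume a: "a \<in> carrier A" "u \<in> carrier PP"
 note c = LN.inverse_map_closed[OF a(2)]
 show "S (a \<odot>\<^bsub>PP\<^esub> u) = a \<odot>\<^bsub>PP\<^esub> S u"
  by (rule LN.inverse_map_eqI)
    (use a c in \<open>simp_all add: PQ.T.left_closed deg_hom_smult[OF shift_hom] PQ.T.left_distrib[symmetric] LN.inverse_map_right\<close>)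
 show "S (u \<triangleleft>\<^bsub>PP\<^esub> a) = S u \<triangleleft>\<^bsub>PP\<^esub> a"
  by (rule LN.inverse_map_eqI)
    (use a c in \<open>simp_all add: PQ.T.right_closed deg_hom_ract[OF shift_hom] PQ.T.right_distrib[symmetric] LN.inverse_map_right\<close>)
next
 fix n u assume "u \<in> grade PP n"
 thus "S u \<in> grade PP (n + 0)"
  using LN.inverse_map_subgroup[OF grPP _ \<open>u \<in> grade PP n\<close>] deg_hom_grade[OF shift_hom] by simp
qed

lemmas S_closed [simp] = LN.inverse_map_closed
lemmas S_ahom = LN.inverse_map_ahom

definition "Delta y = S (etaL y)"
definition "f y = muR (Delta y)"
definition "phi u = muR (S (tL u))"

lemma Delta_hom: "deg_hom A P PP 0 Delta"
 unfolding Delta_def[abs_def] by (rule deg_hom_comp[OF etaL_hom S_hom]) simp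

lemma f_hom: "deg_hom A P P 0 f"
 unfolding f_def[abs_def] by (rule deg_hom_comp[OF Delta_hom muR_hom]) simp

lemma phi_hom: "deg_hom A PP P 1 phi"
 unfolding phi_def[abs_def] by (rule deg_hom_comp[OF deg_hom_comp[OF tL_hom S_hom] muR_hom]) simp_all

lemmas op2_closed [simp] = deg_hom_closed[OF Delta_hom] deg_hom_closed[OF f_hom] deg_hom_closed[OF phi_hom]
lemmas op2_ahom = deg_hom_ahom[OF Delta_hom] deg_hom_ahom[OF f_hom] deg_hom_ahom[OF phi_hom]

lemma muL_S: assumes u: "u \<in> carrier PP" shows "muL (S u) = muL u"
proof -
 have "muL u = muL (S u \<oplus>\<^sub>2 shift_right (S u))" by (simp add: LN.inverse_map_right u)
 also have "... = muL (S u)" using u by (simp add: op_add muL_tL)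
 finally show ?thesis ..
qed

text \<open>The core of the perturbation argument: up to the term with \<open>etaL\<close>, the map
  1 + t_L d_R intertwines D with d_L. It follows from d_R^2 = 0, the anticommutation of d_L and d_R,
  and the unperturbed contraction applied to d_R u.\<close>

lemma one_plus_D:
 assumes u: "u \<in> carrier PP"
 shows "D u \<oplus>\<^sub>2 shift_right (D u) = dL (u \<oplus>\<^sub>2 shift_right u) \<oplus>\<^sub>2 etaL (muL (dR u))"
proof -
 let ?w = "dR u" and ?X = "tL (dR (dL u))"
 have w: "?w \<in> carrier PP" using u by simp
 have "dR (D u) = dR (dL u)"
  using u by (simp add: D_def op_add dR_dR)
 moreover have "tL (dL ?w) \<oplus>\<^sub>2 ?X = \<zero>\<^bsub>PP\<^esub>"
  using u dL_dR[OF u] by (simp add: op_add(5)[symmetric] ahom_zero[OF PPg PPg op_ahom(5)])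
 moreover have "?w = dL (tL ?w) \<oplus>\<^sub>2 tL (dL ?w) \<oplus>\<^sub>2 etaL (muL ?w)"
  using left_contract[OF w] by simp
 ultimately have "?w \<oplus>\<^sub>2 tL (dR (D u)) = (dL (tL ?w) \<oplus>\<^sub>2 tL (dL ?w) \<oplus>\<^sub>2 etaL (muL ?w)) \<oplus>\<^sub>2 ?X"
  by simp
 also have "... = (dL (tL ?w) \<oplus>\<^sub>2 etaL (muL ?w)) \<oplus>\<^sub>2 (tL (dL ?w) \<oplus>\<^sub>2 ?X)"
  using u by (simp add: PQ.T.a_ac)
 also have "... = dL (tL ?w) \<oplus>\<^sub>2 etaL (muL ?w)"
  using u \<open>tL (dL ?w) \<oplus>\<^sub>2 ?X = \<zero>\<^bsub>PP\<^esub>\<close> by simp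
 finally have "dR u \<oplus>\<^sub>2 tL (dR (D u)) = dL (tL ?w) \<oplus>\<^sub>2 etaL (muL ?w)" .
 hence "dL u \<oplus>\<^sub>2 (dR u \<oplus>\<^sub>2 tL (dR (D u))) = dL u \<oplus>\<^sub>2 (dL (tL ?w) \<oplus>\<^sub>2 etaL (muL ?w))"
  by simp
 thus ?thesis
  using u by (simp add: D_def[of u] op_add PQ.T.a_assoc)
qed

text \<open>After undoing \<open>S\<close>, d_L eta_L = 0 leaves only the correction term of the
  intertwining relation, and mu_L d_R = d mu_L identifies it with eta_L d.\<close>

lemma D_Delta:
 assumes y: "y \<in> carrier P" shows "D (Delta y) = Delta (d y)"
proof -
 have "Delta (d y) = D (Delta y)"
  unfolding Delta_def
 proof (rule LN.inverse_map_eqI)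
  show "D (S (etaL y)) \<oplus>\<^sub>2 shift_right (D (S (etaL y))) = etaL (d y)"
   using y by (simp add: one_plus_D LN.inverse_map_right dL_etaL muL_dR muL_S muL_etaL)
 qed (use y in simp)
 thus ?thesis ..
qed

text \<open>The same computation, in which the correction vanishes because mu_L S t_L = mu_L t_L =
  0.\<close>

lemma D_S_tL:
 assumes u: "u \<in> carrier PP" shows "D (S (tL u)) = S (dL (tL u))"
proof (rule sym, rule LN.inverse_map_eqI)
 show "D (S (tL u)) \<oplus>\<^sub>2 shift_right (D (S (tL u))) = dL (tL u)"
  using u by (simp add: one_plus_D LN.inverse_map_right muL_dR muL_S muL_tL d_zero ahom_zero[OF Pg PPg op_ahom(6)])
qed (use u in simp)

text \<open>\<open>S\<close> is applied to the unperturbed identity; replacing d_L by D adds t_L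
  d_R, which completes the right-hand side to the map inverted by \<open>S\<close>.\<close>

lemma PP_contract:
 assumes u: "u \<in> carrier PP"
 shows "D (S (tL u)) \<oplus>\<^sub>2 S (tL (D u)) \<oplus>\<^sub>2 Delta (muL u) = u"
proof -
 have "D (S (tL u)) \<oplus>\<^sub>2 S (tL (D u)) \<oplus>\<^sub>2 Delta (muL u) = S (dL (tL u) \<oplus>\<^sub>2 tL (D u) \<oplus>\<^sub>2 etaL (muL u))"
  using u by (simp add: D_S_tL Delta_def ahom_add[OF S_ahom])
 also have "dL (tL u) \<oplus>\<^sub>2 tL (D u) \<oplus>\<^sub>2 etaL (muL u) = (dL (tL u) \<oplus>\<^sub>2 tL (dL u) \<oplus>\<^sub>2 etaL (muL u)) \<oplus>\<^sub>2 tL (dR u)"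
  using u by (simp add: D_def op_add PQ.T.a_ac)
 finally show ?thesis using u by (simp add: left_contract LN.inverse_map_left)
qed

lemma muR_D: "u \<in> carrier PP ==> muR (D u) = d (muR u)"
 by (simp add: D_def op_add muR_dL muR_dR)

lemma muL_D: "u \<in> carrier PP ==> muL (D u) = d (muL u)"
 by (simp add: D_def op_add muL_dL muL_dR)

lemma phi_homotopy:
 assumes u: "u \<in> carrier PP"
 shows "d (phi u) \<oplus>\<^sub>P phi (D u) \<oplus>\<^sub>P f (muL u) = muR u"
proof -
 have "muR (D (S (tL u)) \<oplus>\<^sub>2 S (tL (D u)) \<oplus>\<^sub>2 Delta (muL u)) = muR u" by (simp only: PP_contract[OF u])
 thus ?thesis using u by (simp add: op_add muR_D phi_def f_def)
qed

lemma muL_Delta: "y \<in> carrier P ==> muL (Delta y) = y"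
 by (simp add: Delta_def muL_S muL_etaL)

lemma d_f: "y \<in> carrier P ==> d (f y) = f (d y)"
 by (simp add: f_def muR_D[symmetric] D_Delta)

lemma mu_f: "y \<in> carrier P ==> \<mu> (f y) = \<mu> y"
 by (simp add: f_def mu_muL[symmetric] muL_Delta)

definition "right_map g = tensor_map (carrier A) P P P 0 id g"

context
 fixes g assumes g: "deg_hom A P P 0 g"
begin

lemma right_map_tens: "[|x \<in> carrier P; y \<in> carrier P|] ==> right_map g (tp x y) = tp x (g y)"
 and right_map_hom: "deg_hom A PP PP 0 (right_map g)"
proof -
 note tm = tensor_map_hom[OF PQ.tensor_bimodule_axioms PQ.tensor_bimodule_axioms P.graded_bimodule_axioms
   ahom_id(2) _ deg_hom_ahom[OF g], where m = 0]
 show t: "right_map g (tp x y) = tp x (g y)" if "x \<in> carrier P" "y \<in> carrier P" for x y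
  unfolding right_map_def by (subst tm(2)) (simp_all add: that P.twist_0 deg_hom_smult[OF g])
 have h: "right_map g \<in> ahom PP PP" unfolding right_map_def by (rule tm(1)) (simp_all add: deg_hom_smult[OF g])
 show "deg_hom A PP PP 0 (right_map g)"
  by (rule PP_deg_homI[OF h PQ.bimodule_tensor grPP])
    (auto simp: t P.grade_closed PP_simps deg_hom_closed[OF g] deg_hom_ract[OF g]
     simp del: P.r_zero intro!: PQ.tens_grade deg_hom_grade[OF g])
qed

lemma D_right_map:
 assumes gd: "!!y. y \<in> carrier P ==> d (g y) = g (d y)" and u: "u \<in> carrier PP"
 shows "D (right_map g u) = right_map g (D u)"
proof (rule PP_eq[OF ahom_comp[OF deg_hom_ahom[OF right_map_hom] D_ahom] ahom_comp[OF D_ahom deg_hom_ahom[OF right_map_hom]] PPg _ u])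
 fix x y i j assume xy: "x \<in> grade P i" "y \<in> grade P j"
 thus "D (right_map g (tp x y)) = right_map g (D (tp x y))"
  by (simp add: D_def right_map_tens dL_tens dR_tens P.grade_closed gd deg_hom_closed[OF g]
   deg_hom_add[OF right_map_hom] ahom_sgn[OF PPg PPg deg_hom_ahom[OF right_map_hom]])
qed

lemma muL_right_map: "u \<in> carrier PP ==> muL (right_map g u) = g (muL u)"
 by (rule PP_eq[OF ahom_comp[OF deg_hom_ahom[OF right_map_hom] op_ahom(3)] ahom_comp[OF op_ahom(3) deg_hom_ahom[OF g]] Pg])
   (simp_all add: right_map_tens P.grade_closed muL_tens deg_hom_closed[OF g] deg_hom_smult[OF g])

lemma muR_right_map:
 assumes gm: "!!y. y \<in> carrier P ==> \<mu> (g y) = \<mu> y" and u: "u \<in> carrier PP"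
 shows "muR (right_map g u) = muR u"
 by (rule PP_eq[OF ahom_comp[OF deg_hom_ahom[OF right_map_hom] op_ahom(4)] op_ahom(4) Pg _ u])
   (simp_all add: right_map_tens P.grade_closed muR_tens deg_hom_closed[OF g] gm)

end

text \<open>Inserting f^2 on the right changes mu_L Delta from the identity to f^2 but leaves mu_R
  Delta = f alone, because \<open>\<mu>\<close> is invariant under f. Hence mu_L Delta' = f (mu_R
  Delta'), which is why the square is the right power.\<close>

definition "Delta' y = right_map (f \<circ> f) (Delta y)"

lemma ff_hom: "deg_hom A P P 0 (f \<circ> f)"
 unfolding comp_def by (rule deg_hom_comp[OF f_hom f_hom]) simp

lemma Delta'_hom: "deg_hom A P PP 0 Delta'"
 unfolding Delta'_def[abs_def] by (rule deg_hom_comp[OF Delta_hom right_map_hom[OF ff_hom]]) simp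

lemmas Delta'_closed [simp] = deg_hom_closed[OF Delta'_hom]

lemma D_Delta': "y \<in> carrier P ==> D (Delta' y) = Delta' (d y)"
 by (simp add: Delta'_def D_right_map[OF ff_hom] D_Delta d_f)

lemma muL_Delta': "y \<in> carrier P ==> muL (Delta' y) = f (f y)"
 by (simp add: Delta'_def muL_right_map[OF ff_hom] muL_Delta)

lemma muR_Delta': "y \<in> carrier P ==> muR (Delta' y) = f y"
 by (simp add: Delta'_def muR_right_map[OF ff_hom] mu_f f_def[symmetric])

end

section \<open>Passing to the trace: the given map and its behaviour under the differential\<close>

context contraction
begin

sublocale TP: trace_group K A P by unfold_locales

lemmas TPg = TP.ag_Tr

text \<open>Starts on P (x) P itself instead of its trace, where an element can be taken apart into
  homogeneous tensors.\<close>

definition "hat g u = Tr_map A P g (swap_tensor u)"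

lemmas trace_map_hom = Tr_map_hom[OF TP.trace_group_axioms TP.trace_group_axioms]
lemmas trace_map_tr = Tr_map_tr[OF TP.trace_group_axioms TP.trace_group_axioms]
lemmas PP_trace_map_hom = Tr_map_hom[OF TPQ.trace_group_axioms TP.trace_group_axioms]
lemmas PP_trace_map_tr = Tr_map_tr[OF TPQ.trace_group_axioms TP.trace_group_axioms]

lemma hat_ahom: "deg_hom A PP P k g ==> hat g \<in> ahom PP (Tr A P)"
 unfolding hat_def[abs_def]
 by (rule ahom_comp[OF swap_tensor_ahom PP_trace_map_hom[OF deg_hom_bimod]])

lemma hat_tens:
 assumes g: "deg_hom A PP P k g" and xy: "x \<in> grade P i" "y \<in> grade P j"
 shows "hat g (tp x y) = TP.tr (g (tp (sgn_elt P (j * i) y) x))"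
 using xy[THEN P.grade_closed] unfolding hat_def
 by (simp add: swap_tensor_tens[OF xy] PP_trace_map_tr[OF deg_hom_bimod[OF g]])

definition "dT = Tr_diff A P"

lemma dT_tr: "x \<in> carrier P ==> dT (TP.tr x) = TP.tr (d x)"
 unfolding dT_def Tr_diff_def by (rule trace_map_tr[OF deg_hom_bimod[OF d_hom]])

lemma dT_ahom: "dT \<in> ahom (Tr A P) (Tr A P)"
 unfolding dT_def Tr_diff_def by (rule trace_map_hom[OF deg_hom_bimod[OF d_hom]])

lemma Tr_cases: assumes "u \<in> carrier (Tr A P)" obtains x where "x \<in> carrier P" "u = TP.tr x"
 using assms unfolding TP.Tr_carrier by auto

text \<open>The swap is a chain map for the total differential: exchanging the factors exchanges d_L
  and d_R, and the Koszul signs match.\<close>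

lemma hat_D_tens:
 assumes g: "deg_hom A PP P k g" and xy: "x \<in> grade P i" "y \<in> grade P j"
 shows "hat g (D (tp x y)) = TP.tr (g (D (tp (sgn_elt P (j * i) y) x)))"
proof -
 let ?k = "%u. TP.tr (g u)"
 have k: "?k \<in> ahom PP (Tr A P)" by (rule ahom_comp[OF deg_hom_ahom[OF g] TP.tr_ahom]) simp
 note c = xy[THEN P.grade_closed]
 have dx: "d x \<in> grade P (i - 1)" "d y \<in> grade P (j - 1)" by (rule deg_hom_grade[OF d_hom xy(1)], simp, rule deg_hom_grade[OF d_hom xy(2)], simp)
 note ks = ahom_sgn[OF PPg TPg k]
 note hs = ahom_sgn[OF PPg TPg hat_ahom[OF g]]
 \<comment> \<open>Only parities matter: i + (j - 1) i is congruent to j i, and j i + j to j (i -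
   1).\<close>
 have s: "sgn_elt (Tr A P) i (sgn_elt (Tr A P) ((j - 1) * i) z) = sgn_elt (Tr A P) (j * i) z"
  "sgn_elt (Tr A P) (j * i) (sgn_elt (Tr A P) j z) = sgn_elt (Tr A P) (j * (i - 1)) z"
  if "z \<in> carrier (Tr A P)" for z
  using that by (auto simp: sgn_elt_def)
 have kc: "?k u \<in> carrier (Tr A P)" if "u \<in> carrier PP" for u using ahom_closed[OF k that] .
 have "hat g (D (tp x y)) = hat g (tp (d x) y) \<oplus>\<^sub>T sgn_elt (Tr A P) i (hat g (tp x (d y)))"
  using c by (simp add: D_def dL_tens dR_tens[OF xy(1)] ahom_add[OF hat_ahom[OF g]] hs)
 also have "... = sgn_elt (Tr A P) (j * (i - 1)) (?k (tp y (d x))) \<oplus>\<^sub>T sgn_elt (Tr A P) (j * i) (?k (tp (d y) x))"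
  using c kc by (simp add: hat_tens[OF g dx(1) xy(2)] hat_tens[OF g xy(1) dx(2)] PQ.tens_sgn_left ks s)
 finally have l: "hat g (D (tp x y)) = ..." .
 have "?k (D (tp (sgn_elt P (j * i) y) x)) = sgn_elt (Tr A P) (j * i) (?k (D (tp y x)))"
  using c by (simp add: PQ.tens_sgn_left ahom_sgn[OF PPg PPg D_ahom] ks)
 also have "?k (D (tp y x)) = ?k (tp (d y) x) \<oplus>\<^sub>T sgn_elt (Tr A P) j (?k (tp y (d x)))"
  using c by (simp add: D_def dL_tens dR_tens[OF xy(2)] ahom_add[OF k] ks)
 finally show ?thesis
  unfolding l using c kc by (simp add: TP.Tr.sgn_elt_add s TP.Tr.a_comm)
qed

text \<open>Under the swap mu_L becomes mu_R. For x of nonzero degree both sides vanish; in degree 0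
  there is no sign and cyclicity of the trace moves \<open>\<mu> x\<close> to the other
  side.\<close>

lemma tr_muL_tens:
 assumes xy: "x \<in> grade P i" "y \<in> grade P j"
 shows "TP.tr (muL (tp x y)) = TP.tr (muR (tp (sgn_elt P (j * i) y) x))"
proof (cases "i = 0")
 case True
 thus ?thesis using xy[THEN P.grade_closed] by (simp add: muL_tens muR_tens TP.tr_cyclic)
next
 case False
 thus ?thesis using xy[THEN P.grade_closed] mu_degree[OF False xy(1)] by (simp add: muL_tens muR_tens)
qed

lemma tr_muR_tens:
 assumes g: "deg_hom A P P k g" and xy: "x \<in> grade P i" "y \<in> grade P j"
 shows "TP.tr (g (muR (tp x y))) = TP.tr (g (muL (tp (sgn_elt P (j * i) y) x)))"
proof (cases "j = 0")
 case True
 thus ?thesis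
  using xy[THEN P.grade_closed]
  by (simp add: muL_tens muR_tens deg_hom_ract[OF g] deg_hom_smult[OF g] TP.tr_cyclic deg_hom_closed[OF g])
next
 case False
 have "\<mu> (sgn_elt P (j * i) y) = \<zero>\<^sub>A"
  using mu_degree[OF False] P.subgroup_sgn[OF P.grade_asubgroup xy(2)] by blast
 thus ?thesis using xy[THEN P.grade_closed] mu_degree[OF False xy(2)] by (simp add: muL_tens muR_tens)
qed

text \<open>The homotopy relation of \<open>phi\<close> at the swapped tensor. Since the swap
  exchanges mu_L and mu_R, the map f now stands in front of mu_R.\<close>

lemma hat_phi_homotopy:
 assumes u: "u \<in> carrier PP"
 shows "dT (hat phi u) \<oplus>\<^sub>T hat phi (D u) \<oplus>\<^sub>T TP.tr (f (muR u)) = TP.tr (muL u)"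
proof (rule PP_eq[OF _ ahom_comp[OF muL_ahom TP.tr_ahom[OF A.one_closed]] TPg _ u])
 show "(%u. dT (hat phi u) \<oplus>\<^sub>T hat phi (D u) \<oplus>\<^sub>T TP.tr (f (muR u))) \<in> ahom PP (Tr A P)"
  by (intro ahom_plus[OF PPg TPg] ahom_comp[OF hat_ahom[OF phi_hom] dT_ahom] ahom_comp[OF D_ahom hat_ahom[OF phi_hom]]
   ahom_comp[OF ahom_comp[OF op_ahom(4) op2_ahom(2)] TP.tr_ahom]) simp
 fix x y i j assume xy: "x \<in> grade P i" "y \<in> grade P j"
 let ?v = "tp (sgn_elt P (j * i) y) x"
 have v: "?v \<in> carrier PP" using xy[THEN P.grade_closed] by simp
 have "TP.tr (muR ?v) = TP.tr (d (phi ?v) \<oplus>\<^sub>P phi (D ?v) \<oplus>\<^sub>P f (muL ?v))"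
  using phi_homotopy[OF v] by simp
 also have "... = dT (TP.tr (phi ?v)) \<oplus>\<^sub>T TP.tr (phi (D ?v)) \<oplus>\<^sub>T TP.tr (f (muL ?v))"
  using v by (simp add: TP.tr_add dT_tr)
 finally show "dT (hat phi (tp x y)) \<oplus>\<^sub>T hat phi (D (tp x y)) \<oplus>\<^sub>T TP.tr (f (muR (tp x y))) = TP.tr (muL (tp x y))"
  by (simp add: hat_tens[OF phi_hom xy] hat_D_tens[OF phi_hom xy] tr_muR_tens[OF f_hom xy] tr_muL_tens[OF xy])
qed

abbreviation "connes == trace_connes K A P \<mu> t \<eta> \<iota>"

lemma connes_eq: "connes = (%u. \<ominus>\<^sub>T Tr_map A P phi (tr_swap A P P (Tr_map A PP Delta' u)))"
proof -
 have "(muR \<circ> S \<circ> etaL) = f" by (rule ext) (simp add: f_def Delta_def)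
 moreover have "(muR \<circ> S \<circ> tL) = phi" by (rule ext) (simp add: phi_def)
 moreover have "right_map (f \<circ> f) \<circ> S \<circ> etaL = Delta'" by (rule ext) (simp add: Delta'_def Delta_def)
 ultimately show ?thesis
  by (simp only: trace_connes_def Let_def S_map_eq tL_def[symmetric] etaL_def[symmetric] muR_def[symmetric]
   right_map_def[symmetric]) (simp only: comp_apply)
qed

lemma connes_ahom: "connes \<in> ahom (Tr A P) (Tr A P)"
 unfolding connes_eq
 by (rule ahom_uminus[OF TPg TPg ahom_comp[OF ahom_comp[OF Tr_map_hom[OF TP.trace_group_axioms TPQ.trace_group_axioms
  deg_hom_bimod[OF Delta'_hom]] tr_swap_ahom] PP_trace_map_hom[OF deg_hom_bimod[OF phi_hom]]]])

lemma connes_tr: "x \<in> carrier P ==> connes (TP.tr x) = \<ominus>\<^sub>T hat phi (Delta' x)"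
 unfolding connes_eq hat_def
 by (simp add: Tr_map_tr[OF TP.trace_group_axioms TPQ.trace_group_axioms deg_hom_bimod[OF Delta'_hom]] tr_swap_tr)

lemma connes_closed: "u \<in> carrier (Tr A P) ==> connes u \<in> carrier (Tr A P)"
 by (rule ahom_closed[OF connes_ahom])

lemmas trace_grade = Tr_grade_eq[OF assoc_algebra_axioms P.graded_bimodule_axioms]

lemma trace_grade_asubgroup: "asubgroup (Tr_grade A P n) (Tr A P)"
 unfolding trace_grade by (rule TP.tr_image_subgroup[OF P.grade_asubgroup])

lemma hat_grade:
 assumes g: "deg_hom A PP P k g" and u: "u \<in> grade PP n"
 shows "hat g u \<in> Tr_grade A P (n + k)"
proof (rule PQ.grade_tensor_image[OF hat_ahom[OF g] TPg trace_grade_asubgroup _ u])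
 fix x y i j assume xy: "x \<in> grade P i" "y \<in> grade P j" "i + j = n"
 have "tp (sgn_elt P (j * i) y) x \<in> grade PP n"
  by (rule PQ.tens_grade[OF P.subgroup_sgn[OF P.grade_asubgroup xy(2)] xy(1)]) (use xy(3) in simp)
 hence "g (tp (sgn_elt P (j * i) y) x) \<in> grade P (n + k)" by (rule deg_hom_grade[OF g]) simp
 thus "hat g (tp x y) \<in> Tr_grade A P (n + k)" by (simp add: hat_tens[OF g xy(1,2)] trace_grade)
qed

lemma connes_grade: "u \<in> Tr_grade A P n ==> connes u \<in> Tr_grade A P (n + 1)"
 using hat_grade[OF phi_hom deg_hom_grade[OF Delta'_hom]] TP.Tr.subgroup_minus[OF trace_grade_asubgroup]
 by (auto simp: trace_grade[of n] connes_tr P.grade_closed)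

text \<open>At Delta' x the two terms without \<open>phi\<close> in the previous relation are both
  the trace of f (f x). Anticommuting with the differential is what a map into the shifted complex
  needs, as the shift carries the negated differential.\<close>

lemma connes_anticommutes:
 assumes u: "u \<in> carrier (Tr A P)"
 shows "dT (connes u) = \<ominus>\<^sub>T connes (dT u)"
proof -
 obtain x where x: "x \<in> carrier P" "u = TP.tr x" using Tr_cases[OF u] .
 note h = ahom_closed[OF hat_ahom[OF phi_hom]] and t = ahom_closed[OF dT_ahom]
 have "dT (hat phi (Delta' x)) \<oplus>\<^sub>T hat phi (Delta' (d x)) \<oplus>\<^sub>T TP.tr (f (f x)) = TP.tr (f (f x))"
  using hat_phi_homotopy[of "Delta' x"] x by (simp add: D_Delta' muL_Delta' muR_Delta')
 hence "dT (hat phi (Delta' x)) \<oplus>\<^sub>T hat phi (Delta' (d x)) = \<zero>\<^sub>T"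
  using x h t TP.tr_closed by (simp add: TP.Tr.add.r_cancel_one)
 hence "dT (hat phi (Delta' x)) = \<ominus>\<^sub>T hat phi (Delta' (d x))"
  using TP.Tr.minus_equality[of "dT (hat phi (Delta' x))" "hat phi (Delta' (d x))"] x h t by simp
 thus ?thesis
  using x h by (simp add: connes_tr dT_tr ahom_neg[OF TPg TPg dT_ahom])
qed

lemma Tr_shift: "Tr A (shift 1 P) = Tr A P" "Tr_grade A (shift 1 P) n = Tr_grade A P (1 + n)"
 by (simp_all add: Tr_def Tr_grade_def tr_gen_def tr_rels_def shift_def tensor_rels_def)

lemma Tr_diff_shift:
 assumes "u \<in> carrier (Tr A P)" shows "Tr_diff A (shift 1 P) u = \<ominus>\<^sub>T dT u"
proof -
 obtain x where x: "x \<in> carrier P" "u = TP.tr x" using Tr_cases[OF assms] .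
 have h: "deg_hom A P P (- 1) (%x. \<ominus>\<^sub>P d x)"
  by (rule deg_hom_uminus[OF d_hom P.ag P.bimodule_axioms P.grade_asubgroup])
 have s: "sgn_elt P 1 = (%x. \<ominus>\<^sub>P x)" by (rule ext) (simp add: sgn_elt_def)
 have "Tr_diff A (shift 1 P) = Tr_map A P (%x. \<ominus>\<^sub>P d x)"
  unfolding Tr_diff_def Tr_map_def Tr_shift
  by (simp add: tr_gen_def tr_rels_def shift_def tensor_rels_def s)
 thus ?thesis
  using x trace_map_tr[OF deg_hom_bimod[OF h]] by (simp add: TP.tr_minus dT_tr)
qed

lemma trace_grade_closed: "u \<in> Tr_grade A P n ==> u \<in> carrier (Tr A P)"
 by (rule TP.Tr.asubgroup_carrier[OF trace_grade_asubgroup])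

lemma boundaries_shift: "boundaries (Tr_grade A (shift 1 P)) (Tr_diff A (shift 1 P)) n = boundaries (Tr_grade A P) dT (n + 1)"
proof -
 have "Tr_diff A (shift 1 P) ` Tr_grade A P (2 + n) = dT ` Tr_grade A P (2 + n)"
 proof safe
  fix u assume u: "u \<in> Tr_grade A P (2 + n)"
  hence m: "\<ominus>\<^sub>T u \<in> Tr_grade A P (2 + n)" by (rule TP.Tr.subgroup_minus[OF trace_grade_asubgroup])
  have e: "dT (\<ominus>\<^sub>T u) = \<ominus>\<^sub>T dT u" by (rule ahom_neg[OF TPg TPg dT_ahom trace_grade_closed[OF u]])
  show "Tr_diff A (shift 1 P) u \<in> dT ` Tr_grade A P (2 + n)"
   using e m by (simp add: Tr_diff_shift trace_grade_closed[OF u] image_iff) metis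
  show "dT u \<in> Tr_diff A (shift 1 P) ` Tr_grade A P (2 + n)"
   using e Tr_diff_shift[OF trace_grade_closed[OF m]] ahom_closed[OF dT_ahom trace_grade_closed[OF u]] m
   by (metis TP.Tr.minus_minus image_iff)
 qed
 thus ?thesis by (simp add: boundaries_def Tr_shift algebra_simps)
qed

lemma connes_induces:
 "induces_on_homology (Tr A P) (Tr_grade A P) (Tr_diff A P)
   (Tr A (shift 1 P)) (Tr_grade A (shift 1 P)) (Tr_diff A (shift 1 P)) connes"
 unfolding induces_on_homology_def boundaries_shift
proof (intro conjI allI)
 show "connes \<in> hom (add_monoid (Tr A P)) (add_monoid (Tr A (shift 1 P)))"
  using connes_ahom unfolding Tr_shift ahom_def .
 fix n
 show "connes ` Tr_grade A P n <= Tr_grade A (shift 1 P) n"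
  using connes_grade[of _ n] by (auto simp: Tr_shift add.commute)
 show "connes ` cycles (Tr A P) (Tr_grade A P) (Tr_diff A P) n
   <= cycles (Tr A (shift 1 P)) (Tr_grade A (shift 1 P)) (Tr_diff A (shift 1 P)) n"
  using connes_grade[of _ n] connes_anticommutes trace_grade_closed[of _ n] connes_closed
   ahom_zero[OF TPg TPg connes_ahom]
  by (auto simp: cycles_def Tr_shift Tr_diff_shift add.commute dT_def[symmetric])
 show "connes ` boundaries (Tr_grade A P) (Tr_diff A P) n <= boundaries (Tr_grade A P) dT (n + 1)"
 proof
  fix v assume "v \<in> connes ` boundaries (Tr_grade A P) (Tr_diff A P) n"
  then obtain u where u: "u \<in> Tr_grade A P (n + 1)" "v = connes (dT u)"
   by (auto simp: boundaries_def dT_def[symmetric])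
  note uc = trace_grade_closed[OF u(1)]
  have "v = dT (\<ominus>\<^sub>T connes u)"
   using u(2) connes_anticommutes[OF uc] connes_closed[OF uc] connes_closed[OF ahom_closed[OF dT_ahom uc]]
   by (simp add: ahom_neg[OF TPg TPg dT_ahom])
  moreover have "\<ominus>\<^sub>T connes u \<in> Tr_grade A P (n + 1 + 1)"
   by (rule TP.Tr.subgroup_minus[OF trace_grade_asubgroup connes_grade[OF u(1)]])
  ultimately show "v \<in> boundaries (Tr_grade A P) dT (n + 1)" by (auto simp: boundaries_def)
 qed
qed

end

section \<open>Faces of words, of marked words and of cyclic words, in free abelian groups\<close>

context assoc_algebra
begin

definition face :: "nat => 'c list => 'c list" where
 "face k w = take k w @ [w ! k \<otimes>\<^sub>A w ! Suc k] @ drop (k + 2) w"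

lemma length_face: "Suc k < length w ==> length (face k w) = length w - 1"
 by (simp add: face_def)

lemma nth_face:
 "[|Suc k < length w; i < length w - 1|] ==>
  face k w ! i = (if i < k then w ! i else if i = k then w ! k \<otimes>\<^sub>A w ! Suc k else w ! Suc i)"
 by (auto simp: face_def nth_append min_def Suc_diff_Suc)

lemma nth_carrier: "[|w \<in> A_lists; i < length w|] ==> w ! i \<in> carrier A"
 by (auto simp: in_lists_conv_set)

lemma in_lists_nth: "(!!i. i < length w ==> w ! i \<in> carrier A) ==> w \<in> A_lists"
 by (auto simp: in_lists_conv_set in_set_conv_nth)

lemma face_lists: "[|w \<in> A_lists; Suc k < length w|] ==> face k w \<in> A_lists"
 by (rule in_lists_nth) (auto simp: length_face nth_face nth_carrier)

text \<open>The simplicial identity. Associativity is used exactly when k = j + 1.\<close>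

lemma face_face:
 assumes w: "w \<in> A_lists" and jk: "j < k" "Suc k < length w"
 shows "face j (face k w) = face (k - 1) (face j w)"
proof (rule nth_equalityI)
 show "length (face j (face k w)) = length (face (k - 1) (face j w))" using jk by (simp add: length_face)
 fix i assume "i < length (face j (face k w))"
 hence i: "i < length w - 2" using jk by (simp add: length_face)
 show "face j (face k w) ! i = face (k - 1) (face j w) ! i"
  using i jk nth_carrier[OF w] by (auto simp: nth_face length_face A.m_assoc)
qed

text \<open>The pairs with j < k are matched with those with k <= j by (k, j) -> (j, k - 1). Stated
  abstractly because the faces of plain words and of marked words cancel by the same
  pairing.\<close>

lemma alternating_double_sum:
 fixes T :: "nat => nat => 'g::ab_group_add"
 assumes "!!j k. [|j < k; k <= n|] ==> T k j = - T j (k - 1)"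
 shows "(\<Sum>k<Suc n. \<Sum>j<n. T k j) = 0"
proof -
 have "(\<Sum>k<Suc n. \<Sum>j<n. T k j) = (\<Sum>(k, j)\<in>{..<Suc n} \<times> {..<n}. T k j)"
  by (simp only: sum.cartesian_product)
 also have "... = (\<Sum>(k, j)\<in>{(k, j). k <= n & j < k}. T k j) + (\<Sum>(k, j)\<in>{(k, j). j < n & k <= j}. T k j)"
 proof (subst sum.union_disjoint[symmetric])
  show "finite {(k, j). k <= n & j < k}" by (rule finite_subset[of _ "{..n} \<times> {..n}"]) auto
  show "finite {(k, j). j < n & k <= j}" by (rule finite_subset[of _ "{..n} \<times> {..n}"]) auto
 qed (auto intro!: sum.cong)
 also have "(\<Sum>(k, j)\<in>{(k, j). j < n & k <= j}. T k j) = (\<Sum>(k, j)\<in>{(k, j). k <= n & j < k}. T j (k - 1))"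
  by (rule sum.reindex_bij_witness[of _ "%(k, j). (j, k - 1)" "%(k, j). (Suc j, k)"]) auto
 also have "... = - (\<Sum>(k, j)\<in>{(k, j). k <= n & j < k}. T k j)"
  unfolding sum_negf[symmetric] by (rule sum.cong) (auto simp: assms)
 finally show ?thesis by simp
qed

text \<open>The bar differential before any relation is imposed. It also contains the one-letter
  face of a two-letter word, which has no counterpart in the bar complex and is sent to zero on
  evaluation.\<close>

definition face_sum :: "'c list => 'c list \<Rightarrow>\<^sub>0 int" where
 "face_sum w = (\<Sum>k<length w - 1. frag_cmul ((- 1) ^ k) (frag_of (face k w)))"

text \<open>
 The pair \<open>(m, w)\<close> encodes the tensor of the two bar words \<open>take m w @ [1]\<close> and \<open>drop m w\<close> over \<open>A\<close>.
 The formal boundary below includes two kinds of degenerate marks, \<open>m = 0\<close> and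
 \<open>m = length w - 1\<close>, which form a subcomplex and on which all functions considered later vanish.
\<close>

definition mark_face :: "nat => nat => nat" where
 "mark_face m k = (if k < m then m - 1 else m)"

text \<open>Behind the mark, the Koszul sign (-1)^(m-1) of the first factor times the sign
  (-1)^(k-m) of the face within the second factor is -(-1)^k.\<close>

definition mark_sign :: "nat => nat => int" where
 "mark_sign m k = (if k < m then (- 1) ^ k else - ((- 1) ^ k))"

definition marked_sum :: "nat \<times> 'c list => nat \<times> 'c list \<Rightarrow>\<^sub>0 int" where
 "marked_sum x = (\<Sum>k<length (snd x) - 1.
   frag_cmul (mark_sign (fst x) k) (frag_of (mark_face (fst x) k, face k (snd x))))"

lemma frag_extend_signed_sum:
 "finite I ==> frag_extend f (\<Sum>i\<in>I. frag_cmul (c i) (frag_of (x i))) = (\<Sum>i\<in>I. frag_cmul (c i) (f (x i)))"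
 by (simp add: frag_extend_sum frag_extend_cmul o_def)

lemma face_sum_face_sum:
 assumes w: "w \<in> A_lists"
 shows "frag_extend face_sum (face_sum w) = 0"
proof (cases "length w <= 1")
 case True
 thus ?thesis by (simp add: face_sum_def)
next
 case False
 define n where "n = length w - 2"
 have n: "length w = n + 2" using False by (simp add: n_def)
 have "frag_extend face_sum (face_sum w) = (\<Sum>k<Suc n. frag_cmul ((- 1) ^ k) (face_sum (face k w)))"
  unfolding face_sum_def[of w] by (simp add: frag_extend_signed_sum n del: sum.lessThan_Suc)
 also have "... = (\<Sum>k<Suc n. \<Sum>j<n. frag_cmul ((- 1) ^ (k + j)) (frag_of (face j (face k w))))"
  by (rule sum.cong) (simp_all add: face_sum_def length_face n frag_cmul_sum o_def power_add)
 also have "... = 0"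
 proof (rule alternating_double_sum)
  fix j k assume jk: "j < k" "k <= n"
  hence "(- 1 :: int) ^ (k + j) = - ((- 1) ^ (j + (k - 1)))" by (cases k) (simp_all add: add.commute)
  thus "frag_cmul ((- 1) ^ (k + j)) (frag_of (face j (face k w))) =
    - frag_cmul ((- 1) ^ (j + (k - 1))) (frag_of (face (k - 1) (face j w)))"
   using jk by (simp add: face_face[OF w] n)
 qed
 finally show ?thesis .
qed

lemma mark_sign_swap:
 assumes "j < k"
 shows "mark_sign m k * mark_sign (mark_face m k) j = - (mark_sign m j * mark_sign (mark_face m j) (k - 1))"
  and "mark_face (mark_face m k) j = mark_face (mark_face m j) (k - 1)"
proof -
 have "(- 1 :: int) ^ k = - ((- 1) ^ (k - 1))" using assms by (cases k) auto
 thus "mark_sign m k * mark_sign (mark_face m k) j = - (mark_sign m j * mark_sign (mark_face m j) (k - 1))"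
  using assms by (auto simp: mark_sign_def mark_face_def)
 show "mark_face (mark_face m k) j = mark_face (mark_face m j) (k - 1)"
  using assms by (auto simp: mark_face_def)
qed

lemma marked_sum_marked_sum:
 assumes w: "w \<in> A_lists"
 shows "frag_extend marked_sum (marked_sum (m, w)) = 0"
proof (cases "length w <= 1")
 case True
 thus ?thesis by (simp add: marked_sum_def)
next
 case False
 define n where "n = length w - 2"
 have n: "length w = n + 2" using False by (simp add: n_def)
 have "frag_extend marked_sum (marked_sum (m, w)) =
   (\<Sum>k<Suc n. frag_cmul (mark_sign m k) (marked_sum (mark_face m k, face k w)))"
  unfolding marked_sum_def[of "(m, w)"] by (simp add: frag_extend_signed_sum n del: sum.lessThan_Suc)
 also have "... = (\<Sum>k<Suc n. \<Sum>j<n. frag_cmul (mark_sign m k * mark_sign (mark_face m k) j)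
   (frag_of (mark_face (mark_face m k) j, face j (face k w))))"
  by (rule sum.cong) (simp_all add: marked_sum_def length_face n frag_cmul_sum o_def)
 also have "... = 0"
 proof (rule alternating_double_sum)
  fix j k assume jk: "j < k" "k <= n"
  show "frag_cmul (mark_sign m k * mark_sign (mark_face m k) j) (frag_of (mark_face (mark_face m k) j, face j (face k w)))
   = - frag_cmul (mark_sign m j * mark_sign (mark_face m j) (k - 1))
     (frag_of (mark_face (mark_face m j) (k - 1), face (k - 1) (face j w)))"
   using jk by (simp add: mark_sign_swap[OF jk(1)] face_face[OF w] n)
 qed
 finally show ?thesis .
qed

text \<open>Read R i j as the cut at i of the j-th face. The cut at i of the whole word contributes
  R i j for the faces behind it and R (i - 1) j for those before it; altogether each cut of each
  face occurs once.\<close>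

lemma triangular_sum:
 fixes R :: "nat => nat => 'g::ab_group_add"
 shows "(\<Sum>i\<in>{1..Suc n}. (\<Sum>j\<in>{i..n}. R i j) + (\<Sum>j<i - 1. R (i - 1) j)) = (\<Sum>i\<in>{1..n}. \<Sum>j\<le>n. R i j)"
proof -
 have "(\<Sum>i\<in>{1..Suc n}. \<Sum>j\<in>{i..n}. R i j) = (\<Sum>i\<in>{1..n}. \<Sum>j\<in>{i..n}. R i j)" by simp
 moreover have "(\<Sum>i\<in>{1..Suc n}. \<Sum>j<i - 1. R (i - 1) j) = (\<Sum>i\<in>{0..n}. \<Sum>j<i. R i j)"
  by (rule sum.reindex_bij_witness[of _ Suc "%i. i - 1"]) auto
 moreover have "... = (\<Sum>i\<in>{1..n}. \<Sum>j<i. R i j)"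
  by (rule sum.mono_neutral_right) (auto simp: not_less_eq_eq)
 moreover have "(\<Sum>j\<in>{i..n}. R i j) + (\<Sum>j<i. R i j) = (\<Sum>j\<le>n. R i j)" if "i \<in> {1..n}" for i
 proof -
  have "{..n} = {i..n} \<union> {..<i}" using that by auto
  thus ?thesis by (simp only:) (rule sum.union_disjoint[symmetric], auto)
 qed
 ultimately show ?thesis
  by (simp only: sum.distrib) (simp only: sum.distrib[symmetric] cong: sum.cong)
qed

definition insert_one :: "nat => 'c list => 'c list" where
 "insert_one i w = take i w @ \<one>\<^sub>A # drop i w"

text \<open>Deconcatenation: with mark i, the word with a unit inserted at i encodes the tensor of
  \<open>take i w @ [\<one>\<^sub>A]\<close> and \<open>\<one>\<^sub>A # drop i w\<close>.\<close>

definition cuts :: "'c list => nat \<times> 'c list \<Rightarrow>\<^sub>0 int" where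
 "cuts w = (\<Sum>i\<in>{1..<length w}. frag_of (i, insert_one i w))"

lemma length_insert_one: "length (insert_one i w) = Suc (length w)"
 by (simp add: insert_one_def)

lemma nth_insert_one:
 "[|i <= length w; q <= length w|] ==> insert_one i w ! q = (if q < i then w ! q else if q = i then \<one>\<^sub>A else w ! (q - 1))"
 by (auto simp: insert_one_def nth_append min_def nth_Cons')

lemma insert_one_lists: "w \<in> A_lists ==> insert_one i w \<in> A_lists"
 by (auto simp: insert_one_def in_lists_conv_set dest: in_set_takeD in_set_dropD)

lemma face_insert_one:
 assumes w: "w \<in> A_lists"
 shows "[|Suc k < i; i <= length w|] ==> face k (insert_one i w) = insert_one (i - 1) (face k w)"
  and "[|1 <= i; i <= length w|] ==> face (i - 1) (insert_one i w) = w"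
  and "i < length w ==> face i (insert_one i w) = w"
  and "[|i < k; k < length w|] ==> face k (insert_one i w) = insert_one i (face (k - 1) w)"
 by (rule nth_equalityI;
   auto simp: length_face length_insert_one nth_face nth_insert_one nth_carrier[OF w] not_less less_Suc_eq_le)+

text \<open>Faces away from the inserted unit are cuts of faces of w. The two faces adjoining the
  unit give w back with marks i - 1 and i; these telescope over i and leave only the degenerate
  marks 0 and n + 1.\<close>

lemma marked_sum_cuts:
 assumes w: "w \<in> A_lists" and n: "length w = n + 2"
 shows "frag_extend marked_sum (cuts w) =
  frag_extend cuts (face_sum w) + (frag_of (0, w) + frag_cmul ((- 1) ^ n) (frag_of (Suc n, w)))"
proof -
 define R where "R i j = frag_cmul ((- 1) ^ j) (frag_of (i, insert_one i (face j w)))" for i j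
 have pw: "(- 1 :: int) ^ (a - Suc 0) = - ((- 1) ^ a)" if "i < a" for a i :: nat
  using that by (cases a) auto
 have inner: "marked_sum (i, insert_one i w) = (\<Sum>j\<in>{i..n}. R i j) + (\<Sum>j<i - 1. R (i - 1) j)
   + (frag_cmul ((- 1) ^ (i - 1)) (frag_of (i - 1, w)) - frag_cmul ((- 1) ^ i) (frag_of (i, w)))"
  if i: "i \<in> {1..Suc n}" for i
 proof -
  let ?t = "%k. frag_cmul (mark_sign i k) (frag_of (mark_face i k, face k (insert_one i w)))"
  have "{..<n + 2} = {..<i - 1} \<union> {i - 1, i} \<union> {Suc i..Suc n}" using i by auto
  hence "marked_sum (i, insert_one i w) = sum ?t ({..<i - 1} \<union> {i - 1, i} \<union> {Suc i..Suc n})"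
   by (simp only: marked_sum_def length_insert_one n fst_conv snd_conv diff_Suc_1)
  also have "... = sum ?t ({..<i - 1} \<union> {i - 1, i}) + sum ?t {Suc i..Suc n}"
   by (rule sum.union_disjoint) auto
  also have "sum ?t ({..<i - 1} \<union> {i - 1, i}) = sum ?t {..<i - 1} + sum ?t {i - 1, i}"
   by (rule sum.union_disjoint) auto
  also have "sum ?t {Suc i..Suc n} = (\<Sum>j\<in>{i..n}. R i j)"
   by (rule sum.reindex_bij_witness[of _ Suc "%k. k - 1"])
     (use n in \<open>auto simp: R_def mark_sign_def mark_face_def face_insert_one(4)[OF w] Suc_le_eq pw\<close>)
  also have "sum ?t {..<i - 1} = (\<Sum>j<i - 1. R (i - 1) j)"
   by (rule sum.cong) (use i n in \<open>auto simp: R_def mark_sign_def mark_face_def face_insert_one(1)[OF w]\<close>)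
  also have "sum ?t {i - 1, i} = frag_cmul ((- 1) ^ (i - 1)) (frag_of (i - 1, w)) - frag_cmul ((- 1) ^ i) (frag_of (i, w))"
   using i n by (auto simp: mark_sign_def mark_face_def face_insert_one(2)[OF w, simplified] face_insert_one(3)[OF w]
     minus_frag_cmul[symmetric] simp del: minus_frag_cmul)
  finally show ?thesis by (simp add: algebra_simps)
 qed
 \<comment> \<open>The surviving ends of the telescope are exactly the two degenerate marks, on
   which evaluation will vanish.\<close>
 have tele: "(\<Sum>i\<in>{1..Suc n}. frag_cmul ((- 1) ^ (i - 1)) (frag_of (i - 1, w)) - frag_cmul ((- 1) ^ i) (frag_of (i, w)))
   = frag_of (0, w) + frag_cmul ((- 1) ^ n) (frag_of (Suc n, w))"
  by (induction n) (simp_all add: algebra_simps minus_frag_cmul[symmetric] del: minus_frag_cmul)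
 have "frag_extend marked_sum (cuts w) = (\<Sum>i\<in>{1..Suc n}. marked_sum (i, insert_one i w))"
  unfolding cuts_def using n by (simp add: frag_extend_sum o_def atLeastLessThanSuc_atLeastAtMost del: sum.cl_ivl_Suc)
 also have "... = (\<Sum>i\<in>{1..n}. \<Sum>j\<le>n. R i j) + (frag_of (0, w) + frag_cmul ((- 1) ^ n) (frag_of (Suc n, w)))"
  by (simp only: inner sum.distrib tele triangular_sum[symmetric] cong: sum.cong)
 also have "(\<Sum>i\<in>{1..n}. \<Sum>j\<le>n. R i j) = (\<Sum>j<Suc n. frag_cmul ((- 1) ^ j) (cuts (face j w)))"
  by (subst sum.swap)
    (simp add: R_def cuts_def length_face n frag_cmul_sum o_def lessThan_Suc_atMost atLeastLessThanSuc_atLeastAtMost)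
 also have "... = frag_extend cuts (face_sum w)"
  by (simp add: face_sum_def frag_extend_signed_sum n del: sum.lessThan_Suc)
 finally show ?thesis .
qed

text \<open>
 \<open>cyclic_word i w\<close> arises from the cut of \<open>w\<close> at \<open>i\<close> by exchanging the two tensor factors:
 it is \<open>(1, w\<^sub>i, ..., w\<^sub>n, w\<^sub>n\<^sub>+\<^sub>1 w\<^sub>0, w\<^sub>1, ..., w\<^sub>i\<^sub>-\<^sub>1, 1)\<close>, with mark at the product.
\<close>

definition cyclic_word :: "nat => 'c list => 'c list" where
 "cyclic_word i w = map (%q. if q = 0 \<or> q = length w then \<one>\<^sub>A
   else if q < length w - i then w ! (i + q - 1)
   else if q = length w - i then w ! (length w - 1) \<otimes>\<^sub>A w ! 0
   else w ! (q - (length w - i))) [0..<Suc (length w)]"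

text \<open>The sign is the Koszul sign of the exchange: the factors of the cut at i have degrees i
  - 1 and length w - 1 - i. The mark \<open>length w - i\<close> is the position of the product of
  the last and the first letter.\<close>

definition cyclic_cuts :: "'c list => nat \<times> 'c list \<Rightarrow>\<^sub>0 int" where
 "cyclic_cuts w = (\<Sum>i\<in>{1..<length w}.
   frag_cmul ((- 1) ^ ((i - 1) * (length w - 1 - i))) (frag_of (length w - i, cyclic_word i w)))"

lemma length_cyclic_word: "length (cyclic_word i w) = Suc (length w)"
 by (simp add: cyclic_word_def)

lemma nth_cyclic_word:
 "q <= length w ==> cyclic_word i w ! q = (if q = 0 \<or> q = length w then \<one>\<^sub>A
   else if q < length w - i then w ! (i + q - 1)
   else if q = length w - i then w ! (length w - 1) \<otimes>\<^sub>A w ! 0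
   else w ! (q - (length w - i)))"
 unfolding cyclic_word_def by (subst nth_map) (simp_all del: upt_Suc)

lemma cyclic_word_lists:
 "[|w \<in> A_lists; 1 <= i; i < length w|] ==> cyclic_word i w \<in> A_lists"
 by (rule in_lists_nth) (auto simp: length_cyclic_word nth_cyclic_word less_Suc_eq_le intro!: nth_carrier A.m_closed)

text \<open>Every face other than the two outermost ones is again a cyclic word of a face. A face of
  letters behind the cut keeps the cut index i; for letters before the cut the index drops from i +
  1 to i. Associativity enters when a neighbour is multiplied into the product letter, that is for j
  = n and j = 0 respectively.\<close>

lemma face_cyclic_word:
 assumes w: "w \<in> A_lists" and n: "length w = n + 2"
 shows "[|1 <= i; i <= j; j <= n|] ==> face (Suc j - i) (cyclic_word i w) = cyclic_word i (face j w)"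
  and "[|1 <= i; i <= n; j < i|] ==> face (j + Suc n - i) (cyclic_word (Suc i) w) = cyclic_word i (face j w)"
proof -
 note c = nth_carrier[OF w, unfolded n]
 show "face (Suc j - i) (cyclic_word i w) = cyclic_word i (face j w)" if ij: "1 <= i" "i <= j" "j <= n"
 proof (rule nth_equalityI)
  show "length (face (Suc j - i) (cyclic_word i w)) = length (cyclic_word i (face j w))"
   using ij by (simp add: length_face length_cyclic_word n)
  fix q assume "q < length (face (Suc j - i) (cyclic_word i w))"
  hence q: "q < n + 2" using ij by (simp add: length_face length_cyclic_word n)
  \<comment> \<open>Writing j = i + e and n = i + e + r removes the subtractions, so the position q
    can be compared by linear cases.\<close>
  obtain e r where e: "j = i + e" "n = i + e + r" using ij le_Suc_ex by blast
  note f = nth_face[of "Suc j - i" "cyclic_word i w" q] nth_cyclic_word length_face length_cyclic_word n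
  obtain i' where i': "i = Suc i'" using ij by (cases i) auto
  consider "q = 0" | "0 < q" "q <= e" | "q = Suc e" "r = 0" | "q = Suc e" "0 < r"
   | "Suc e < q" "q < Suc (e + r)" | "Suc e < q" "q = Suc (e + r)" | "Suc (e + r) < q" "q < Suc n" | "q = Suc n"
   using q e by linarith
  thus "face (Suc j - i) (cyclic_word i w) ! q = cyclic_word i (face j w) ! q"
  proof cases
   case 1 thus ?thesis using ij e i' by (simp add: f nth_face)
  next
   case 2
   then obtain p where "q = Suc p" by (cases q) auto
   with 2 show ?thesis using ij e i' by (simp add: f nth_face)
  next
   case 3 thus ?thesis using ij e i' c by (simp add: f nth_face A.m_assoc)
  next
   case 4 thus ?thesis using ij e i' by (simp add: f nth_face)
  next
   case 5 thus ?thesis using ij e i' by (simp add: f nth_face)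
  next
   case 6 thus ?thesis using ij e i' by (simp add: f nth_face)
  next
   case 7
   hence "q - Suc (e + r) < Suc (i' + e)" using q e i' by linarith
   with 7 show ?thesis using ij e i' by (simp add: f nth_face)
  next
   case 8 thus ?thesis using ij e i' by (simp add: f nth_face)
  qed
 qed
 show "face (j + Suc n - i) (cyclic_word (Suc i) w) = cyclic_word i (face j w)" if ij: "1 <= i" "i <= n" "j < i"
 proof (rule nth_equalityI)
  show "length (face (j + Suc n - i) (cyclic_word (Suc i) w)) = length (cyclic_word i (face j w))"
   using ij by (simp add: length_face length_cyclic_word n)
  fix q assume "q < length (face (j + Suc n - i) (cyclic_word (Suc i) w))"
  hence q: "q < n + 2" using ij by (simp add: length_face length_cyclic_word n)
  obtain e where e: "n = i + e" using ij le_Suc_ex by blast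
  note f = nth_face[of "j + Suc n - i" "cyclic_word (Suc i) w" q] nth_cyclic_word length_face length_cyclic_word n
  obtain i' where i': "i = Suc i'" using ij by (cases i) auto
  consider "q = 0" | "0 < q" "q <= e" | "q = Suc e" "0 < j" | "Suc e < q" "q < j + Suc e"
   | "q = Suc e" "j = 0" | "q = j + Suc e" "0 < j" | "j + Suc e < q" "q < Suc n" | "q = Suc n"
   using q e by linarith
  thus "face (j + Suc n - i) (cyclic_word (Suc i) w) ! q = cyclic_word i (face j w) ! q"
  proof cases
   case 1 thus ?thesis using ij e i' by (simp add: f nth_face)
  next
   case 2
   then obtain p where "q = Suc p" by (cases q) auto
   with 2 show ?thesis using ij e i' by (simp add: f nth_face)
  next
   case 3 thus ?thesis using ij e i' by (simp add: f nth_face)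
  next
   case 4
   hence "q - Suc e < j" by linarith
   with 4 show ?thesis using ij e i' by (simp add: f nth_face)
  next
   case 5 thus ?thesis using ij e i' c by (simp add: f nth_face A.m_assoc)
  next
   case 6 thus ?thesis using ij e i' by (simp add: f nth_face)
  next
   case 7
   then obtain p where "q = Suc e + p" using le_Suc_ex[of "Suc e" q] by auto
   with 7 show ?thesis using ij e i' by (simp add: f nth_face)
  next
   case 8 thus ?thesis using ij e i' by (simp add: f nth_face)
  qed
 qed
qed

lemma frag_cmul_diff2: "frag_cmul c (a - b) = frag_cmul c a - frag_cmul c b"
 using frag_cmul_distrib2[of c "a - b" b] by (simp add: eq_diff_eq)

text \<open>In contrast to plain cuts the outermost faces do not cancel formally: face 0 of one
  rotation and face n + 1 of the next absorb the same letter at opposite ends. They are kept as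
  differences that vanish only under a trace.\<close>

lemma marked_sum_cyclic_cuts:
 assumes w: "w \<in> A_lists" and n: "length w = n + 2"
 shows "frag_extend marked_sum (cyclic_cuts w) = frag_extend cyclic_cuts (face_sum w)
  + (\<Sum>i\<in>{1..n}. frag_cmul ((- 1) ^ ((i - 1) * (Suc n - i)))
    (frag_of (Suc n - i, face 0 (cyclic_word i w)) - frag_of (Suc n - i, face (Suc n) (cyclic_word (Suc i) w))))
  + frag_of (0, face 0 (cyclic_word (Suc n) w)) + frag_cmul ((- 1) ^ n) (frag_of (Suc n, face (Suc n) (cyclic_word 1 w)))"
proof -
 define \<epsilon> :: "nat => int" where "\<epsilon> i = (- 1) ^ ((i - 1) * (Suc n - i))" for i
 define R where "R i j = frag_cmul ((- 1) ^ ((i - 1) * (n - i)) * (- 1) ^ j) (frag_of (Suc n - i, cyclic_word i (face j w)))" for i j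
 define u where "u i = frag_cmul (\<epsilon> i) (frag_of (Suc n - i, face 0 (cyclic_word i w)))" for i
 define v where "v i = frag_cmul (\<epsilon> i * (- 1) ^ n) (frag_of (Suc (Suc n) - i, face (Suc n) (cyclic_word i w)))" for i
 have inner: "frag_cmul (\<epsilon> i) (marked_sum (Suc (Suc n) - i, cyclic_word i w))
   = (\<Sum>j\<in>{i..n}. R i j) + (\<Sum>j<i - 1. R (i - 1) j) + (u i + v i)"
  if i: "i \<in> {1..Suc n}" for i
 proof -
  let ?m = "Suc (Suc n) - i"
  let ?t = "%k. frag_cmul (\<epsilon> i * mark_sign ?m k) (frag_of (mark_face ?m k, face k (cyclic_word i w)))"
  have "{..<n + 2} = ({1..Suc n - i} \<union> {?m..n}) \<union> {0, Suc n}" using i by auto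
  hence "frag_cmul (\<epsilon> i) (marked_sum (?m, cyclic_word i w)) = sum ?t (({1..Suc n - i} \<union> {?m..n}) \<union> {0, Suc n})"
   by (simp only: marked_sum_def length_cyclic_word n fst_conv snd_conv diff_Suc_1 frag_cmul_sum o_def frag_cmul_cmul)
  also have "... = sum ?t ({1..Suc n - i} \<union> {?m..n}) + sum ?t {0, Suc n}"
   by (rule sum.union_disjoint) (use i in auto)
  also have "sum ?t ({1..Suc n - i} \<union> {?m..n}) = sum ?t {1..Suc n - i} + sum ?t {?m..n}"
   by (rule sum.union_disjoint) auto
  also have "sum ?t {1..Suc n - i} = (\<Sum>j\<in>{i..n}. R i j)"
  proof (rule sum.reindex_bij_witness[of _ "%j. Suc j - i" "%k. k + i - 1"])
   fix k assume k: "k \<in> {1..Suc n - i}"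
   obtain l where l: "i = Suc l" using i by (cases i) auto
   obtain k' where k': "k = Suc k'" using k by (cases k) auto
   have "k + l <= n" using k l by auto
   then obtain r where r: "n = k + l + r" using le_Suc_ex by blast
   have f: "face k (cyclic_word i w) = cyclic_word i (face (k + i - 1) w)"
    using face_cyclic_word(1)[OF w n, of i "k + i - 1"] k l \<open>k + l <= n\<close> by simp
   have "(- 1 :: int) ^ ((i - 1) * (n - i)) * (- 1) ^ (k + i - 1) = \<epsilon> i * (- 1) ^ k"
    unfolding \<epsilon>_def r l k' by (simp add: power_add[symmetric] algebra_simps)
   thus "R i (k + i - 1) = ?t k"
    unfolding f R_def using k l \<open>k + l <= n\<close> less_diff_conv[of k "Suc n" l] by (simp add: mark_sign_def mark_face_def)
  qed (use i in auto)
  also have "sum ?t {?m..n} = (\<Sum>j<i - 1. R (i - 1) j)"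
  proof (rule sum.reindex_bij_witness[of _ "%j. j + ?m" "%k. k - ?m"])
   fix k assume k: "k \<in> {?m..n}"
   obtain j where j: "k = ?m + j" using k le_Suc_ex by auto
   obtain l where l: "i = Suc l" using i by (cases i) auto
   have lj: "j < l" "l <= n" using k j l i by auto
   obtain r where r: "n = l + r" using lj(2) le_Suc_ex by blast
   have "k = j + Suc n - l" using j l lj by auto
   hence f: "face k (cyclic_word i w) = cyclic_word l (face j w)"
    using face_cyclic_word(2)[OF w n, of l j] lj l by simp
   obtain l' where l': "l = Suc l'" using lj by (cases l) auto
   have "(- 1 :: int) ^ ((l - 1) * (n - l)) * (- 1) ^ j = - (\<epsilon> i * (- 1) ^ k)"
    unfolding \<epsilon>_def j l r l' by (simp add: power_add algebra_simps)
   thus "R (i - 1) (k - ?m) = ?t k"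
    unfolding f R_def using k l lj j by (simp add: mark_sign_def mark_face_def Suc_diff_Suc)
  qed (use i in auto)
  also have "sum ?t {0, Suc n} = u i + v i"
   using i by (auto simp: u_def v_def mark_sign_def mark_face_def)
  finally show ?thesis .
 qed
 \<comment> \<open>This relative sign makes the last face of the cut at i + 1 appear with the sign
   opposite to that of face 0 of the cut at i.\<close>
 have \<epsilon>: "\<epsilon> (Suc i) * (- 1) ^ n = - \<epsilon> i" if i: "i \<in> {1..n}" for i
 proof -
  obtain l where l: "i = Suc l" using i by (cases i) auto
  obtain r where r: "n = i + r" using i le_Suc_ex by auto
  show ?thesis unfolding \<epsilon>_def r l by (simp add: power_add algebra_simps)
 qed
 have "(\<Sum>i\<in>{1..Suc n}. u i + v i) = (\<Sum>i\<in>{1..n}. u i + v (Suc i)) + u (Suc n) + v 1"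
 proof -
  have "(\<Sum>i\<in>{1..Suc n}. v i) = v 1 + (\<Sum>i\<in>{1..n}. v (Suc i))"
   by (induction n) (simp_all add: algebra_simps)
  thus ?thesis by (simp add: sum.distrib algebra_simps)
 qed
 also have "(\<Sum>i\<in>{1..n}. u i + v (Suc i)) = (\<Sum>i\<in>{1..n}. frag_cmul (\<epsilon> i)
    (frag_of (Suc n - i, face 0 (cyclic_word i w)) - frag_of (Suc n - i, face (Suc n) (cyclic_word (Suc i) w))))"
  by (rule sum.cong) (simp_all add: u_def v_def \<epsilon> frag_cmul_diff2 flip: minus_frag_cmul)
 finally have bd: "(\<Sum>i\<in>{1..Suc n}. u i + v i) = ... + u (Suc n) + v 1" .
 have "frag_extend marked_sum (cyclic_cuts w) = (\<Sum>i\<in>{1..Suc n}. frag_cmul (\<epsilon> i) (marked_sum (Suc (Suc n) - i, cyclic_word i w)))"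
  unfolding cyclic_cuts_def using n
  by (simp add: frag_extend_signed_sum \<epsilon>_def atLeastLessThanSuc_atLeastAtMost del: sum.cl_ivl_Suc)
 also have "... = (\<Sum>i\<in>{1..n}. \<Sum>j\<le>n. R i j) + (\<Sum>i\<in>{1..Suc n}. u i + v i)"
  by (simp only: inner sum.distrib triangular_sum[symmetric] cong: sum.cong)
 also have "(\<Sum>i\<in>{1..n}. \<Sum>j\<le>n. R i j) = (\<Sum>j<Suc n. frag_cmul ((- 1) ^ j) (cyclic_cuts (face j w)))"
  by (subst sum.swap)
    (simp add: R_def cyclic_cuts_def length_face n frag_cmul_sum o_def lessThan_Suc_atMost atLeastLessThanSuc_atLeastAtMost mult.commute)
 also have "... = frag_extend cyclic_cuts (face_sum w)"
  by (simp add: face_sum_def frag_extend_signed_sum n del: sum.lessThan_Suc)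
 finally show ?thesis
  unfolding bd by (simp add: u_def v_def \<epsilon>_def algebra_simps)
qed

end

context abelian_group
begin

lemma add_minus_minus:
 assumes "x \<in> carrier G" "y \<in> carrier G" shows "x \<oplus> y \<ominus> x \<ominus> y = \<zero>"
proof -
 have "x \<oplus> y \<ominus> x \<ominus> y = (x \<oplus> y) \<oplus> (\<ominus> x \<oplus> \<ominus> y)" using assms by (simp add: minus_eq a_assoc)
 thus ?thesis using assms by (simp add: minus_add[symmetric] r_neg)
qed

lemma frag_lift_cong: "(!!x. x \<in> Poly_Mapping.keys z ==> b x = c x) ==> (!!x. x \<in> Poly_Mapping.keys z ==> c x \<in> carrier G) ==> frag_lift G b z = frag_lift G c z"
 unfolding frag_lift_def by (rule finsum_cong') (auto intro!: add.int_pow_closed)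

lemma ahom_frag_lift:
 assumes f: "f \<in> ahom G H" and H: "abelian_group H" and b: "!!x. b x \<in> carrier G"
 shows "f (frag_lift G b z) = frag_lift H (%x. f (b x)) z"
proof -
 interpret H: abelian_group H by fact
 have c: "f (b x) \<in> carrier H" for x by (rule ahom_closed[OF f b])
 show ?thesis
 proof (rule frag_subset_induct[of z UNIV])
  show "f (frag_lift G b 0) = frag_lift H (%x. f (b x)) 0"
   by (simp add: ahom_zero[OF ag H f])
  show "f (frag_lift G b (x - y)) = frag_lift H (%x. f (b x)) (x - y)"
   if "f (frag_lift G b x) = frag_lift H (%x. f (b x)) x" "f (frag_lift G b y) = frag_lift H (%x. f (b x)) y" for x y
   using that by (simp add: frag_lift_diff[OF b b] H.frag_lift_diff[OF c c]
    ahom_minus[OF ag H f] frag_lift_closed[OF b])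
 qed (simp_all add: b c)
qed

text \<open>The bridge from formal identities to values: a formal operator \<open>E\<close> may be
  applied to the combination first and evaluated afterwards.\<close>

lemma frag_lift_extend:
 assumes b: "!!x. b x \<in> carrier G"
 shows "frag_lift G (%x. frag_lift G b (E x)) z = frag_lift G b (frag_extend E z)"
proof -
 have c: "frag_lift G b (E x) \<in> carrier G" for x by (rule frag_lift_closed[OF b])
 show ?thesis
 proof (rule frag_subset_induct[of z UNIV])
 show "frag_lift G (%x. frag_lift G b (E x)) (x - y) = frag_lift G b (frag_extend E (x - y))"
  if "frag_lift G (%x. frag_lift G b (E x)) x = frag_lift G b (frag_extend E x)"
   "frag_lift G (%x. frag_lift G b (E x)) y = frag_lift G b (frag_extend E y)" for x y
  using that by (simp only: frag_lift_diff[OF c c] frag_extend_diff frag_lift_diff[OF b b])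
 qed (simp_all add: c)
qed

lemma frag_lift_signed_sum:
 assumes "!!x. b x \<in> carrier G" "finite I"
 shows "frag_lift G b (\<Sum>i\<in>I. frag_cmul ((- 1) ^ k i) (frag_of (x i))) = (\<Oplus>i\<in>I. sgn_elt G (int (k i)) (b (x i)))"
 using frag_lift_sum[of I "%i. frag_cmul ((- 1) ^ k i) (frag_of (x i))" b] assms
 by (simp add: frag_lift_neg_sign)

end

section \<open>Multilinear functions on words and the universal property of tensor powers\<close>

context assoc_algebra
begin

definition letter_maps :: "('c => 'c) set" where
 "letter_maps = {\<phi> \<in> ahom A A. \<forall>c\<in>carrier K. \<forall>a\<in>carrier A. \<phi> (c \<odot>\<^sub>A a) = c \<odot>\<^sub>A \<phi> a}"

lemma letter_maps:
 shows "(%a. a) \<in> letter_maps"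
  and "b \<in> carrier A ==> (%a. b \<otimes>\<^sub>A a) \<in> letter_maps"
  and "b \<in> carrier A ==> (%a. a \<otimes>\<^sub>A b) \<in> letter_maps"
 by (auto simp: letter_maps_def smult_mult_left smult_mult_right A.r_distr A.l_distr intro!: ahomI)

text \<open>Varying one letter of w varies exactly one letter of the result, through a K-linear map.
  Faces, rotations, scalings and insertions of a unit all have this form, so multilinearity is
  transported along them by a single lemma.\<close>

definition letterwise :: "'c list => ('c list => 'c list) => bool" where
 "letterwise w \<rho> \<longleftrightarrow> (\<forall>k<length w. \<exists>k' \<phi>. k' < length (\<rho> w) & \<phi> \<in> letter_maps &
   (\<forall>a\<in>carrier A. \<rho> (w[k := a]) = (\<rho> w)[k' := \<phi> a]))"

text \<open>Precisely compatibility with the relations of words: additive in each letter, and a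
  scalar may sit at any letter. No scalar action on the target occurs, so a plain group such as the
  trace can serve as target.\<close>

definition bml :: "('g, 'z) ring_scheme => ('c list => 'g) => 'c list => bool" where
 "bml G q w \<longleftrightarrow> (\<forall>k<length w. (%a. q (w[k := a])) \<in> ahom A G) &
   (\<forall>c\<in>carrier K. \<forall>j<length w. \<forall>k<length w. q (w[j := c \<odot>\<^sub>A w ! j]) = q (w[k := c \<odot>\<^sub>A w ! k]))"

lemma bml_letterwise:
 assumes w: "w \<in> A_lists" and \<rho>: "letterwise w \<rho>" and q: "bml G q (\<rho> w)"
 shows "bml G (%w. q (\<rho> w)) w"
proof -
 obtain \<kappa> \<phi> where k: "!!k. k < length w ==> \<kappa> k < length (\<rho> w)"
  and l: "!!k. k < length w ==> \<phi> k \<in> letter_maps"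
  and u: "!!k a. [|k < length w; a \<in> carrier A|] ==> \<rho> (w[k := a]) = (\<rho> w)[\<kappa> k := \<phi> k a]"
  using \<rho> unfolding letterwise_def by metis
 have self: "\<rho> w ! \<kappa> k = \<phi> k (w ! k)" if "k < length w" for k
  using u[OF that nth_carrier[OF w that]] that k[OF that] by (metis list_update_id nth_list_update_eq)
 show ?thesis
  unfolding bml_def
 proof (intro conjI ballI allI impI)
  fix i assume i: "i < length w"
  have p: "\<phi> i \<in> ahom A A" using l[OF i] by (simp add: letter_maps_def)
  have "(%a. q ((\<rho> w)[\<kappa> i := a])) \<in> ahom A G" using q k[OF i] by (simp add: bml_def)
  from ahom_comp[OF p this] show "(%a. q (\<rho> (w[i := a]))) \<in> ahom A G"
   by (rule ahom_cong) (simp_all add: u[OF i] A.ag)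
 next
  fix c i j assume c: "c \<in> carrier K" and ij: "i < length w" "j < length w"
  have "q (\<rho> (w[k := c \<odot>\<^sub>A w ! k])) = q ((\<rho> w)[\<kappa> k := c \<odot>\<^sub>A (\<rho> w ! \<kappa> k)])" if "k < length w" for k
  proof -
   have "\<phi> k (c \<odot>\<^sub>A w ! k) = c \<odot>\<^sub>A \<phi> k (w ! k)"
    using l[OF that] c nth_carrier[OF w that] unfolding letter_maps_def by blast
   thus ?thesis by (simp only: u[OF that KA.smult_closed[OF c nth_carrier[OF w that]]] self[OF that])
  qed
  thus "q (\<rho> (w[i := c \<odot>\<^sub>A w ! i])) = q (\<rho> (w[j := c \<odot>\<^sub>A w ! j]))"
   using q c k[OF ij(1)] k[OF ij(2)] ij unfolding bml_def by metis
 qed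
qed

lemma bml_hom:
 assumes "bml G q w" "f \<in> ahom G H" shows "bml H (%w. f (q w)) w"
 unfolding bml_def
proof (intro conjI ballI allI impI)
 show "(%a. f (q (w[k := a]))) \<in> ahom A H" if "k < length w" for k
  using assms(1) that by (intro ahom_comp[OF _ assms(2)]) (simp add: bml_def)
 show "f (q (w[j := c \<odot>\<^sub>A w ! j])) = f (q (w[k := c \<odot>\<^sub>A w ! k]))"
  if "c \<in> carrier K" "j < length w" "k < length w" for c j k
 proof -
  have "q (w[j := c \<odot>\<^sub>A w ! j]) = q (w[k := c \<odot>\<^sub>A w ! k])"
   using assms(1) that unfolding bml_def by blast
  thus ?thesis by (rule arg_cong)
 qed
qed

lemma bml_finsum:
 assumes G: "abelian_group G" and q: "!!i. i \<in> I ==> bml G (q i) w"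
  and w: "w \<in> A_lists"
 shows "bml G (%w. \<Oplus>\<^bsub>G\<^esub>i\<in>I. q i w) w"
proof -
 interpret G: abelian_group G by fact
 show ?thesis
  unfolding bml_def
 proof (intro conjI ballI allI impI)
  fix k assume "k < length w"
  thus "(%a. \<Oplus>\<^bsub>G\<^esub>i\<in>I. q i (w[k := a])) \<in> ahom A G"
   using q by (intro ahom_sum[OF A.ag G]) (simp add: bml_def)
 next
  fix c j k assume c: "c \<in> carrier K" "j < length w" "k < length w"
  have m: "q i (w[k := c \<odot>\<^sub>A w ! k]) \<in> carrier G" if "i \<in> I" for i
  proof -
   have "(%a. q i (w[k := a])) \<in> ahom A G" using q[OF that] c(3) by (simp add: bml_def)
   thus ?thesis by (rule ahom_closed) (use c(1) nth_carrier[OF w c(3)] in simp)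
  qed
  show "(\<Oplus>\<^bsub>G\<^esub>i\<in>I. q i (w[j := c \<odot>\<^sub>A w ! j])) = (\<Oplus>\<^bsub>G\<^esub>i\<in>I. q i (w[k := c \<odot>\<^sub>A w ! k]))"
  proof (rule G.finsum_cong'[OF refl])
   show "(%i. q i (w[k := c \<odot>\<^sub>A w ! k])) \<in> I \<rightarrow> carrier G" using m by blast
   show "q i (w[j := c \<odot>\<^sub>A w ! j]) = q i (w[k := c \<odot>\<^sub>A w ! k])" if "i \<in> I" for i
    using q[OF that] c unfolding bml_def by blast
  qed
 qed
qed

lemma bml_cong:
 assumes "bml G q w" "w \<in> A_lists"
  "!!k a. [|k < length w; a \<in> carrier A|] ==> q (w[k := a]) = r (w[k := a])"
 shows "bml G r w"
 unfolding bml_def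
proof (intro conjI ballI allI impI)
 fix k assume k: "k < length w"
 have "(%a. q (w[k := a])) \<in> ahom A G" using assms(1) k by (simp add: bml_def)
 thus "(%a. r (w[k := a])) \<in> ahom A G"
  by (rule ahom_cong[OF _ assms(3)[OF k] A.ag])
next
 fix c j k assume c: "c \<in> carrier K" "j < length w" "k < length w"
 show "r (w[j := c \<odot>\<^sub>A w ! j]) = r (w[k := c \<odot>\<^sub>A w ! k])"
  unfolding assms(3)[OF c(2) KA.smult_closed[OF c(1) nth_carrier[OF assms(2) c(2)]], symmetric]
   assms(3)[OF c(3) KA.smult_closed[OF c(1) nth_carrier[OF assms(2) c(3)]], symmetric]
  using assms(1) c unfolding bml_def by blast
qed

lemma update_lists: "[|w \<in> A_lists; a \<in> carrier A|] ==> w[k := a] \<in> A_lists"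
 by (auto dest!: subsetD[OF set_update_subset_insert])

lemma letterwise_update:
 assumes "\<phi> \<in> letter_maps" "!!v. length v = length w ==> i v = i w" "i w < length w"
 shows "letterwise w (%w. w[i w := \<phi> (w ! i w)])"
 unfolding letterwise_def
proof (intro allI impI)
 fix k assume k: "k < length w"
 show "\<exists>k' \<psi>. k' < length (w[i w := \<phi> (w ! i w)]) & \<psi> \<in> letter_maps &
   (\<forall>a\<in>carrier A. w[k := a, i (w[k := a]) := \<phi> (w[k := a] ! i (w[k := a]))] = w[i w := \<phi> (w ! i w), k' := \<psi> a])"
 proof -
  have e: "i (w[k := a]) = i w" for a by (rule assms(2)) simp
  show ?thesis
  proof (cases "k = i w")
   case True
   show ?thesis
    using k assms(1) unfolding e True[symmetric] by (intro exI[of _ k] exI[of _ \<phi>]) simp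
  next
   case False
   thus ?thesis
    using k letter_maps(1) unfolding e by (intro exI[of _ k] exI[of _ "%a. a"]) (simp add: list_update_swap)
  qed
 qed
qed

lemma face_update:
 assumes "Suc j < length w" "k < length w"
 shows "face j (w[k := x]) = (if k < j then (face j w)[k := x] else if k = j then (face j w)[j := x \<otimes>\<^sub>A w ! Suc j]
  else if k = Suc j then (face j w)[j := w ! j \<otimes>\<^sub>A x] else (face j w)[k - 1 := x])"
proof (rule nth_equalityI)
 fix i assume "i < length (face j (w[k := x]))"
 hence i: "i < length w - 1" using assms by (simp add: length_face)
 consider "k < j" | "k = j" | "k = Suc j" | "Suc j < k" by linarith
 thus "face j (w[k := x]) ! i = (if k < j then (face j w)[k := x] else if k = j then (face j w)[j := x \<otimes>\<^sub>A w ! Suc j]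
  else if k = Suc j then (face j w)[j := w ! j \<otimes>\<^sub>A x] else (face j w)[k - 1 := x]) ! i"
  using i assms by cases (auto simp: nth_face nth_list_update length_face)
qed (use assms in \<open>simp add: length_face\<close>)

lemma letterwise_face:
 assumes w: "w \<in> A_lists" and j: "Suc j < length w"
 shows "letterwise w (face j)"
 unfolding letterwise_def
proof (intro allI impI)
 fix k assume k: "k < length w"
 have c: "w ! j \<in> carrier A" "w ! Suc j \<in> carrier A" using nth_carrier[OF w] j by auto
 consider "k < j" | "k = j" | "k = Suc j" | "Suc j < k" by linarith
 thus "\<exists>k' \<phi>. k' < length (face j w) & \<phi> \<in> letter_maps & (\<forall>a\<in>carrier A. face j (w[k := a]) = (face j w)[k' := \<phi> a])"
 proof cases
  case 1 thus ?thesis using k j letter_maps(1) by (intro exI[of _ k] exI[of _ "%a. a"]) (simp add: face_update length_face)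
 next
  case 2 thus ?thesis using k j letter_maps(3)[OF c(2)] by (intro exI[of _ j] exI[of _ "%a. a \<otimes>\<^sub>A w ! Suc j"]) (simp add: face_update length_face)
 next
  case 3 thus ?thesis using k j letter_maps(2)[OF c(1)] by (intro exI[of _ j] exI[of _ "%a. w ! j \<otimes>\<^sub>A a"]) (simp add: face_update length_face)
 next
  case 4 thus ?thesis using k j letter_maps(1) by (intro exI[of _ "k - 1"] exI[of _ "%a. a"]) (simp add: face_update length_face)
 qed
qed

lemma word_gens_iff: "w \<in> word_gens A l \<longleftrightarrow> w \<in> A_lists & l <= length w"
 by (simp add: word_gens_def)

lemma word_presentation: "presentation (word_gens A l) (word_rels K A l)"
proof
 fix r assume "r \<in> word_rels K A l"
 thus "Poly_Mapping.keys r <= word_gens A l"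
  unfolding word_rels_def
  by (elim UnE CollectE exE conjE; hypsubst; intro subset_trans[OF keys_diff] Un_least)
    (simp_all add: word_gens_iff)
qed

lemma ag_words: "abelian_group (words K A l)"
 unfolding words_def by (rule presentation.ag_pres[OF word_presentation])

lemma word_closed: "w \<in> word_gens A l ==> word K A l w \<in> carrier (words K A l)"
 unfolding words_def word_def by (rule presentation.pres_gen_closed[OF word_presentation])

lemma update_split: "k < length w ==> w[k := a] = take k w @ [a] @ drop (Suc k) w"
 by (simp add: upd_conv_take_nth_drop)

lemma word_bml:
 assumes w: "w \<in> word_gens A l"
 shows "bml (words K A l) (word K A l) w"
proof -
 have l: "w \<in> A_lists" using w by (simp add: word_gens_iff)
 have u: "w[k := a] \<in> word_gens A l" if "a \<in> carrier A" for k a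
  using w that update_lists[OF l that] by (simp add: word_gens_iff)
 have s: "word K A l (w[j := c \<odot>\<^sub>A w ! j]) = word K A l (w[k := c \<odot>\<^sub>A w ! k])"
  if c: "c \<in> carrier K" and jk: "j < k" "k < length w" for c j k
 proof -
  have m: "w ! j \<in> carrier A" "w ! k \<in> carrier A" using nth_carrier[OF l] jk by auto
  let ?us = "take j w" and ?vs = "take (k - Suc j) (drop (Suc j) w)" and ?ws = "drop (Suc k) w"
  have t: "take k w = ?us @ w ! j # ?vs"
   using id_take_nth_drop[of j "take k w"] jk by (simp add: drop_take)
  have d: "drop (Suc j) w = ?vs @ w ! k # ?ws"
  proof -
   have "drop (Suc j) w = ?vs @ drop (k - Suc j) (drop (Suc j) w)" by (rule append_take_drop_id[symmetric])
   also have "drop (k - Suc j) (drop (Suc j) w) = drop k w" using jk by simp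
   also have "drop k w = w ! k # ?ws" using jk by (simp add: Cons_nth_drop_Suc)
   finally show ?thesis .
  qed
  have e: "w = ?us @ [w ! j] @ ?vs @ [w ! k] @ ?ws"
   using id_take_nth_drop[OF jk(2)] unfolding t by simp
  have "word K A l (?us @ [c \<odot>\<^sub>A w ! j] @ ?vs @ [w ! k] @ ?ws) = word K A l (?us @ [w ! j] @ ?vs @ [c \<odot>\<^sub>A w ! k] @ ?ws)"
   unfolding word_def
  proof (rule presentation.rel2[OF word_presentation])
   show "frag_of (?us @ [c \<odot>\<^sub>A w ! j] @ ?vs @ [w ! k] @ ?ws) - frag_of (?us @ [w ! j] @ ?vs @ [c \<odot>\<^sub>A w ! k] @ ?ws) \<in> word_rels K A l"
   proof -
    have "?us @ [w ! j] @ ?vs @ [w ! k] @ ?ws \<in> word_gens A l" unfolding e[symmetric] by (rule w)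
    thus ?thesis unfolding word_rels_def using c by blast
   qed
   show "?us @ [c \<odot>\<^sub>A w ! j] @ ?vs @ [w ! k] @ ?ws \<in> word_gens A l"
    using u[of "c \<odot>\<^sub>A w ! j" j] c m update_split[of j w] jk d by simp
   show "?us @ [w ! j] @ ?vs @ [c \<odot>\<^sub>A w ! k] @ ?ws \<in> word_gens A l"
    using u[of "c \<odot>\<^sub>A w ! k" k] c m update_split[of k w] jk t by simp
  qed
  thus ?thesis
   using update_split[of j w] update_split[of k w] jk d t by simp
 qed
 show ?thesis
  unfolding bml_def
 proof (intro conjI ballI allI impI)
  fix k assume k: "k < length w"
  show "(%a. word K A l (w[k := a])) \<in> ahom A (words K A l)"
  proof (rule ahomI)
   fix a b assume ab: "a \<in> carrier A" "b \<in> carrier A"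
   let ?us = "take k w" and ?vs = "drop (Suc k) w"
   have g: "?us @ [x] @ ?vs \<in> word_gens A l" if "x \<in> carrier A" for x
    using u[OF that, of k] update_split[OF k, of x] by simp
   show "word K A l (w[k := a \<oplus>\<^bsub>A\<^esub> b]) = word K A l (w[k := a]) \<oplus>\<^bsub>words K A l\<^esub> word K A l (w[k := b])"
    unfolding update_split[OF k] word_def words_def
   proof (rule presentation.rel3[OF word_presentation])
    show "frag_of (?us @ [a \<oplus>\<^bsub>A\<^esub> b] @ ?vs) - frag_of (?us @ [a] @ ?vs) - frag_of (?us @ [b] @ ?vs) \<in> word_rels K A l"
     unfolding word_rels_def using g[OF ab(1)] ab(2) by blast
   qed (use g ab in auto)
  qed (rule word_closed[OF u])
 next
  fix c j k assume a: "c \<in> carrier K" "j < length w" "k < length w"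
  consider "j < k" | "j = k" | "k < j" by linarith
  thus "word K A l (w[j := c \<odot>\<^sub>A w ! j]) = word K A l (w[k := c \<odot>\<^sub>A w ! k])"
  proof cases
   case 1 thus ?thesis by (rule s[OF a(1) _ a(3)])
  next
   case 2 thus ?thesis by simp
  next
   case 3 thus ?thesis by (rule s[OF a(1) _ a(2), symmetric])
  qed
 qed
qed

text \<open>The universal property of the tensor powers; additivity in a letter kills the three-term
  relations and moving scalars kills the two-term ones.\<close>

lemma word_lift:
 assumes G: "abelian_group G" and l: "0 < l" and q: "!!w. w \<in> word_gens A l ==> bml G q w"
 shows word_lift_hom: "pres_lift G q \<in> ahom (words K A l) G"
  and word_lift_word: "w \<in> word_gens A l ==> pres_lift G q (word K A l w) = q w"
proof -
 interpret G: abelian_group G by fact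
 have c: "q w \<in> carrier G" if w: "w \<in> word_gens A l" for w
 proof -
  \<comment> \<open>Membership of the value in the group is read off by updating letter 0 with
    itself, which requires a letter to exist.\<close>
  have 0: "0 < length w" using w l by (auto simp: word_gens_iff)
  have "(%a. q (w[0 := a])) \<in> ahom A G" using q[OF w] 0 by (simp add: bml_def)
  from ahom_closed[OF this, of "w ! 0"] show ?thesis
   using w nth_carrier[of w 0] 0 by (simp add: word_gens_iff)
 qed
 have kills: "frag_lift G q r = \<zero>\<^bsub>G\<^esub>" if r: "r \<in> word_rels K A l" for r
 proof -
  consider us a b vs where "r = frag_of (us @ [a \<oplus>\<^bsub>A\<^esub> b] @ vs) - frag_of (us @ [a] @ vs) - frag_of (us @ [b] @ vs)"
    "us @ [a] @ vs \<in> word_gens A l" "b \<in> carrier A"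
   | us a vs b ws c where "r = frag_of (us @ [c \<odot>\<^sub>A a] @ vs @ [b] @ ws) - frag_of (us @ [a] @ vs @ [c \<odot>\<^sub>A b] @ ws)"
    "us @ [a] @ vs @ [b] @ ws \<in> word_gens A l" "c \<in> carrier K"
   using r unfolding word_rels_def by blast
  thus ?thesis
  proof cases
   case 1
   let ?w = "us @ [a] @ vs"
   have "\<forall>k<length ?w. (%a. q (?w[k := a])) \<in> ahom A G" using q[OF 1(2)] unfolding bml_def by blast
   from this[rule_format, of "length us"] have "(%x. q (?w[length us := x])) \<in> ahom A G" by simp
   moreover have "?w[length us := x] = us @ [x] @ vs" for x by (simp add: list_update_append)
   ultimately have h: "(%x. q (us @ [x] @ vs)) \<in> ahom A G" by simp
   have a: "a \<in> carrier A" using 1(2) by (simp add: word_gens_iff)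
   have "frag_lift G q r = q (us @ [a \<oplus>\<^bsub>A\<^esub> b] @ vs) \<ominus>\<^bsub>G\<^esub> q (us @ [a] @ vs) \<ominus>\<^bsub>G\<^esub> q (us @ [b] @ vs)"
    unfolding 1(1) by (rule G.frag_lift_rel3) (use ahom_closed[OF h] a 1(3) in auto)
   also have "... = \<zero>\<^bsub>G\<^esub>"
    unfolding ahom_add[OF h a 1(3)] by (rule G.add_minus_minus[OF ahom_closed[OF h a] ahom_closed[OF h 1(3)]])
   finally show ?thesis .
  next
   case 2
   let ?w = "us @ [a] @ vs @ [b] @ ws"
   let ?j = "length us" and ?k = "Suc (length us + length vs)"
   have jk: "?w ! ?j = a" "?w ! ?k = b" by (simp_all add: nth_append)
   have up: "?w[?j := x] = us @ [x] @ vs @ [b] @ ws" "?w[?k := x] = us @ [a] @ vs @ [x] @ ws" for x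
    by (simp_all add: list_update_append)
   have "\<forall>c\<in>carrier K. \<forall>j<length ?w. \<forall>k<length ?w. q (?w[j := c \<odot>\<^sub>A ?w ! j]) = q (?w[k := c \<odot>\<^sub>A ?w ! k])"
    using q[OF 2(2)] unfolding bml_def by (rule conjunct2)
   hence "q (?w[?j := c \<odot>\<^sub>A ?w ! ?j]) = q (?w[?k := c \<odot>\<^sub>A ?w ! ?k])"
    by (elim ballE[of _ _ c] allE[of _ ?j] allE[of _ ?k] impE) (simp_all only: length_append list.size, simp_all add: 2(3))
   hence eq: "q (us @ [c \<odot>\<^sub>A a] @ vs @ [b] @ ws) = q (us @ [a] @ vs @ [c \<odot>\<^sub>A b] @ ws)"
    by (simp only: jk up)
   have "us @ [a] @ vs @ [c \<odot>\<^sub>A b] @ ws \<in> word_gens A l"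
    using 2(2,3) by (simp add: word_gens_iff)
   thus ?thesis
    unfolding 2(1) by (subst G.frag_lift_rel2) (simp_all only: eq c G.minus_eq G.r_neg)
  qed
 qed
 show "pres_lift G q \<in> ahom (words K A l) G"
  unfolding words_def by (rule presentation.pres_lift_hom[OF word_presentation G c kills])
 show "w \<in> word_gens A l ==> pres_lift G q (word K A l w) = q w"
  unfolding word_def by (rule presentation.pres_lift_gen[OF word_presentation G c kills])
qed

lemma words_hom_eq:
 assumes "f \<in> ahom (words K A l) G" "g \<in> ahom (words K A l) G" "abelian_group G"
  "!!w. w \<in> word_gens A l ==> f (word K A l w) = g (word K A l w)" "u \<in> carrier (words K A l)"
 shows "f u = g u"
 by (rule presentation.pres_hom_eq[OF word_presentation assms(1-3)[unfolded words_def]])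
   (use assms(4,5) in \<open>simp_all add: word_def words_def\<close>)

end

text \<open>Asks of the grading only subgroups stable under the left action, which is what will be
  shown for the bar complex.\<close>

lemma Tr_grade_image:
 assumes "trace_group K A M" "asubgroup (grade M n) M"
  and left: "!!a x. [|a \<in> carrier A; x \<in> grade M n|] ==> a \<odot>\<^bsub>M\<^esub> x \<in> grade M n"
 shows "Tr_grade A M n = (%x. tr_gen A M \<one>\<^bsub>A\<^esub> x) ` grade M n"
proof -
 interpret trace_group K A M by fact
 note c = M.asubgroup_carrier[OF assms(2)]
 have "agenerate (Tr A M) {tr_gen A M a x |a x. a \<in> carrier A & x \<in> grade M n} <= (%x. tr x) ` grade M n"
 proof (rule Tr.generate_subset[OF tr_image_subgroup[OF assms(2)]], clarify)
  fix a x assume ax: "a \<in> carrier A" "x \<in> grade M n"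
  thus "tr_gen A M a x \<in> (%x. tr x) ` grade M n"
   unfolding tr_gen_eq[OF ax(1) c[OF ax(2)]] by (intro imageI left)
 qed
 moreover have "(%x. tr x) ` grade M n <= agenerate (Tr A M) {tr_gen A M a x |a x. a \<in> carrier A & x \<in> grade M n}"
  by (auto simp: agenerate_def intro!: generate.incl)
 ultimately show ?thesis by (auto simp: Tr_grade_def agenerate_def)
qed

section \<open>The bar complex as a complex of bimodules\<close>

context assoc_algebra
begin

abbreviation "Br == Bar K A"
abbreviation Br_smult (infixl "\<odot>\<^sub>B" 70) where "a \<odot>\<^sub>B u == a \<odot>\<^bsub>Br\<^esub> u"
abbreviation Br_ract (infixl "\<triangleleft>\<^sub>B" 70) where "u \<triangleleft>\<^sub>B a == u \<triangleleft>\<^bsub>Br\<^esub> a"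
abbreviation "wd == word K A 2"

lemma carrier_Bar: "carrier Br = carrier (words K A 2)"
 and add_Bar: "add Br = add (words K A 2)"
 and zero_Bar: "zero Br = zero (words K A 2)"
 by (simp_all add: Bar_def Let_def)

lemma ahom_Bar: "ahom Br G = ahom (words K A 2) G" "ahom G Br = ahom G (words K A 2)"
 by (simp_all add: ahom_def hom_def carrier_Bar add_Bar)

lemma ag_Bar: "abelian_group Br"
 by (rule abelian_group_cong[OF ag_words carrier_Bar add_Bar zero_Bar])

interpretation Br: abelian_group Br by (rule ag_Bar)

lemma bml_Bar: "bml Br q w = bml (words K A 2) q w"
 by (simp add: bml_def ahom_Bar)

lemma wd_closed: "w \<in> word_gens A 2 ==> wd w \<in> carrier Br"
 unfolding carrier_Bar by (rule word_closed)

lemma wd_bml: "w \<in> word_gens A 2 ==> bml Br wd w"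
 unfolding bml_Bar by (rule word_bml)

lemma Bar_hom_eq:
 assumes "f \<in> ahom Br G" "g \<in> ahom Br G" "abelian_group G"
  "!!w. w \<in> word_gens A 2 ==> f (wd w) = g (wd w)" "u \<in> carrier Br"
 shows "f u = g u"
 by (rule words_hom_eq[OF assms(1,2)[unfolded ahom_Bar] assms(3,4) assms(5)[unfolded carrier_Bar]])

lemma gens_update: "[|w \<in> word_gens A l; a \<in> carrier A|] ==> w[k := a] \<in> word_gens A l"
 by (simp add: word_gens_iff update_lists del: in_lists_conv_set)

lemma gens_nth: "[|w \<in> word_gens A l; k < length w|] ==> w ! k \<in> carrier A"
 by (rule nth_carrier) (simp_all only: word_gens_iff)

definition "scale_first a w = w[0 := a \<otimes>\<^sub>A w ! 0]"
definition "scale_last a w = w[length w - 1 := w ! (length w - 1) \<otimes>\<^sub>A a]"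

lemma scale_first_eq: "w ~= [] ==> (a \<otimes>\<^sub>A hd w) # tl w = scale_first a w"
 by (cases w) (simp_all add: scale_first_def)

lemma scale_last_eq: "w ~= [] ==> butlast w @ [last w \<otimes>\<^sub>A a] = scale_last a w"
 by (cases w rule: rev_cases) (simp_all add: scale_last_def)

lemma gens_nonempty: "[|w \<in> word_gens A l; 0 < l|] ==> w ~= []"
 by (auto simp: word_gens_iff)

lemma gens_length: "w \<in> word_gens A l ==> l <= length w"
 by (simp add: word_gens_iff)

lemma gens_lists: "w \<in> word_gens A l ==> w \<in> A_lists"
 by (simp only: word_gens_iff)

lemma scale_gens:
 assumes "w \<in> word_gens A l" "0 < l" "a \<in> carrier A"
 shows "scale_first a w \<in> word_gens A l" "scale_last a w \<in> word_gens A l"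
proof -
 have "0 < length w" using gens_length[OF assms(1)] assms(2) by linarith
 thus "scale_first a w \<in> word_gens A l" "scale_last a w \<in> word_gens A l"
  unfolding scale_first_def scale_last_def
  by (intro gens_update assms A.m_closed gens_nth[OF assms(1)]; simp)+
qed

lemma scale_bml:
 assumes w: "w \<in> word_gens A l" and l: "0 < l" and a: "a \<in> carrier A"
  and q: "!!w. w \<in> word_gens A l ==> bml G q w"
 shows "bml G (%w. q (scale_first a w)) w" "bml G (%w. q (scale_last a w)) w"
proof -
 have len: "0 < length w" using gens_length[OF w] l by linarith
 show "bml G (%w. q (scale_first a w)) w"
 proof (rule bml_letterwise[where q = q and \<rho> = "scale_first a", OF gens_lists[OF w] _ q[OF scale_gens(1)[OF w l a]]])
  show "letterwise w (scale_first a)"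
   unfolding scale_first_def[abs_def]
   by (rule letterwise_update[where i = "%_. 0", OF letter_maps(2)[OF a] refl len])
 qed
 show "bml G (%w. q (scale_last a w)) w"
 proof (rule bml_letterwise[where q = q and \<rho> = "scale_last a", OF gens_lists[OF w] _ q[OF scale_gens(2)[OF w l a]]])
  show "letterwise w (scale_last a)"
   unfolding scale_last_def[abs_def]
   by (rule letterwise_update[where i = "%w. length w - 1" and \<phi> = "%x. x \<otimes>\<^sub>A a", OF letter_maps(3)[OF a]])
     (use len in simp_all)
 qed
qed

lemma smult_Bar:
 assumes a: "a \<in> carrier A"
 shows smult_Bar_ahom: "(%u. a \<odot>\<^sub>B u) \<in> ahom Br Br"
  and smult_wd: "w \<in> word_gens A 2 ==> a \<odot>\<^sub>B wd w = wd (scale_first a w)"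
proof -
 have b: "bml (words K A 2) (%as. wd ((a \<otimes>\<^sub>A hd as) # tl as)) w" if w: "w \<in> word_gens A 2" for w
 proof (rule bml_cong[OF scale_bml(1)[OF w _ a word_bml] gens_lists[OF w]])
  fix k x assume "x \<in> carrier A"
  show "wd (scale_first a (w[k := x])) = wd ((a \<otimes>\<^sub>A hd (w[k := x])) # tl (w[k := x]))"
   using gens_nonempty[OF w] by (subst scale_first_eq) simp_all
 qed simp_all
 have e: "(%u. a \<odot>\<^sub>B u) = pres_lift (words K A 2) (%as. wd ((a \<otimes>\<^sub>A hd as) # tl as))"
  by (simp add: Bar_def Let_def)
 show "(%u. a \<odot>\<^sub>B u) \<in> ahom Br Br"
  unfolding e ahom_Bar by (rule word_lift_hom[OF ag_words _ b]) simp_all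
 show "a \<odot>\<^sub>B wd w = wd (scale_first a w)" if w: "w \<in> word_gens A 2"
  using fun_cong[OF e, of "wd w"] word_lift_word[OF ag_words _ b w] scale_first_eq[OF gens_nonempty[OF w]] by simp
qed

lemma ract_Bar:
 assumes a: "a \<in> carrier A"
 shows ract_Bar_ahom: "(%u. u \<triangleleft>\<^sub>B a) \<in> ahom Br Br"
  and ract_wd: "w \<in> word_gens A 2 ==> wd w \<triangleleft>\<^sub>B a = wd (scale_last a w)"
proof -
 have b: "bml (words K A 2) (%as. wd (butlast as @ [last as \<otimes>\<^sub>A a])) w" if w: "w \<in> word_gens A 2" for w
 proof (rule bml_cong[OF scale_bml(2)[OF w _ a word_bml] gens_lists[OF w]])
  fix k x assume "x \<in> carrier A"
  show "wd (scale_last a (w[k := x])) = wd (butlast (w[k := x]) @ [last (w[k := x]) \<otimes>\<^sub>A a])"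
   using gens_nonempty[OF w] by (subst scale_last_eq) simp_all
 qed simp_all
 have e: "(%u. u \<triangleleft>\<^sub>B a) = pres_lift (words K A 2) (%as. wd (butlast as @ [last as \<otimes>\<^sub>A a]))"
  by (simp add: Bar_def Let_def)
 show "(%u. u \<triangleleft>\<^sub>B a) \<in> ahom Br Br"
  unfolding e ahom_Bar by (rule word_lift_hom[OF ag_words _ b]) simp_all
 show "wd w \<triangleleft>\<^sub>B a = wd (scale_last a w)" if w: "w \<in> word_gens A 2"
  using fun_cong[OF e, of "wd w"] word_lift_word[OF ag_words _ b w] scale_last_eq[OF gens_nonempty[OF w]] by simp
qed

lemma bml_add:
 assumes "bml G q w" "k < length w" "a \<in> carrier A" "b \<in> carrier A"
 shows "q (w[k := a \<oplus>\<^bsub>A\<^esub> b]) = q (w[k := a]) \<oplus>\<^bsub>G\<^esub> q (w[k := b])"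
proof -
 have "(%a. q (w[k := a])) \<in> ahom A G" using assms(1,2) by (simp add: bml_def)
 from ahom_add[OF this assms(3,4)] show ?thesis .
qed

lemma bml_scal:
 assumes "bml G q w" "j < length w" "k < length w" "c \<in> carrier K"
 shows "q (w[j := c \<odot>\<^sub>A w ! j]) = q (w[k := c \<odot>\<^sub>A w ! k])"
 using assms unfolding bml_def by blast

lemma bimodule_Bar: "bimodule K A Br"
proof -
 note E = Bar_hom_eq[OF _ _ ag_Bar]
 note sm = smult_Bar_ahom and ra = ract_Bar_ahom
 note pl = ahom_plus[OF ag_Bar ag_Bar]
 note sg = scale_gens(1)[OF _ zero_less_numeral] scale_gens(2)[OF _ zero_less_numeral]
 have idx: "0 < length w" "length w - 1 < length w" "length w - 1 ~= 0" "w ! 0 \<in> carrier A" "w ! (length w - 1) \<in> carrier A"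
  if w: "w \<in> word_gens A 2" for w
 proof -
  have l: "0 < length w" "length w - 1 < length w" "length w - 1 ~= 0" using gens_length[OF w] by linarith+
  show "0 < length w" "length w - 1 < length w" "length w - 1 ~= 0" "w ! 0 \<in> carrier A" "w ! (length w - 1) \<in> carrier A"
   by (rule l gens_nth[OF w l(1)] gens_nth[OF w l(2)])+
 qed
 show ?thesis
 proof (unfold_locales, goal_cases)
  case (1 a x) thus ?case by (simp add: ahom_closed[OF sm])
 next
  case (2 a b x)
  show ?case
  proof (rule E[OF sm pl[OF sm sm] _ 2(3)])
   fix w assume w: "w \<in> word_gens A 2"
   thus "(a \<oplus>\<^bsub>A\<^esub> b) \<odot>\<^sub>B wd w = a \<odot>\<^sub>B wd w \<oplus>\<^bsub>Br\<^esub> b \<odot>\<^sub>B wd w"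
    using bml_add[OF wd_bml[OF w] idx(1)[OF w], of "a \<otimes>\<^sub>A w ! 0" "b \<otimes>\<^sub>A w ! 0"] 2(1,2) idx(4)[OF w]
    by (simp add: smult_wd scale_first_def A.l_distr)
  qed (use 2 in simp_all)
 next
  case (3 a x y) thus ?case by (simp add: ahom_add[OF sm])
 next
  case (4 a b x)
  show ?case
  proof (rule E[OF sm ahom_comp[OF sm sm] _ 4(3)])
   fix w assume w: "w \<in> word_gens A 2"
   show "(a \<otimes>\<^sub>A b) \<odot>\<^sub>B wd w = a \<odot>\<^sub>B (b \<odot>\<^sub>B wd w)"
    using idx[OF w] 4(1,2) by (simp add: smult_wd w sg) (simp add: scale_first_def A.m_assoc)
  qed (use 4 in simp_all)
 next
  case (5 x)
  show ?case
  proof (rule E[OF sm ahom_id(1) _ 5])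
   fix w assume w: "w \<in> word_gens A 2"
   show "\<one>\<^sub>A \<odot>\<^sub>B wd w = wd w"
    using idx[OF w] by (simp add: smult_wd w) (simp add: scale_first_def)
  qed simp
 next
  case (6 a x) thus ?case by (simp add: ahom_closed[OF ra])
 next
  case (7 a b x)
  show ?case
  proof (rule E[OF ra pl[OF ra ra] _ 7(3)])
   fix w assume w: "w \<in> word_gens A 2"
   thus "wd w \<triangleleft>\<^sub>B (a \<oplus>\<^bsub>A\<^esub> b) = wd w \<triangleleft>\<^sub>B a \<oplus>\<^bsub>Br\<^esub> wd w \<triangleleft>\<^sub>B b"
    using bml_add[OF wd_bml[OF w] idx(2)[OF w], of "w ! (length w - 1) \<otimes>\<^sub>A a" "w ! (length w - 1) \<otimes>\<^sub>A b"] 7(1,2) idx(5)[OF w]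
    by (simp add: ract_wd scale_last_def A.r_distr)
  qed (use 7 in simp_all)
 next
  case (8 a x y) thus ?case by (simp add: ahom_add[OF ra])
 next
  case (9 a b x)
  show ?case
  proof (rule E[OF ra ahom_comp[OF ra ra] _ 9(3)])
   fix w assume w: "w \<in> word_gens A 2"
   show "wd w \<triangleleft>\<^sub>B (a \<otimes>\<^sub>A b) = wd w \<triangleleft>\<^sub>B a \<triangleleft>\<^sub>B b"
    using idx[OF w] 9(1,2) by (simp add: ract_wd w sg) (simp add: scale_last_def A.m_assoc)
  qed (use 9 in simp_all)
 next
  case (10 x)
  show ?case
  proof (rule E[OF ra ahom_id(1) _ 10])
   fix w assume w: "w \<in> word_gens A 2"
   show "wd w \<triangleleft>\<^sub>B \<one>\<^sub>A = wd w"
    using idx[OF w] by (simp add: ract_wd w) (simp add: scale_last_def)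
  qed simp
 next
  case (11 a b x)
  show ?case
  proof (rule E[OF ahom_comp[OF sm ra] ahom_comp[OF ra sm] _ 11(3)])
   fix w assume w: "w \<in> word_gens A 2"
   have "scale_last b (scale_first a w) = scale_first a (scale_last b w)"
    using idx[OF w] unfolding scale_first_def scale_last_def
    by (simp add: list_update_swap)
   thus "(a \<odot>\<^sub>B wd w) \<triangleleft>\<^sub>B b = a \<odot>\<^sub>B (wd w \<triangleleft>\<^sub>B b)"
    using 11(1,2) by (simp add: smult_wd ract_wd w sg)
  qed (use 11 in simp_all)
 next
  case (12 c x)
  show ?case
  proof (rule E[OF sm ra _ 12(2)])
   fix w assume w: "w \<in> word_gens A 2"
   show "c \<odot>\<^sub>A \<one>\<^sub>A \<odot>\<^sub>B wd w = wd w \<triangleleft>\<^sub>B (c \<odot>\<^sub>A \<one>\<^sub>A)"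
    using bml_scal[OF wd_bml[OF w] idx(1,2)[OF w] 12(1)] 12(1) idx[OF w]
    by (simp add: smult_wd ract_wd w) (simp add: scale_first_def scale_last_def smult_mult_left smult_mult_right)
  qed (use 12 in simp_all)
 qed
qed

interpretation Br: bimodule K A Br by (rule bimodule_Bar)

lemma trace_group_Bar: "trace_group K A Br"
 by (intro trace_group.intro assoc_algebra_axioms bimodule_Bar)

text \<open>The functions on words that extend to bimodule homomorphisms on the bar complex: the
  outer letters carry the two actions.\<close>

definition barfun :: "('c, 'n, 'y) bimodule_scheme => ('c list => 'n) => bool" where
 "barfun N q \<longleftrightarrow> (\<forall>w\<in>word_gens A 2. bml N q w &
   (\<forall>a\<in>carrier A. q (scale_first a w) = a \<odot>\<^bsub>N\<^esub> q w & q (scale_last a w) = q w \<triangleleft>\<^bsub>N\<^esub> a))"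

lemma bar_lift:
 assumes N: "bimodule K A N" and q: "barfun N q"
 shows bar_lift_hom: "pres_lift N q \<in> bimod_hom A Br N"
  and bar_lift_wd: "w \<in> word_gens A 2 ==> pres_lift N q (wd w) = q w"
proof -
 interpret N: bimodule K A N by fact
 have b: "bml N q w" if "w \<in> word_gens A 2" for w using q that by (simp add: barfun_def)
 have h: "pres_lift N q \<in> ahom Br N"
  unfolding ahom_Bar by (rule word_lift_hom[OF N.ag _ b]) simp_all
 show v: "pres_lift N q (wd w) = q w" if "w \<in> word_gens A 2" for w
  by (rule word_lift_word[OF N.ag _ b that]) simp_all
 note sg = scale_gens(1)[OF _ zero_less_numeral] scale_gens(2)[OF _ zero_less_numeral]
 show "pres_lift N q \<in> bimod_hom A Br N"
 proof (rule bimod_homI[OF h])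
  fix a u assume a: "a \<in> carrier A" and u: "u \<in> carrier Br"
  show "pres_lift N q (a \<odot>\<^sub>B u) = a \<odot>\<^bsub>N\<^esub> pres_lift N q u"
   by (rule Bar_hom_eq[OF ahom_comp[OF smult_Bar_ahom[OF a] h] ahom_comp[OF h N.smult_ahom[OF a]] N.ag _ u])
     (use q a in \<open>simp add: smult_wd v sg barfun_def\<close>)
  show "pres_lift N q (u \<triangleleft>\<^sub>B a) = pres_lift N q u \<triangleleft>\<^bsub>N\<^esub> a"
   by (rule Bar_hom_eq[OF ahom_comp[OF ract_Bar_ahom[OF a] h] ahom_comp[OF h N.ract_ahom[OF a]] N.ag _ u])
     (use q a in \<open>simp add: ract_wd v sg barfun_def\<close>)
 qed
qed

lemma face_scale_first:
 assumes w: "w \<in> A_lists" "Suc i < length w" and a: "a \<in> carrier A"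
 shows "face i (scale_first a w) = scale_first a (face i w)"
proof -
 have l: "0 < length w" "i < length w" using w(2) by linarith+
 note c = nth_carrier[OF w(1) l(1)] nth_carrier[OF w(1) l(2)] nth_carrier[OF w(1,2)]
 show ?thesis
  unfolding scale_first_def using w(2) a c l
  by (cases "i = 0") (simp_all add: face_update nth_face A.m_assoc)
qed

lemma face_scale_last:
 assumes w: "w \<in> A_lists" "Suc i < length w" and a: "a \<in> carrier A"
 shows "face i (scale_last a w) = scale_last a (face i w)"
proof -
 have l: "length w - 1 < length w" "i < length w" using w(2) by linarith+
 note c = nth_carrier[OF w(1) l(1)] nth_carrier[OF w(1) l(2)] nth_carrier[OF w(1,2)]
 consider "length w = i + 2" | m where "length w = i + 3 + m"
  using w(2) le_Suc_ex[of "i + 3" "length w"] by fastforce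
 thus ?thesis
  unfolding scale_last_def using a c
  by cases (simp_all add: face_update nth_face length_face A.m_assoc)
qed

text \<open>Words with fewer than two letters get the value zero. With this default one formula,
  evaluation of \<open>face_sum\<close>, describes the differential in degree 0 as well, where the
  definition of the complex needs a separate case.\<close>

definition "wz w = (if w \<in> word_gens A 2 then wd w else \<zero>\<^bsub>Br\<^esub>)"

lemma wz_closed: "wz w \<in> carrier Br"
 by (simp add: wz_def wd_closed)

lemma face_gens: "[|w \<in> A_lists; Suc i < length w; l < length w|] ==> face i w \<in> word_gens A l"
 unfolding word_gens_iff by (simp add: face_lists length_face del: in_lists_conv_set)

lemma frag_lift_face_sum:
 assumes "abelian_group G" "!!w. b w \<in> carrier G"
 shows "frag_lift G b (face_sum w) = (\<Oplus>\<^bsub>G\<^esub>i\<in>{..<length w - 1}. sgn_elt G (int i) (b (face i w)))"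
 unfolding face_sum_def by (rule abelian_group.frag_lift_signed_sum[OF assms]) simp

lemma Bar_boundary_eq:
 assumes w: "w \<in> word_gens A 2"
 shows "(if length w = 2 then \<zero>\<^bsub>words K A 2\<^esub> else
      (\<Oplus>\<^bsub>words K A 2\<^esub>i \<in> {..<length w - 1}. sgn_elt (words K A 2) (int i) (wd (face i w)))) = frag_lift Br wz (face_sum w)"
proof (cases "length w = 2")
 case True
 hence "wz (face i w) = \<zero>\<^bsub>Br\<^esub>" if "i < length w - 1" for i
  using that by (simp add: wz_def word_gens_iff length_face)
 hence "frag_lift Br wz (face_sum w) = (\<Oplus>\<^bsub>Br\<^esub>i\<in>{..<length w - 1}. \<zero>\<^bsub>Br\<^esub>)"
  unfolding frag_lift_face_sum[OF ag_Bar wz_closed] by (intro Br.finsum_cong') auto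
 hence "frag_lift Br wz (face_sum w) = \<zero>\<^bsub>Br\<^esub>" by (simp only: Br.finsum_zero)
 thus ?thesis using True by (simp add: zero_Bar)
next
 case False
 interpret W: abelian_group "words K A 2" by (rule ag_words)
 have f: "face i w \<in> word_gens A 2" if "i < length w - 1" for i
  using that False gens_length[OF w] by (intro face_gens[OF gens_lists[OF w]]) auto
 have sg: "sgn_elt Br = sgn_elt (words K A 2)"
  using a_inv_cong[OF carrier_Bar add_Bar zero_Bar] by (simp add: sgn_elt_def fun_eq_iff)
 have fs: "finsum Br = finsum (words K A 2)"
  by (simp add: finsum_def finprod_def carrier_Bar add_Bar zero_Bar fun_eq_iff)
 show ?thesis
  unfolding frag_lift_face_sum[OF ag_Bar wz_closed] sg fs
 proof -
  have "(\<Oplus>\<^bsub>words K A 2\<^esub>i \<in> {..<length w - 1}. sgn_elt (words K A 2) (int i) (wd (face i w)))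
    = (\<Oplus>\<^bsub>words K A 2\<^esub>i \<in> {..<length w - 1}. sgn_elt (words K A 2) (int i) (wz (face i w)))"
   by (rule W.finsum_cong'[OF refl]) (simp_all add: wz_def f word_closed)
  thus "(if length w = 2 then \<zero>\<^bsub>words K A 2\<^esub> else
      (\<Oplus>\<^bsub>words K A 2\<^esub>i \<in> {..<length w - 1}. sgn_elt (words K A 2) (int i) (wd (face i w))))
    = (\<Oplus>\<^bsub>words K A 2\<^esub>i \<in> {..<length w - 1}. sgn_elt (words K A 2) (int i) (wz (face i w)))"
   using False by simp
 qed
qed

lemma wz_bml_face:
 assumes w: "w \<in> A_lists" and k: "k < length w - 1"
 shows "bml Br (%w. wz (face k w)) w"
proof (cases "2 < length w")
 case True
 have k': "Suc k < length w" using k by linarith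
 have g: "face k w \<in> word_gens A 2" by (rule face_gens[OF w k' True])
 show ?thesis
 proof (rule bml_cong[OF bml_letterwise[where q = wd and \<rho> = "face k", OF w letterwise_face[OF w k'] wd_bml[OF g]] w])
  fix j a assume "j < length w" and a: "a \<in> carrier A"
  have "face k (w[j := a]) \<in> word_gens A 2"
   by (rule face_gens[OF update_lists[OF w a]]) (use k' True in simp_all)
  thus "wd (face k (w[j := a])) = wz (face k (w[j := a]))" by (simp add: wz_def)
 qed
next
 case False
 have z: "wz (face k (w[j := a])) = \<zero>\<^bsub>Br\<^esub>" for j a
 proof -
  have "length (face k (w[j := a])) = length w - 1" using k by (simp add: length_face)
  hence "~ 2 <= length (face k (w[j := a]))" using False by linarith
  thus ?thesis unfolding wz_def word_gens_iff by simp
 qed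
 show ?thesis
  unfolding bml_def using z by (simp add: ahom_const_zero[OF A.ag ag_Bar])
qed

lemma bml_face_sum:
 assumes w: "w \<in> A_lists"
 shows "bml Br (%w. frag_lift Br wz (face_sum w)) w"
proof (rule bml_cong[OF bml_finsum[OF ag_Bar _ w] w])
 fix i assume "i \<in> {..<length w - 1}"
 hence "bml Br (%w. wz (face i w)) w" by (intro wz_bml_face[OF w]) simp
 thus "bml Br (%w. sgn_elt Br (int i) (wz (face i w))) w"
  by (rule bml_hom) (rule ahom_sgn_elt[OF ag_Bar ag_Bar ahom_id(1)])
qed (simp add: frag_lift_face_sum[OF ag_Bar wz_closed])

lemma wz_scale:
 assumes w: "w \<in> A_lists" "w ~= []" and a: "a \<in> carrier A"
 shows "wz (scale_first a w) = a \<odot>\<^sub>B wz w" "wz (scale_last a w) = wz w \<triangleleft>\<^sub>B a"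
proof -
 have i: "scale_first a w \<in> word_gens A 2 \<longleftrightarrow> w \<in> word_gens A 2" "scale_last a w \<in> word_gens A 2 \<longleftrightarrow> w \<in> word_gens A 2"
  using scale_gens[of w 1 a] w a by (simp_all add: word_gens_iff Suc_le_eq scale_first_def scale_last_def)
 show "wz (scale_first a w) = a \<odot>\<^sub>B wz w"
  unfolding wz_def i using a by (simp add: smult_wd Br.smult_zero)
 show "wz (scale_last a w) = wz w \<triangleleft>\<^sub>B a"
  unfolding wz_def i using a by (simp add: ract_wd Br.ract_zero)
qed

lemma barfun_face_sum: "barfun Br (%w. frag_lift Br wz (face_sum w))"
 unfolding barfun_def
proof (intro ballI conjI)
 fix w assume w: "w \<in> word_gens A 2"
 note wl = gens_lists[OF w]
 show "bml Br (%w. frag_lift Br wz (face_sum w)) w" by (rule bml_face_sum[OF wl])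
 fix a assume a: "a \<in> carrier A"
 have f: "face i w \<in> A_lists" "face i w ~= []" "Suc i < length w" if "i \<in> {..<length w - 1}" for i
 proof -
  show "Suc i < length w" using that by auto
  thus "face i w \<in> A_lists" by (rule face_lists[OF wl])
  show "face i w ~= []" by (simp add: face_def)
 qed
 have sc: "sgn_elt Br k (a \<odot>\<^sub>B x) = a \<odot>\<^sub>B sgn_elt Br k x" "sgn_elt Br k (x \<triangleleft>\<^sub>B a) = sgn_elt Br k x \<triangleleft>\<^sub>B a"
  if "x \<in> carrier Br" for k x
  using that a by (simp_all add: Br.smult_sgn Br.ract_sgn)
 have len: "length (scale_first a w) = length w" "length (scale_last a w) = length w"
  by (simp_all add: scale_first_def scale_last_def)
 have c: "(%i. sgn_elt Br (int i) (wz (face i w))) \<in> I \<rightarrow> carrier Br" for I by (simp add: wz_closed)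
 have cl: "(%i. a \<odot>\<^sub>B sgn_elt Br (int i) (wz (face i w))) \<in> I \<rightarrow> carrier Br"
  "(%i. sgn_elt Br (int i) (wz (face i w)) \<triangleleft>\<^sub>B a) \<in> I \<rightarrow> carrier Br" for I
  by (simp_all add: wz_closed a Br.left_closed Br.right_closed)
 show "frag_lift Br wz (face_sum (scale_first a w)) = a \<odot>\<^sub>B frag_lift Br wz (face_sum w)"
  unfolding frag_lift_face_sum[OF ag_Bar wz_closed] len Br.smult_finsum[OF a c]
  by (rule Br.finsum_cong'[OF refl cl(1)]) (simp only: face_scale_first[OF wl f(3) a] wz_scale(1)[OF f(1,2) a] sc(1)[OF wz_closed])
 show "frag_lift Br wz (face_sum (scale_last a w)) = frag_lift Br wz (face_sum w) \<triangleleft>\<^sub>B a"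
  unfolding frag_lift_face_sum[OF ag_Bar wz_closed] len Br.ract_finsum[OF a c]
  by (rule Br.finsum_cong'[OF refl cl(2)]) (simp only: face_scale_last[OF wl f(3) a] wz_scale(2)[OF f(1,2) a] sc(2)[OF wz_closed])
qed

lemma diff_Bar_hom: "diff Br \<in> bimod_hom A Br Br"
 and diff_wd: "w \<in> word_gens A 2 ==> diff Br (wd w) = frag_lift Br wz (face_sum w)"
proof -
 let ?q = "%w. if length w = 2 then \<zero>\<^bsub>words K A 2\<^esub> else
      (\<Oplus>\<^bsub>words K A 2\<^esub>i \<in> {..<length w - 1}. sgn_elt (words K A 2) (int i) (wd (face i w)))"
 have e: "diff Br = pres_lift (words K A 2) ?q"
  unfolding Bar_def Let_def face_def by simp
 have bW: "bml (words K A 2) ?q w" if w: "w \<in> word_gens A 2" for w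
  by (rule bml_cong[OF bml_face_sum[OF gens_lists[OF w], unfolded bml_Bar] gens_lists[OF w]])
    (simp only: Bar_boundary_eq[OF gens_update[OF w]])
 have h: "diff Br \<in> ahom Br Br"
  unfolding e ahom_Bar by (rule word_lift_hom[OF ag_words _ bW]) simp_all
 show v: "diff Br (wd w) = frag_lift Br wz (face_sum w)" if w: "w \<in> word_gens A 2" for w
  unfolding e using word_lift_word[OF ag_words _ bW w] by (simp only: Bar_boundary_eq[OF w] zero_less_numeral)
 have ext: "diff Br u = pres_lift Br (%w. frag_lift Br wz (face_sum w)) u" if "u \<in> carrier Br" for u
  by (rule Bar_hom_eq[OF h bimod_hom_ahom[OF bar_lift_hom[OF bimodule_Bar barfun_face_sum]] ag_Bar _ that])
    (simp only: v bar_lift_wd[OF bimodule_Bar barfun_face_sum])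
 note L = bar_lift_hom[OF bimodule_Bar barfun_face_sum]
 show "diff Br \<in> bimod_hom A Br Br"
  by (rule bimod_homI[OF h])
    (simp_all only: ext Br.left_closed Br.right_closed left_hom_smult[OF bimod_hom_left[OF L]] bimod_hom_ract[OF L])
qed

lemma keys_face_sum:
 assumes "w \<in> A_lists" "v \<in> Poly_Mapping.keys (face_sum w)" shows "v \<in> A_lists"
proof -
 have "Poly_Mapping.keys (face_sum w) <= (\<Union>k\<in>{..<length w - 1}. Poly_Mapping.keys (frag_cmul ((- 1) ^ k) (frag_of (face k w))))"
  unfolding face_sum_def by (rule keys_sum)
 then obtain k where "k < length w - 1" "v \<in> Poly_Mapping.keys (frag_cmul ((- 1) ^ k) (frag_of (face k w)))"
  using assms(2) by blast
 thus ?thesis using face_lists[OF assms(1), of k] by simp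
qed

lemma diff_wz: assumes w: "w \<in> A_lists" shows "diff Br (wz w) = frag_lift Br wz (face_sum w)"
proof (cases "w \<in> word_gens A 2")
 case True thus ?thesis by (simp add: wz_def diff_wd)
next
 case False
 hence "length w - 1 = 0" using w unfolding word_gens_iff by auto
 thus ?thesis
  using False by (simp add: wz_def face_sum_def ahom_zero[OF ag_Bar ag_Bar bimod_hom_ahom[OF diff_Bar_hom]])
qed

lemma diff_diff_Bar: assumes u: "u \<in> carrier Br" shows "diff Br (diff Br u) = \<zero>\<^bsub>Br\<^esub>"
proof -
 note h = bimod_hom_ahom[OF diff_Bar_hom]
 show ?thesis
 proof (rule Bar_hom_eq[OF ahom_comp[OF h h] ahom_const_zero[OF ag_Bar ag_Bar] ag_Bar _ u])
  fix w assume w: "w \<in> word_gens A 2"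
  have fc: "frag_lift Br wz z \<in> carrier Br" for z by (rule Br.frag_lift_closed[OF wz_closed])
  have "diff Br (diff Br (wd w)) = frag_lift Br (%v. diff Br (wz v)) (face_sum w)"
   unfolding diff_wd[OF w] by (rule Br.ahom_frag_lift[OF h ag_Bar wz_closed])
  also have "... = frag_lift Br (%v. frag_lift Br wz (face_sum v)) (face_sum w)"
   by (rule Br.frag_lift_cong) (simp_all only: diff_wz[OF keys_face_sum[OF gens_lists[OF w]]] fc)
  also have "... = frag_lift Br wz (frag_extend face_sum (face_sum w))"
   by (rule Br.frag_lift_extend[OF wz_closed])
  finally show "diff Br (diff Br (wd w)) = \<zero>\<^bsub>Br\<^esub>"
   by (simp only: face_sum_face_sum[OF gens_lists[OF w]] Br.frag_lift_0)
 qed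
qed

lemma grade_Bar: "grade Br n = agenerate Br {wd w | w. w \<in> word_gens A 2 & int (length w) = n + 2}"
proof -
 have "grade Br n = agenerate (words K A 2) {wd w | w. w \<in> word_gens A 2 & int (length w) = n + 2}"
  by (simp add: Bar_def Let_def agenerate_def)
 thus ?thesis by (simp only: agenerate_cong[OF carrier_Bar add_Bar zero_Bar])
qed

lemma grade_Bar_asubgroup: "asubgroup (grade Br n) Br"
 unfolding grade_Bar by (rule Br.generate_subgroup) (auto intro: wd_closed)

lemma wd_grade: "[|w \<in> word_gens A 2; int (length w) = n + 2|] ==> wd w \<in> grade Br n"
 unfolding grade_Bar agenerate_def by (rule generate.incl) blast

lemma grade_Bar_image:
 assumes "f \<in> ahom Br G" "abelian_group G" "asubgroup C G"
  "!!w. [|w \<in> word_gens A 2; int (length w) = n + 2|] ==> f (wd w) \<in> C" "u \<in> grade Br n"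
 shows "f u \<in> C"
 by (rule Br.generate_image_subset[OF assms(1-3) _ _ assms(5)[unfolded grade_Bar]])
   (use assms(4) wd_closed in blast)+

lemma grade_Bar_left: "[|a \<in> carrier A; u \<in> grade Br n|] ==> a \<odot>\<^sub>B u \<in> grade Br n"
 by (rule grade_Bar_image[OF smult_Bar_ahom ag_Bar grade_Bar_asubgroup])
   (simp_all add: smult_wd, rule wd_grade, simp_all add: scale_gens, simp add: scale_first_def)

lemma Tr_grade_Bar: "Tr_grade A Br n = (%x. tr_gen A Br \<one>\<^sub>A x) ` grade Br n"
 by (rule Tr_grade_image[OF trace_group_Bar grade_Bar_asubgroup grade_Bar_left])

lemma diff_Bar_grade:
 assumes "u \<in> grade Br n" shows "diff Br u \<in> grade Br (n - 1)"
proof (rule grade_Bar_image[OF bimod_hom_ahom[OF diff_Bar_hom] ag_Bar grade_Bar_asubgroup _ assms])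
 fix w assume w: "w \<in> word_gens A 2" "int (length w) = n + 2"
 show "diff Br (wd w) \<in> grade Br (n - 1)"
  unfolding diff_wd[OF w(1)] frag_lift_face_sum[OF ag_Bar wz_closed]
 proof (rule Br.subgroup_finsum[OF grade_Bar_asubgroup], rule Br.subgroup_sgn[OF grade_Bar_asubgroup])
  fix i assume i: "i \<in> {..<length w - 1}"
  show "wz (face i w) \<in> grade Br (n - 1)"
  proof (cases "face i w \<in> word_gens A 2")
   case True
   have "int (length (face i w)) = n - 1 + 2" using i w(2) by (simp add: length_face)
   thus ?thesis using True by (simp add: wz_def wd_grade)
  qed (simp add: wz_def Br.subgroup_zero[OF grade_Bar_asubgroup])
 qed
qed

end

section \<open>Connes' operator on bar words, expressed through cyclic words\<close>

text \<open>Connes' formula numbers the rotations from 0 to n, cuts are numbered from 1 to n + 1;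
  rotation by 0 and by n + 1 coincide.\<close>

lemma (in abelian_group) finsum_shift_cyclic:
 assumes "!!i. i <= Suc n ==> h i \<in> carrier G" "h 0 = h (Suc n)"
 shows "(\<Oplus>i\<in>{..n}. h i) = (\<Oplus>i\<in>{1..<n + 2}. h i)"
proof -
 have "{..n} = insert 0 {1..<Suc n}" "{1..<n + 2} = insert (Suc n) {1..<Suc n}" by auto
 moreover have "h \<in> {1..<Suc n} \<rightarrow> carrier G" using assms(1) by auto
 ultimately show ?thesis using assms by (simp del: atLeastLessThan_iff) auto
qed

context assoc_algebra
begin

interpretation Br: bimodule K A Br by (rule bimodule_Bar)
interpretation TB: trace_group K A Br by (rule trace_group_Bar)

abbreviation "tb x == tr_gen A Br \<one>\<^sub>A x"

lemma letterwiseI: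
 assumes "!!k. k < length w ==> \<kappa> k < length (\<rho> w)"
  "!!k a. [|k < length w; a \<in> carrier A|] ==> \<rho> (w[k := a]) = (\<rho> w)[\<kappa> k := a]"
 shows "letterwise w \<rho>"
 unfolding letterwise_def using assms letter_maps(1) by blast

lemma letterwise_Cons: "letterwise w (%w. x # w)"
 by (rule letterwiseI[of _ Suc]) simp_all

lemma letterwise_append: "letterwise w (%w. w @ [x])"
 by (rule letterwiseI[of _ "%k. k"]) (simp_all add: list_update_append)

lemma letterwise_insert: "w ~= [] ==> letterwise w (%w. hd w # x # tl w)"
 by (rule letterwiseI[of _ "%k. if k = 0 then 0 else Suc k"]; cases w) (auto split: nat.split simp: gr0_conv_Suc)

lemma letterwise_rotate: "letterwise w (rotate i)"
proof -
 let ?m = "i mod length w"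
 have u: "rotate i (w[k := a]) = (rotate i w)[(if k < ?m then length w - ?m + k else k - ?m) := a]"
  if "k < length w" for k a
  using that
  by (auto simp: rotate_drop_take drop_update_swap drop_update_cancel take_update_swap take_update_cancel list_update_append list_update_beyond)
 show ?thesis
 proof (rule letterwiseI[OF _ u])
  show "(if k < ?m then length w - ?m + k else k - ?m) < length (rotate i w)" if "k < length w" for k
   using that mod_less_divisor[of "length w" i] by (auto simp del: mod_less_divisor)
 qed
qed

definition "cyclic_letters b w = (last w \<otimes>\<^sub>A b \<otimes>\<^sub>A hd w) # butlast (tl w)"

lemma word_ends:
 assumes "2 <= length w" obtains x ys y where "w = x # ys @ [y]"
proof -
 obtain x v where v: "w = x # v" using assms by (cases w) auto
 then obtain ys y where "v = ys @ [y]" using assms by (cases v rule: rev_cases) auto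
 with v that show thesis by simp
qed

lemma cyclic_letters_simp: "cyclic_letters b (x # ys @ [y]) = (y \<otimes>\<^sub>A b \<otimes>\<^sub>A x) # ys"
 by (simp add: cyclic_letters_def)

lemma cyclic_letters_lists:
 assumes "w \<in> word_gens A 2" "b \<in> carrier A" shows "cyclic_letters b w \<in> word_gens A 1"
proof -
 obtain x ys y where w: "w = x # ys @ [y]" using word_ends gens_length[OF assms(1)] by blast
 show ?thesis using assms unfolding w cyclic_letters_simp word_gens_iff by simp
qed

lemma letterwise_cyclic_letters:
 assumes w: "w \<in> word_gens A 2" and b: "b \<in> carrier A"
 shows "letterwise w (cyclic_letters b)"
proof -
 obtain x ys y where e: "w = x # ys @ [y]" using word_ends gens_length[OF w] by blast
 have c: "x \<in> carrier A" "y \<in> carrier A" using w by (simp_all add: e word_gens_iff)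
 show ?thesis
  unfolding letterwise_def
 proof (intro allI impI)
  fix k assume k: "k < length w"
  consider "k = 0" | j where "k = Suc j" "j < length ys" | "k = Suc (length ys)"
   using k unfolding e by (cases k) (auto simp: less_Suc_eq)
  thus "\<exists>k' \<phi>. k' < length (cyclic_letters b w) & \<phi> \<in> letter_maps &
    (\<forall>a\<in>carrier A. cyclic_letters b (w[k := a]) = (cyclic_letters b w)[k' := \<phi> a])"
  proof cases
   case 1
   show ?thesis
    by (rule exI[of _ 0], rule exI[of _ "%a. (y \<otimes>\<^sub>A b) \<otimes>\<^sub>A a"])
      (use b c in \<open>simp add: e 1 cyclic_letters_simp letter_maps(2)\<close>)
  next
   case 2
   have u: "w[k := a] = x # (ys[j := a]) @ [y]" for a using 2 by (simp add: e list_update_append)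
   show ?thesis
    by (rule exI[of _ "Suc j"], rule exI[of _ "%a. a"])
      (use 2(2) letter_maps(1) in \<open>simp add: u\<close>, simp add: e cyclic_letters_simp)
  next
   case 3
   have u: "w[k := a] = x # ys @ [a]" for a using 3 by (simp add: e list_update_append)
   have m: "(%a. a \<otimes>\<^sub>A b \<otimes>\<^sub>A x) = (%a. a \<otimes>\<^sub>A b \<otimes>\<^sub>A x)" ..
   have "(%a. a \<otimes>\<^sub>A (b \<otimes>\<^sub>A x)) \<in> letter_maps" by (rule letter_maps(3)) (use b c in simp)
   thus ?thesis
    by (intro exI[of _ 0] exI[of _ "%a. a \<otimes>\<^sub>A (b \<otimes>\<^sub>A x)"])
      (use b c in \<open>simp add: u, simp add: e cyclic_letters_simp A.m_assoc\<close>)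
  qed
 qed
qed

abbreviation "W1 == words K A 1"
abbreviation "w1 == word K A 1"

interpretation W1: abelian_group W1 by (rule ag_words)

definition "to_words b = pres_lift W1 (%as. w1 (cyclic_letters b as))"

lemma to_words_bml: "[|w \<in> word_gens A 2; b \<in> carrier A|] ==> bml W1 (%as. w1 (cyclic_letters b as)) w"
 by (rule bml_letterwise[where q = w1 and \<rho> = "cyclic_letters b", OF gens_lists letterwise_cyclic_letters word_bml[OF cyclic_letters_lists]])

lemma to_words_ahom: "b \<in> carrier A ==> to_words b \<in> ahom Br W1"
 unfolding to_words_def ahom_Bar by (rule word_lift_hom[OF ag_words _ to_words_bml]) simp_all

lemma to_words_wd: "[|b \<in> carrier A; w \<in> word_gens A 2|] ==> to_words b (wd w) = w1 (cyclic_letters b w)"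
 unfolding to_words_def by (rule word_lift_word[OF ag_words _ to_words_bml]) simp_all

lemma cyclic_letters_scale:
 assumes w: "w \<in> word_gens A 2" and a: "a \<in> carrier A"
 shows "cyclic_letters \<one>\<^sub>A (scale_first a w) = cyclic_letters a w" "cyclic_letters \<one>\<^sub>A (scale_last a w) = cyclic_letters a w"
proof -
 obtain x ys y where e: "w = x # ys @ [y]" using word_ends gens_length[OF w] by blast
 have c: "x \<in> carrier A" "y \<in> carrier A" using w by (simp_all add: e word_gens_iff)
 have "scale_first a w = (a \<otimes>\<^sub>A x) # ys @ [y]" "scale_last a w = x # ys @ [y \<otimes>\<^sub>A a]"
  unfolding e scale_first_def scale_last_def by (simp_all add: list_update_append)
 thus "cyclic_letters \<one>\<^sub>A (scale_first a w) = cyclic_letters a w" "cyclic_letters \<one>\<^sub>A (scale_last a w) = cyclic_letters a w"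
  using a c by (simp_all add: cyclic_letters_simp e A.m_assoc)
qed

lemma tr_bar_to_words_eq: "tr_bar_to_words K A = pres_lift W1 (%(b, u). to_words b u)"
 by (simp add: tr_bar_to_words_def to_words_def cyclic_letters_def)

lemma tr_bar_to_words:
 shows tr_bar_to_words_ahom: "tr_bar_to_words K A \<in> ahom (Tr A Br) W1"
  and tr_bar_to_words_tr: "w \<in> word_gens A 2 ==> tr_bar_to_words K A (tb (wd w)) = w1 (cyclic_letters \<one>\<^sub>A w)"
proof -
 note h = to_words_ahom[OF A.one_closed]
 have l: "to_words \<one>\<^sub>A (a \<odot>\<^sub>B u) = to_words a u" if a: "a \<in> carrier A" and u: "u \<in> carrier Br" for a u
  by (rule Bar_hom_eq[OF ahom_comp[OF smult_Bar_ahom[OF a] h] to_words_ahom[OF a] ag_words _ u])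
    (simp only: smult_wd[OF a] to_words_wd a A.one_closed scale_gens(1)[OF _ zero_less_numeral a] cyclic_letters_scale(1)[OF _ a])
 have r: "to_words \<one>\<^sub>A (u \<triangleleft>\<^sub>B a) = to_words a u" if a: "a \<in> carrier A" and u: "u \<in> carrier Br" for a u
  by (rule Bar_hom_eq[OF ahom_comp[OF ract_Bar_ahom[OF a] h] to_words_ahom[OF a] ag_words _ u])
    (simp only: ract_wd[OF a] to_words_wd a A.one_closed scale_gens(2)[OF _ zero_less_numeral a] cyclic_letters_scale(2)[OF _ a])
 have cyc: "to_words \<one>\<^sub>A (a \<odot>\<^sub>B u) = to_words \<one>\<^sub>A (u \<triangleleft>\<^sub>B a)" if "a \<in> carrier A" "u \<in> carrier Br" for a u
  using l[OF that] r[OF that] by simp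
 have b: "to_words a u = to_words \<one>\<^sub>A (a \<odot>\<^sub>B u)" if "a \<in> carrier A" "u \<in> carrier Br" for a u
  using l[OF that] by simp
 show "tr_bar_to_words K A \<in> ahom (Tr A Br) W1"
  unfolding tr_bar_to_words_eq by (rule TB.Tr_lift_hom[OF ag_words h cyc b])
 show "tr_bar_to_words K A (tb (wd w)) = w1 (cyclic_letters \<one>\<^sub>A w)" if w: "w \<in> word_gens A 2"
 proof -
  have "pres_lift W1 (%(b, u). to_words b u) (tb (wd w)) = to_words \<one>\<^sub>A (wd w)"
   by (rule TB.Tr_lift_tr[OF ag_words h cyc b wd_closed[OF w]])
  thus ?thesis by (simp only: tr_bar_to_words_eq to_words_wd[OF A.one_closed w])
 qed
qed

lemma rotate_gens: "w \<in> word_gens A l ==> rotate i w \<in> word_gens A l"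
 unfolding word_gens_iff in_lists_conv_set by simp

definition "connes_list w =
 (\<Oplus>\<^bsub>W1\<^esub>i \<in> {..length w - 1}. sgn_elt W1 (int (i * (length w - 1))) (w1 (\<one>\<^sub>A # rotate i w))) \<oplus>\<^bsub>W1\<^esub>
 (\<Oplus>\<^bsub>W1\<^esub>i \<in> {..length w - 1}. sgn_elt W1 (int (i * (length w - 1))) (w1 (hd (rotate i w) # \<one>\<^sub>A # tl (rotate i w))))"

lemma connes_words_eq: "connes_words K A = pres_lift W1 connes_list"
 by (simp add: connes_words_def connes_list_def[abs_def] Let_def)

lemma rotated_gens:
 assumes "w \<in> word_gens A 1"
 shows "\<one>\<^sub>A # rotate i w \<in> word_gens A 1" "hd (rotate i w) # \<one>\<^sub>A # tl (rotate i w) \<in> word_gens A 1"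
proof -
 have g: "rotate i w \<in> word_gens A 1" by (rule rotate_gens[OF assms])
 thus "\<one>\<^sub>A # rotate i w \<in> word_gens A 1" "hd (rotate i w) # \<one>\<^sub>A # tl (rotate i w) \<in> word_gens A 1"
  unfolding word_gens_iff by (cases "rotate i w"; simp)+
qed

lemma bml_plus:
 assumes "abelian_group G" "bml G q w" "bml G r w"
 shows "bml G (%w. q w \<oplus>\<^bsub>G\<^esub> r w) w"
 unfolding bml_def
proof (intro conjI ballI allI impI)
 show "(%a. q (w[k := a]) \<oplus>\<^bsub>G\<^esub> r (w[k := a])) \<in> ahom A G" if "k < length w" for k
  using assms(2,3) that by (intro ahom_plus[OF A.ag assms(1)]) (simp_all add: bml_def)
 show "q (w[j := c \<odot>\<^sub>A w ! j]) \<oplus>\<^bsub>G\<^esub> r (w[j := c \<odot>\<^sub>A w ! j]) = q (w[k := c \<odot>\<^sub>A w ! k]) \<oplus>\<^bsub>G\<^esub> r (w[k := c \<odot>\<^sub>A w ! k])"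
  if "c \<in> carrier K" "j < length w" "k < length w" for c j k
  using bml_scal[OF assms(2) that(2,3,1)] bml_scal[OF assms(3) that(2,3,1)] by simp
qed

lemma bml_sgn: "[|abelian_group G; bml G q w|] ==> bml G (%w. sgn_elt G k (q w)) w"
 by (rule bml_hom) (assumption, rule ahom_sgn_elt[OF _ _ ahom_id(1)])

lemma connes_list_bml:
 assumes w: "w \<in> word_gens A 1"
 shows "bml W1 connes_list w"
proof -
 note wl = gens_lists[OF w]
 have r: "rotate i w \<in> A_lists" "rotate i w ~= []" for i
  using gens_lists[OF rotate_gens[OF w]] gens_nonempty[OF rotate_gens[OF w]] by auto
 have 1: "bml W1 (%w. w1 (\<one>\<^sub>A # rotate i w)) w" for i
  by (rule bml_letterwise[where \<rho> = "rotate i" and q = "%w. w1 (\<one>\<^sub>A # w)", OF wl letterwise_rotate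
    bml_letterwise[where q = w1, OF r(1) letterwise_Cons word_bml[OF rotated_gens(1)[OF w]]]])
 have 2: "bml W1 (%w. w1 (hd (rotate i w) # \<one>\<^sub>A # tl (rotate i w))) w" for i
  by (rule bml_letterwise[where \<rho> = "rotate i" and q = "%w. w1 (hd w # \<one>\<^sub>A # tl w)", OF wl letterwise_rotate
    bml_letterwise[where q = w1, OF r(1) letterwise_insert[OF r(2)] word_bml[OF rotated_gens(2)[OF w]]]])
 define N where "N = length w - 1"
 have s: "bml W1 (%w. \<Oplus>\<^bsub>W1\<^esub>i \<in> {..N}. sgn_elt W1 (int (i * N)) (g i w)) w" if "!!i. bml W1 (g i) w" for g
  by (rule bml_finsum[OF ag_words bml_sgn[OF ag_words that] wl])
 show ?thesis
  by (rule bml_cong[OF bml_plus[OF ag_words s[OF 1] s[OF 2]] wl]) (simp add: connes_list_def N_def)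
qed

lemma connes_words_ahom: "connes_words K A \<in> ahom W1 W1"
 unfolding connes_words_eq by (rule word_lift_hom[OF ag_words _ connes_list_bml]) simp_all

lemma connes_words_w1: "w \<in> word_gens A 1 ==> connes_words K A (w1 w) = connes_list w"
 unfolding connes_words_eq by (rule word_lift_word[OF ag_words _ connes_list_bml]) simp_all

lemma append_one_gens: "w \<in> word_gens A 1 ==> w @ [\<one>\<^sub>A] \<in> word_gens A 2"
 unfolding word_gens_iff by simp

lemma words_to_tr_bar_bml:
 assumes w: "w \<in> word_gens A 1" shows "bml (Tr A Br) (%as. tb (wd (as @ [\<one>\<^sub>A]))) w"
 by (rule bml_hom[OF bml_letterwise[where q = wd, OF gens_lists[OF w] letterwise_append wd_bml[OF append_one_gens[OF w]]]
   TB.tr_ahom[OF A.one_closed]])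

lemma words_to_tr_bar_ahom: "words_to_tr_bar K A \<in> ahom W1 (Tr A Br)"
 unfolding words_to_tr_bar_def by (rule word_lift_hom[OF TB.ag_Tr _ words_to_tr_bar_bml]) simp_all

lemma words_to_tr_bar_w1: "w \<in> word_gens A 1 ==> words_to_tr_bar K A (w1 w) = tb (wd (w @ [\<one>\<^sub>A]))"
 unfolding words_to_tr_bar_def by (rule word_lift_word[OF TB.ag_Tr _ words_to_tr_bar_bml]) simp_all

lemma connes_bar_ahom: "connes_bar K A \<in> ahom (Tr A Br) (Tr A Br)"
 unfolding connes_bar_def comp_def
 by (rule ahom_comp[OF ahom_comp[OF tr_bar_to_words_ahom connes_words_ahom] words_to_tr_bar_ahom])

text \<open>The meeting point of the two descriptions: exchanging the factors of the cut at i gives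
  the i-th rotation of the cyclic word, enclosed by units.\<close>

lemma cyclic_word_rotate:
 assumes w: "w \<in> word_gens A 2" and i: "1 <= i" "i < length w"
 shows "cyclic_word i w = \<one>\<^sub>A # rotate i (cyclic_letters \<one>\<^sub>A w) @ [\<one>\<^sub>A]"
proof -
 obtain x ys y where e: "w = x # ys @ [y]" using word_ends gens_length[OF w] by blast
 have c: "x \<in> carrier A" "y \<in> carrier A" using w by (simp_all add: e word_gens_iff)
 let ?c = "(y \<otimes>\<^sub>A x) # ys"
 have ce: "cyclic_letters \<one>\<^sub>A w = ?c" using c by (simp add: e cyclic_letters_simp)
 obtain l where l: "i = Suc l" using i by (cases i) auto
 have "l <= length ys" using i by (simp add: e l)
 then obtain r where r: "length ys = l + r" using le_Suc_ex by blast
 have rot: "rotate i ?c = drop l ys @ (y \<otimes>\<^sub>A x) # take l ys"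
 \<comment> \<open>Here i is the full length of the cyclic word, so the rotation is the identity,
   and the general formula with remainders would give a different normal form.\<close>
 proof (cases "l = length ys")
  case True
  thus ?thesis using rotate_id[of "Suc l" ?c] unfolding l by simp
 next
  case False
  thus ?thesis using \<open>l <= length ys\<close> by (simp add: rotate_drop_take l)
 qed
 show ?thesis
  unfolding ce rot
 proof (rule nth_equalityI)
  show "length (cyclic_word i w) = length (\<one>\<^sub>A # (drop l ys @ (y \<otimes>\<^sub>A x) # take l ys) @ [\<one>\<^sub>A])"
   by (simp add: length_cyclic_word e r)
  fix q assume "q < length (cyclic_word i w)"
  hence q: "q < l + r + 3" by (simp add: length_cyclic_word e r)
  consider "q = 0" | p where "q = Suc p" "p < r" | "q = Suc r" | p where "q = Suc (Suc r) + p" "p < l" | "q = l + r + 2"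
  proof -
   have "q = 0 \<or> (0 < q & q - 1 < r) \<or> q = Suc r \<or> (Suc (Suc r) <= q & q - Suc (Suc r) < l) \<or> q = l + r + 2"
    using q by linarith
   thus ?thesis
    using that by (metis Suc_pred le_add_diff_inverse diff_Suc_1 One_nat_def)
  qed
  thus "cyclic_word i w ! q = (\<one>\<^sub>A # (drop l ys @ (y \<otimes>\<^sub>A x) # take l ys) @ [\<one>\<^sub>A]) ! q"
  proof cases
   case 1 thus ?thesis by (simp add: nth_cyclic_word e)
  next
   case 2 thus ?thesis by (simp add: nth_cyclic_word e r l nth_append)
  next
   case 3 thus ?thesis by (simp add: nth_cyclic_word e r l nth_append)
  next
   case 4 thus ?thesis by (simp add: nth_cyclic_word e r l nth_append)
  next
   case 5 thus ?thesis by (simp add: nth_cyclic_word e r l nth_append)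
  qed
 qed
qed

text \<open>On a word with leading unit, (1, a, ...), it gives (a, 1, ...): the summand of the
  second half of Connes' formula obtained from that of the first half.\<close>

definition "split_first v = (v ! 0 \<otimes>\<^sub>A v ! 1) # \<one>\<^sub>A # drop 2 v"

lemma connes_bar_tr:
 assumes w: "w \<in> word_gens A 2"
 shows "connes_bar K A (tb (wd w)) =
  (\<Oplus>\<^bsub>Tr A Br\<^esub>i \<in> {1..<length w}. sgn_elt (Tr A Br) (int (i * (length w - 2))) (tb (wd (cyclic_word i w)))) \<oplus>\<^bsub>Tr A Br\<^esub>
  (\<Oplus>\<^bsub>Tr A Br\<^esub>i \<in> {1..<length w}. sgn_elt (Tr A Br) (int (i * (length w - 2))) (tb (wd (split_first (cyclic_word i w)))))"
proof -
 let ?c = "cyclic_letters \<one>\<^sub>A w"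
 define n where "n = length w - 2"
 have n: "length w = n + 2" using gens_length[OF w] by (simp add: n_def)
 have c: "?c \<in> word_gens A 1" by (rule cyclic_letters_lists[OF w A.one_closed])
 have lc: "length ?c = Suc n" by (simp add: cyclic_letters_def n)
 let ?R = "%i. sgn_elt (Tr A Br) (int (i * n)) (tb (wd (\<one>\<^sub>A # rotate i ?c @ [\<one>\<^sub>A])))"
 let ?Q = "%i. sgn_elt (Tr A Br) (int (i * n)) (tb (wd (hd (rotate i ?c) # \<one>\<^sub>A # tl (rotate i ?c) @ [\<one>\<^sub>A])))"
 note g1 = rotated_gens(1)[OF c] and g2 = rotated_gens(2)[OF c]
 have RQ: "?R i \<in> carrier (Tr A Br)" "?Q i \<in> carrier (Tr A Br)" for i
  using append_one_gens[OF g1[of i]] append_one_gens[OF g2[of i]] by (simp_all add: wd_closed TB.tr_closed)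
 have rl: "rotate (Suc n) ?c = ?c" using rotate_id[of "Suc n" ?c] lc by simp
 \<comment> \<open>The sign at i = n + 1 is trivial because n (n + 1) is even.\<close>
 have per: "?R 0 = ?R (Suc n)" "?Q 0 = ?Q (Suc n)" unfolding rl by (simp_all add: sgn_elt_def)
 have "connes_bar K A (tb (wd w)) = words_to_tr_bar K A (connes_list ?c)"
  by (simp only: connes_bar_def comp_apply tr_bar_to_words_tr[OF w] connes_words_w1[OF c])
 also have "... = (\<Oplus>\<^bsub>Tr A Br\<^esub>i \<in> {..n}. ?R i) \<oplus>\<^bsub>Tr A Br\<^esub> (\<Oplus>\<^bsub>Tr A Br\<^esub>i \<in> {..n}. ?Q i)"
 proof -
  note h = words_to_tr_bar_ahom
  have fin: "words_to_tr_bar K A (\<Oplus>\<^bsub>W1\<^esub>i \<in> {..n}. sgn_elt W1 (int (i * n)) (w1 (g i)))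
    = (\<Oplus>\<^bsub>Tr A Br\<^esub>i \<in> {..n}. sgn_elt (Tr A Br) (int (i * n)) (tb (wd (g i @ [\<one>\<^sub>A]))))"
   if g: "!!i. g i \<in> word_gens A 1" for g
   by (subst ahom_finsum[OF ag_words TB.ag_Tr h])
     (simp_all add: word_closed[OF g] ahom_sgn[OF ag_words TB.ag_Tr h] words_to_tr_bar_w1[OF g] del: One_nat_def)
  have cl: "(\<Oplus>\<^bsub>W1\<^esub>i \<in> {..n}. sgn_elt W1 (int (i * n)) (w1 (g i))) \<in> carrier W1" if g: "!!i. g i \<in> word_gens A 1" for g
   by (rule W1.finsum_closed) (simp add: word_closed[OF g] del: One_nat_def)
  show ?thesis
   unfolding connes_list_def lc diff_Suc_1 ahom_add[OF h cl[OF g1] cl[OF g2]] fin[OF g1] fin[OF g2] by simp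
 qed
 also have "(\<Oplus>\<^bsub>Tr A Br\<^esub>i \<in> {..n}. ?R i) = (\<Oplus>\<^bsub>Tr A Br\<^esub>i \<in> {1..<n + 2}. ?R i)"
  by (rule TB.Tr.finsum_shift_cyclic[OF RQ(1) per(1)])
 also have "(\<Oplus>\<^bsub>Tr A Br\<^esub>i \<in> {..n}. ?Q i) = (\<Oplus>\<^bsub>Tr A Br\<^esub>i \<in> {1..<n + 2}. ?Q i)"
  by (rule TB.Tr.finsum_shift_cyclic[OF RQ(2) per(2)])
 also have "(\<Oplus>\<^bsub>Tr A Br\<^esub>i \<in> {1..<n + 2}. ?R i) = (\<Oplus>\<^bsub>Tr A Br\<^esub>i \<in> {1..<length w}. sgn_elt (Tr A Br) (int (i * (length w - 2))) (tb (wd (cyclic_word i w))))"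
  unfolding n by (rule TB.Tr.finsum_cong'[OF refl]) (use cyclic_word_rotate[OF w] RQ(1) n in \<open>auto\<close>)
 also have "(\<Oplus>\<^bsub>Tr A Br\<^esub>i \<in> {1..<n + 2}. ?Q i) = (\<Oplus>\<^bsub>Tr A Br\<^esub>i \<in> {1..<length w}. sgn_elt (Tr A Br) (int (i * (length w - 2))) (tb (wd (split_first (cyclic_word i w)))))"
 proof -
  have s: "split_first (cyclic_word i w) = hd (rotate i ?c) # \<one>\<^sub>A # tl (rotate i ?c) @ [\<one>\<^sub>A]" if "1 <= i" "i < length w" for i
  proof -
   obtain z zs where z: "rotate i ?c = z # zs" using lc by (cases "rotate i ?c") auto
   have "z \<in> carrier A" using gens_lists[OF rotate_gens[OF c, of i]] unfolding z by simp
   thus ?thesis unfolding cyclic_word_rotate[OF w that] split_first_def z by simp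
  qed
  show ?thesis
   unfolding n by (rule TB.Tr.finsum_cong'[OF refl]) (use s RQ(2) n in \<open>auto\<close>)
 qed
 finally show ?thesis .
qed

end

section \<open>Scalar-compatible functions on words, and faces at a mark\<close>

context assoc_algebra
begin

text \<open>Stronger than \<open>bml\<close>: a scalar on a letter is the action of c 1 on the
  value. It is needed for tensors of two such functions, where a scalar passes from a letter of one
  factor to a letter of the other through the values.\<close>

definition kml :: "('c, 'n, 'y) bimodule_scheme => ('c list => 'n) => 'c list => bool" where
 "kml N q w \<longleftrightarrow> (\<forall>k<length w. (%a. q (w[k := a])) \<in> ahom A N) &
   (\<forall>c\<in>carrier K. \<forall>k<length w. q (w[k := c \<odot>\<^sub>A w ! k]) = (c \<odot>\<^sub>A \<one>\<^sub>A) \<odot>\<^bsub>N\<^esub> q w)"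

lemma kml_bml: "kml N q w ==> bml N q w"
 by (simp add: kml_def bml_def)

lemma kml_add: "[|kml N q w; k < length w|] ==> (%a. q (w[k := a])) \<in> ahom A N"
 by (simp add: kml_def)

lemma kml_scal: "[|kml N q w; k < length w; c \<in> carrier K|] ==> q (w[k := c \<odot>\<^sub>A w ! k]) = (c \<odot>\<^sub>A \<one>\<^sub>A) \<odot>\<^bsub>N\<^esub> q w"
 by (simp add: kml_def)

lemma wz_bml: assumes w: "w \<in> A_lists" shows "bml Br wz w"
proof (cases "w \<in> word_gens A 2")
 case True
 show ?thesis
  by (rule bml_cong[OF wd_bml[OF True] w]) (simp add: wz_def gens_update[OF True])
next
 case False
 have "wz (w[k := a]) = \<zero>\<^bsub>Br\<^esub>" for k a
  using False w by (simp add: wz_def word_gens_iff del: in_lists_conv_set)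
 thus ?thesis
  by (simp add: bml_def ahom_const_zero[OF A.ag ag_Bar])
qed

lemma wz_kml: assumes w: "w \<in> A_lists" shows "kml Br wz w"
 unfolding kml_def
proof (intro conjI ballI allI impI)
 show "(%a. wz (w[k := a])) \<in> ahom A Br" if "k < length w" for k
  using wz_bml[OF w] that by (simp add: bml_def)
 fix c k assume c: "c \<in> carrier K" and k: "k < length w"
 have ne: "w ~= []" "0 < length w" using k by auto
 have "wz (w[k := c \<odot>\<^sub>A w ! k]) = wz (w[0 := c \<odot>\<^sub>A w ! 0])"
  by (rule bml_scal[OF wz_bml[OF w] k ne(2) c])
 also have "w[0 := c \<odot>\<^sub>A w ! 0] = scale_first (c \<odot>\<^sub>A \<one>\<^sub>A) w"
  using c nth_carrier[OF w ne(2)] by (simp add: scale_first_def smult_mult_left)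
 finally show "wz (w[k := c \<odot>\<^sub>A w ! k]) = (c \<odot>\<^sub>A \<one>\<^sub>A) \<odot>\<^sub>B wz w"
  using wz_scale(1)[OF w ne(1)] c by simp
qed

lemma kml_left_hom:
 assumes q: "kml N q w" and f: "f \<in> left_hom A N L" and c: "q w \<in> carrier N"
 shows "kml L (%w. f (q w)) w"
 unfolding kml_def
proof (intro conjI ballI allI impI)
 show "(%a. f (q (w[k := a]))) \<in> ahom A L" if "k < length w" for k
  by (rule ahom_comp[OF kml_add[OF q that] left_hom_ahom[OF f]])
 show "f (q (w[k := x \<odot>\<^sub>A w ! k])) = (x \<odot>\<^sub>A \<one>\<^sub>A) \<odot>\<^bsub>L\<^esub> f (q w)" if "x \<in> carrier K" "k < length w" for x k
  unfolding kml_scal[OF q that(2,1)] by (rule left_hom_smult[OF f _ c]) (use that in simp)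
qed

lemma letterwise_insert_one: "i <= length w ==> letterwise w (insert_one i)"
proof (rule letterwiseI[of _ "%k. if k < i then k else Suc k"])
 assume i: "i <= length w"
 show "(if k < i then k else Suc k) < length (insert_one i w)" if "k < length w" for k
  using that by (simp add: length_insert_one)
 fix k a assume k: "k < length w"
 show "insert_one i (w[k := a]) = (insert_one i w)[(if k < i then k else Suc k) := a]"
 proof (rule nth_equalityI)
  fix q assume "q < length (insert_one i (w[k := a]))"
  hence q: "q <= length w" by (simp add: length_insert_one)
  show "insert_one i (w[k := a]) ! q = (insert_one i w)[(if k < i then k else Suc k) := a] ! q"
   using i k q by (auto simp: nth_insert_one nth_list_update length_insert_one)
 qed (simp add: length_insert_one)
qed

lemma frag_lift_marked_sum:
 assumes "abelian_group G" "!!x. b x \<in> carrier G"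
 shows "frag_lift G b (marked_sum (m, w)) =
  (\<Oplus>\<^bsub>G\<^esub>k\<in>{..<length w - 1}. sgn_elt G (int (if k < m then k else Suc k)) (b (mark_face m k, face k w)))"
proof -
 have "mark_sign m k = (- 1) ^ (if k < m then k else Suc k)" for k by (simp add: mark_sign_def)
 hence "marked_sum (m, w) = (\<Sum>k\<in>{..<length w - 1}. frag_cmul ((- 1) ^ (if k < m then k else Suc k)) (frag_of (mark_face m k, face k w)))"
  by (simp add: marked_sum_def)
 thus ?thesis by (simp only: abelian_group.frag_lift_signed_sum[OF assms] finite_lessThan)
qed

lemma one_letter_lists: "w \<in> A_lists ==> take m w @ [\<one>\<^sub>A] \<in> A_lists"
 by (auto dest: in_set_takeD)

lemma drop_lists: "w \<in> A_lists ==> drop m w \<in> A_lists"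
 by (auto dest: in_set_dropD)

lemma face_take:
 assumes w: "w \<in> A_lists" and k: "Suc k < m" "m < length w"
 shows "face k (take m w @ [\<one>\<^sub>A]) = take (m - 1) (face k w) @ [\<one>\<^sub>A]"
  and "drop (m - 1) (face k w) = drop m w"
proof -
 show "face k (take m w @ [\<one>\<^sub>A]) = take (m - 1) (face k w) @ [\<one>\<^sub>A]"
 proof (rule nth_equalityI)
  show "length (face k (take m w @ [\<one>\<^sub>A])) = length (take (m - 1) (face k w) @ [\<one>\<^sub>A])"
   using k by (simp add: length_face)
  fix q assume "q < length (face k (take m w @ [\<one>\<^sub>A]))"
  hence q: "q < m" using k by (simp add: length_face)
  thus "face k (take m w @ [\<one>\<^sub>A]) ! q = (take (m - 1) (face k w) @ [\<one>\<^sub>A]) ! q"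
   using k by (auto simp: nth_face length_face nth_append min_def)
 qed
 show "drop (m - 1) (face k w) = drop m w"
  by (rule nth_equalityI) (use k in \<open>auto simp: length_face nth_face\<close>)
qed

lemma face_take_last:
 assumes w: "w \<in> A_lists" and m: "0 < m" "m < length w"
 shows "face (m - 1) (take m w @ [\<one>\<^sub>A]) = scale_last (w ! (m - 1)) (take (m - 1) w @ [\<one>\<^sub>A])"
  and "take (m - 1) (face (m - 1) w) = take (m - 1) w"
  and "drop (m - 1) (face (m - 1) w) = scale_first (w ! (m - 1)) (drop m w)"
proof -
 obtain k where k: "m = Suc k" using m by (cases m) auto
 have c: "w ! k \<in> carrier A" using nth_carrier[OF w, of k] m k by simp
 have t: "take (Suc k) w = take k w @ [w ! k]" using m k by (simp add: take_Suc_conv_app_nth)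
 show "face (m - 1) (take m w @ [\<one>\<^sub>A]) = scale_last (w ! (m - 1)) (take (m - 1) w @ [\<one>\<^sub>A])"
  using m c by (simp add: k t face_def scale_last_def nth_append list_update_append)
 show "take (m - 1) (face (m - 1) w) = take (m - 1) w" using m by (simp add: k face_def)
 have d: "drop (Suc k) w = w ! Suc k # drop (Suc (Suc k)) w" using m k by (simp add: Cons_nth_drop_Suc)
 show "drop (m - 1) (face (m - 1) w) = scale_first (w ! (m - 1)) (drop m w)"
  using m by (simp add: k face_def scale_first_def d)
qed

lemma face_drop:
 assumes "Suc (m + l) < length w"
 shows "face l (drop m w) = drop m (face (m + l) w)" "take m (face (m + l) w) = take m w"
 using assms by (simp_all add: face_def add.commute take_drop)

end

section \<open>Comparison maps and the coproduct obtained from deconcatenation\<close>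

locale comparison = contraction K A P \<mu> t \<eta> \<iota>
 for K :: "'k ring" and A :: "('k, 'a) module" and P :: "('a, 'p) bimodule_complex"
  and \<mu> :: "'p => 'a" and t :: "'p => 'p" and \<eta> :: "'a => 'p"
  and \<iota> :: "'p => ('a \<times> 'p \<Rightarrow>\<^sub>0 int) set" +
 fixes \<psi> :: "('a list \<Rightarrow>\<^sub>0 int) set => 'p"
 assumes comparison: "comparison_map A (Bar K A) (bar_aug A) P \<mu> \<psi>"
begin

sublocale Br: bimodule K A Br by (rule bimodule_Bar)
sublocale TB: trace_group K A Br by (rule trace_group_Bar)

lemma psi_hom: "deg_hom A Br P 0 \<psi>"
 using comparison by (auto simp: comparison_map_def deg_hom_def)

lemma psi_d: "u \<in> carrier Br ==> \<psi> (diff Br u) = d (\<psi> u)"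
 and mu_psi: "u \<in> carrier Br ==> \<mu> (\<psi> u) = bar_aug A u"
 using comparison by (auto simp: comparison_map_def)

definition "p w = \<psi> (wz w)"

lemma p_closed [simp]: "p w \<in> carrier P"
 unfolding p_def by (rule deg_hom_closed[OF psi_hom wz_closed])

lemma d_p: "w \<in> A_lists ==> d (p w) = frag_lift P p (face_sum w)"
 unfolding p_def psi_d[OF wz_closed, symmetric] diff_wz
 by (rule Br.ahom_frag_lift[OF deg_hom_ahom[OF psi_hom] Pg wz_closed])

lemma p_short: "length w < 2 ==> p w = \<zero>\<^sub>P"
 unfolding p_def wz_def word_gens_iff
 by (simp add: ahom_zero[OF ag_Bar Pg deg_hom_ahom[OF psi_hom]])

lemma p_grade: "int (length w) = n + 2 ==> p w \<in> grade P n"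
proof (cases "w \<in> word_gens A 2")
 case True
 assume "int (length w) = n + 2"
 thus ?thesis unfolding p_def wz_def using True deg_hom_grade[OF psi_hom wd_grade[OF True], of n n] by simp
next
 case False
 thus ?thesis
  unfolding p_def wz_def by (simp add: ahom_zero[OF ag_Bar Pg deg_hom_ahom[OF psi_hom]] P.grade_zero)
qed

lemma p_scale_first: "[|w \<in> A_lists; w ~= []; a \<in> carrier A|] ==> p (scale_first a w) = a \<odot>\<^sub>P p w"
 and p_scale_last: "[|w \<in> A_lists; w ~= []; a \<in> carrier A|] ==> p (scale_last a w) = p w \<triangleleft>\<^sub>P a"
 unfolding p_def
  by (subst wz_scale, assumption+, rule deg_hom_smult[OF psi_hom _ wz_closed], assumption)
   (subst wz_scale, assumption+, rule deg_hom_ract[OF psi_hom _ wz_closed], assumption)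

lemma p_kml: "w \<in> A_lists ==> kml P p w"
 unfolding p_def[abs_def] by (rule kml_left_hom[OF wz_kml bimod_hom_left[OF deg_hom_bimod[OF psi_hom]] wz_closed])

lemma bar_aug_pair:
 assumes a: "a \<in> carrier A" "b \<in> carrier A"
 shows "\<mu> (p [a, b]) = a \<otimes>\<^sub>A b"
proof -
 let ?q = "%as. if length as = 2 then as ! 0 \<otimes>\<^sub>A as ! 1 else \<zero>\<^sub>A"
 have b: "bml A ?q w" if w: "w \<in> word_gens A 2" for w
 proof (cases "length w = 2")
  case True
  then obtain x y where e: "w = [x, y]" by (metis One_nat_def Suc_1 length_0_conv length_Suc_conv)
  hence c: "x \<in> carrier A" "y \<in> carrier A" using gens_lists[OF w] by auto
  show ?thesis
   unfolding bml_def
  proof (intro conjI ballI allI impI)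
   show "(%a. ?q (w[k := a])) \<in> ahom A A" if "k < length w" for k
    using that c by (auto simp: e less_Suc_eq intro!: ahomI simp: A.l_distr A.r_distr)
   show "?q (w[j := z \<odot>\<^sub>A w ! j]) = ?q (w[k := z \<odot>\<^sub>A w ! k])" if "z \<in> carrier K" "j < length w" "k < length w" for z j k
    using that c by (auto simp: e less_Suc_eq smult_mult_left smult_mult_right)
  qed
 next
  case False
  thus ?thesis by (simp add: bml_def ahom_const_zero[OF A.ag A.ag])
 qed
 have g: "[a, b] \<in> word_gens A 2" using a by (simp add: word_gens_iff)
 have "bar_aug A (wd [a, b]) = ?q [a, b]"
  unfolding bar_aug_def by (rule word_lift_word[OF A.ag _ b g]) simp
 thus ?thesis using g mu_psi[OF wd_closed[OF g]] by (simp add: p_def wz_def)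
qed

lemma mu_p_long: assumes "length w ~= 2" shows "\<mu> (p w) = \<zero>\<^sub>A"
 by (rule mu_degree[OF _ p_grade, of "int (length w) - 2"]) (use assms in auto)

text \<open>The value of the marked word (m, w) under the tensor square of the comparison
  map.\<close>

definition "Q m w = tp (p (take m w @ [\<one>\<^sub>A])) (p (drop m w))"

lemma Q_closed [simp]: "Q m w \<in> carrier PP"
 by (simp add: Q_def)

lemma Q_degenerate: "m = 0 \<or> length w < m + 2 ==> Q m w = \<zero>\<^bsub>PP\<^esub>"
 unfolding Q_def by (elim disjE) (simp_all add: p_short PQ.tens_zero_left PQ.tens_zero_right)

lemma Q_grade:
 assumes "m <= length w" "int (length w) = n + 3" shows "Q m w \<in> grade PP n"
 unfolding Q_def by (rule PQ.tens_grade[OF p_grade[of _ "int m - 1"] p_grade[of _ "n + 1 - int m"]]) (use assms in auto)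

text \<open>Faces before the mark make up d_L and faces behind it d_R; the Koszul sign of d_R is
  already contained in the formal signs. Only the face at the mark needs the tensor
  relation.\<close>

lemma D_Q:
 assumes w: "w \<in> A_lists" and m: "0 < m" "m < length w"
 shows "D (Q m w) = frag_lift PP (%(m, w). Q m w) (marked_sum (m, w))"
proof -
 let ?x = "take m w @ [\<one>\<^sub>A]" and ?y = "drop m w"
 let ?t = "%k. sgn_elt PP (int (if k < m then k else Suc k)) (Q (mark_face m k) (face k w))"
 have xl: "?x \<in> A_lists" and yl: "?y \<in> A_lists"
  by (rule one_letter_lists[OF w], rule drop_lists[OF w])
 have gx: "p ?x \<in> grade P (int m - 1)" by (rule p_grade) (use m in simp)
 have lx: "length ?x - 1 = m" "length ?y - 1 = length w - 1 - m" using m by simp_all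
 have 1: "dL (Q m w) = (\<Oplus>\<^bsub>PP\<^esub>k\<in>{..<m}. ?t k)"
 proof -
  have "dL (Q m w) = tp (\<Oplus>\<^bsub>P\<^esub>k\<in>{..<m}. sgn_elt P (int k) (p (face k ?x))) (p ?y)"
   by (simp add: Q_def dL_tens d_p[OF xl] frag_lift_face_sum[OF Pg p_closed] lx del: length_append One_nat_def)
  also have "... = (\<Oplus>\<^bsub>PP\<^esub>k\<in>{..<m}. sgn_elt PP (int k) (tp (p (face k ?x)) (p ?y)))"
   by (subst ahom_finsum[OF Pg PPg PQ.tens_left_ahom]) (simp_all add: PQ.tens_sgn_left)
  also have "... = (\<Oplus>\<^bsub>PP\<^esub>k\<in>{..<m}. ?t k)"
  proof (rule PQ.T.finsum_cong'[OF refl])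
   fix k assume k: "k \<in> {..<m}"
   have "tp (p (face k ?x)) (p ?y) = Q (m - 1) (face k w)"
   proof (cases "Suc k < m")
    case True
    show ?thesis unfolding Q_def face_take[OF w True m(2)] ..
   next
    case False
    \<comment> \<open>At the mark the letter is multiplied onto the closing unit of the first
      factor; as a right action it crosses the tensor sign and becomes a factor of the first letter
      of the second word.\<close>
    hence e: "k = m - 1" using k by auto
    have c: "w ! (m - 1) \<in> carrier A" by (rule nth_carrier[OF w]) (use m in simp)
    have "tp (p (face k ?x)) (p ?y) = tp (p (take (m - 1) w @ [\<one>\<^sub>A]) \<triangleleft>\<^sub>P w ! (m - 1)) (p ?y)"
     unfolding e face_take_last(1)[OF w m] by (subst p_scale_last[OF one_letter_lists[OF w] _ c]) simp_all
    also have "... = tp (p (take (m - 1) w @ [\<one>\<^sub>A])) (w ! (m - 1) \<odot>\<^sub>P p ?y)"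
     by (rule PQ.tens_bal) (simp_all add: c del: One_nat_def)
    also have "w ! (m - 1) \<odot>\<^sub>P p ?y = p (scale_first (w ! (m - 1)) ?y)"
     by (rule p_scale_first[OF yl _ c, symmetric]) (use m in simp)
    finally show ?thesis unfolding Q_def e face_take_last(2,3)[OF w m] .
   qed
   thus "sgn_elt PP (int k) (tp (p (face k ?x)) (p ?y)) = ?t k"
    using k by (simp add: mark_face_def)
  qed simp
  finally show ?thesis .
 qed
 have 2: "dR (Q m w) = (\<Oplus>\<^bsub>PP\<^esub>k\<in>{m..<length w - 1}. ?t k)"
 proof -
  have "dR (Q m w) = sgn_elt PP (int m - 1) (tp (p ?x) (\<Oplus>\<^bsub>P\<^esub>k\<in>{..<length w - 1 - m}. sgn_elt P (int k) (p (face k ?y))))"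
   using dR_tens[OF gx p_closed] by (simp add: Q_def d_p[OF yl] frag_lift_face_sum[OF Pg p_closed] lx del: length_drop One_nat_def)
  also have "... = (\<Oplus>\<^bsub>PP\<^esub>l\<in>{..<length w - 1 - m}. sgn_elt PP (int m - 1) (sgn_elt PP (int l) (tp (p ?x) (p (face l ?y)))))"
   by (subst ahom_finsum[OF Pg PPg PQ.tens_right_ahom], simp, simp, subst PQ.T.sgn_elt_finsum) (simp_all add: PQ.tens_sgn_right)
  also have "... = (\<Oplus>\<^bsub>PP\<^esub>l\<in>{..<length w - 1 - m}. ?t (m + l))"
  proof (rule PQ.T.finsum_cong'[OF refl])
   fix l assume l: "l \<in> {..<length w - 1 - m}"
   hence l': "Suc (m + l) < length w" by auto
   have "tp (p ?x) (p (face l ?y)) = Q m (face (m + l) w)" unfolding Q_def face_drop[OF l'] ..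
   thus "sgn_elt PP (int m - 1) (sgn_elt PP (int l) (tp (p ?x) (p (face l ?y)))) = ?t (m + l)"
    by (auto simp: mark_face_def sgn_elt_def)
  qed simp
  also have "... = (\<Oplus>\<^bsub>PP\<^esub>k\<in>(%l. m + l) ` {..<length w - 1 - m}. ?t k)"
   by (rule PQ.T.finsum_reindex[symmetric]) (auto simp: inj_on_def)
  also have "(%l. m + l) ` {..<length w - 1 - m} = {m..<length w - 1}"
   using m by (auto simp: image_iff le_iff_add)
  finally show ?thesis .
 qed
 have U: "{..<length w - 1} = {..<m} \<union> {m..<length w - 1}" using m by auto
 have "(\<Oplus>\<^bsub>PP\<^esub>k\<in>{..<length w - 1}. ?t k) = (\<Oplus>\<^bsub>PP\<^esub>k\<in>{..<m}. ?t k) \<oplus>\<^sub>2 (\<Oplus>\<^bsub>PP\<^esub>k\<in>{m..<length w - 1}. ?t k)"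
  unfolding U by (rule PQ.T.finsum_Un_disjoint) auto
 moreover have "frag_lift PP (%(m, w). Q m w) (marked_sum (m, w)) = (\<Oplus>\<^bsub>PP\<^esub>k\<in>{..<length w - 1}. ?t k)"
  by (subst frag_lift_marked_sum[OF PPg]) (auto intro: PQ.T.finsum_cong')
 ultimately show ?thesis by (simp only: D_def 1 2)
qed

lemma base_central: "[|c \<in> carrier K; x \<in> carrier P|] ==> (c \<odot>\<^sub>A \<one>\<^sub>A) \<odot>\<^sub>P x = x \<triangleleft>\<^sub>P (c \<odot>\<^sub>A \<one>\<^sub>A)"
 by (rule P.scalars_central)

lemma Q_kml: assumes w: "w \<in> A_lists" shows "kml PP (Q m) w"
proof -
 let ?x = "take m w @ [\<one>\<^sub>A]" and ?y = "drop m w"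
 note kx = p_kml[OF one_letter_lists[OF w], of m] and ky = p_kml[OF drop_lists[OF w], of m]
 have u1: "take m (w[k := a]) @ [\<one>\<^sub>A] = ?x[k := a]" "drop m (w[k := a]) = ?y" "?x ! k = w ! k" "k < length ?x"
  if "k < m" "k < length w" for k a
  using that by (simp_all add: take_update_swap list_update_append drop_update_cancel nth_append)
 have u2: "take m (w[k := a]) @ [\<one>\<^sub>A] = ?x" "drop m (w[k := a]) = ?y[k - m := a]" "?y ! (k - m) = w ! k" "k - m < length ?y"
  if "~ k < m" "k < length w" for k a
  using that by (simp_all add: take_update_cancel drop_update_swap)
 show ?thesis
  unfolding kml_def
 proof (intro conjI ballI allI impI)
  fix k assume k: "k < length w"
  show "(%a. Q m (w[k := a])) \<in> ahom A PP"
  proof (cases "k < m")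
   case True
   show ?thesis
    unfolding Q_def u1(1,2)[OF True k] by (rule ahom_comp[OF kml_add[OF kx u1(4)[OF True k]] PQ.tens_left_ahom[OF p_closed]])
  next
   case False
   show ?thesis
    unfolding Q_def u2(1,2)[OF False k] by (rule ahom_comp[OF kml_add[OF ky u2(4)[OF False k]] PQ.tens_right_ahom[OF p_closed]])
  qed
 next
  fix c k assume c: "c \<in> carrier K" and k: "k < length w"
  let ?c = "c \<odot>\<^sub>A \<one>\<^sub>A"
  have cc: "?c \<in> carrier A" using c by simp
  show "Q m (w[k := c \<odot>\<^sub>A w ! k]) = ?c \<odot>\<^bsub>PP\<^esub> Q m w"
  proof (cases "k < m")
   case True
   have "p (?x[k := c \<odot>\<^sub>A w ! k]) = ?c \<odot>\<^sub>P p ?x"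
    using kml_scal[OF kx u1(4)[OF True k] c] unfolding u1(3)[OF True k] .
   thus ?thesis
    unfolding Q_def u1(1,2)[OF True k] by (simp only: PQ.smult_tens[OF cc p_closed p_closed])
  next
   case False
   have "p (?y[k - m := c \<odot>\<^sub>A w ! k]) = ?c \<odot>\<^sub>P p ?y"
    using kml_scal[OF ky u2(4)[OF False k] c] unfolding u2(3)[OF False k] .
   thus ?thesis
    unfolding Q_def u2(1,2)[OF False k]
    by (simp only: PQ.smult_tens[OF cc p_closed p_closed] base_central[OF c p_closed] PQ.tens_bal[OF p_closed cc p_closed])
  qed
 qed
qed

definition "Gam w = frag_lift PP (%(m, w). Q m w) (cuts w)"

lemma Gam_eq: "Gam w = (\<Oplus>\<^bsub>PP\<^esub>i\<in>{1..<length w}. Q i (insert_one i w))"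
proof -
 have "cuts w = (\<Sum>i\<in>{1..<length w}. frag_cmul ((- 1) ^ 0) (frag_of (i, insert_one i w)))" by (simp add: cuts_def)
 hence "Gam w = (\<Oplus>\<^bsub>PP\<^esub>i\<in>{1..<length w}. sgn_elt PP (int 0) ((%(m, w). Q m w) (i, insert_one i w)))"
  unfolding Gam_def by (simp only:) (rule PQ.T.frag_lift_signed_sum, auto)
 thus ?thesis by simp
qed

lemma Gam_closed: "Gam w \<in> carrier PP"
 unfolding Gam_eq by (rule PQ.T.finsum_closed) simp

lemma insert_one_parts: "i <= length w ==> take i (insert_one i w) = take i w" "i <= length w ==> drop i (insert_one i w) = \<one>\<^sub>A # drop i w"
 by (simp_all add: insert_one_def)

lemma Q_insert_one: "i <= length w ==> Q i (insert_one i w) = tp (p (take i w @ [\<one>\<^sub>A])) (p (\<one>\<^sub>A # drop i w))"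
 by (simp add: Q_def insert_one_parts)

lemma Gam_barfun: "barfun PP Gam"
 unfolding barfun_def
proof (intro ballI conjI)
 fix w assume w: "w \<in> word_gens A 2"
 note wl = gens_lists[OF w]
 have i: "i <= length w" if "i \<in> {1..<length w}" for i using that by auto
 show "bml PP Gam w"
 proof (rule bml_cong[OF bml_finsum[OF PPg _ wl, where I = "{1..<length w}" and q = "%i w. Q i (insert_one i w)"] wl])
  fix i assume "i \<in> {1..<length w}"
  show "bml PP (%w. Q i (insert_one i w)) w"
   by (rule bml_letterwise[where q = "Q i" and \<rho> = "insert_one i", OF wl letterwise_insert_one[OF i[OF \<open>i \<in> _\<close>]]
     kml_bml[OF Q_kml[OF insert_one_lists[OF wl]]]])
 qed (simp add: Gam_eq)
 fix a assume a: "a \<in> carrier A"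
 have len: "length (scale_first a w) = length w" "length (scale_last a w) = length w"
  by (simp_all add: scale_first_def scale_last_def)
 show "Gam (scale_first a w) = a \<odot>\<^bsub>PP\<^esub> Gam w"
  unfolding Gam_eq len
 proof (subst PQ.T.smult_finsum[OF a], simp, rule PQ.T.finsum_cong'[OF refl])
  fix i assume i: "i \<in> {1..<length w}"
  have "take i (scale_first a w) @ [\<one>\<^sub>A] = scale_first a (take i w @ [\<one>\<^sub>A])" "drop i (scale_first a w) = drop i w"
   using i by (auto simp: scale_first_def take_update_swap list_update_append nth_append drop_update_cancel)
  thus "Q i (insert_one i (scale_first a w)) = a \<odot>\<^bsub>PP\<^esub> Q i (insert_one i w)"
   using i p_scale_first[OF one_letter_lists[OF wl, of i] _ a] a
   by (simp add: Q_insert_one len PQ.smult_tens)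
 qed (simp add: a PQ.T.left_closed)
 show "Gam (scale_last a w) = Gam w \<triangleleft>\<^bsub>PP\<^esub> a"
  unfolding Gam_eq len
 proof (subst PQ.T.ract_finsum[OF a], simp, rule PQ.T.finsum_cong'[OF refl])
  fix i assume i: "i \<in> {1..<length w}"
  have "\<one>\<^sub>A # drop i (scale_last a w) = scale_last a (\<one>\<^sub>A # drop i w)" "take i (scale_last a w) = take i w"
  proof -
   obtain n where n: "length w = Suc n" using i by (cases "length w") auto
   thus "\<one>\<^sub>A # drop i (scale_last a w) = scale_last a (\<one>\<^sub>A # drop i w)" "take i (scale_last a w) = take i w"
    using i by (auto simp: scale_last_def drop_update_swap take_update_cancel Suc_diff_le)
  qed
  moreover have "\<one>\<^sub>A # drop i w \<in> A_lists" using drop_lists[OF wl, of i] by simp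
  ultimately show "Q i (insert_one i (scale_last a w)) = Q i (insert_one i w) \<triangleleft>\<^bsub>PP\<^esub> a"
   using i p_scale_last[of "\<one>\<^sub>A # drop i w" a] a
   by (simp add: Q_insert_one len PQ.ract_tens)
 qed (simp add: a PQ.T.right_closed)
qed

definition "gam = pres_lift PP Gam"

lemma gam_wd: "w \<in> word_gens A 2 ==> gam (wd w) = Gam w"
 unfolding gam_def by (rule bar_lift_wd[OF PQ.bimodule_tensor Gam_barfun])

lemma gam_hom: "deg_hom A Br PP 0 gam"
proof -
 have h: "gam \<in> bimod_hom A Br PP" unfolding gam_def by (rule bar_lift_hom[OF PQ.bimodule_tensor Gam_barfun])
 have "gam u \<in> grade PP (n + 0)" if u: "u \<in> grade Br n" for n u
 proof (rule grade_Bar_image[OF bimod_hom_ahom[OF h] PPg grPP _ u])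
  fix w assume w: "w \<in> word_gens A 2" "int (length w) = n + 2"
  show "gam (wd w) \<in> grade PP (n + 0)"
   unfolding gam_wd[OF w(1)] Gam_eq
   by (rule PQ.T.subgroup_finsum[OF grPP Q_grade]) (use w(2) in \<open>auto simp: length_insert_one\<close>)
 qed
 thus ?thesis using h by (simp add: deg_hom_def)
qed

lemma gam_wz: "w \<in> A_lists ==> gam (wz w) = Gam w"
proof (cases "w \<in> word_gens A 2")
 case True thus ?thesis by (simp add: wz_def gam_wd)
next
 case False
 assume "w \<in> A_lists"
 hence "~ 2 <= length w" using False unfolding word_gens_iff by simp
 hence "{1..<length w} = {}" by simp
 thus ?thesis
  using False by (simp only: wz_def Gam_eq if_False ahom_zero[OF ag_Bar PPg deg_hom_ahom[OF gam_hom]] PQ.T.finsum_empty)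
qed

lemma D_gam: assumes u: "u \<in> carrier Br" shows "D (gam u) = gam (diff Br u)"
proof (rule Bar_hom_eq[OF ahom_comp[OF deg_hom_ahom[OF gam_hom] D_ahom] ahom_comp[OF bimod_hom_ahom[OF diff_Bar_hom] deg_hom_ahom[OF gam_hom]] PPg _ u])
 fix w assume w: "w \<in> word_gens A 2"
 note wl = gens_lists[OF w]
 obtain n where n: "length w = n + 2" using gens_length[OF w] le_Suc_ex by (metis add.commute)
 let ?Q = "%(m, w). Q m w"
 have Qc: "?Q x \<in> carrier PP" for x by (simp add: case_prod_beta)
 have fc: "frag_lift PP ?Q z \<in> carrier PP" for z by (rule PQ.T.frag_lift_closed[OF Qc])
 have "D (gam (wd w)) = frag_lift PP (%x. D (?Q x)) (cuts w)"
  unfolding gam_wd[OF w] Gam_def by (rule PQ.T.ahom_frag_lift[OF D_ahom PPg Qc])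
 also have "... = frag_lift PP (%x. frag_lift PP ?Q (marked_sum x)) (cuts w)"
 proof (rule PQ.T.frag_lift_cong[OF _ fc])
  fix x assume "x \<in> Poly_Mapping.keys (cuts w)"
  moreover have "Poly_Mapping.keys (cuts w) <= (\<Union>i\<in>{1..<length w}. Poly_Mapping.keys (frag_of (i, insert_one i w)))"
   unfolding cuts_def by (rule keys_sum)
  ultimately obtain i where i: "i \<in> {1..<length w}" "x = (i, insert_one i w)" by auto
  thus "D (?Q x) = frag_lift PP ?Q (marked_sum x)"
   using D_Q[OF insert_one_lists[OF wl], of i i] by (simp add: length_insert_one)
 qed
 also have "... = frag_lift PP ?Q (frag_extend marked_sum (cuts w))" by (rule PQ.T.frag_lift_extend[OF Qc])
 also have "... = frag_lift PP ?Q (frag_extend cuts (face_sum w)) \<oplus>\<^sub>2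
   (frag_lift PP ?Q (frag_of (0, w)) \<oplus>\<^sub>2 frag_lift PP ?Q (frag_cmul ((- 1) ^ n) (frag_of (Suc n, w))))"
  unfolding marked_sum_cuts[OF wl n] by (simp only: PQ.T.frag_lift_add[OF Qc Qc])
 \<comment> \<open>Both degenerate marks give a factor with fewer than two letters and hence
   zero.\<close>
 also have "... = frag_lift PP ?Q (frag_extend cuts (face_sum w))"
  by (simp add: PQ.T.frag_lift_neg_sign[OF Qc] Q_degenerate n fc)
 also have "... = frag_lift PP Gam (face_sum w)"
  unfolding Gam_def by (rule PQ.T.frag_lift_extend[OF Qc, symmetric])
 also have "... = frag_lift PP (%v. gam (wz v)) (face_sum w)"
  by (rule PQ.T.frag_lift_cong) (simp_all only: gam_wz[OF keys_face_sum[OF wl]] deg_hom_closed[OF gam_hom wz_closed] Gam_closed)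
 also have "... = gam (diff Br (wd w))"
  unfolding diff_wd[OF w] by (rule Br.ahom_frag_lift[OF deg_hom_ahom[OF gam_hom] PPg wz_closed, symmetric])
 finally show "D (gam (wd w)) = gam (diff Br (wd w))" .
qed

lemma finsum_one:
 assumes "abelian_group G" "j \<in> I" "finite I" "h j \<in> carrier G" "!!i. [|i \<in> I; i ~= j|] ==> h i = \<zero>\<^bsub>G\<^esub>"
 shows "finsum G h I = h j"
proof -
 interpret G: abelian_group G by fact
 have "finsum G h I = (\<Oplus>\<^bsub>G\<^esub>i\<in>I. if j = i then h i else \<zero>\<^bsub>G\<^esub>)"
  by (rule G.finsum_cong'[OF refl]) (use assms(4,5) in auto)
 also have "... = h j"
 proof -
  have "(\<Oplus>\<^bsub>G\<^esub>i\<in>I. if j = i then h i else \<zero>\<^bsub>G\<^esub>) = (\<Oplus>\<^bsub>G\<^esub>i\<in>{j}. h i)"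
   by (rule G.add.finprod_mono_neutral_cong_right) (use assms in auto)
  thus ?thesis using assms(4) by simp
 qed
 finally show ?thesis .
qed

lemma muL_Q: "muL (Q m w) = \<mu> (p (take m w @ [\<one>\<^sub>A])) \<odot>\<^sub>P p (drop m w)"
 and muR_Q: "muR (Q m w) = p (take m w @ [\<one>\<^sub>A]) \<triangleleft>\<^sub>P \<mu> (p (drop m w))"
 by (simp_all add: Q_def muL_tens muR_tens)

text \<open>The augmentation vanishes on values of words whose length is not two. Hence mu_L sees
  only the cut after the first letter, whose left factor is \<open>[x, \<one>\<^sub>A]\<close>, and
  that letter is returned by left linearity. Symmetrically, mu_R sees only the cut before the last
  letter.\<close>

lemma muL_gam: assumes u: "u \<in> carrier Br" shows "muL (gam u) = \<psi> u"
proof (rule Bar_hom_eq[OF ahom_comp[OF deg_hom_ahom[OF gam_hom] muL_ahom] deg_hom_ahom[OF psi_hom] Pg _ u])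
 fix w assume w: "w \<in> word_gens A 2"
 note wl = gens_lists[OF w]
 obtain x ys y where e: "w = x # ys @ [y]" using word_ends gens_length[OF w] by blast
 have c: "x \<in> carrier A" "\<one>\<^sub>A # ys @ [y] \<in> A_lists" using wl by (simp_all add: e)
 have "muL (gam (wd w)) = (\<Oplus>\<^bsub>P\<^esub>i\<in>{1..<length w}. muL (Q i (insert_one i w)))"
  unfolding gam_wd[OF w] Gam_eq by (rule ahom_finsum[OF PPg Pg muL_ahom]) simp
 also have "... = muL (Q 1 (insert_one 1 w))"
 proof (rule finsum_one[OF Pg])
  fix i assume "i \<in> {1..<length w}" "i ~= 1"
  thus "muL (Q i (insert_one i w)) = \<zero>\<^sub>P"
   by (simp add: muL_Q insert_one_parts mu_p_long)
 qed (simp_all add: e)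
 also have "... = x \<odot>\<^sub>P p (\<one>\<^sub>A # ys @ [y])"
  using c by (simp add: muL_Q insert_one_def e bar_aug_pair)
 also have "... = p (scale_first x (\<one>\<^sub>A # ys @ [y]))" by (rule p_scale_first[OF c(2) _ c(1), symmetric]) simp
 also have "scale_first x (\<one>\<^sub>A # ys @ [y]) = w" using c by (simp add: scale_first_def e)
 finally show "muL (gam (wd w)) = \<psi> (wd w)" using w by (simp add: p_def wz_def)
qed

lemma muR_gam: assumes u: "u \<in> carrier Br" shows "muR (gam u) = \<psi> u"
proof (rule Bar_hom_eq[OF ahom_comp[OF deg_hom_ahom[OF gam_hom] deg_hom_ahom[OF muR_hom]] deg_hom_ahom[OF psi_hom] Pg _ u])
 fix w assume w: "w \<in> word_gens A 2"
 note wl = gens_lists[OF w]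
 obtain x ys y where e: "w = x # ys @ [y]" using word_ends gens_length[OF w] by blast
 have c: "y \<in> carrier A" "x # ys @ [\<one>\<^sub>A] \<in> A_lists" using wl by (simp_all add: e)
 have "muR (gam (wd w)) = (\<Oplus>\<^bsub>P\<^esub>i\<in>{1..<length w}. muR (Q i (insert_one i w)))"
  unfolding gam_wd[OF w] Gam_eq by (rule ahom_finsum[OF PPg Pg deg_hom_ahom[OF muR_hom]]) simp
 also have "... = muR (Q (length w - 1) (insert_one (length w - 1) w))"
 proof (rule finsum_one[OF Pg])
  fix i assume "i \<in> {1..<length w}" "i ~= length w - 1"
  thus "muR (Q i (insert_one i w)) = \<zero>\<^sub>P"
   by (simp add: muR_Q insert_one_parts mu_p_long)
 qed (simp_all add: e)
 also have "... = p (x # ys @ [\<one>\<^sub>A]) \<triangleleft>\<^sub>P y"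
  using c by (simp add: muR_Q insert_one_def e bar_aug_pair)
 also have "... = p (scale_last y (x # ys @ [\<one>\<^sub>A]))" by (rule p_scale_last[OF c(2) _ c(1), symmetric]) simp
 also have "scale_last y (x # ys @ [\<one>\<^sub>A]) = w" using c by (simp add: scale_last_def e)
 finally show "muR (gam (wd w)) = \<psi> (wd w)" using w by (simp add: p_def wz_def)
qed

end

section \<open>Replacing Delta' by the deconcatenation coproduct\<close>

context comparison
begin

lemmas Brg = ag_Bar

lemma diff_Br_hom: "deg_hom A Br Br (- 1) (diff Br)"
 unfolding deg_hom_def using diff_Bar_hom diff_Bar_grade by auto

lemmas diff_Br_closed = deg_hom_closed[OF diff_Br_hom]
lemmas psi_closed = deg_hom_closed[OF psi_hom]
lemmas gam_closed = deg_hom_closed[OF gam_hom]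

lemmas PP_plus_hom = deg_hom_plus[OF _ _ Brg PQ.bimodule_tensor grPP]
lemmas PP_uminus_hom = deg_hom_uminus[OF _ Brg PQ.bimodule_tensor grPP]
lemmas P_plus_hom = deg_hom_plus[OF _ _ Brg P.bimodule_axioms P.grade_asubgroup]
lemmas P_uminus_hom = deg_hom_uminus[OF _ Brg P.bimodule_axioms P.grade_asubgroup]

definition "gap u = Delta' (\<psi> u) \<ominus>\<^bsub>PP\<^esub> gam u"

text \<open>\<open>phi (gam u)\<close> bounds psi - f psi; adding its image under f gives a homotopy
  bounding psi - f^2 psi, the difference seen by mu_L.\<close>

definition "defect u = f (phi (gam u)) \<oplus>\<^sub>P phi (gam u)"

lemma gap_hom: "deg_hom A Br PP 0 gap"
 unfolding gap_def[abs_def] a_minus_def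
 by (intro PP_plus_hom PP_uminus_hom gam_hom deg_hom_comp[OF psi_hom Delta'_hom]) simp

lemma phi_gam_hom: "deg_hom A Br P 1 (%u. phi (gam u))"
 by (rule deg_hom_comp[OF gam_hom phi_hom]) simp

lemma defect_hom: "deg_hom A Br P 1 defect"
 unfolding defect_def[abs_def]
 by (intro P_plus_hom phi_gam_hom deg_hom_comp[OF phi_gam_hom f_hom]) simp

lemma D_gap: "u \<in> carrier Br ==> D (gap u) = gap (diff Br u)"
 unfolding gap_def
 by (simp add: ahom_minus[OF PPg PPg D_ahom] psi_closed gam_closed D_Delta' D_gam psi_d)

lemma muL_gap: "u \<in> carrier Br ==> muL (gap u) = f (f (\<psi> u)) \<ominus>\<^sub>P \<psi> u"
 and muR_gap: "u \<in> carrier Br ==> muR (gap u) = f (\<psi> u) \<ominus>\<^sub>P \<psi> u"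
 unfolding gap_def
 by (simp_all add: ahom_minus[OF PPg Pg op_ahom(3)] ahom_minus[OF PPg Pg op_ahom(4)] psi_closed gam_closed
   muL_Delta' muR_Delta' muL_gam muR_gam)

lemma phi_gam_homotopy:
 "u \<in> carrier Br ==> d (phi (gam u)) \<oplus>\<^sub>P phi (gam (diff Br u)) \<oplus>\<^sub>P f (\<psi> u) = \<psi> u"
 using phi_homotopy[OF gam_closed] by (simp add: D_gam muL_gam muR_gam)

lemma d_defect:
 assumes u: "u \<in> carrier Br"
 shows "d (defect u) \<oplus>\<^sub>P defect (diff Br u) = \<psi> u \<ominus>\<^sub>P f (f (\<psi> u))"
proof -
 define a where "a = d (phi (gam u))"
 define b where "b = phi (gam (diff Br u))"
 have ab: "a \<in> carrier P" "b \<in> carrier P" unfolding a_def b_def using u by (simp_all add: gam_closed diff_Br_closed)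
 have y: "\<psi> u \<in> carrier P" by (rule psi_closed[OF u])
 have e: "a \<oplus>\<^sub>P b \<oplus>\<^sub>P f (\<psi> u) = \<psi> u" unfolding a_def b_def by (rule phi_gam_homotopy[OF u])
 have fe: "f (\<psi> u) = f a \<oplus>\<^sub>P f b \<oplus>\<^sub>P f (f (\<psi> u))"
  using arg_cong[OF e, of f] ab y by (simp add: ahom_add[OF op2_ahom(2)])
 have "d (defect u) \<oplus>\<^sub>P defect (diff Br u) = (f a \<oplus>\<^sub>P a) \<oplus>\<^sub>P (f b \<oplus>\<^sub>P b)"
  unfolding defect_def a_def b_def
  using u by (simp add: ahom_add[OF op_ahom(7)] gam_closed diff_Br_closed d_f)
 also have "... = (a \<oplus>\<^sub>P b) \<oplus>\<^sub>P (f a \<oplus>\<^sub>P f b)" using ab by (simp add: P.a_ac)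
 also have "f a \<oplus>\<^sub>P f b = f (\<psi> u) \<ominus>\<^sub>P f (f (\<psi> u))"
  by (subst fe) (use ab y in \<open>simp add: a_minus_def P.a_assoc P.r_neg\<close>)
 finally show ?thesis
  using ab y arg_cong[OF e, of "%z. z \<ominus>\<^sub>P f (f (\<psi> u))"] by (simp add: a_minus_def P.a_assoc)
qed

text \<open>If mu_L of \<open>gap\<close> vanished, S t_L \<open>gap\<close> would be a null
  homotopy by the perturbed contraction. The error is Delta of f^2 psi - psi, and since Delta is a
  chain map it is removed by Delta of \<open>defect\<close>.\<close>

definition "h1 u = S (tL (gap u)) \<ominus>\<^bsub>PP\<^esub> Delta (defect u)"

lemma h1_hom: "deg_hom A Br PP 1 h1"
 unfolding h1_def[abs_def] a_minus_def
 by (intro PP_plus_hom PP_uminus_hom deg_hom_comp[OF deg_hom_comp[OF gap_hom tL_hom] S_hom]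
   deg_hom_comp[OF defect_hom Delta_hom]) simp_all

lemmas h1_closed = deg_hom_closed[OF h1_hom]
lemmas gap_closed = deg_hom_closed[OF gap_hom]
lemmas defect_closed = deg_hom_closed[OF defect_hom]

lemma (in abelian_group) minus_plus_minus:
 "[|a \<in> carrier G; b \<in> carrier G; x \<in> carrier G; y \<in> carrier G|]
  ==> (a \<ominus> x) \<oplus> (b \<ominus> y) = (a \<oplus> b) \<ominus> (x \<oplus> y)"
 by (simp add: a_minus_def minus_add a_ac)

lemma D_h1:
 assumes u: "u \<in> carrier Br" shows "D (h1 u) \<oplus>\<^sub>2 h1 (diff Br u) = gap u"
proof -
 note du = diff_Br_closed[OF u]
 have "Delta (d (defect u)) \<oplus>\<^sub>2 Delta (defect (diff Br u)) = Delta (d (defect u) \<oplus>\<^bsub>P\<^esub> defect (diff Br u))"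
  using u du by (simp add: ahom_add[OF op2_ahom(1)] defect_closed)
 also have "... = \<ominus>\<^bsub>PP\<^esub> Delta (muL (gap u))"
  unfolding d_defect[OF u] muL_gap[OF u]
  using psi_closed[OF u] by (simp add: a_minus_def ahom_add[OF op2_ahom(1)] ahom_neg[OF Pg PPg op2_ahom(1)] PQ.T.minus_add PQ.T.a_comm)
 finally have e: "Delta (d (defect u)) \<oplus>\<^sub>2 Delta (defect (diff Br u)) = \<ominus>\<^bsub>PP\<^esub> Delta (muL (gap u))" .
 have "D (h1 u) \<oplus>\<^sub>2 h1 (diff Br u) = (D (S (tL (gap u))) \<ominus>\<^bsub>PP\<^esub> Delta (d (defect u)))
   \<oplus>\<^sub>2 (S (tL (D (gap u))) \<ominus>\<^bsub>PP\<^esub> Delta (defect (diff Br u)))"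
  unfolding h1_def using u by (simp add: ahom_minus[OF PPg PPg D_ahom] gap_closed defect_closed D_gap D_Delta)
 also have "... = D (S (tL (gap u))) \<oplus>\<^sub>2 S (tL (D (gap u))) \<ominus>\<^bsub>PP\<^esub> (Delta (d (defect u)) \<oplus>\<^sub>2 Delta (defect (diff Br u)))"
  by (rule PQ.T.minus_plus_minus) (use u du in \<open>simp_all add: gap_closed defect_closed\<close>)
 also have "... = gap u"
  unfolding e using PP_contract[OF gap_closed[OF u]] gap_closed[OF u] by (simp add: a_minus_def)
 finally show ?thesis .
qed

text \<open>The trace of this element is exactly what the homotopy relation for
  \<open>hat phi\<close> leaves at \<open>h1 u\<close>. Its boundary is mu_L - f mu_R of
  \<open>gap\<close>, in which the f^2 terms cancel.\<close>

definition "K1 u = muL (h1 u) \<ominus>\<^bsub>P\<^esub> f (muR (h1 u))"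

lemma K1_hom: "deg_hom A Br P 1 K1"
 unfolding K1_def[abs_def] a_minus_def
 by (intro P_plus_hom P_uminus_hom deg_hom_comp[OF h1_hom muL_hom]
   deg_hom_comp[OF deg_hom_comp[OF h1_hom muR_hom] f_hom]) simp_all

lemmas K1_closed = deg_hom_closed[OF K1_hom]

lemma d_K1:
 assumes u: "u \<in> carrier Br"
 shows "d (K1 u) \<oplus>\<^bsub>P\<^esub> K1 (diff Br u) = f (\<psi> u) \<ominus>\<^bsub>P\<^esub> \<psi> u"
proof -
 note c = h1_closed[OF u] h1_closed[OF diff_Br_closed[OF u]] psi_closed[OF u]
 have "d (K1 u) \<oplus>\<^bsub>P\<^esub> K1 (diff Br u)
   = (muL (D (h1 u)) \<ominus>\<^bsub>P\<^esub> f (muR (D (h1 u)))) \<oplus>\<^bsub>P\<^esub> (muL (h1 (diff Br u)) \<ominus>\<^bsub>P\<^esub> f (muR (h1 (diff Br u))))"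
  unfolding K1_def using c by (simp add: ahom_minus[OF Pg Pg op_ahom(7)] muR_D muL_D d_f)
 also have "... = (muL (D (h1 u)) \<oplus>\<^bsub>P\<^esub> muL (h1 (diff Br u))) \<ominus>\<^bsub>P\<^esub> (f (muR (D (h1 u))) \<oplus>\<^bsub>P\<^esub> f (muR (h1 (diff Br u))))"
  by (rule P.minus_plus_minus) (use c in simp_all)
 also have "... = muL (gap u) \<ominus>\<^bsub>P\<^esub> f (muR (gap u))"
  unfolding D_h1[OF u, symmetric] using c
  by (simp add: ahom_add[OF op_ahom(3)] ahom_add[OF op_ahom(4)] ahom_add[OF op2_ahom(2)])
 also have "... = (f (f (\<psi> u)) \<ominus>\<^bsub>P\<^esub> \<psi> u) \<ominus>\<^bsub>P\<^esub> (f (f (\<psi> u)) \<ominus>\<^bsub>P\<^esub> f (\<psi> u))"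
  unfolding muL_gap[OF u] muR_gap[OF u] using c(3) by (simp add: ahom_minus[OF Pg Pg op2_ahom(2)])
 also have "... = f (\<psi> u) \<ominus>\<^bsub>P\<^esub> \<psi> u"
  using c(3) by (simp add: a_minus_def P.minus_add P.a_ac P.r_neg1 P.r_neg)
 finally show ?thesis .
qed

definition "bar_trace g = pres_lift (Tr A P) (%(b, u). g (b \<odot>\<^bsub>Br\<^esub> u))"

lemma bar_trace:
 assumes g: "g \<in> ahom Br (Tr A P)"
  and cyc: "!!a u. [|a \<in> carrier A; u \<in> carrier Br|] ==> g (a \<odot>\<^bsub>Br\<^esub> u) = g (u \<triangleleft>\<^bsub>Br\<^esub> a)"
 shows bar_trace_ahom: "bar_trace g \<in> ahom (Tr A Br) (Tr A P)"
  and bar_trace_tb: "u \<in> carrier Br ==> bar_trace g (tb u) = g u"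
 unfolding bar_trace_def
 by (rule TB.Tr_lift_hom[OF TPg g cyc refl], assumption+) (rule TB.Tr_lift_tr[OF TPg g cyc refl], assumption+)

lemma hat_cyclic:
 assumes g: "deg_hom A PP P k g" and a: "a \<in> carrier A" and u: "u \<in> carrier PP"
 shows "hat g (a \<odot>\<^bsub>PP\<^esub> u) = hat g (u \<triangleleft>\<^bsub>PP\<^esub> a)"
 unfolding hat_def using a u by (simp add: swap_tensor_cyclic)

abbreviation "Tpsi == Tr_map A P \<psi>"

lemmas Tpsi_ahom = Tr_map_hom[OF TB.trace_group_axioms TP.trace_group_axioms deg_hom_bimod[OF psi_hom]]
lemmas Tpsi_tb = Tr_map_tr[OF TB.trace_group_axioms TP.trace_group_axioms deg_hom_bimod[OF psi_hom]]

definition "Eh = bar_trace (%u. hat phi (h1 u))"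

lemma Eh_cyc: "[|a \<in> carrier A; u \<in> carrier Br|] ==> hat phi (h1 (a \<odot>\<^bsub>Br\<^esub> u)) = hat phi (h1 (u \<triangleleft>\<^bsub>Br\<^esub> a))"
 by (simp add: deg_hom_smult[OF h1_hom] deg_hom_ract[OF h1_hom] hat_cyclic[OF phi_hom] h1_closed)

lemma Eh_ahom: "Eh \<in> ahom (Tr A Br) (Tr A P)"
 and Eh_tb: "u \<in> carrier Br ==> Eh (tb u) = hat phi (h1 u)"
 unfolding Eh_def
 by (rule bar_trace_ahom[OF ahom_comp[OF deg_hom_ahom[OF h1_hom] hat_ahom[OF phi_hom]]], erule (1) Eh_cyc)
   (rule bar_trace_tb[OF ahom_comp[OF deg_hom_ahom[OF h1_hom] hat_ahom[OF phi_hom]]], erule (1) Eh_cyc)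

text \<open>Delta' psi is written as gamma plus the boundary of \<open>h1\<close>. Under
  \<open>hat phi\<close> the boundary part becomes the trace of \<open>K1\<close> and terms with
  \<open>Eh\<close>, so the given map is replaced by one built from gamma.\<close>

lemma connes_Tpsi:
 assumes u: "u \<in> carrier Br"
 shows "connes (Tpsi (tb u)) \<oplus>\<^bsub>Tr A P\<^esub> (hat phi (gam u) \<oplus>\<^bsub>Tr A P\<^esub> TP.tr (K1 u))
   = dT (Eh (tb u)) \<ominus>\<^bsub>Tr A P\<^esub> Eh (tb (diff Br u))"
proof -
 note hc = ahom_closed[OF hat_ahom[OF phi_hom]]
 note c = h1_closed[OF u] h1_closed[OF diff_Br_closed[OF u]] psi_closed[OF u] gam_closed[OF u]
 define e where "e = dT (hat phi (h1 u))"
 define a where "a = hat phi (D (h1 u))"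
 define b where "b = hat phi (h1 (diff Br u))"
 define g where "g = hat phi (gam u)"
 define k where "k = TP.tr (K1 u)"
 have cc: "e \<in> carrier (Tr A P)" "a \<in> carrier (Tr A P)" "b \<in> carrier (Tr A P)" "g \<in> carrier (Tr A P)" "k \<in> carrier (Tr A P)"
  unfolding e_def a_def b_def g_def k_def using c ahom_closed[OF dT_ahom] K1_closed[OF u] by (simp_all add: hc TP.tr_closed)
 have z: "e \<oplus>\<^bsub>Tr A P\<^esub> a \<oplus>\<^bsub>Tr A P\<^esub> TP.tr (f (muR (h1 u))) = TP.tr (muL (h1 u))"
  unfolding e_def a_def by (rule hat_phi_homotopy[OF c(1)])
 have "k = TP.tr (muL (h1 u)) \<ominus>\<^bsub>Tr A P\<^esub> TP.tr (f (muR (h1 u)))"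
  unfolding k_def K1_def using c by (simp add: a_minus_def a_minus_def TP.tr_add TP.tr_minus)
 moreover have "TP.tr (f (muR (h1 u))) \<in> carrier (Tr A P)" using c by (simp add: TP.tr_closed)
 ultimately have k: "k = e \<oplus>\<^bsub>Tr A P\<^esub> a"
  unfolding z[symmetric] using cc by (simp add: a_minus_def TP.Tr.a_assoc TP.Tr.r_neg)
 have "Delta' (\<psi> u) = (D (h1 u) \<oplus>\<^sub>2 h1 (diff Br u)) \<oplus>\<^sub>2 gam u"
  unfolding D_h1[OF u] gap_def using c by (simp add: a_minus_def PQ.T.a_assoc PQ.T.l_neg)
 hence "hat phi (Delta' (\<psi> u)) = a \<oplus>\<^bsub>Tr A P\<^esub> b \<oplus>\<^bsub>Tr A P\<^esub> g"
  unfolding a_def b_def g_def using c by (simp add: ahom_add[OF hat_ahom[OF phi_hom]])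
 hence "connes (Tpsi (tb u)) = \<ominus>\<^bsub>Tr A P\<^esub> (a \<oplus>\<^bsub>Tr A P\<^esub> b \<oplus>\<^bsub>Tr A P\<^esub> g)"
  using c u by (simp add: Tpsi_tb connes_tr)
 moreover have "\<ominus>\<^bsub>Tr A P\<^esub> (a \<oplus>\<^bsub>Tr A P\<^esub> b \<oplus>\<^bsub>Tr A P\<^esub> g) \<oplus>\<^bsub>Tr A P\<^esub> (g \<oplus>\<^bsub>Tr A P\<^esub> (e \<oplus>\<^bsub>Tr A P\<^esub> a)) = e \<ominus>\<^bsub>Tr A P\<^esub> b"
  using cc
  by (simp add: a_minus_def TP.Tr.minus_add TP.Tr.a_ac TP.Tr.r_neg1 TP.Tr.r_neg2 TP.Tr.r_neg TP.Tr.l_neg,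
    subst TP.Tr.a_lcomm, simp_all add: TP.Tr.r_neg2)
 moreover have "dT (Eh (tb u)) = e" "Eh (tb (diff Br u)) = b"
  unfolding e_def b_def by (simp_all add: Eh_tb u diff_Br_closed)
 ultimately show ?thesis unfolding g_def[symmetric] k_def[symmetric] by (simp only: k)
qed

end

section \<open>Functions on marked words and one lifting step along P\<close>

context comparison
begin

text \<open>The marks for which both tensor factors, \<open>take m w @ [\<one>\<^sub>A]\<close> and
  \<open>drop m w\<close>, have at least two letters.\<close>

definition valid :: "nat => 'a list => bool" where
 "valid m w \<longleftrightarrow> w \<in> A_lists & 1 <= m & m + 2 <= length w"

lemma validD: "valid m w ==> w \<in> A_lists" "valid m w ==> 1 <= m" "valid m w ==> m + 2 <= length w"
 unfolding valid_def by blast+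

lemma valid_iff: "w \<in> A_lists ==> valid m w \<longleftrightarrow> 1 <= m & m + 2 <= length w"
 unfolding valid_def by blast

lemma valid_update: "[|w \<in> A_lists; a \<in> carrier A|] ==> valid m (w[k := a]) \<longleftrightarrow> valid m w"
 by (simp only: valid_iff update_lists length_list_update)

lemma scale_lists:
 assumes "w \<in> A_lists" "w ~= []" "a \<in> carrier A"
 shows "scale_first a w \<in> A_lists" "scale_last a w \<in> A_lists"
proof -
 have "w ! 0 \<in> carrier A" "w ! (length w - 1) \<in> carrier A"
  by (rule nth_carrier[OF assms(1)], use assms(2) in simp)+
 thus "scale_first a w \<in> A_lists" "scale_last a w \<in> A_lists"
  unfolding scale_first_def scale_last_def by (intro update_lists assms A.m_closed; simp)+
qed

lemma length_scale [simp]: "length (scale_first a w) = length w" "length (scale_last a w) = length w"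
 by (simp_all add: scale_first_def scale_last_def)

lemma valid_scale:
 assumes "w \<in> A_lists" "w ~= []" "a \<in> carrier A"
 shows "valid m (scale_first a w) \<longleftrightarrow> valid m w" "valid m (scale_last a w) \<longleftrightarrow> valid m w"
 by (simp_all only: valid_iff scale_lists[OF assms] assms(1) length_scale)

definition cutoff :: "(nat => 'a list => 'p) => nat => 'a list => 'p" where
 "cutoff g m w = (if valid m w then g m w else \<zero>\<^sub>P)"

lemma cutoff_simps: "valid m w ==> cutoff g m w = g m w" "~ valid m w ==> cutoff g m w = \<zero>\<^sub>P"
 by (simp_all add: cutoff_def)

text \<open>Encodes bimodule maps from the tensor square of the bar complex to P. A marked word with
  L letters has degree L - 3 there, so the index \<open>j\<close> stands for degree j + 3: it is -2
  for \<open>theta\<close>, of degree 1, and -1 for its null homotopy.\<close>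

definition mfun :: "int => (nat => 'a list => 'p) => bool" where
 "mfun j g \<longleftrightarrow> (\<forall>m w. ~ valid m w --> g m w = \<zero>\<^sub>P) &
   (\<forall>m w. valid m w --> g m w \<in> grade P (int (length w) + j) & bml P (g m) w &
    (\<forall>a\<in>carrier A. g m (scale_first a w) = a \<odot>\<^sub>P g m w & g m (scale_last a w) = g m w \<triangleleft>\<^sub>P a))"

lemma mfunD:
 assumes "mfun j g"
 shows mfun_invalid: "~ valid m w ==> g m w = \<zero>\<^sub>P"
  and mfun_grade: "g m w \<in> grade P (int (length w) + j)"
  and mfun_closed: "g m w \<in> carrier P"
  and mfun_bml: "w \<in> A_lists ==> bml P (g m) w"
  and mfun_first: "[|w \<in> A_lists; w ~= []; a \<in> carrier A|] ==> g m (scale_first a w) = a \<odot>\<^sub>P g m w"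
  and mfun_last: "[|w \<in> A_lists; w ~= []; a \<in> carrier A|] ==> g m (scale_last a w) = g m w \<triangleleft>\<^sub>P a"
proof -
 have i: "g m w = \<zero>\<^sub>P" if "~ valid m w" for w using assms that unfolding mfun_def by blast
 thus "~ valid m w ==> g m w = \<zero>\<^sub>P" .
 show gr: "g m w \<in> grade P (int (length w) + j)"
 proof (cases "valid m w")
  case True thus ?thesis using assms unfolding mfun_def by blast
 next
  case False show ?thesis unfolding i[OF False] by (rule P.grade_zero)
 qed
 thus "g m w \<in> carrier P" by (rule P.grade_closed)
 show "bml P (g m) w" if w: "w \<in> A_lists"
 proof (cases "valid m w")
  case True thus ?thesis using assms unfolding mfun_def by blast
 next
  case False
  have z: "bml P (%w. \<zero>\<^sub>P) w" by (simp add: bml_def ahom_const_zero[OF A.ag Pg])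
  show ?thesis by (rule bml_cong[OF z w]) (simp only: i valid_update[OF w] False not_False_eq_True)
 qed
 show "g m (scale_first a w) = a \<odot>\<^sub>P g m w" if w: "w \<in> A_lists" "w ~= []" "a \<in> carrier A"
 proof (cases "valid m w")
  case True thus ?thesis using assms w(3) unfolding mfun_def by blast
 next
  case False thus ?thesis by (simp only: i valid_scale[OF w] P.smult_zero[OF w(3)] not_False_eq_True)
 qed
 show "g m (scale_last a w) = g m w \<triangleleft>\<^sub>P a" if w: "w \<in> A_lists" "w ~= []" "a \<in> carrier A"
 proof (cases "valid m w")
  case True thus ?thesis using assms w(3) unfolding mfun_def by blast
 next
  case False thus ?thesis by (simp only: i valid_scale[OF w] P.ract_zero[OF w(3)] not_False_eq_True)
 qed
qed

lemma valid_nonempty: "valid m w ==> w ~= []"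
 using validD(3) by fastforce

lemma mfun_cutoff:
 assumes "!!m w. valid m w ==> g m w \<in> grade P (int (length w) + j)"
  and b: "!!m w. valid m w ==> bml P (g m) w"
  and "!!m w a. [|valid m w; a \<in> carrier A|] ==> g m (scale_first a w) = a \<odot>\<^sub>P g m w"
  and "!!m w a. [|valid m w; a \<in> carrier A|] ==> g m (scale_last a w) = g m w \<triangleleft>\<^sub>P a"
 shows "mfun j (cutoff g)"
 unfolding mfun_def
proof (intro conjI allI impI ballI)
 fix m w assume v: "valid m w"
 note w = validD(1)[OF v] and ne = valid_nonempty[OF v]
 show "cutoff g m w \<in> grade P (int (length w) + j)" using assms(1)[OF v] v by (simp only: cutoff_simps)
 show "bml P (cutoff g m) w"
  by (rule bml_cong[OF b[OF v] w]) (simp only: cutoff_simps valid_update[OF w] v)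
 fix a assume a: "a \<in> carrier A"
 show "cutoff g m (scale_first a w) = a \<odot>\<^sub>P cutoff g m w" "cutoff g m (scale_last a w) = cutoff g m w \<triangleleft>\<^sub>P a"
  by (simp_all only: cutoff_simps valid_scale[OF w ne a] v assms(3)[OF v a] assms(4)[OF v a])
qed (rule cutoff_simps(2))

lemma mfun_plus:
 assumes g: "mfun j g" and h: "mfun j h" shows "mfun j (%m w. g m w \<oplus>\<^sub>P h m w)"
 unfolding mfun_def
proof (intro conjI allI impI ballI)
 note c = mfun_closed[OF g] mfun_closed[OF h]
 show "g m w \<oplus>\<^sub>P h m w = \<zero>\<^sub>P" if "~ valid m w" for m w using that by (simp add: mfun_invalid[OF g] mfun_invalid[OF h])
 fix m w assume v: "valid m w"
 note w = validD(1)[OF v] and ne = valid_nonempty[OF v]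
 show "g m w \<oplus>\<^sub>P h m w \<in> grade P (int (length w) + j)"
  by (rule P.subgroup_plus[OF P.grade_asubgroup mfun_grade[OF g] mfun_grade[OF h]])
 show "bml P (%w. g m w \<oplus>\<^sub>P h m w) w" by (rule bml_plus[OF Pg mfun_bml[OF g w] mfun_bml[OF h w]])
 fix a assume a: "a \<in> carrier A"
 show "g m (scale_first a w) \<oplus>\<^sub>P h m (scale_first a w) = a \<odot>\<^sub>P (g m w \<oplus>\<^sub>P h m w)"
  by (simp only: mfun_first[OF g w ne a] mfun_first[OF h w ne a] P.left_distrib[OF a c])
 show "g m (scale_last a w) \<oplus>\<^sub>P h m (scale_last a w) = (g m w \<oplus>\<^sub>P h m w) \<triangleleft>\<^sub>P a"
  by (simp only: mfun_last[OF g w ne a] mfun_last[OF h w ne a] P.right_distrib[OF a c])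
qed

definition "fsum g m w = frag_lift P (%(m, w). g m w) (marked_sum (m, w))"

lemma fsum_eq:
 assumes "!!m w. g m w \<in> carrier P"
 shows "fsum g m w = (\<Oplus>\<^bsub>P\<^esub>k\<in>{..<length w - 1}. sgn_elt P (int (if k < m then k else Suc k)) (g (mark_face m k) (face k w)))"
 unfolding fsum_def by (subst frag_lift_marked_sum[OF Pg]) (simp_all add: assms case_prod_beta)

lemma invalid_face:
 assumes "w \<in> A_lists" "~ valid m w" "k < length w - 1" shows "~ valid (mark_face m k) (face k w)"
proof -
 have k: "Suc k < length w" using assms(3) by simp
 show ?thesis
  using assms(2) k unfolding valid_iff[OF face_lists[OF assms(1) k]] valid_iff[OF assms(1)] length_face[OF k] mark_face_def
  by auto
qed

lemma fsum_invalid: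
 assumes "w \<in> A_lists" "~ valid m w" "mfun j g" shows "fsum g m w = \<zero>\<^sub>P"
proof -
 have "fsum g m w = (\<Oplus>\<^bsub>P\<^esub>k\<in>{..<length w - 1}. \<zero>\<^sub>P)"
  unfolding fsum_eq[OF mfun_closed[OF assms(3)]]
  by (rule P.finsum_cong'[OF refl]) (simp_all add: mfun_invalid[OF assms(3) invalid_face[OF assms(1,2)]])
 thus ?thesis by simp
qed

definition "msum g = cutoff (fsum g)"

lemma msum_fsum: "[|w \<in> A_lists; mfun j g|] ==> msum g m w = fsum g m w"
 unfolding msum_def cutoff_def using fsum_invalid by auto

lemma mfun_msum:
 assumes g: "mfun j g" shows "mfun (j - 1) (msum g)"
 unfolding msum_def
proof (rule mfun_cutoff)
 fix m w assume v: "valid m w"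
 note w = validD(1)[OF v] and ne = valid_nonempty[OF v]
 note c = mfun_closed[OF g]
 let ?t = "%k w. sgn_elt P (int (if k < m then k else Suc k)) (g (mark_face m k) (face k w))"
 have k: "Suc k < length w" if "k \<in> {..<length w - 1}" for k using that by auto
 have tc: "?t k w \<in> carrier P" for k w by (rule P.sgn_elt_closed[OF c])
 have Pi: "(%k. ?t k w) \<in> I \<rightarrow> carrier P" for I by (rule Pi_I, rule tc)
 show "fsum g m w \<in> grade P (int (length w) + (j - 1))"
  unfolding fsum_eq[OF c]
 proof (rule P.subgroup_finsum[OF P.grade_asubgroup], rule P.subgroup_sgn[OF P.grade_asubgroup])
  fix i assume "i \<in> {..<length w - 1}"
  hence e: "int (length w) + (j - 1) = int (length (face i w)) + j" using length_face[OF k] by auto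
  show "g (mark_face m i) (face i w) \<in> grade P (int (length w) + (j - 1))"
   unfolding e by (rule mfun_grade[OF g])
 qed
 have fi: "finite {..<length w - 1}" by simp
 show "bml P (fsum g m) w"
 proof (rule bml_cong[OF bml_finsum[OF Pg _ w, where I = "{..<length w - 1}" and q = ?t] w])
  fix i assume i: "i \<in> {..<length w - 1}"
  show "bml P (?t i) w"
   by (rule bml_sgn[OF Pg bml_letterwise[where q = "g (mark_face m i)" and \<rho> = "face i", OF w letterwise_face[OF w k[OF i]] mfun_bml[OF g face_lists[OF w k[OF i]]]]])
 qed (simp only: fsum_eq[OF c] length_list_update)
 fix a assume a: "a \<in> carrier A"
 have fne: "face i w ~= []" for i by (simp add: face_def)
 show "fsum g m (scale_first a w) = a \<odot>\<^sub>P fsum g m w"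
  unfolding fsum_eq[OF c] length_scale P.smult_finsum[OF a Pi]
 proof (rule P.finsum_cong'[OF refl])
  show "(%k. a \<odot>\<^sub>P ?t k w) \<in> {..<length w - 1} \<rightarrow> carrier P" by (rule Pi_I, rule P.left_closed[OF a tc])
  fix i assume i: "i \<in> {..<length w - 1}"
  show "?t i (scale_first a w) = a \<odot>\<^sub>P ?t i w"
   unfolding face_scale_first[OF w k[OF i] a] mfun_first[OF g face_lists[OF w k[OF i]] fne a] P.smult_sgn[OF a c] ..
 qed
 show "fsum g m (scale_last a w) = fsum g m w \<triangleleft>\<^sub>P a"
  unfolding fsum_eq[OF c] length_scale P.ract_finsum[OF a Pi]
 proof (rule P.finsum_cong'[OF refl])
  show "(%k. ?t k w \<triangleleft>\<^sub>P a) \<in> {..<length w - 1} \<rightarrow> carrier P" by (rule Pi_I, rule P.right_closed[OF a tc])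
  fix i assume i: "i \<in> {..<length w - 1}"
  show "?t i (scale_last a w) = ?t i w \<triangleleft>\<^sub>P a"
   unfolding face_scale_last[OF w k[OF i] a] mfun_last[OF g face_lists[OF w k[OF i]] fne a] P.ract_sgn[OF a c] ..
 qed
qed

lemma keys_marked_sum:
 assumes w: "w \<in> A_lists" and x: "x \<in> Poly_Mapping.keys (marked_sum (m, w))"
 obtains k where "k < length w - 1" "x = (mark_face m k, face k w)" "face k w \<in> A_lists"
proof -
 have "Poly_Mapping.keys (marked_sum (m, w)) <= (\<Union>k\<in>{..<length w - 1}. Poly_Mapping.keys (frag_cmul (mark_sign m k) (frag_of (mark_face m k, face k w))))"
  unfolding marked_sum_def fst_conv snd_conv by (rule keys_sum)
 moreover have "Poly_Mapping.keys (frag_cmul c (frag_of y)) <= {y}" for c and y :: "nat \<times> 'a list"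
  using keys_cmul[of c "frag_of y"] by auto
 ultimately obtain k where k: "k < length w - 1" "x = (mark_face m k, face k w)" using x by blast
 hence "face k w \<in> A_lists" by (intro face_lists[OF w]) simp
 thus ?thesis using k by (intro that)
qed

lemma fsum_cong:
 assumes "w \<in> A_lists"
  "!!k. [|k < length w - 1; face k w \<in> A_lists|] ==> g (mark_face m k) (face k w) = h (mark_face m k) (face k w)"
  "!!k. [|k < length w - 1; face k w \<in> A_lists|] ==> h (mark_face m k) (face k w) \<in> carrier P"
 shows "fsum g m w = fsum h m w"
 unfolding fsum_def
proof (rule P.frag_lift_cong)
 fix x assume "x \<in> Poly_Mapping.keys (marked_sum (m, w))"
 then obtain k where k: "k < length w - 1" "x = (mark_face m k, face k w)" "face k w \<in> A_lists"
  using keys_marked_sum[OF assms(1)] by blast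
 show "(case x of (m, w) => g m w) = (case x of (m, w) => h m w)" "(case x of (m, w) => h m w) \<in> carrier P"
  unfolding k(2) prod.case by (rule assms(2)[OF k(1,3)], rule assms(3)[OF k(1,3)])
qed

lemma fsum_fsum:
 assumes w: "w \<in> A_lists" and c: "!!m w. g m w \<in> carrier P"
 shows "fsum (fsum g) m w = \<zero>\<^sub>P"
proof -
 have c': "(%(m, w). g m w) x \<in> carrier P" for x using c by (simp add: case_prod_beta)
 have "(%(m, w). fsum g m w) = (%x. frag_lift P (%(m, w). g m w) (marked_sum x))"
  by (rule ext) (simp add: fsum_def case_prod_beta)
 hence "fsum (fsum g) m w = frag_lift P (%(m, w). g m w) (frag_extend marked_sum (marked_sum (m, w)))"
  unfolding fsum_def[of "fsum g"] by (simp only: P.frag_lift_extend[OF c'])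
 thus ?thesis unfolding marked_sum_marked_sum[OF w] by simp
qed

lemma fsum_plus:
 assumes "!!m w. g m w \<in> carrier P" "!!m w. h m w \<in> carrier P"
 shows "fsum (%m w. g m w \<oplus>\<^sub>P h m w) m w = fsum g m w \<oplus>\<^sub>P fsum h m w"
proof -
 have c: "g m w \<oplus>\<^sub>P h m w \<in> carrier P" for m w using assms by simp
 show ?thesis
  unfolding fsum_eq[OF c] fsum_eq[OF assms(1)] fsum_eq[OF assms(2)] P.sgn_elt_add[OF assms]
  by (rule P.finsum_addf) (simp_all add: assms)
qed

lemma fsum_hom:
 assumes "f' \<in> ahom P P" "!!m w. g m w \<in> carrier P"
 shows "f' (fsum g m w) = fsum (%m w. f' (g m w)) m w"
proof -
 have c: "(%(m, w). g m w) x \<in> carrier P" for x using assms(2) by (simp add: case_prod_beta)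
 show ?thesis unfolding fsum_def by (simp only: P.ahom_frag_lift[OF assms(1) Pg c]) (simp add: split_def)
qed

lemma fsum_closed: "(!!m w. g m w \<in> carrier P) ==> fsum g m w \<in> carrier P"
 unfolding fsum_def by (rule P.frag_lift_closed) (simp add: case_prod_beta)

definition "inner w = \<one>\<^sub>A # butlast (tl w) @ [\<one>\<^sub>A]"

lemma inner_simp: "inner (x # ys @ [y]) = \<one>\<^sub>A # ys @ [\<one>\<^sub>A]"
 by (simp add: inner_def)

lemma valid_split:
 assumes "valid m w" obtains x ys y where "w = x # ys @ [y]" "x \<in> carrier A" "y \<in> carrier A" "ys \<in> A_lists"
proof -
 obtain x ys y where e: "w = x # ys @ [y]" using word_ends[of w] validD(3)[OF assms] by auto
 thus ?thesis using validD(1)[OF assms] that by auto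
qed

lemma valid_inner: assumes "valid m w" shows "valid m (inner w)"
 by (rule valid_split[OF assms], insert validD(2,3)[OF assms]) (simp add: inner_simp valid_def)

lemma length_inner: "valid m w ==> length (inner w) = length w"
 by (erule valid_split[of m w]) (simp add: inner_simp)

lemma mfun_outer:
 assumes g: "mfun j g" and v: "valid m w"
 shows "g m w = (hd w \<odot>\<^sub>P g m (inner w)) \<triangleleft>\<^sub>P last w"
proof (rule valid_split[OF v])
 fix x ys y assume e: "w = x # ys @ [y]" and c: "x \<in> carrier A" "y \<in> carrier A" "ys \<in> A_lists"
 let ?v = "\<one>\<^sub>A # ys @ [\<one>\<^sub>A]"
 have v': "?v \<in> A_lists" "?v ~= []" using c by simp_all
 have v2: "scale_first x ?v \<in> A_lists" "scale_first x ?v ~= []" using c by (simp_all add: scale_first_def)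
 have "w = scale_last y (scale_first x ?v)"
  using c by (simp add: e scale_first_def scale_last_def nth_append list_update_append)
 hence "g m w = (x \<odot>\<^sub>P g m ?v) \<triangleleft>\<^sub>P y"
  by (simp only: mfun_last[OF g v2 c(2)] mfun_first[OF g v' c(1)])
 thus ?thesis by (simp add: e inner_def)
qed

text \<open>As \<open>t\<close> respects only the left action, it is applied where both outer
  letters are units, and the outer letters act on the result. The outcome is then compatible with
  both actions by construction.\<close>

definition "Tm g = cutoff (%m w. (hd w \<odot>\<^sub>P t (g m (inner w))) \<triangleleft>\<^sub>P last w)"

lemma smult_left_ahom: "z \<in> carrier P ==> (%a. a \<odot>\<^sub>P z) \<in> ahom A P"
 and ract_left_ahom: "z \<in> carrier P ==> (%a. z \<triangleleft>\<^sub>P a) \<in> ahom A P"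
 by (auto intro!: ahomI simp: P.left_closed P.right_closed P.left_distrib_ring P.right_distrib_ring)

lemma bml_T:
 assumes g: "mfun j g" and v: "valid m w"
 shows "bml P (%w. (hd w \<odot>\<^sub>P t (g m (inner w))) \<triangleleft>\<^sub>P last w) w"
proof (rule valid_split[OF v])
 fix x ys y assume e: "w = x # ys @ [y]" and c: "x \<in> carrier A" "y \<in> carrier A" "ys \<in> A_lists"
 let ?q = "%w. (hd w \<odot>\<^sub>P t (g m (inner w))) \<triangleleft>\<^sub>P last w"
 let ?v = "\<one>\<^sub>A # ys @ [\<one>\<^sub>A]"
 have v': "?v \<in> A_lists" "?v ~= []" using c by simp_all
 define z where "z = t (g m ?v)"
 have z: "z \<in> carrier P" by (simp add: z_def mfun_closed[OF g])
 have q: "?q w = (x \<odot>\<^sub>P z) \<triangleleft>\<^sub>P y" by (simp add: e inner_def z_def)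
 have u0: "?q (w[0 := a]) = (a \<odot>\<^sub>P z) \<triangleleft>\<^sub>P y" for a by (simp add: e inner_def z_def)
 have u1: "?q (w[Suc (length ys) := a]) = (x \<odot>\<^sub>P z) \<triangleleft>\<^sub>P a" for a by (simp add: e inner_def z_def)
 have u2: "?q (w[Suc l := a]) = (x \<odot>\<^sub>P t (g m (?v[Suc l := a]))) \<triangleleft>\<^sub>P y" if "l < length ys" for l a
  using that by (simp add: e inner_def list_update_append)
 have cases: "k = 0 \<or> k = Suc (length ys) \<or> (\<exists>l<length ys. k = Suc l)" if "k < length w" for k
 proof (cases k)
  case (Suc l)
  thus ?thesis using that by (auto simp: e)
 qed simp
 have add: "(%a. ?q (w[k := a])) \<in> ahom A P" if "k < length w" for k
  using cases[OF that]
 proof (elim disjE exE conjE)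
  assume "k = 0"
  show ?thesis unfolding \<open>k = 0\<close> u0 by (rule ahom_comp[OF smult_left_ahom[OF z] P.ract_ahom[OF c(2)]])
 next
  assume k: "k = Suc (length ys)"
  show ?thesis unfolding k u1 by (rule ract_left_ahom[OF P.left_closed[OF c(1) z]])
 next
  fix l assume l: "l < length ys" "k = Suc l"
  have "(%a. g m (?v[Suc l := a])) \<in> ahom A P"
  proof -
   have "Suc l < length ?v" using l(1) by simp
   thus ?thesis using mfun_bml[OF g v'(1), of m] unfolding bml_def by blast
  qed
  thus ?thesis
   unfolding l(2) u2[OF l(1)]
   by (rule ahom_comp[OF ahom_comp[OF ahom_comp[OF _ left_hom_ahom[OF t_hom]] P.smult_ahom[OF c(1)]] P.ract_ahom[OF c(2)]])
 qed
 have scal: "?q (w[k := s \<odot>\<^sub>A w ! k]) = (s \<odot>\<^sub>A \<one>\<^sub>A) \<odot>\<^sub>P ?q w" if k: "k < length w" and s: "s \<in> carrier K" for s k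
  using cases[OF k]
 proof (elim disjE exE conjE)
  have o: "s \<odot>\<^sub>A \<one>\<^sub>A \<in> carrier A" using s by simp
  note cl = P.left_closed P.right_closed c(1,2) z o
  have l1: "s \<odot>\<^sub>A b = (s \<odot>\<^sub>A \<one>\<^sub>A) \<otimes>\<^sub>A b" and r1: "s \<odot>\<^sub>A b = b \<otimes>\<^sub>A (s \<odot>\<^sub>A \<one>\<^sub>A)" if "b \<in> carrier A" for b
   using that s by (simp_all add: smult_mult_left smult_mult_right)
  {
   assume "k = 0"
   have "w ! 0 = x" by (simp add: e)
   show ?thesis unfolding \<open>k = 0\<close> u0 q \<open>w ! 0 = x\<close> l1[OF c(1)] by (simp only: P.left_assoc P.left_right cl)
  next
   assume k: "k = Suc (length ys)"
   have "w ! Suc (length ys) = y" by (simp add: e nth_append)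
   show ?thesis unfolding k u1 q \<open>w ! Suc (length ys) = y\<close> r1[OF c(2)]
    by (simp only: P.right_assoc[OF c(2) o] cl base_central[OF s])
  next
   fix l assume l: "l < length ys" "k = Suc l"
   have wl: "w ! Suc l = ?v ! Suc l" using l by (simp add: e nth_append)
   have l': "Suc l < length ?v" "0 < length ?v" using l by simp_all
   \<comment> \<open>A scalar on an inner letter is first moved to the leading unit. There it is a
     left action and passes through \<open>t\<close>.\<close>
   have "g m (?v[Suc l := s \<odot>\<^sub>A ?v ! Suc l]) = g m (?v[0 := s \<odot>\<^sub>A ?v ! 0])"
    by (rule bml_scal[OF mfun_bml[OF g v'(1)] l' s])
   also have "?v[0 := s \<odot>\<^sub>A ?v ! 0] = scale_first (s \<odot>\<^sub>A \<one>\<^sub>A) ?v" using s by (simp add: scale_first_def)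
   also have "g m ... = (s \<odot>\<^sub>A \<one>\<^sub>A) \<odot>\<^sub>P g m ?v" by (rule mfun_first[OF g v' o])
   finally have "?q (w[k := s \<odot>\<^sub>A w ! k]) = (x \<odot>\<^sub>P ((s \<odot>\<^sub>A \<one>\<^sub>A) \<odot>\<^sub>P z)) \<triangleleft>\<^sub>P y"
    unfolding l(2) wl u2[OF l(1)] z_def by (simp only: left_hom_smult[OF t_hom o mfun_closed[OF g]])
   also have "x \<odot>\<^sub>P ((s \<odot>\<^sub>A \<one>\<^sub>A) \<odot>\<^sub>P z) = (s \<odot>\<^sub>A \<one>\<^sub>A) \<odot>\<^sub>P (x \<odot>\<^sub>P z)"
    unfolding P.left_assoc[OF c(1) o z, symmetric] P.left_assoc[OF o c(1) z, symmetric] l1[OF c(1), symmetric] r1[OF c(1), symmetric] ..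
   finally show ?thesis unfolding q by (simp only: P.left_right cl)
  }
 qed
 show ?thesis unfolding bml_def using add scal by simp
qed

lemma mfun_T: assumes g: "mfun j g" shows "mfun (j + 1) (Tm g)"
 unfolding Tm_def
proof (rule mfun_cutoff)
 fix m w assume v: "valid m w"
 show "bml P (%w. (hd w \<odot>\<^sub>P t (g m (inner w))) \<triangleleft>\<^sub>P last w) w" by (rule bml_T[OF g v])
 obtain x ys y where e: "w = x # ys @ [y]" and c: "x \<in> carrier A" "y \<in> carrier A" "ys \<in> A_lists"
  using valid_split[OF v] .
 have z: "t (g m (inner w)) \<in> grade P (int (length w) + (j + 1))"
  using t_grade[OF mfun_grade[OF g, of m "inner w"]] by (simp add: length_inner[OF v] add.assoc)
 thus "(hd w \<odot>\<^sub>P t (g m (inner w))) \<triangleleft>\<^sub>P last w \<in> grade P (int (length w) + (j + 1))"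
  using c by (simp add: e P.grade_left P.grade_right)
 have zc: "t (g m (\<one>\<^sub>A # ys @ [\<one>\<^sub>A])) \<in> carrier P" by (simp add: mfun_closed[OF g])
 fix a assume a: "a \<in> carrier A"
 have f: "scale_first a (x # ys @ [y]) = (a \<otimes>\<^sub>A x) # ys @ [y]" and l: "scale_last a (x # ys @ [y]) = x # ys @ [y \<otimes>\<^sub>A a]"
  by (simp_all add: scale_first_def scale_last_def nth_append list_update_append)
 show "(hd (scale_first a w) \<odot>\<^sub>P t (g m (inner (scale_first a w)))) \<triangleleft>\<^sub>P last (scale_first a w)
   = a \<odot>\<^sub>P ((hd w \<odot>\<^sub>P t (g m (inner w))) \<triangleleft>\<^sub>P last w)"
  unfolding e f inner_simp using a c zc by (simp add: P.left_assoc P.left_right P.left_closed)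
 show "(hd (scale_last a w) \<odot>\<^sub>P t (g m (inner (scale_last a w)))) \<triangleleft>\<^sub>P last (scale_last a w)
   = ((hd w \<odot>\<^sub>P t (g m (inner w))) \<triangleleft>\<^sub>P last w) \<triangleleft>\<^sub>P a"
  unfolding e l inner_simp using a c zc by (simp add: P.right_assoc P.left_closed)
qed

text \<open>The two hypotheses remove the terms t d and eta mu of the contraction identity at the
  inner word; the outer letters are carried along because d respects both actions.\<close>

lemma d_T:
 assumes g: "mfun j g" and v: "valid m w"
  and dg: "d (g m (inner w)) = \<zero>\<^sub>P" and mg: "\<mu> (g m (inner w)) = \<zero>\<^sub>A"
 shows "d (Tm g m w) = g m w"
proof -
 obtain x ys y where e: "w = x # ys @ [y]" and c: "x \<in> carrier A" "y \<in> carrier A" "ys \<in> A_lists"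
  using valid_split[OF v] .
 note gc = mfun_closed[OF g, of m "inner w"]
 have "\<eta> \<zero>\<^sub>A = \<zero>\<^sub>P" "t \<zero>\<^sub>P = \<zero>\<^sub>P"
  using ahom_zero[OF R.ag Pg left_hom_ahom[OF eta_hom]] ahom_zero[OF Pg Pg left_hom_ahom[OF t_hom]] by simp_all
 hence dt: "d (t (g m (inner w))) = g m (inner w)" using contract[OF gc] gc by (simp add: dg mg)
 have "d (Tm g m w) = (hd w \<odot>\<^sub>P d (t (g m (inner w)))) \<triangleleft>\<^sub>P last w"
  using v c gc by (simp add: Tm_def cutoff_simps e deg_hom_ract[OF d_hom] deg_hom_smult[OF d_hom] P.left_closed)
 thus ?thesis unfolding dt mfun_outer[OF g v] .
qed

end

section \<open>Solving the boundary equation by length, and the function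
  \<open>theta\<close>\<close>

context comparison
begin

text \<open>Step n is used only on words of length n. The equation at length n + 1 involves the
  unknown only on faces, which have length n, so \<open>null\<close> selects the step by the length
  of the word.\<close>

primrec lift_step :: "(nat => 'a list => 'p) => nat => nat => 'a list => 'p" where
 "lift_step \<theta> 0 = (%m w. \<zero>\<^sub>P)"
| "lift_step \<theta> (Suc n) = Tm (%m w. \<theta> m w \<oplus>\<^sub>P msum (lift_step \<theta> n) m w)"

definition "null \<theta> m w = lift_step \<theta> (length w) m w"

context
 fixes \<theta> assumes th: "mfun (- 2) \<theta>"
  and closed: "!!m w. valid m w ==> d (\<theta> m w) \<oplus>\<^sub>P fsum \<theta> m w = \<zero>\<^sub>P"
begin

lemma mfun_lift_step: "mfun (- 1) (lift_step \<theta> n)"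
proof (induction n)
 case 0
 show ?case
  unfolding mfun_def
  by (simp add: P.grade_zero bml_def ahom_const_zero[OF A.ag Pg] P.smult_zero P.ract_zero)
next
 case (Suc n)
 have "mfun (- 2) (msum (lift_step \<theta> n))" using mfun_msum[OF Suc] by simp
 from mfun_T[OF mfun_plus[OF th this]] show ?case by simp
qed

lemma mfun_null: "mfun (- 1) (null \<theta>)"
 unfolding mfun_def
proof (intro conjI allI impI ballI)
 note h = mfun_lift_step
 show "null \<theta> m w = \<zero>\<^sub>P" if "~ valid m w" for m w
  unfolding null_def by (rule mfun_invalid[OF h that])
 fix m w assume v: "valid m w"
 note w = validD(1)[OF v] and ne = valid_nonempty[OF v]
 show "null \<theta> m w \<in> grade P (int (length w) + - 1)" unfolding null_def by (rule mfun_grade[OF h])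
 show "bml P (null \<theta> m) w"
  by (rule bml_cong[OF mfun_bml[OF h w, of "length w" m] w]) (simp only: null_def length_list_update)
 fix a assume a: "a \<in> carrier A"
 show "null \<theta> m (scale_first a w) = a \<odot>\<^sub>P null \<theta> m w" "null \<theta> m (scale_last a w) = null \<theta> m w \<triangleleft>\<^sub>P a"
  unfolding null_def length_scale by (rule mfun_first[OF h w ne a], rule mfun_last[OF h w ne a])
qed

lemma d_null: "valid m w ==> d (null \<theta> m w) = \<theta> m w \<oplus>\<^sub>P fsum (null \<theta>) m w"
proof (induction "length w" arbitrary: m w)
 case 0
 thus ?case using valid_nonempty by simp
next
 case (Suc n)
 note h = mfun_lift_step
 let ?G = "%m w. \<theta> m w \<oplus>\<^sub>P msum (lift_step \<theta> n) m w"
 have g: "mfun (- 2) ?G" using mfun_plus[OF th mfun_msum[OF h, of n, simplified]] .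
 have G: "?G m v = \<theta> m v \<oplus>\<^sub>P fsum (null \<theta>) m v" if "v \<in> A_lists" "length v = Suc n" for v
 proof -
  have "fsum (lift_step \<theta> n) m v = fsum (null \<theta>) m v"
  proof (rule fsum_cong[OF that(1) _ mfun_closed[OF mfun_null]])
   fix k assume "k < length v - 1"
   hence "length (face k v) = n" using length_face[of k v] that(2) by simp
   thus "lift_step \<theta> n (mark_face m k) (face k v) = null \<theta> (mark_face m k) (face k v)"
    by (simp add: null_def)
  qed
  thus ?thesis by (simp add: msum_fsum[OF that(1) h])
 qed
 let ?v = "inner w"
 have v: "valid m ?v" by (rule valid_inner[OF Suc.prems])
 note vl = validD(1)[OF v]
 have lv: "length ?v = Suc n" using length_inner[OF Suc.prems] Suc.hyps(2) by simp
 have Gv: "?G m ?v = \<theta> m ?v \<oplus>\<^sub>P fsum (null \<theta>) m ?v" by (rule G[OF vl lv])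
 note c = mfun_closed[OF th] mfun_closed[OF mfun_null] fsum_closed[OF mfun_closed[OF th]] fsum_closed[OF mfun_closed[OF mfun_null]]
 \<comment> \<open>Together with closedness of \<open>\<theta>\<close> this makes the right-hand
   side a cycle: by the induction hypothesis on faces, d of the face sum is the face sum of
   \<open>\<theta>\<close> plus a double face sum, which is zero.\<close>
 have "d (fsum (null \<theta>) m ?v) = fsum (%m w. d (null \<theta> m w)) m ?v"
  by (rule fsum_hom[OF op_ahom(7) c(2)])
 also have "... = fsum (%m w. \<theta> m w \<oplus>\<^sub>P fsum (null \<theta>) m w) m ?v"
 proof (rule fsum_cong[OF vl])
  fix k assume k: "k < length ?v - 1" "face k ?v \<in> A_lists"
  have l: "n = length (face k ?v)" using length_face[of k ?v] k(1) lv by simp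
  show "d (null \<theta> (mark_face m k) (face k ?v)) = \<theta> (mark_face m k) (face k ?v) \<oplus>\<^sub>P fsum (null \<theta>) (mark_face m k) (face k ?v)"
  proof (cases "valid (mark_face m k) (face k ?v)")
   case True
   show ?thesis by (rule Suc.hyps(1)[OF l True])
  next
   case False
   thus ?thesis
    by (simp add: mfun_invalid[OF th] mfun_invalid[OF mfun_null] fsum_invalid[OF k(2) False mfun_null] ahom_zero[OF Pg Pg op_ahom(7)])
  qed
 qed (simp add: c)
 also have "... = fsum \<theta> m ?v"
  by (simp only: fsum_plus[OF c(1,4)] fsum_fsum[OF vl c(2)] P.r_zero c(3))
 finally have "d (?G m ?v) = \<zero>\<^sub>P"
  unfolding Gv using closed[OF v] c by (simp add: ahom_add[OF op_ahom(7)])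
 \<comment> \<open>A valid mark forces at least three letters, so the value lies in degree length -
   2 > 0 and there is no obstruction in H_0.\<close>
 moreover have "\<mu> (?G m ?v) = \<zero>\<^sub>A"
  by (rule mu_degree[OF _ mfun_grade[OF g]]) (use validD(2,3)[OF v] in simp)
 ultimately have "d (Tm ?G m w) = ?G m w" by (rule d_T[OF g Suc.prems])
 moreover have "null \<theta> m w = Tm ?G m w" unfolding null_def Suc.hyps(2)[symmetric] lift_step.simps ..
 ultimately show ?case using G[OF validD(1)[OF Suc.prems] Suc.hyps(2)[symmetric]] by simp
qed

end

definition wfun :: "int => ('a list => 'p) => bool" where
 "wfun j q \<longleftrightarrow> (\<forall>w. q w \<in> grade P (int (length w) + j)) & (\<forall>w\<in>A_lists. bml P q w &
   (\<forall>a\<in>carrier A. w ~= [] --> q (scale_first a w) = a \<odot>\<^sub>P q w & q (scale_last a w) = q w \<triangleleft>\<^sub>P a))"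

lemma wfunD:
 assumes "wfun j q"
 shows wfun_grade: "q w \<in> grade P (int (length w) + j)"
  and wfun_closed: "q w \<in> carrier P"
  and wfun_bml: "w \<in> A_lists ==> bml P q w"
  and wfun_first: "[|w \<in> A_lists; w ~= []; a \<in> carrier A|] ==> q (scale_first a w) = a \<odot>\<^sub>P q w"
  and wfun_last: "[|w \<in> A_lists; w ~= []; a \<in> carrier A|] ==> q (scale_last a w) = q w \<triangleleft>\<^sub>P a"
proof -
 show gr: "q w \<in> grade P (int (length w) + j)" using assms unfolding wfun_def by blast
 show "q w \<in> carrier P" by (rule P.grade_closed[OF gr])
qed (use assms in \<open>unfold wfun_def, blast+\<close>)

lemma wfun_p: "wfun (- 2) p"
 unfolding wfun_def
 by (intro conjI allI ballI impI p_scale_first p_scale_last kml_bml p_kml p_grade) simp_all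

text \<open>A face before the mark lowers m by one and so changes the sign, which compensates the
  jump of the formal sign at the mark. All faces of w then enter with one common sign relative to
  (-1)^k.\<close>

definition "alt q = cutoff (%m w. sgn_elt P (int (Suc m)) (q w))"

lemma mfun_alt: assumes q: "wfun j q" shows "mfun j (alt q)"
 unfolding alt_def
proof (rule mfun_cutoff)
 fix m w assume v: "valid m w"
 note w = validD(1)[OF v] and ne = valid_nonempty[OF v]
 show "sgn_elt P (int (Suc m)) (q w) \<in> grade P (int (length w) + j)"
  by (rule P.subgroup_sgn[OF P.grade_asubgroup wfun_grade[OF q]])
 show "bml P (%w. sgn_elt P (int (Suc m)) (q w)) w" by (rule bml_sgn[OF Pg wfun_bml[OF q w]])
 fix a assume a: "a \<in> carrier A"
 show "sgn_elt P (int (Suc m)) (q (scale_first a w)) = a \<odot>\<^sub>P sgn_elt P (int (Suc m)) (q w)"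
  unfolding wfun_first[OF q w ne a] P.smult_sgn[OF a wfun_closed[OF q]] ..
 show "sgn_elt P (int (Suc m)) (q (scale_last a w)) = sgn_elt P (int (Suc m)) (q w) \<triangleleft>\<^sub>P a"
  unfolding wfun_last[OF q w ne a] P.ract_sgn[OF a wfun_closed[OF q]] ..
qed

lemma finsum_delta_if:
 assumes "abelian_group G" "finite I" "x \<in> carrier G"
 shows "finsum G (%i. if i = j & B then x else \<zero>\<^bsub>G\<^esub>) I = (if j \<in> I & B then x else \<zero>\<^bsub>G\<^esub>)"
proof -
 interpret G: abelian_group G by fact
 show ?thesis
 proof (cases "j \<in> I & B")
  case True
  thus ?thesis using finsum_one[OF assms(1), of j I "%i. if i = j & B then x else \<zero>\<^bsub>G\<^esub>"] assms by simp
 next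
  case False
  have "finsum G (%i. if i = j & B then x else \<zero>\<^bsub>G\<^esub>) I = finsum G (%i. \<zero>\<^bsub>G\<^esub>) I"
   by (rule G.finsum_cong'[OF refl]) (use False in auto)
  also have "... = \<zero>\<^bsub>G\<^esub>" by simp
  finally show ?thesis unfolding if_not_P[OF False] .
 qed
qed

text \<open>The uniform sign would give a multiple of the face sum of w, but two faces are missing
  because their mark becomes degenerate: face 0 when m = 1, and face m when m + 2 is the length. The
  last two terms restore them.\<close>

lemma fsum_alt:
 assumes q: "wfun j q" and v: "valid m w"
 shows "fsum (alt q) m w = \<ominus>\<^sub>P sgn_elt P (int (Suc m)) (frag_lift P q (face_sum w))
  \<oplus>\<^sub>P ((if m = 1 then q (face 0 w) else \<zero>\<^sub>P) \<ominus>\<^sub>P (if m + 2 = length w then q (face m w) else \<zero>\<^sub>P))"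
proof -
 note w = validD(1)[OF v] and qc = wfun_closed[OF q]
 have m: "1 <= m" "m + 2 <= length w" using validD(2,3)[OF v] .
 let ?I = "{..<length w - 1}"
 have mz: "\<ominus>\<^sub>P \<zero>\<^sub>P = \<zero>\<^sub>P" using P.sgn_elt_zero[of 1] unfolding sgn_elt_def by simp
 let ?a = "%k. sgn_elt P (int (Suc (Suc m))) (sgn_elt P (int k) (q (face k w)))"
 let ?b = "%k. if k = 0 & m = 1 then q (face 0 w) else \<zero>\<^sub>P"
 let ?c = "%k. if k = m & m + 2 = length w then \<ominus>\<^sub>P q (face m w) else \<zero>\<^sub>P"
 have abc: "?a k \<in> carrier P" "?b k \<in> carrier P" "?c k \<in> carrier P" for k using qc by simp_all
 have "fsum (alt q) m w = (\<Oplus>\<^bsub>P\<^esub>k\<in>?I. ?a k \<oplus>\<^sub>P (?b k \<oplus>\<^sub>P ?c k))"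
  unfolding fsum_eq[OF mfun_closed[OF mfun_alt[OF q]]]
 proof (rule P.finsum_cong'[OF refl])
  show "(%k. ?a k \<oplus>\<^sub>P (?b k \<oplus>\<^sub>P ?c k)) \<in> ?I \<rightarrow> carrier P" using abc by blast
  fix k assume "k \<in> ?I"
  hence k: "Suc k < length w" by auto
  note x = qc[of "face k w"]
  have vi: "valid (mark_face m k) (face k w) \<longleftrightarrow> 1 <= mark_face m k & mark_face m k + 2 <= length w - 1"
   unfolding valid_iff[OF face_lists[OF w k]] length_face[OF k] ..
  consider "k < m" "m = 1" | "k < m" "m ~= 1" | "~ k < m" "m + 2 = length w" | "~ k < m" "m + 2 ~= length w" by blast
  thus "sgn_elt P (int (if k < m then k else Suc k)) (alt q (mark_face m k) (face k w)) = ?a k \<oplus>\<^sub>P (?b k \<oplus>\<^sub>P ?c k)"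
  proof cases
   case 1
   hence z: "k = 0" "~ valid (mark_face m k) (face k w)" unfolding vi by (auto simp: mark_face_def)
   show ?thesis unfolding alt_def cutoff_simps(2)[OF z(2)] using 1 z(1) x by (simp add: sgn_elt_def P.l_neg)
  next
   case 2
   hence z: "valid (mark_face m k) (face k w)" "mark_face m k = m - 1" unfolding vi using m by (auto simp: mark_face_def)
   obtain l where l: "m = Suc l" using m(1) by (cases m) auto
   have "alt q (mark_face m k) (face k w) = sgn_elt P (int (Suc (mark_face m k))) (q (face k w))"
    unfolding alt_def cutoff_simps(1)[OF z(1)] ..
   thus ?thesis unfolding z(2) using 2 l x by (simp add: sgn_elt_def)
  next
   case 3
   hence z: "k = m" "~ valid (mark_face m k) (face k w)" unfolding vi using k by (auto simp: mark_face_def)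
   show ?thesis unfolding alt_def cutoff_simps(2)[OF z(2)] using 3(2)[symmetric] z(1) m x by (auto simp: sgn_elt_def P.r_neg P.l_neg)
  next
   case 4
   hence z: "valid (mark_face m k) (face k w)" "mark_face m k = m" unfolding vi using m by (auto simp: mark_face_def)
   have "alt q (mark_face m k) (face k w) = sgn_elt P (int (Suc (mark_face m k))) (q (face k w))"
    unfolding alt_def cutoff_simps(1)[OF z(1)] ..
   thus ?thesis unfolding z(2) using 4 m x by (auto simp: sgn_elt_def)
  qed
 qed
 also have "... = finsum P ?a ?I \<oplus>\<^sub>P (finsum P ?b ?I \<oplus>\<^sub>P finsum P ?c ?I)"
 proof -
  have "(\<Oplus>\<^bsub>P\<^esub>k\<in>?I. ?b k \<oplus>\<^sub>P ?c k) = finsum P ?b ?I \<oplus>\<^sub>P finsum P ?c ?I"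
   by (rule P.finsum_addf) (use abc(2,3) in blast)+
  moreover have "(\<Oplus>\<^bsub>P\<^esub>k\<in>?I. ?a k \<oplus>\<^sub>P (?b k \<oplus>\<^sub>P ?c k)) = finsum P ?a ?I \<oplus>\<^sub>P (\<Oplus>\<^bsub>P\<^esub>k\<in>?I. ?b k \<oplus>\<^sub>P ?c k)"
   by (rule P.finsum_addf) (use abc P.a_closed[OF abc(2,3)] in blast)+
  ultimately show ?thesis by (simp only:)
 qed
 also have "finsum P ?a ?I = \<ominus>\<^sub>P sgn_elt P (int (Suc m)) (frag_lift P q (face_sum w))"
  unfolding frag_lift_face_sum[OF Pg qc]
  by (subst P.sgn_elt_finsum[symmetric]) (simp_all add: qc sgn_elt_def P.finsum_closed)
 also have "finsum P ?b ?I = (if m = 1 then q (face 0 w) else \<zero>\<^sub>P)"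
  by (subst finsum_delta_if[OF Pg]) (use m qc in auto)
 also have "finsum P ?c ?I = \<ominus>\<^sub>P (if m + 2 = length w then q (face m w) else \<zero>\<^sub>P)"
 proof -
  have "finsum P ?c ?I = (if m \<in> ?I & m + 2 = length w then \<ominus>\<^sub>P q (face m w) else \<zero>\<^sub>P)"
   by (rule finsum_delta_if[OF Pg]) (simp_all add: qc)
  moreover have "m \<in> ?I" if "m + 2 = length w" using that by simp
  ultimately show ?thesis by (cases "m + 2 = length w") (simp_all only: if_True if_False simp_thms mz)
 qed
 finally show ?thesis by (simp only: a_minus_def)
qed

definition "th1 = cutoff (%m w. phi (Q m w))"
text \<open>At m = 1 the boundaries of the other two functions leave p and f p of the same face,
  which do not cancel; \<open>K1\<close> bounds their difference.\<close>

definition "th3 = cutoff (%m w. if m = 1 then K1 (wz (face 0 w)) else \<zero>\<^sub>P)"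

lemma Q_scale:
 assumes v: "valid m w" and a: "a \<in> carrier A"
 shows "Q m (scale_first a w) = a \<odot>\<^bsub>PP\<^esub> Q m w" "Q m (scale_last a w) = Q m w \<triangleleft>\<^bsub>PP\<^esub> a"
proof -
 note w = validD(1)[OF v] and m = validD(2,3)[OF v]
 have "take m (scale_first a w) @ [\<one>\<^sub>A] = scale_first a (take m w @ [\<one>\<^sub>A])" "drop m (scale_first a w) = drop m w"
  using m by (auto simp: scale_first_def take_update_swap list_update_append nth_append drop_update_cancel)
 thus "Q m (scale_first a w) = a \<odot>\<^bsub>PP\<^esub> Q m w"
  unfolding Q_def using p_scale_first[OF one_letter_lists[OF w, of m] _ a] a by (simp add: PQ.smult_tens)
 obtain n where n: "length w = Suc n" "m <= n" using m by (cases "length w") auto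
 hence "drop m (scale_last a w) = scale_last a (drop m w)" "take m (scale_last a w) = take m w"
  by (auto simp: scale_last_def drop_update_swap take_update_cancel Suc_diff_le)
 thus "Q m (scale_last a w) = Q m w \<triangleleft>\<^bsub>PP\<^esub> a"
  unfolding Q_def using p_scale_last[OF drop_lists[OF w, of m] _ a] a m by (simp add: PQ.ract_tens)
qed

lemma mfun_th1: "mfun (- 2) th1"
 unfolding th1_def
proof (rule mfun_cutoff)
 fix m w assume v: "valid m w"
 note w = validD(1)[OF v] and m = validD(2,3)[OF v]
 show "phi (Q m w) \<in> grade P (int (length w) + - 2)"
  by (rule deg_hom_grade[OF phi_hom Q_grade[of m w "int (length w) - 3"]]) (use m in simp_all)
 show "bml P (%w. phi (Q m w)) w" by (rule bml_hom[OF kml_bml[OF Q_kml[OF w]] deg_hom_ahom[OF phi_hom]])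
 fix a assume a: "a \<in> carrier A"
 show "phi (Q m (scale_first a w)) = a \<odot>\<^sub>P phi (Q m w)" "phi (Q m (scale_last a w)) = phi (Q m w) \<triangleleft>\<^sub>P a"
  unfolding Q_scale[OF v a] by (rule deg_hom_smult[OF phi_hom a Q_closed], rule deg_hom_ract[OF phi_hom a Q_closed])
qed

lemma mfun_th3: "mfun (- 2) th3"
 unfolding th3_def
proof (rule mfun_cutoff)
 fix m w assume v: "valid m w"
 note w = validD(1)[OF v] and m = validD(2,3)[OF v] and ne = valid_nonempty[OF v]
 have s: "Suc 0 < length w" using m by simp
 note fw = face_lists[OF w s]
 have fne: "face 0 w ~= []" by (simp add: face_def)
 have g: "face 0 w \<in> word_gens A 2" using fw m length_face[OF s] unfolding word_gens_iff by simp
 show "(if m = 1 then K1 (wz (face 0 w)) else \<zero>\<^sub>P) \<in> grade P (int (length w) + - 2)"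
 proof -
  have "wz (face 0 w) \<in> grade Br (int (length w) - 3)"
   using g wd_grade[OF g, of "int (length w) - 3"] length_face[OF s] m by (simp add: wz_def)
  thus ?thesis using deg_hom_grade[OF K1_hom, of "wz (face 0 w)" "int (length w) - 3" "int (length w) - 2"] by (simp add: P.grade_zero)
 qed
 show "bml P (%w. if m = 1 then K1 (wz (face 0 w)) else \<zero>\<^sub>P) w"
 proof (cases "m = 1")
  case True
  show ?thesis
   unfolding if_P[OF True]
   by (rule bml_hom[OF bml_letterwise[where q = wz and \<rho> = "face 0", OF w letterwise_face[OF w s] wz_bml[OF fw]] deg_hom_ahom[OF K1_hom]])
 next
  case False
  thus ?thesis by (simp add: bml_def ahom_const_zero[OF A.ag Pg])
 qed
 fix a assume a: "a \<in> carrier A"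
 show "(if m = 1 then K1 (wz (face 0 (scale_first a w))) else \<zero>\<^sub>P) = a \<odot>\<^sub>P (if m = 1 then K1 (wz (face 0 w)) else \<zero>\<^sub>P)"
  unfolding face_scale_first[OF w s a] wz_scale[OF fw fne a] deg_hom_smult[OF K1_hom a wz_closed] by (simp add: P.smult_zero[OF a])
 show "(if m = 1 then K1 (wz (face 0 (scale_last a w))) else \<zero>\<^sub>P) = (if m = 1 then K1 (wz (face 0 w)) else \<zero>\<^sub>P) \<triangleleft>\<^sub>P a"
  unfolding face_scale_last[OF w s a] wz_scale[OF fw fne a] deg_hom_ract[OF K1_hom a wz_closed] by (simp add: P.ract_zero[OF a])
qed

text \<open>The homotopy relation of \<open>phi\<close> at \<open>Q m w\<close>. The augmentation is
  nonzero only on two-letter words, so mu_L contributes for m = 1 only and mu_R only when the second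
  factor has two letters.\<close>

lemma d_th1:
 assumes v: "valid m w"
 shows "d (th1 m w) \<oplus>\<^sub>P fsum th1 m w = (if m + 2 = length w then p (face m w) else \<zero>\<^sub>P)
  \<ominus>\<^sub>P f (if m = 1 then p (face 0 w) else \<zero>\<^sub>P)"
proof -
 note w = validD(1)[OF v] and m = validD(2,3)[OF v]
 have Qc: "(%(m, w). Q m w) x \<in> carrier PP" for x by (simp add: case_prod_beta)
 have "phi (D (Q m w)) = frag_lift P (%x. phi ((%(m, w). Q m w) x)) (marked_sum (m, w))"
  by (subst D_Q[OF w]) (use m in simp, use m in simp, rule PQ.T.ahom_frag_lift[OF deg_hom_ahom[OF phi_hom] Pg Qc])
 also have "... = fsum (%m w. phi (Q m w)) m w" unfolding fsum_def by (simp add: split_def)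
 also have "... = fsum th1 m w"
 proof (rule fsum_cong[OF w _ mfun_closed[OF mfun_th1]])
  fix k assume k: "face k w \<in> A_lists"
  show "phi (Q (mark_face m k) (face k w)) = th1 (mark_face m k) (face k w)"
  proof (cases "valid (mark_face m k) (face k w)")
   case True thus ?thesis by (simp add: th1_def cutoff_simps)
  next
   case False
   hence "Q (mark_face m k) (face k w) = \<zero>\<^bsub>PP\<^esub>" unfolding valid_iff[OF k] by (intro Q_degenerate) auto
   thus ?thesis using False by (simp add: th1_def cutoff_simps ahom_zero[OF PPg Pg deg_hom_ahom[OF phi_hom]])
  qed
 qed
 finally have s: "phi (D (Q m w)) = fsum th1 m w" .
 have L: "muL (Q m w) = (if m = 1 then p (face 0 w) else \<zero>\<^sub>P)"
 proof (cases "m = 1")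
  case True
  obtain x y ys where e: "w = x # y # ys" using m True by (metis Suc_le_length_iff add_2_eq_Suc' le_add1 le_trans numeral_2_eq_2 add.commute)
  have c: "x \<in> carrier A" "y \<in> carrier A" "y # ys \<in> A_lists" using w by (simp_all add: e)
  have "muL (Q m w) = x \<odot>\<^sub>P p (y # ys)" using c by (simp add: muL_Q True e bar_aug_pair)
  also have "... = p (scale_first x (y # ys))" by (rule p_scale_first[OF c(3) _ c(1), symmetric]) simp
  finally show ?thesis using True by (simp add: e face_def scale_first_def)
 next
  case False
  hence "\<mu> (p (take m w @ [\<one>\<^sub>A])) = \<zero>\<^sub>A" using m by (intro mu_p_long) simp
  thus ?thesis using False by (simp add: muL_Q)
 qed
 have R: "muR (Q m w) = (if m + 2 = length w then p (face m w) else \<zero>\<^sub>P)"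
 proof (cases "m + 2 = length w")
  case True
  have "length (drop m w) = Suc (Suc 0)" using True by simp
  then obtain x y where d: "drop m w = [x, y]" by (metis length_0_conv length_Suc_conv)
  have c: "x \<in> carrier A" "y \<in> carrier A" using drop_lists[OF w, of m] unfolding d by simp_all
  have tw: "take m w @ [\<one>\<^sub>A] \<in> A_lists" by (rule one_letter_lists[OF w])
  have n: "w ! m = x" "w ! Suc m = y" using arg_cong[OF d, of "%l. l ! 0"] arg_cong[OF d, of "%l. l ! Suc 0"] True by simp_all
  have "muR (Q m w) = p (take m w @ [\<one>\<^sub>A]) \<triangleleft>\<^sub>P (x \<otimes>\<^sub>A y)" using c by (simp add: muR_Q d bar_aug_pair)
  also have "... = p (scale_last (x \<otimes>\<^sub>A y) (take m w @ [\<one>\<^sub>A]))" by (rule p_scale_last[OF tw _ , symmetric]) (use c in simp_all)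
  also have "scale_last (x \<otimes>\<^sub>A y) (take m w @ [\<one>\<^sub>A]) = face m w"
   using c True[symmetric] by (simp add: face_def scale_last_def n nth_append list_update_append)
  finally show ?thesis using True by simp
 next
  case False
  hence "\<mu> (p (drop m w)) = \<zero>\<^sub>A" using m by (intro mu_p_long) simp
  thus ?thesis using False by (simp add: muR_Q)
 qed
 have "d (phi (Q m w)) \<oplus>\<^sub>P phi (D (Q m w)) \<oplus>\<^sub>P f (muL (Q m w)) = muR (Q m w)" by (rule phi_homotopy) simp
 hence "muR (Q m w) \<ominus>\<^sub>P f (muL (Q m w)) = d (phi (Q m w)) \<oplus>\<^sub>P phi (D (Q m w))"
  by (auto simp: a_minus_def P.a_assoc P.r_neg dest: sym)
 thus ?thesis unfolding L R s using v by (simp only: th1_def cutoff_simps)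
qed

end

context comparison
begin

text \<open>For m = 1 the faces keeping mark 1 are those of \<open>face 0 w\<close>, with opposite
  index parity, and yield \<open>K1\<close> of its boundary. For m = 2 faces 0 and 1 both acquire
  mark 1 and cancel by the simplicial identity. For larger m no face reaches mark 1.\<close>

lemma d_th3:
 assumes v: "valid m w"
 shows "d (th3 m w) \<oplus>\<^sub>P fsum th3 m w
  = f (if m = 1 then p (face 0 w) else \<zero>\<^sub>P) \<ominus>\<^sub>P (if m = 1 then p (face 0 w) else \<zero>\<^sub>P)"
proof -
 note w = validD(1)[OF v] and m = validD(2,3)[OF v]
 note c = mfun_closed[OF mfun_th3]
 have mz: "\<ominus>\<^sub>P \<zero>\<^sub>P = \<zero>\<^sub>P" using P.sgn_elt_zero[of 1] unfolding sgn_elt_def by simp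
 have s: "Suc 0 < length w" using m by simp
 note fw = face_lists[OF w s]
 note fs = fsum_eq[OF c]
 \<comment> \<open>True also for two-letter words, whose mark 1 is degenerate: face 0 then has a
   single letter and evaluates to zero.\<close>
 have th3_one: "th3 1 u = K1 (wz (face 0 u))" if "u \<in> A_lists" "Suc 0 < length u" for u
 proof (cases "valid 1 u")
  case True thus ?thesis by (simp add: th3_def cutoff_simps)
 next
  case False
  hence "length (face 0 u) < 2" using that length_face[of 0 u] unfolding valid_iff[OF that(1)] by simp
  hence "wz (face 0 u) = \<zero>\<^bsub>Br\<^esub>" unfolding wz_def word_gens_iff by simp
  thus ?thesis using False by (simp add: th3_def cutoff_simps ahom_zero[OF Brg Pg deg_hom_ahom[OF K1_hom]])
 qed
 have th3_other: "th3 l u = \<zero>\<^sub>P" if "l ~= 1" for l u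
  using that unfolding th3_def cutoff_def by simp
 consider "m = 1" | "m = 2" | "2 < m" using m by linarith
 thus ?thesis
 proof cases
  case 1
  let ?v = "face 0 w"
  obtain N where N: "length w = Suc (Suc (Suc N))" using m 1 by (metis add_2_eq_Suc' Suc_le_D Suc_le_mono One_nat_def)
  have lv: "length ?v - 1 = Suc N" using length_face[OF s] N by simp
  let ?t = "%k. sgn_elt P (int (if k < 1 then k else Suc k)) (th3 (mark_face 1 k) (face k w))"
  have "fsum th3 m w = finsum P ?t {..Suc N}" unfolding fs 1 N by (simp add: lessThan_Suc_atMost)
  also have "... = finsum P (%k. ?t (Suc k)) {..N} \<oplus>\<^sub>P ?t 0"
   by (rule P.finsum_Suc2) (simp add: c)
  also have "?t 0 = \<zero>\<^sub>P" by (simp add: mark_face_def th3_other)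
  also have "finsum P (%k. ?t (Suc k)) {..N} = (\<Oplus>\<^bsub>P\<^esub>l\<in>{..<Suc N}. sgn_elt P (int l) (K1 (wz (face l ?v))))"
   unfolding lessThan_Suc_atMost
  proof (rule P.finsum_cong'[OF refl])
   show "(%l. sgn_elt P (int l) (K1 (wz (face l ?v)))) \<in> {..N} \<rightarrow> carrier P" by (simp add: K1_closed wz_closed)
   fix l assume l: "l \<in> {..N}"
   hence sl: "Suc (Suc l) < length w" by (simp add: N)
   have "mark_face 1 (Suc l) = 1" by (simp add: mark_face_def)
   moreover have "th3 1 (face (Suc l) w) = K1 (wz (face 0 (face (Suc l) w)))"
    by (rule th3_one[OF face_lists[OF w sl]]) (simp add: length_face[OF sl] N)
   moreover have "face 0 (face (Suc l) w) = face l ?v"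
    using face_face[OF w _ sl, of 0] by simp
   ultimately show "?t (Suc l) = sgn_elt P (int l) (K1 (wz (face l ?v)))" by (simp add: sgn_elt_def)
  qed
  also have "... = frag_lift P (%u. K1 (wz u)) (face_sum ?v)"
   unfolding frag_lift_face_sum[OF Pg K1_closed[OF wz_closed]] lv ..
  also have "... = K1 (diff Br (wz ?v))"
   unfolding diff_wz[OF fw] by (rule Br.ahom_frag_lift[OF deg_hom_ahom[OF K1_hom] Pg wz_closed, symmetric])
  finally have e: "fsum th3 m w = K1 (diff Br (wz ?v))"
   by (simp add: K1_closed diff_Br_closed wz_closed)
  have "th3 m w = K1 (wz ?v)" unfolding 1 by (rule th3_one[OF w s])
  thus ?thesis using d_K1[OF wz_closed, of ?v] unfolding e unfolding 1 p_def by simp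
 next
  case 2
  let ?x = "th3 1 (face 0 w)"
  have l: "Suc 1 < length w" "Suc (Suc 0) < length w" using m 2 by simp_all
  have "?x = K1 (wz (face 0 (face 0 w)))" by (rule th3_one[OF fw]) (use length_face[OF s] m 2 in simp)
  moreover have "th3 1 (face 1 w) = K1 (wz (face 0 (face 1 w)))"
   by (rule th3_one[OF face_lists[OF w l(1)]]) (use length_face[OF l(1)] m 2 in simp)
  moreover have "face 0 (face 1 w) = face 0 (face 0 w)" using face_face[OF w _ l(1), of 0] by simp
  ultimately have x: "th3 1 (face 1 w) = ?x" by simp
  have "fsum th3 m w = (\<Oplus>\<^bsub>P\<^esub>k\<in>{..<length w - 1}. (if k = 0 & True then ?x else \<zero>\<^sub>P) \<oplus>\<^sub>P (if k = 1 & True then \<ominus>\<^sub>P ?x else \<zero>\<^sub>P))"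
   unfolding fs 2
  proof (rule P.finsum_cong'[OF refl])
   fix k :: nat
   consider "k = 0" | "k = 1" | "2 <= k" by linarith
   thus "sgn_elt P (int (if k < 2 then k else Suc k)) (th3 (mark_face 2 k) (face k w)) =
     (if k = 0 & True then ?x else \<zero>\<^sub>P) \<oplus>\<^sub>P (if k = 1 & True then \<ominus>\<^sub>P ?x else \<zero>\<^sub>P)"
   proof cases
    case 1 thus ?thesis by (simp add: mark_face_def c)
   next
    case 2 thus ?thesis using x c[of 1 "face 0 w"] by (simp add: mark_face_def sgn_elt_def)
   next
    case 3 thus ?thesis by (simp add: mark_face_def th3_other)
   qed
  qed (use c in auto)
  also have "... = (\<Oplus>\<^bsub>P\<^esub>k\<in>{..<length w - 1}. (if k = 0 & True then ?x else \<zero>\<^sub>P)) \<oplus>\<^sub>P (\<Oplus>\<^bsub>P\<^esub>k\<in>{..<length w - 1}. (if k = 1 & True then \<ominus>\<^sub>P ?x else \<zero>\<^sub>P))"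
   by (rule P.finsum_addf) (use c in auto)
  also have "... = \<zero>\<^sub>P"
  proof -
   have l3: "0 < length w - 1" "1 < length w - 1" "1 < length w" using m 2 by linarith+
   show ?thesis using c by (subst (1 2) finsum_delta_if[OF Pg]) (simp_all add: P.r_neg l3 del: One_nat_def)
  qed
  finally show ?thesis using 2 by (simp add: mz th3_other ahom_zero[OF Pg Pg op_ahom(7)] ahom_zero[OF Pg Pg op2_ahom(2)] a_minus_def)
 next
  case 3
  have "fsum th3 m w = (\<Oplus>\<^bsub>P\<^esub>k\<in>{..<length w - 1}. \<zero>\<^sub>P)"
   unfolding fs by (rule P.finsum_cong'[OF refl]) (use 3 in \<open>simp_all add: mark_face_def th3_other\<close>)
  thus ?thesis using 3 by (simp add: mz th3_other ahom_zero[OF Pg Pg op_ahom(7)] ahom_zero[OF Pg Pg op2_ahom(2)] a_minus_def)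
 qed
qed

lemma d_alt:
 assumes q: "wfun j q" and v: "valid m w"
 shows "d (alt q m w) = sgn_elt P (int (Suc m)) (d (q w))"
 using v wfun_closed[OF q] unfolding alt_def by (simp only: cutoff_simps ahom_sgn[OF Pg Pg op_ahom(7)])

definition "theta m w = th1 m w \<oplus>\<^sub>P (alt p m w \<oplus>\<^sub>P th3 m w)"

lemma mfun_theta: "mfun (- 2) theta"
 unfolding theta_def[abs_def] by (intro mfun_plus mfun_th1 mfun_th3 mfun_alt wfun_p)

text \<open>The three boundaries form a cycle: with x the term at m = 1 and y the term at m + 2 =
  length, they are y - f x, x - y and f x - x.\<close>

lemma theta_closed:
 assumes v: "valid m w"
 shows "d (theta m w) \<oplus>\<^sub>P fsum theta m w = \<zero>\<^sub>P"
proof -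
 note w = validD(1)[OF v]
 note c = mfun_closed[OF mfun_th1] mfun_closed[OF mfun_alt[OF wfun_p]] mfun_closed[OF mfun_th3]
 define x where "x = (if m = 1 then p (face 0 w) else \<zero>\<^sub>P)"
 define y where "y = (if m + 2 = length w then p (face m w) else \<zero>\<^sub>P)"
 have xy: "x \<in> carrier P" "y \<in> carrier P" unfolding x_def y_def by simp_all
 have c23: "alt p m w \<oplus>\<^sub>P th3 m w \<in> carrier P" for m w using c by simp
 have s: "fsum theta m w = fsum th1 m w \<oplus>\<^sub>P (fsum (alt p) m w \<oplus>\<^sub>P fsum th3 m w)"
  unfolding theta_def[abs_def] by (simp only: fsum_plus[OF c(1) c23] fsum_plus[OF c(2,3)])
 have f: "fsum th1 m w \<in> carrier P" "fsum (alt p) m w \<in> carrier P" "fsum th3 m w \<in> carrier P"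
  by (rule fsum_closed, rule c)+
 have 2: "d (alt p m w) \<oplus>\<^sub>P fsum (alt p) m w = x \<ominus>\<^sub>P y"
 proof -
  let ?z = "sgn_elt P (int (Suc m)) (frag_lift P p (face_sum w))"
  have "?z \<in> carrier P" by (rule P.sgn_elt_closed[OF P.frag_lift_closed[OF p_closed]])
  thus ?thesis
   unfolding d_alt[OF wfun_p v] fsum_alt[OF wfun_p v] d_p[OF w] x_def[symmetric] y_def[symmetric]
   using xy by (simp add: a_minus_def P.a_assoc[symmetric] P.r_neg)
 qed
 have 1: "d (th1 m w) \<oplus>\<^sub>P fsum th1 m w = y \<ominus>\<^sub>P f x" using d_th1[OF v] unfolding x_def y_def .
 have 3: "d (th3 m w) \<oplus>\<^sub>P fsum th3 m w = f x \<ominus>\<^sub>P x" using d_th3[OF v] unfolding x_def .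
 have "d (theta m w) \<oplus>\<^sub>P fsum theta m w = (d (th1 m w) \<oplus>\<^sub>P fsum th1 m w)
   \<oplus>\<^sub>P ((d (alt p m w) \<oplus>\<^sub>P fsum (alt p) m w) \<oplus>\<^sub>P (d (th3 m w) \<oplus>\<^sub>P fsum th3 m w))"
  unfolding theta_def s using c f by (simp add: ahom_add[OF op_ahom(7)] P.a_ac)
 also have "... = (y \<ominus>\<^sub>P f x) \<oplus>\<^sub>P ((x \<ominus>\<^sub>P y) \<oplus>\<^sub>P (f x \<ominus>\<^sub>P x))" by (simp only: 1 2 3)
 also have "... = \<zero>\<^sub>P"
 proof -
  have "(x \<ominus>\<^sub>P y) \<oplus>\<^sub>P (f x \<ominus>\<^sub>P x) = f x \<ominus>\<^sub>P y"
   using xy by (simp add: a_minus_def P.a_ac P.r_neg1 P.r_neg2)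
  moreover have "(y \<ominus>\<^sub>P f x) \<oplus>\<^sub>P (f x \<ominus>\<^sub>P y) = \<zero>\<^sub>P"
   using xy by (simp add: a_minus_def P.a_assoc P.r_neg P.r_neg1)
  ultimately show ?thesis by (simp only:)
 qed
 finally show ?thesis .
qed

section \<open>Transport to the trace by summing over rotations\<close>

text \<open>The counterpart for marked words of the swap in \<open>hat\<close>: it evaluates on the
  cuts with exchanged factors, which have valid marks only.\<close>

definition "chat g w = frag_lift (Tr A P) (%(m, v). TP.tr (g m v)) (cyclic_cuts w)"

lemma chat_eq:
 assumes "!!m w. g m w \<in> carrier P"
 shows "chat g w = (\<Oplus>\<^bsub>Tr A P\<^esub>i\<in>{1..<length w}. sgn_elt (Tr A P) (int ((i - 1) * (length w - 1 - i))) (TP.tr (g (length w - i) (cyclic_word i w))))"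
proof -
 have c: "(%(m, v). TP.tr (g m v)) x \<in> carrier (Tr A P)" for x using assms by (simp add: case_prod_beta TP.tr_closed)
 show ?thesis unfolding chat_def cyclic_cuts_def by (subst TP.Tr.frag_lift_signed_sum[OF c]) simp_all
qed

lemma valid_cyclic:
 "[|w \<in> A_lists; i \<in> {1..<length w}|] ==> valid (length w - i) (cyclic_word i w)"
 by (subst valid_iff[OF cyclic_word_lists]) (auto simp: length_cyclic_word)

lemma chat_cong:
 assumes w: "w \<in> A_lists" and c: "!!m w. g m w \<in> carrier P" "!!m w. h m w \<in> carrier P"
  and e: "!!m w. valid m w ==> g m w = h m w"
 shows "chat g w = chat h w"
 unfolding chat_eq[OF c(1)] chat_eq[OF c(2)]
 by (rule TP.Tr.finsum_cong'[OF refl]) (use c in \<open>auto simp: e[OF valid_cyclic[OF w]] TP.tr_closed\<close>)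

lemma chat_plus:
 assumes c: "!!m w. g m w \<in> carrier P" "!!m w. h m w \<in> carrier P"
 shows "chat (%m w. g m w \<oplus>\<^sub>P h m w) w = chat g w \<oplus>\<^sub>T chat h w"
proof -
 have c': "g m w \<oplus>\<^sub>P h m w \<in> carrier P" for m w using c by simp
 have t: "TP.tr (g m w) \<in> carrier (Tr A P)" "TP.tr (h m w) \<in> carrier (Tr A P)" for m w using c by (simp_all add: TP.tr_closed)
 show ?thesis
  unfolding chat_eq[OF c'] chat_eq[OF c(1)] chat_eq[OF c(2)] TP.tr_add[OF c] TP.Tr.sgn_elt_add[OF t]
  by (rule TP.Tr.finsum_addf) (simp_all add: t)
qed

lemma chat_closed: "(!!m w. g m w \<in> carrier P) ==> chat g w \<in> carrier (Tr A P)"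
 unfolding chat_def by (rule TP.Tr.frag_lift_closed) (simp add: case_prod_beta TP.tr_closed)

lemma chat_d:
 assumes c: "!!m w. g m w \<in> carrier P"
 shows "chat (%m w. d (g m w)) w = dT (chat g w)"
proof -
 have b: "(%(m, v). TP.tr (g m v)) x \<in> carrier (Tr A P)" for x using c by (simp add: case_prod_beta TP.tr_closed)
 have "dT (chat g w) = frag_lift (Tr A P) (%x. dT ((%(m, v). TP.tr (g m v)) x)) (cyclic_cuts w)"
  unfolding chat_def by (rule TP.Tr.ahom_frag_lift[OF dT_ahom TPg b])
 also have "(%x. dT ((%(m, v). TP.tr (g m v)) x)) = (%(m, v). TP.tr (d (g m v)))"
  by (rule ext) (simp add: split_def dT_tr c)
 finally show ?thesis unfolding chat_def by simp
qed

text \<open>A cyclic word is built from w by merging the outer letters, rotating, appending a unit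
  and prefixing one; each of these operations is letterwise.\<close>

lemma chat_bml:
 assumes g: "mfun j g" and w: "w \<in> word_gens A 2"
 shows "bml (Tr A P) (chat g) w"
proof -
 note wl = gens_lists[OF w] and c = mfun_closed[OF g]
 let ?l = "cyclic_letters \<one>\<^sub>A w"
 have cl: "?l \<in> word_gens A 1" by (rule cyclic_letters_lists[OF w A.one_closed])
 let ?q = "%i w. sgn_elt (Tr A P) (int ((i - 1) * (length w - 1 - i))) (TP.tr (g (length w - i) (cyclic_word i w)))"
 have "bml (Tr A P) (%v. \<Oplus>\<^bsub>Tr A P\<^esub>i\<in>{1..<length w}. sgn_elt (Tr A P) (int ((i - 1) * (length w - 1 - i))) (TP.tr (g (length w - i) (cyclic_word i v)))) w"
 proof (rule bml_finsum[OF TPg bml_sgn[OF TPg] wl])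
  fix i assume i: "i \<in> {1..<length w}"
  let ?G = "%v. TP.tr (g (length w - i) v)"
  have r: "rotate i ?l \<in> A_lists" by (rule gens_lists[OF rotate_gens[OF cl]])
  have r1: "rotate i ?l @ [\<one>\<^sub>A] \<in> A_lists" using r by simp
  have r2: "\<one>\<^sub>A # rotate i ?l @ [\<one>\<^sub>A] \<in> A_lists" using r1 by simp
  have "bml (Tr A P) ?G (\<one>\<^sub>A # rotate i ?l @ [\<one>\<^sub>A])"
   by (rule bml_hom[OF mfun_bml[OF g r2] TP.tr_ahom[OF A.one_closed]])
  from bml_letterwise[where q = ?G and \<rho> = "%v. \<one>\<^sub>A # v", OF r1 letterwise_Cons this]
  have "bml (Tr A P) (%v. ?G (\<one>\<^sub>A # v)) (rotate i ?l @ [\<one>\<^sub>A])" .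
  from bml_letterwise[where q = "%v. ?G (\<one>\<^sub>A # v)" and \<rho> = "%v. v @ [\<one>\<^sub>A]", OF r letterwise_append this]
  have "bml (Tr A P) (%v. ?G (\<one>\<^sub>A # v @ [\<one>\<^sub>A])) (rotate i ?l)" .
  from bml_letterwise[where q = "%v. ?G (\<one>\<^sub>A # v @ [\<one>\<^sub>A])" and \<rho> = "rotate i", OF gens_lists[OF cl] letterwise_rotate this]
  have "bml (Tr A P) (%v. ?G (\<one>\<^sub>A # rotate i v @ [\<one>\<^sub>A])) ?l" .
  from bml_letterwise[where q = "%v. ?G (\<one>\<^sub>A # rotate i v @ [\<one>\<^sub>A])" and \<rho> = "cyclic_letters \<one>\<^sub>A", OF wl letterwise_cyclic_letters[OF w A.one_closed] this]
  have b: "bml (Tr A P) (%v. ?G (\<one>\<^sub>A # rotate i (cyclic_letters \<one>\<^sub>A v) @ [\<one>\<^sub>A])) w" .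
  show "bml (Tr A P) (%v. ?G (cyclic_word i v)) w"
  proof (rule bml_cong[OF b wl])
   fix k a assume "k < length w" "a \<in> carrier A"
   hence "cyclic_word i (w[k := a]) = \<one>\<^sub>A # rotate i (cyclic_letters \<one>\<^sub>A (w[k := a])) @ [\<one>\<^sub>A]"
    using i by (intro cyclic_word_rotate gens_update w) auto
   thus "?G (\<one>\<^sub>A # rotate i (cyclic_letters \<one>\<^sub>A (w[k := a])) @ [\<one>\<^sub>A]) = ?G (cyclic_word i (w[k := a]))" by (simp only:)
  qed
 qed
 thus ?thesis by (rule bml_cong[OF _ wl]) (simp only: chat_eq[OF c] length_list_update)
qed

text \<open>Cyclic words contain the outer letters only through the product of the last and the
  first, so it does not matter which of them is scaled. This is the cyclicity needed to descend to
  the trace.\<close>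

lemma chat_scale:
 assumes c: "!!m w. g m w \<in> carrier P" and w: "w \<in> word_gens A 2" and a: "a \<in> carrier A"
 shows "chat g (scale_first a w) = chat g (scale_last a w)"
proof -
 have two: "(0::nat) < 2" by simp
 have e: "cyclic_word i (scale_first a w) = cyclic_word i (scale_last a w)" if "i \<in> {1..<length w}" for i
  using that cyclic_word_rotate[OF scale_gens(1)[OF w two a], of i] cyclic_word_rotate[OF scale_gens(2)[OF w two a], of i]
  by (simp add: cyclic_letters_scale[OF w a])
 show ?thesis
  unfolding chat_eq[OF c] length_scale
  by (rule TP.Tr.finsum_cong'[OF refl]) (use c in \<open>simp_all add: e TP.tr_closed\<close>)
qed

definition "chB g = pres_lift (Tr A P) (chat g)"

lemma chB_ahom: "mfun j g ==> chB g \<in> ahom Br (Tr A P)"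
 unfolding chB_def ahom_Bar by (rule word_lift_hom[OF TPg _ chat_bml]) simp_all

lemma chB_wd: "[|mfun j g; w \<in> word_gens A 2|] ==> chB g (wd w) = chat g w"
 unfolding chB_def by (rule word_lift_word[OF TPg _ chat_bml]) simp_all

lemma chB_cyc:
 assumes g: "mfun j g" and a: "a \<in> carrier A" and u: "u \<in> carrier Br"
 shows "chB g (a \<odot>\<^sub>B u) = chB g (u \<triangleleft>\<^sub>B a)"
proof (rule Bar_hom_eq[OF ahom_comp[OF Br.smult_ahom[OF a] chB_ahom[OF g]] ahom_comp[OF Br.ract_ahom[OF a] chB_ahom[OF g]] TPg _ u])
 fix w assume w: "w \<in> word_gens A 2"
 have two: "(0::nat) < 2" by simp
 show "chB g (a \<odot>\<^sub>B wd w) = chB g (wd w \<triangleleft>\<^sub>B a)"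
  unfolding smult_wd[OF a w] ract_wd[OF a w] chB_wd[OF g scale_gens(1)[OF w two a]] chB_wd[OF g scale_gens(2)[OF w two a]]
  by (rule chat_scale[OF mfun_closed[OF g] w a])
qed

definition "ch g = bar_trace (chB g)"

lemma ch_ahom: "mfun j g ==> ch g \<in> ahom (Tr A Br) (Tr A P)"
 unfolding ch_def by (rule bar_trace_ahom[OF chB_ahom chB_cyc])

lemma ch_tb: "[|mfun j g; u \<in> carrier Br|] ==> ch g (tb u) = chB g u"
 unfolding ch_def by (rule bar_trace_tb[OF chB_ahom chB_cyc])

end

lemma (in abelian_group) finsum_lessThan_Suc:
 assumes "!!i. h i \<in> carrier G"
 shows "finsum G h {..<Suc n} = finsum G (%i. h (Suc i)) {..<n} \<oplus> h 0"
proof (cases n)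
 case 0
 thus ?thesis using assms by (simp add: lessThan_Suc)
next
 case (Suc m)
 thus ?thesis unfolding lessThan_Suc_atMost Suc by (intro finsum_Suc2) (simp add: assms)
qed

context comparison
begin

text \<open>The first letter a of a rotation is the last letter of the next one. Multiplying it into
  the adjacent unit gives the same word v with a acting on the left in one case and on the right in
  the other.\<close>

lemma rotation_faces:
 assumes c: "c \<in> A_lists" "length c = Suc n"
 obtains a v where "a \<in> carrier A" "v \<in> A_lists" "v ~= []"
  "face 0 (\<one>\<^sub>A # rotate i c @ [\<one>\<^sub>A]) = scale_first a v"
  "face (Suc n) (\<one>\<^sub>A # rotate (Suc i) c @ [\<one>\<^sub>A]) = scale_last a v"
proof -
 obtain a s where r: "rotate i c = a # s" using c(2) by (cases "rotate i c") auto
 have "length (rotate i c) = Suc n" "set (rotate i c) = set c" using c(2) by simp_all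
 hence s: "length s = n" "a \<in> carrier A" "s \<in> A_lists" using c(1) unfolding r by auto
 have "rotate (Suc i) c = s @ [a]" unfolding rotate_Suc r by simp
 thus ?thesis
  using s by (intro that[of a "\<one>\<^sub>A # s @ [\<one>\<^sub>A]"]) (simp_all add: r face_def scale_first_def scale_last_def nth_append list_update_append)
qed

lemma tr_rotation_faces:
 assumes c: "c \<in> A_lists" "length c = Suc n" and qc: "!!w. q w \<in> carrier P"
  and q: "!!a w. [|a \<in> carrier A; w \<in> A_lists; w ~= []|] ==> q (scale_first a w) = a \<odot>\<^sub>P q w"
   "!!a w. [|a \<in> carrier A; w \<in> A_lists; w ~= []|] ==> q (scale_last a w) = q w \<triangleleft>\<^sub>P a"
 shows "TP.tr (q (face 0 (\<one>\<^sub>A # rotate i c @ [\<one>\<^sub>A]))) = TP.tr (q (face (Suc n) (\<one>\<^sub>A # rotate (Suc i) c @ [\<one>\<^sub>A])))"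
proof -
 obtain a v where av: "a \<in> carrier A" "v \<in> A_lists" "v ~= []"
  and e: "face 0 (\<one>\<^sub>A # rotate i c @ [\<one>\<^sub>A]) = scale_first a v"
   "face (Suc n) (\<one>\<^sub>A # rotate (Suc i) c @ [\<one>\<^sub>A]) = scale_last a v"
  using rotation_faces[OF c] by blast
 show ?thesis unfolding e q(1)[OF av] q(2)[OF av] by (rule TP.tr_cyclic[OF av(1) qc])
qed

text \<open>Inner faces of cyclic cuts are cyclic cuts of faces. The outermost faces cancel in pairs
  by cyclicity of the trace, except for two with degenerate marks. So \<open>chat\<close> carries
  the marked boundary to the bar differential.\<close>

lemma chat_msum:
 assumes g: "mfun j g" and w: "w \<in> word_gens A 2"
 shows "chat (msum g) w = frag_lift (Tr A P) (chat g) (face_sum w)"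
proof -
 note wl = gens_lists[OF w] and c = mfun_closed[OF g]
 obtain n where n: "length w = n + 2" using gens_length[OF w] le_Suc_ex by (metis add.commute)
 define bb where "bb = (%(m, v). TP.tr (g m v))"
 have b: "bb x \<in> carrier (Tr A P)" for x using c by (simp add: bb_def case_prod_beta TP.tr_closed)
 let ?c = "cyclic_letters \<one>\<^sub>A w"
 have cl: "?c \<in> A_lists" by (rule gens_lists[OF cyclic_letters_lists[OF w A.one_closed]])
 have lc: "length ?c = Suc n" by (simp add: cyclic_letters_def n)
 have "chat (msum g) w = chat (fsum g) w"
  by (rule chat_cong[OF wl mfun_closed[OF mfun_msum[OF g]] fsum_closed[OF c]]) (rule msum_fsum[OF validD(1) g])
 also have "... = frag_lift (Tr A P) (%x. frag_lift (Tr A P) bb (marked_sum x)) (cyclic_cuts w)"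
 proof -
  have pc: "(%(m, w). g m w) x \<in> carrier P" for x using c by (simp add: case_prod_beta)
  have "TP.tr (fsum g m v) = frag_lift (Tr A P) bb (marked_sum (m, v))" for m v
   unfolding fsum_def by (subst P.ahom_frag_lift[OF TP.tr_ahom[OF A.one_closed] TPg pc]) (simp add: bb_def split_def)
  hence "(%(m, v). TP.tr (fsum g m v)) = (%x. frag_lift (Tr A P) bb (marked_sum x))" by (intro ext) (simp add: split_def)
  thus ?thesis unfolding chat_def by (simp only:)
 qed
 also have "... = frag_lift (Tr A P) bb (frag_extend marked_sum (cyclic_cuts w))" by (rule TP.Tr.frag_lift_extend[OF b])
 also have "... = frag_lift (Tr A P) bb (frag_extend cyclic_cuts (face_sum w))"
 proof -
  let ?x = "%i. (Suc n - i, face 0 (cyclic_word i w))" and ?y = "%i. (Suc n - i, face (Suc n) (cyclic_word (Suc i) w))"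
  have bd: "frag_lift (Tr A P) bb (\<Sum>i\<in>{1..n}. frag_cmul ((- 1) ^ ((i - 1) * (Suc n - i))) (frag_of (?x i) - frag_of (?y i))) = \<zero>\<^sub>T"
  proof (subst TP.Tr.frag_lift_sum[OF b])
   have "frag_lift (Tr A P) bb (frag_cmul ((- 1) ^ k) (frag_of (?x i) - frag_of (?y i))) = \<zero>\<^sub>T" if i: "i \<in> {1..n}" for i k
   proof -
    have "1 <= i" "i < length w" "1 <= Suc i" "Suc i < length w" using i n by auto
    note r = cyclic_word_rotate[OF w this(1,2)] cyclic_word_rotate[OF w this(3,4)]
    have "bb (?x i) = bb (?y i)"
     unfolding r bb_def prod.case
     by (rule tr_rotation_faces[OF cl lc c]) (rule mfun_first[OF g], assumption+, rule mfun_last[OF g], assumption+)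
    hence "frag_lift (Tr A P) bb (frag_of (?x i) - frag_of (?y i)) = \<zero>\<^sub>T"
     unfolding TP.Tr.frag_lift_diff[OF b b] TP.Tr.frag_lift_of[where b = bb, OF b] using b[of "?y i"] by (simp only: a_minus_def TP.Tr.r_neg)
    thus ?thesis unfolding TP.Tr.frag_lift_neg_sign[OF b] by (simp only: TP.Tr.sgn_elt_zero)
   qed
   thus "(\<Oplus>\<^bsub>Tr A P\<^esub>i\<in>{1..n}. frag_lift (Tr A P) bb (frag_cmul ((- 1) ^ ((i - 1) * (Suc n - i))) (frag_of (?x i) - frag_of (?y i)))) = \<zero>\<^sub>T"
    by (rule TP.Tr.add.finprod_one_eqI)
  qed simp
  \<comment> \<open>The marks left over by the formal computation are 0 and n + 1 on words with n +
    2 letters, both degenerate.\<close>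
  have z: "bb (0, v) = \<zero>\<^sub>T" "length v = n + 2 ==> bb (Suc n, v) = \<zero>\<^sub>T" for v
   by (simp_all add: bb_def mfun_invalid[OF g] valid_def TP.tr_zero)
  have fl: "frag_lift (Tr A P) bb Z \<in> carrier (Tr A P)" for Z by (rule TP.Tr.frag_lift_closed[OF b])
  have l: "length (face (Suc n) (cyclic_word 1 w)) = n + 2" using length_face[of "Suc n" "cyclic_word 1 w"] by (simp add: length_cyclic_word n)
  show ?thesis
   unfolding marked_sum_cyclic_cuts[OF wl n] TP.Tr.frag_lift_add[OF b b] bd TP.Tr.frag_lift_neg_sign[OF b] TP.Tr.frag_lift_of[where b = bb, OF b] z(1) z(2)[OF l]
   using fl by simp
 qed
 also have "... = frag_lift (Tr A P) (chat g) (face_sum w)"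
  unfolding chat_def[abs_def] bb_def[symmetric] by (rule TP.Tr.frag_lift_extend[OF b, symmetric])
 finally show ?thesis .
qed

lemma chB_msum:
 assumes g: "mfun j g" and w: "w \<in> word_gens A 2"
 shows "chat (msum g) w = chB g (diff Br (wd w))"
proof -
 note wl = gens_lists[OF w] and c = mfun_closed[OF g]
 have "chB g (wz v) = chat g v" if v: "v \<in> A_lists" for v
 proof (cases "v \<in> word_gens A 2")
  case True thus ?thesis by (simp add: wz_def chB_wd[OF g])
 next
  case False
  hence "{1..<length v} = {}" using v unfolding word_gens_iff by auto
  hence "cyclic_cuts v = 0" unfolding cyclic_cuts_def by (simp only: sum.empty)
  thus ?thesis using False by (simp add: wz_def chat_def ahom_zero[OF Brg TPg chB_ahom[OF g]])
 qed
 hence e: "chB g (wz v) = chat g v" if "v \<in> Poly_Mapping.keys (face_sum w)" for v using keys_face_sum[OF wl that] by blast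
 have "chB g (diff Br (wd w)) = frag_lift (Tr A P) (%v. chB g (wz v)) (face_sum w)"
  unfolding diff_wd[OF w] by (rule Br.ahom_frag_lift[OF chB_ahom[OF g] TPg wz_closed])
 also have "... = frag_lift (Tr A P) (chat g) (face_sum w)"
  by (rule TP.Tr.frag_lift_cong[OF e chat_closed[OF c]])
 finally show ?thesis using chat_msum[OF g w] by simp
qed

text \<open>The exchange sign times the sign in \<open>alt\<close> is (-1)^(in) with n = length w -
  2: with i = a + 1 and length a + k + 2 both exponents are congruent to (a + 1) k, since a (a + 1)
  is even.\<close>

lemma chat_alt:
 assumes q: "!!w. q w \<in> carrier P" and w: "w \<in> A_lists"
 shows "chat (alt q) w = (\<Oplus>\<^bsub>Tr A P\<^esub>i\<in>{1..<length w}. sgn_elt (Tr A P) (int (i * (length w - 2))) (TP.tr (q (cyclic_word i w))))"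
proof -
 have c: "alt q m w \<in> carrier P" for m w using q by (simp add: alt_def cutoff_def)
 show ?thesis
  unfolding chat_eq[OF c]
 proof (rule TP.Tr.finsum_cong'[OF refl])
  fix i assume i: "i \<in> {1..<length w}"
  then obtain a k where ak: "i = Suc a" "length w = Suc a + Suc k" by (cases i) (auto dest!: less_imp_Suc_add)
  have t: "TP.tr (q (cyclic_word i w)) \<in> carrier (Tr A P)" by (simp add: q TP.tr_closed)
  have "alt q (length w - i) (cyclic_word i w) = sgn_elt P (int (Suc (length w - i))) (q (cyclic_word i w))"
   unfolding alt_def cutoff_simps(1)[OF valid_cyclic[OF w i]] ..
  hence "sgn_elt (Tr A P) (int ((i - 1) * (length w - 1 - i))) (TP.tr (alt q (length w - i) (cyclic_word i w)))
    = sgn_elt (Tr A P) (int ((i - 1) * (length w - 1 - i)) + int (Suc (length w - i))) (TP.tr (q (cyclic_word i w)))"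
   by (simp only: TP.tr_sgn[OF q] TP.Tr.sgn_elt_sgn_elt[OF t])
  also have "... = sgn_elt (Tr A P) (int (i * (length w - 2))) (TP.tr (q (cyclic_word i w)))"
   unfolding ak by (simp add: sgn_elt_def) blast
  finally show "sgn_elt (Tr A P) (int ((i - 1) * (length w - 1 - i))) (TP.tr (alt q (length w - i) (cyclic_word i w)))
    = sgn_elt (Tr A P) (int (i * (length w - 2))) (TP.tr (q (cyclic_word i w)))" .
 qed (simp add: q TP.tr_closed)
qed

lemma cyclic_word_split:
 assumes c: "x \<in> carrier A" "y \<in> carrier A" "ys \<in> A_lists" and l: "l <= length ys"
 shows "cyclic_word (Suc l) (x # ys @ [y]) = \<one>\<^sub>A # drop l ys @ (y \<otimes>\<^sub>A x) # take l ys @ [\<one>\<^sub>A]"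
proof -
 have g: "x # ys @ [y] \<in> word_gens A 2" using c unfolding word_gens_iff by simp
 have "rotate (Suc l) ((y \<otimes>\<^sub>A x) # ys) = drop l ys @ (y \<otimes>\<^sub>A x) # take l ys"
 proof (cases "l = length ys")
  case True thus ?thesis using rotate_id[of "Suc l" "(y \<otimes>\<^sub>A x) # ys"] by simp
 next
  case False thus ?thesis using l by (simp add: rotate_drop_take)
 qed
 thus ?thesis
  using cyclic_word_rotate[OF g, of "Suc l"] c l by (simp add: cyclic_letters_simp del: rotate_Suc)
qed

text \<open>In the exchanged tensor the last letter of w closes the left factor. Moved across the
  tensor sign it meets the first letter of w, which produces the product letter of the cyclic
  word.\<close>

lemma chat_th1: assumes w: "w \<in> word_gens A 2" shows "chat th1 w = hat phi (gam (wd w))"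
proof -
 note wl = gens_lists[OF w]
 note c = mfun_closed[OF mfun_th1]
 have "hat phi (gam (wd w)) = (\<Oplus>\<^bsub>Tr A P\<^esub>i\<in>{1..<length w}. hat phi (Q i (insert_one i w)))"
  unfolding gam_wd[OF w] Gam_eq by (rule ahom_finsum[OF PPg TPg hat_ahom[OF phi_hom]]) simp
 also have "... = chat th1 w"
  unfolding chat_eq[OF c]
 proof (rule TP.Tr.finsum_cong'[OF refl])
  fix i assume i: "i \<in> {1..<length w}"
  obtain x ys y where e: "w = x # ys @ [y]" using word_ends gens_length[OF w] by blast
  have cc: "x \<in> carrier A" "y \<in> carrier A" "ys \<in> A_lists" using wl by (simp_all add: e)
  obtain l where l: "i = Suc l" "l <= length ys" using i by (cases i) (auto simp: e)
  let ?X = "take i w @ [\<one>\<^sub>A]" and ?Y = "\<one>\<^sub>A # drop i w"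
  have gr: "p ?X \<in> grade P (int i - 1)" "p ?Y \<in> grade P (int (length w) - 1 - int i)" by (rule p_grade, use i in simp)+
  have Q: "tp (p ?Y) (p ?X) = Q (length w - i) (cyclic_word i w)"
  proof -
   let ?Y' = "\<one>\<^sub>A # drop l ys @ [\<one>\<^sub>A]"
   have X: "?X = x # take l ys @ [\<one>\<^sub>A]" using l by (simp add: e)
   have Xl: "?X \<in> A_lists" "?X ~= []" by (rule one_letter_lists[OF wl]) simp
   have Y': "?Y' \<in> A_lists" "?Y' ~= []" using drop_lists[OF cc(3), of l] by simp_all
   have "?Y = scale_last y ?Y'" using l cc by (simp add: e scale_last_def nth_append list_update_append)
   hence "p ?Y = p ?Y' \<triangleleft>\<^sub>P y" by (simp only: p_scale_last[OF Y' cc(2)])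
   hence "tp (p ?Y) (p ?X) = tp (p ?Y') (p (scale_first y ?X))"
    by (simp only: PQ.tens_bal[OF p_closed cc(2) p_closed] p_scale_first[OF Xl cc(2)])
   also have "scale_first y ?X = (y \<otimes>\<^sub>A x) # take l ys @ [\<one>\<^sub>A]" unfolding X by (simp add: scale_first_def)
   also have "tp (p ?Y') (p ...) = Q (length w - i) (cyclic_word i w)"
   proof -
    have len: "length w - i = Suc (length ys - l)" using l by (simp add: e)
    show ?thesis unfolding Q_def len unfolding e l(1) cyclic_word_split[OF cc l(2)] by simp
   qed
   finally show ?thesis .
  qed
  have "hat phi (Q i (insert_one i w)) = TP.tr (phi (tp (sgn_elt P ((int (length w) - 1 - int i) * (int i - 1)) (p ?Y)) (p ?X)))"
   using i by (subst Q_insert_one) (simp_all add: hat_tens[OF phi_hom gr])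
  also have "... = sgn_elt (Tr A P) ((int (length w) - 1 - int i) * (int i - 1)) (TP.tr (phi (Q (length w - i) (cyclic_word i w))))"
   by (simp only: PQ.tens_sgn_left[OF p_closed p_closed] Q ahom_sgn[OF PPg Pg deg_hom_ahom[OF phi_hom] Q_closed] TP.tr_sgn[OF deg_hom_closed[OF phi_hom Q_closed]])
  also have "(int (length w) - 1 - int i) * (int i - 1) = int ((i - 1) * (length w - 1 - i))"
   using i by (simp add: of_nat_diff)
  also have "phi (Q (length w - i) (cyclic_word i w)) = th1 (length w - i) (cyclic_word i w)"
   unfolding th1_def cutoff_simps(1)[OF valid_cyclic[OF wl i]] ..
  finally show "hat phi (Q i (insert_one i w)) = sgn_elt (Tr A P) (int ((i - 1) * (length w - 1 - i))) (TP.tr (th1 (length w - i) (cyclic_word i w)))" .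
 qed (simp add: c TP.tr_closed)
 finally show ?thesis ..
qed

text \<open>Only mark 1 counts, which is the cut before the last letter. Face 0 of its cyclic word
  is w with the last letter moved to the front, and cyclicity of the trace moves it back.\<close>

lemma chat_th3: assumes w: "w \<in> word_gens A 2" shows "chat th3 w = TP.tr (K1 (wd w))"
proof -
 note wl = gens_lists[OF w]
 note c = mfun_closed[OF mfun_th3]
 obtain x ys y where e: "w = x # ys @ [y]" using word_ends gens_length[OF w] by blast
 have cc: "x \<in> carrier A" "y \<in> carrier A" "ys \<in> A_lists" using wl by (simp_all add: e)
 have lw: "length w = length ys + 2" by (simp add: e)
 let ?j = "Suc (length ys)" and ?v = "x # ys @ [\<one>\<^sub>A]"
 have j: "?j \<in> {1..<length w}" using lw by simp
 let ?t = "%i. sgn_elt (Tr A P) (int ((i - 1) * (length w - 1 - i))) (TP.tr (th3 (length w - i) (cyclic_word i w)))"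
 have "chat th3 w = ?t ?j"
  unfolding chat_eq[OF c]
 proof (rule finsum_one[OF TPg j])
  fix i assume i: "i \<in> {1..<length w}" "i ~= ?j"
  hence "length w - i ~= 1" using lw by auto
  hence "th3 (length w - i) (cyclic_word i w) = \<zero>\<^sub>P" by (simp add: th3_def cutoff_def)
  thus "?t i = \<zero>\<^sub>T" by (simp add: TP.tr_zero)
 qed (simp_all add: c TP.tr_closed)
 also have "... = TP.tr (th3 1 (cyclic_word ?j w))" by (simp add: lw)
 also have "th3 1 (cyclic_word ?j w) = K1 (wz (face 0 (cyclic_word ?j w)))"
  using valid_cyclic[OF wl j] by (simp add: th3_def cutoff_def lw)
 also have "face 0 (cyclic_word ?j w) = scale_first y ?v"
  using cc unfolding e cyclic_word_split[OF cc order_refl] by (simp add: face_def scale_first_def)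
 also have "TP.tr (K1 (wz (scale_first y ?v))) = TP.tr (K1 (wz (scale_last y ?v)))"
 proof -
  have v: "?v \<in> A_lists" "?v ~= []" using cc by simp_all
  show ?thesis
   unfolding wz_scale[OF v cc(2)] deg_hom_smult[OF K1_hom cc(2) wz_closed] deg_hom_ract[OF K1_hom cc(2) wz_closed]
   by (rule TP.tr_cyclic[OF cc(2) K1_closed[OF wz_closed]])
 qed
 also have "scale_last y ?v = w" using cc by (simp add: e scale_last_def nth_append list_update_append)
 also have "wz w = wd w" using w by (simp add: wz_def)
 finally show ?thesis .
qed

end

section \<open>The second half of Connes' operator is null homotopic\<close>

context comparison
begin

definition "insert_second u = hd u # \<one>\<^sub>A # tl u"

lemma split_first_eq: "split_first w = insert_second (face 0 w)"
 by (simp add: split_first_def insert_second_def face_def numeral_2_eq_2)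

lemma insert_second_scale:
 assumes "2 <= length u"
 shows "insert_second (scale_first a u) = scale_first a (insert_second u)"
  "insert_second (scale_last a u) = scale_last a (insert_second u)"
proof -
 obtain x ys y where "u = x # ys @ [y]" using word_ends[OF assms] .
 thus "insert_second (scale_first a u) = scale_first a (insert_second u)"
  "insert_second (scale_last a u) = scale_last a (insert_second u)"
  by (simp_all add: insert_second_def scale_first_def scale_last_def nth_append list_update_append)
qed

lemma length_insert_second: "u ~= [] ==> length (insert_second u) = Suc (length u)"
 by (simp add: insert_second_def)

lemma insert_second_lists: "[|u \<in> A_lists; u ~= []|] ==> insert_second u \<in> A_lists"
 by (cases u) (auto simp: insert_second_def)

text \<open>The homotopy inserts a second unit next to the one already present in the split word.
  Words with two letters are sent to zero because \<open>face 0\<close> would merge their outer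
  letters and right linearity would fail.\<close>

definition "q2 w = (if 3 <= length w then p (insert_second (insert_second (face 0 w))) else \<zero>\<^sub>P)"

lemma q2_closed: "q2 w \<in> carrier P"
 by (simp add: q2_def)

lemma wfun_q2: "wfun (- 1) q2"
 unfolding wfun_def
proof (intro conjI allI ballI impI)
 fix w :: "'a list"
 have fne: "face 0 w ~= []" by (simp add: face_def)
 have len: "length (insert_second (insert_second (face 0 w))) = Suc (length w)" if "3 <= length w"
  using that length_face[of 0 w] fne by (simp add: insert_second_def)
 show "q2 w \<in> grade P (int (length w) + - 1)"
  using p_grade[of "insert_second (insert_second (face 0 w))" "int (length w) - 1"] len by (simp add: q2_def P.grade_zero)
next
 fix w assume w: "w \<in> A_lists"
 have fne: "face 0 w ~= []" by (simp add: face_def)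
 have ins: "insert_second = (%u. hd u # \<one>\<^sub>A # tl u)" by (rule ext) (simp add: insert_second_def)
 show "bml P q2 w"
 proof (cases "3 <= length w")
  case True
  hence s: "Suc 0 < length w" by simp
  note f = face_lists[OF w s]
  note i1 = insert_second_lists[OF f fne]
  have ne1: "insert_second (face 0 w) ~= []" by (simp add: insert_second_def)
  have "bml P p (insert_second (insert_second (face 0 w)))" by (rule kml_bml[OF p_kml[OF insert_second_lists[OF i1 ne1]]])
  from bml_letterwise[where q = p and \<rho> = insert_second, OF i1 letterwise_insert[OF ne1, of "\<one>\<^sub>A", folded ins] this]
  have "bml P (%u. p (insert_second u)) (insert_second (face 0 w))" .
  from bml_letterwise[where q = "%u. p (insert_second u)" and \<rho> = insert_second, OF f letterwise_insert[OF fne, of "\<one>\<^sub>A", folded ins] this]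
  have "bml P (%u. p (insert_second (insert_second u))) (face 0 w)" .
  from bml_letterwise[where q = "%u. p (insert_second (insert_second u))" and \<rho> = "face 0", OF w letterwise_face[OF w s] this]
  have b: "bml P (%w. p (insert_second (insert_second (face 0 w)))) w" .
  show ?thesis by (rule bml_cong[OF b w]) (simp add: q2_def True)
 next
  case False
  have z: "bml P (%w. \<zero>\<^sub>P) w" by (simp add: bml_def ahom_const_zero[OF A.ag Pg])
  show ?thesis by (rule bml_cong[OF z w]) (simp add: q2_def False)
 qed
 fix a assume a: "a \<in> carrier A" and ne: "w ~= []"
 have "q2 (scale_first a w) = a \<odot>\<^sub>P q2 w & q2 (scale_last a w) = q2 w \<triangleleft>\<^sub>P a"
 proof (cases "3 <= length w")
  case True
  hence s: "Suc 0 < length w" by simp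
  note f = face_lists[OF w s]
  have l: "2 <= length (face 0 w)" using length_face[OF s] True by simp
  have l1: "2 <= length (insert_second (face 0 w))" using length_insert_second[OF fne] l by simp
  note i2 = insert_second_lists[OF insert_second_lists[OF f fne]]
  have ne2: "insert_second (face 0 w) ~= []" "insert_second (insert_second (face 0 w)) ~= []" by (simp_all add: insert_second_def)
  show ?thesis
   unfolding q2_def length_scale if_P[OF True] face_scale_first[OF w s a] face_scale_last[OF w s a]
    insert_second_scale[OF l] insert_second_scale[OF l1] p_scale_first[OF i2[OF ne2(1)] ne2(2) a] p_scale_last[OF i2[OF ne2(1)] ne2(2) a]
   by simp
 next
  case False
  thus ?thesis by (simp add: q2_def P.smult_zero[OF a] P.ract_zero[OF a])
 qed
 thus "q2 (scale_first a w) = a \<odot>\<^sub>P q2 w" "q2 (scale_last a w) = q2 w \<triangleleft>\<^sub>P a" by blast+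
qed

text \<open>Faces 0, 1, 2 of (ab, 1, 1, c, ...) all give the split word, with signs +, -, +. The
  later faces match those of w shifted by one index, hence with opposite sign, and faces 0 and 1 of
  w cancel under \<open>q2\<close> by associativity.\<close>

lemma d_q2:
 assumes w: "w \<in> A_lists" and l: "3 <= length w"
 shows "d (q2 w) \<oplus>\<^sub>P frag_lift P q2 (face_sum w) = p (split_first w)"
proof -
 obtain a b c vs where e: "w = a # b # c # vs"
  using l by (metis One_nat_def Suc_le_length_iff numeral_3_eq_3)
 have cc: "a \<in> carrier A" "b \<in> carrier A" "c \<in> carrier A" "vs \<in> A_lists" using w by (simp_all add: e)
 define ab where "ab = a \<otimes>\<^sub>A b"
 have abc: "ab \<in> carrier A" unfolding ab_def using cc by simp
 define E where "E = ab # \<one>\<^sub>A # \<one>\<^sub>A # c # vs"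
 have E: "E \<in> A_lists" using abc cc by (simp add: E_def)
 have q2w: "q2 w = p E" by (simp add: q2_def e face_def insert_second_def E_def ab_def)
 have sp: "split_first w = ab # \<one>\<^sub>A # c # vs" by (simp add: split_first_def e ab_def)
 let ?s = "p (split_first w)"
 let ?F = "%k. sgn_elt P (int k) (p (face k E))"
 let ?G = "%k. sgn_elt P (int k) (q2 (face k w))"
 let ?N = "length vs"
 have Fc: "?F k \<in> carrier P" and Gc: "?G k \<in> carrier P" for k by (simp_all add: q2_closed)
 have "d (q2 w) = finsum P ?F {..<Suc (Suc (Suc ?N))}"
  unfolding q2w d_p[OF E] frag_lift_face_sum[OF Pg p_closed] by (simp add: E_def)
 also have "... = finsum P (%k. ?F (Suc (Suc (Suc k)))) {..<?N} \<oplus>\<^sub>P ?F 2 \<oplus>\<^sub>P ?F 1 \<oplus>\<^sub>P ?F 0"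
  unfolding P.finsum_lessThan_Suc[of ?F, OF Fc] P.finsum_lessThan_Suc[of "%k. ?F (Suc k)", OF Fc]
   P.finsum_lessThan_Suc[of "%k. ?F (Suc (Suc k))", OF Fc] by (simp add: numeral_2_eq_2)
 also have "?F 0 = ?s" using abc by (simp add: E_def face_def sp)
 also have "?F 1 = \<ominus>\<^sub>P ?s" using cc abc by (simp add: E_def face_def sp sgn_elt_def)
 also have "?F 2 = ?s" using cc abc by (simp add: E_def face_def sp sgn_elt_def numeral_2_eq_2)
 finally have 1: "d (q2 w) = finsum P (%k. ?F (Suc (Suc (Suc k)))) {..<?N} \<oplus>\<^sub>P ?s \<oplus>\<^sub>P (\<ominus>\<^sub>P ?s) \<oplus>\<^sub>P ?s" .
 have "frag_lift P q2 (face_sum w) = finsum P ?G {..<Suc (Suc ?N)}"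
  unfolding frag_lift_face_sum[OF Pg q2_closed] by (simp add: e)
 also have "... = finsum P (%k. ?G (Suc (Suc k))) {..<?N} \<oplus>\<^sub>P ?G 1 \<oplus>\<^sub>P ?G 0"
  unfolding P.finsum_lessThan_Suc[of ?G, OF Gc] P.finsum_lessThan_Suc[of "%k. ?G (Suc k)", OF Gc] by simp
 also have "?G 1 = \<ominus>\<^sub>P ?G 0"
  using cc by (cases vs) (simp_all add: e face_def q2_def insert_second_def sgn_elt_def A.m_assoc)
 also have "finsum P (%k. ?G (Suc (Suc k))) {..<?N} = \<ominus>\<^sub>P finsum P (%k. ?F (Suc (Suc (Suc k)))) {..<?N}"
 proof -
  have "finsum P (%k. ?G (Suc (Suc k))) {..<?N} = finsum P (%k. sgn_elt P 1 (?F (Suc (Suc (Suc k))))) {..<?N}"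
  proof (rule P.finsum_cong'[OF refl])
   fix k assume "k \<in> {..<?N}"
   hence k: "k < ?N" by simp
   have "q2 (face (Suc (Suc k)) w) = p (face (Suc (Suc (Suc k))) E)"
    using k by (simp add: e E_def face_def q2_def insert_second_def ab_def)
   thus "?G (Suc (Suc k)) = sgn_elt P 1 (?F (Suc (Suc (Suc k))))" by (simp add: sgn_elt_def)
  qed simp
  also have "... = sgn_elt P 1 (finsum P (%k. ?F (Suc (Suc (Suc k)))) {..<?N})"
   by (rule P.sgn_elt_finsum[symmetric]) simp
  finally show ?thesis by (simp add: sgn_elt_def)
 qed
 finally have 2: "frag_lift P q2 (face_sum w) = \<ominus>\<^sub>P finsum P (%k. ?F (Suc (Suc (Suc k)))) {..<?N} \<oplus>\<^sub>P (\<ominus>\<^sub>P ?G 0) \<oplus>\<^sub>P ?G 0" .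
 define R where "R = finsum P (%k. ?F (Suc (Suc (Suc k)))) {..<?N}"
 have Rc: "R \<in> carrier P" unfolding R_def by (rule P.finsum_closed) simp
 show ?thesis
  unfolding 1 2 R_def[symmetric] using Rc Gc[of 0] by (simp add: P.a_assoc P.l_neg P.r_neg P.r_neg1 P.r_neg2 P.a_comm[of _ "\<ominus>\<^sub>P R"])
qed

text \<open>The two end terms that \<open>fsum_alt\<close> produces for \<open>q2\<close>.\<close>

definition "bd = cutoff (%m w. (if m = 1 then q2 (face 0 w) else \<zero>\<^sub>P) \<ominus>\<^sub>P (if m + 2 = length w then q2 (face m w) else \<zero>\<^sub>P))"

lemma bd_closed: "bd m w \<in> carrier P"
 by (simp add: bd_def cutoff_def q2_closed)

text \<open>The end terms occur only for the cuts i = n + 1 and i = 1. These are consecutive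
  rotations modulo the full turn, so their outer faces have equal traces, and both exchange signs
  are trivial.\<close>

lemma chat_bd: assumes w: "w \<in> word_gens A 2" shows "chat bd w = \<zero>\<^sub>T"
proof -
 note wl = gens_lists[OF w]
 obtain n where n: "length w = n + 2" using gens_length[OF w] le_Suc_ex by (metis add.commute)
 let ?c = "cyclic_letters \<one>\<^sub>A w"
 have cl: "?c \<in> A_lists" by (rule gens_lists[OF cyclic_letters_lists[OF w A.one_closed]])
 have lc: "length ?c = Suc n" by (simp add: cyclic_letters_def n)
 let ?A = "TP.tr (q2 (face 0 (cyclic_word (Suc n) w)))" and ?B = "TP.tr (q2 (face (Suc n) (cyclic_word 1 w)))"
 have ABc: "?A \<in> carrier (Tr A P)" "?B \<in> carrier (Tr A P)" by (simp_all add: TP.tr_closed q2_closed)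
 have AB: "?A = ?B"
 proof -
  have 1: "cyclic_word (Suc n) w = \<one>\<^sub>A # rotate (Suc n) ?c @ [\<one>\<^sub>A]" "cyclic_word 1 w = \<one>\<^sub>A # rotate 1 ?c @ [\<one>\<^sub>A]"
   by (rule cyclic_word_rotate[OF w]; simp add: n)+
  have 2: "rotate (Suc (Suc n)) ?c = rotate 1 ?c"
   using rotate_id[of "Suc n" ?c] lc unfolding rotate_Suc[of "Suc n"] by simp
  show ?thesis
   using tr_rotation_faces[OF cl lc q2_closed wfun_first[OF wfun_q2] wfun_last[OF wfun_q2], of "Suc n"]
   unfolding 1 2 by simp
 qed
 have "chat bd w = (\<Oplus>\<^bsub>Tr A P\<^esub>i\<in>{1..<length w}. (if i = Suc n & True then ?A else \<zero>\<^sub>T) \<oplus>\<^sub>T (if i = 1 & True then \<ominus>\<^sub>T ?B else \<zero>\<^sub>T))"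
  unfolding chat_eq[OF bd_closed]
 proof (rule TP.Tr.finsum_cong'[OF refl])
  fix i assume i: "i \<in> {1..<length w}"
  hence ib: "1 <= i" "i <= Suc n" by (auto simp: n)
  let ?v = "cyclic_word i w" and ?m = "length w - i"
  have "TP.tr (bd ?m ?v) = (if i = Suc n then TP.tr (q2 (face 0 ?v)) else \<zero>\<^sub>T) \<oplus>\<^sub>T (if i = 1 then \<ominus>\<^sub>T TP.tr (q2 (face (Suc n) ?v)) else \<zero>\<^sub>T)"
  proof -
   have "?m = 1 \<longleftrightarrow> i = Suc n" "?m + 2 = length ?v \<longleftrightarrow> i = 1" "i = 1 ==> ?m = Suc n" using ib by (auto simp: n length_cyclic_word)
   hence "bd ?m ?v = (if i = Suc n then q2 (face 0 ?v) else \<zero>\<^sub>P) \<ominus>\<^sub>P (if i = 1 then q2 (face (Suc n) ?v) else \<zero>\<^sub>P)"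
    unfolding bd_def cutoff_simps(1)[OF valid_cyclic[OF wl i]] by auto
   thus ?thesis using TP.tr_zero
    by (simp only: a_minus_def) (auto simp: TP.tr_add TP.tr_minus TP.tr_zero q2_closed TP.tr_closed)
  qed
  moreover have "sgn_elt (Tr A P) (int ((i - 1) * (length w - 1 - i))) z = z" if "i = Suc n \<or> i = 1" for z
   using that by (auto simp: n sgn_elt_def)
  ultimately show "sgn_elt (Tr A P) (int ((i - 1) * (length w - 1 - i))) (TP.tr (bd ?m ?v)) =
   (if i = Suc n & True then ?A else \<zero>\<^sub>T) \<oplus>\<^sub>T (if i = 1 & True then \<ominus>\<^sub>T ?B else \<zero>\<^sub>T)"
   by (cases "i = Suc n"; cases "i = 1") simp_all
 qed (simp add: TP.tr_closed q2_closed)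
 also have "... = (\<Oplus>\<^bsub>Tr A P\<^esub>i\<in>{1..<length w}. (if i = Suc n & True then ?A else \<zero>\<^sub>T)) \<oplus>\<^sub>T (\<Oplus>\<^bsub>Tr A P\<^esub>i\<in>{1..<length w}. (if i = 1 & True then \<ominus>\<^sub>T ?B else \<zero>\<^sub>T))"
  by (rule TP.Tr.finsum_addf) (simp_all add: TP.tr_closed q2_closed)
 also have "... = ?A \<oplus>\<^sub>T (\<ominus>\<^sub>T ?B)"
 proof -
  have m: "Suc n \<in> {1..<length w}" "1 \<in> {1..<length w}" using n by auto
  have fi: "finite {1..<length w}" by simp
  show ?thesis
   unfolding finsum_delta_if[OF TPg fi ABc(1)] finsum_delta_if[OF TPg fi TP.Tr.a_inv_closed[OF ABc(2)]] using m by simp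
 qed
 also have "... = \<zero>\<^sub>T" unfolding AB using ABc(2) by (rule TP.Tr.r_neg)
 finally show ?thesis .
qed

text \<open>The sign in \<open>alt\<close> reverses the face sum, so \<open>d_q2\<close> becomes a
  homotopy relation for the marked boundary up to the end terms.\<close>

lemma d_alt_q2:
 assumes v: "valid m w"
 shows "d (alt q2 m w) \<oplus>\<^sub>P bd m w = alt (%w. p (split_first w)) m w \<oplus>\<^sub>P msum (alt q2) m w"
proof -
 note w = validD(1)[OF v]
 have l: "3 <= length w" using validD(2,3)[OF v] by simp
 let ?x = "d (q2 w)" and ?y = "frag_lift P q2 (face_sum w)"
 let ?b = "bd m w" and ?s = "%z. sgn_elt P (int (Suc m)) z"
 have c: "?x \<in> carrier P" "?y \<in> carrier P" "?b \<in> carrier P" by (simp_all add: q2_closed P.frag_lift_closed bd_closed)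
 have "msum (alt q2) m w = \<ominus>\<^sub>P ?s ?y \<oplus>\<^sub>P ?b"
  unfolding msum_fsum[OF w mfun_alt[OF wfun_q2]] fsum_alt[OF wfun_q2 v] bd_def cutoff_simps(1)[OF v] ..
 moreover have "alt (%w. p (split_first w)) m w = ?s ?x \<oplus>\<^sub>P ?s ?y"
  unfolding alt_def cutoff_simps(1)[OF v] d_q2[OF w l, symmetric] by (rule P.sgn_elt_add[OF c(1,2)])
 moreover have "d (alt q2 m w) = ?s ?x" by (rule d_alt[OF wfun_q2 v])
 ultimately show ?thesis using c by (simp add: P.a_assoc P.r_neg2)
qed

end

section \<open>Assembling the homotopy and comparing the maps on homology\<close>

context abelian_group
begin

lemma image_subgroup:
 assumes "f \<in> ahom G H" "abelian_group H" "asubgroup S G" shows "asubgroup (f ` S) H"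
proof -
 interpret H: abelian_group H by fact
 note c = asubgroup_carrier[OF assms(3)]
 show ?thesis
 proof (rule H.add_subgroupI)
  show "f ` S <= carrier H" using c ahom_closed[OF assms(1)] by blast
  show "\<zero>\<^bsub>H\<^esub> \<in> f ` S"
   using subgroup_zero[OF assms(3)] ahom_zero[OF ag assms(2,1)] by (metis image_eqI)
  show "x \<oplus>\<^bsub>H\<^esub> y \<in> f ` S" if xy: "x \<in> f ` S" "y \<in> f ` S" for x y
  proof -
   obtain a b where ab: "a \<in> S" "b \<in> S" and e: "x = f a" "y = f b" using xy by blast
   show ?thesis
    unfolding e ahom_add[OF assms(1) c[OF ab(1)] c[OF ab(2)], symmetric]
    by (rule imageI[OF subgroup_plus[OF assms(3) ab]])
  qed
  show "\<ominus>\<^bsub>H\<^esub> x \<in> f ` S" if x: "x \<in> f ` S" for x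
  proof -
   obtain a where a: "a \<in> S" and e: "x = f a" using x by blast
   show ?thesis
    unfolding e ahom_neg[OF ag assms(2,1) c[OF a], symmetric]
    by (rule imageI[OF subgroup_minus[OF assms(3) a]])
  qed
 qed
qed

lemma coset_absorb:
 assumes B: "asubgroup B G" and b: "b \<in> B" and u: "u \<in> carrier G"
 shows "B +> (b \<oplus> u) = B +> u"
proof -
 note c = asubgroup_carrier[OF B]
 have "(\<exists>h\<in>B. x = h \<oplus> (b \<oplus> u)) \<longleftrightarrow> (\<exists>h\<in>B. x = h \<oplus> u)" for x
 proof
  assume "\<exists>h\<in>B. x = h \<oplus> (b \<oplus> u)"
  then obtain h where h: "h \<in> B" "x = h \<oplus> (b \<oplus> u)" by blast
  hence "x = (h \<oplus> b) \<oplus> u" using c b u by (simp add: a_assoc)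
  thus "\<exists>h\<in>B. x = h \<oplus> u" using subgroup_plus[OF B h(1) b] by blast
 next
  assume "\<exists>h\<in>B. x = h \<oplus> u"
  then obtain h where h: "h \<in> B" "x = h \<oplus> u" by blast
  hence "x = (h \<oplus> \<ominus> b) \<oplus> (b \<oplus> u)" using c[OF b] c[OF h(1)] u by (simp add: a_assoc r_neg1)
  thus "\<exists>h\<in>B. x = h \<oplus> (b \<oplus> u)" using subgroup_plus[OF B h(1) subgroup_minus[OF B b]] by blast
 qed
 thus ?thesis unfolding a_r_coset_def r_coset_def by (auto simp: set_eq_iff)
qed

lemma coset_representative:
 assumes B: "asubgroup B G"
 obtains b where "b \<in> B" "(SOME z. z \<in> B +> u) = b \<oplus> u"
proof -
 have "\<zero> \<oplus> u \<in> B +> u" using subgroup_zero[OF B] unfolding a_r_coset_def r_coset_def by auto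
 hence "(SOME z. z \<in> B +> u) \<in> B +> u" by (rule someI)
 thus ?thesis using that unfolding a_r_coset_def r_coset_def by auto
qed

lemma cancel_common:
 assumes "t \<in> carrier G" "x \<in> carrier G" "c \<in> carrier G" "n \<in> carrier G"
 shows "t \<oplus> ((c \<oplus> x) \<ominus> ((t \<oplus> x) \<oplus> n)) = c \<ominus> n"
proof -
 have "t \<oplus> ((c \<oplus> x) \<ominus> ((t \<oplus> x) \<oplus> n)) = (t \<oplus> \<ominus> t) \<oplus> ((x \<oplus> \<ominus> x) \<oplus> (c \<oplus> \<ominus> n))"
  using assms by (simp only: a_minus_def minus_add a_ac a_closed a_inv_closed)
 thus ?thesis using assms by (simp add: r_neg a_minus_def)
qed

end

context comparison
begin

lemma Tpsi_signed_sum: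
 assumes r: "!!i. i \<in> I ==> \<rho> i \<in> word_gens A 2"
 shows "Tpsi (\<Oplus>\<^bsub>Tr A Br\<^esub>i\<in>I. sgn_elt (Tr A Br) (k i) (tb (wd (\<rho> i)))) = (\<Oplus>\<^bsub>Tr A P\<^esub>i\<in>I. sgn_elt (Tr A P) (k i) (TP.tr (p (\<rho> i))))"
proof -
 have c: "tb (wd (\<rho> i)) \<in> carrier (Tr A Br)" if "i \<in> I" for i by (rule TB.tr_closed[OF wd_closed[OF r[OF that]]])
 have "Tpsi (\<Oplus>\<^bsub>Tr A Br\<^esub>i\<in>I. sgn_elt (Tr A Br) (k i) (tb (wd (\<rho> i)))) = (\<Oplus>\<^bsub>Tr A P\<^esub>i\<in>I. Tpsi (sgn_elt (Tr A Br) (k i) (tb (wd (\<rho> i)))))"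
  by (rule ahom_finsum[OF TB.ag_Tr TPg Tpsi_ahom]) (rule Pi_I, rule TB.Tr.sgn_elt_closed[OF c])
 also have "... = (\<Oplus>\<^bsub>Tr A P\<^esub>i\<in>I. sgn_elt (Tr A P) (k i) (TP.tr (p (\<rho> i))))"
 proof (rule TP.Tr.finsum_cong'[OF refl])
  fix i assume i: "i \<in> I"
  have "Tpsi (tb (wd (\<rho> i))) = TP.tr (p (\<rho> i))" using r[OF i] by (simp add: Tpsi_tb wd_closed p_def wz_def)
  thus "Tpsi (sgn_elt (Tr A Br) (k i) (tb (wd (\<rho> i)))) = sgn_elt (Tr A P) (k i) (TP.tr (p (\<rho> i)))"
   by (simp only: ahom_sgn[OF TB.ag_Tr TPg Tpsi_ahom c[OF i]])
 qed (simp add: TP.tr_closed)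
 finally show ?thesis .
qed

lemma Tpsi_connes_bar:
 assumes w: "w \<in> word_gens A 2"
 shows "Tpsi (connes_bar K A (tb (wd w))) = chat (alt p) w \<oplus>\<^sub>T chat (alt (%w. p (split_first w))) w"
proof -
 note wl = gens_lists[OF w]
 have r: "cyclic_word i w \<in> word_gens A 2" "split_first (cyclic_word i w) \<in> word_gens A 2" if i: "i \<in> {1..<length w}" for i
 proof -
  have l: "cyclic_word i w \<in> A_lists" using i by (intro cyclic_word_lists[OF wl]) auto
  have wne: "w ~= []" using i by (cases w) simp_all
  hence s: "Suc 0 < length (cyclic_word i w)" by (simp add: length_cyclic_word)
  have ne: "face 0 (cyclic_word i w) ~= []" by (simp add: face_def)
  show "cyclic_word i w \<in> word_gens A 2" using l wne unfolding word_gens_iff by (simp add: length_cyclic_word Suc_le_eq del: in_lists_conv_set)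
  show "split_first (cyclic_word i w) \<in> word_gens A 2"
   unfolding split_first_eq word_gens_iff using insert_second_lists[OF face_lists[OF l s] ne] length_insert_second[OF ne] ne
   by (cases "face 0 (cyclic_word i w)") simp_all
 qed
 have c: "(\<Oplus>\<^bsub>Tr A Br\<^esub>i\<in>{1..<length w}. sgn_elt (Tr A Br) (k i) (tb (wd (\<rho> i)))) \<in> carrier (Tr A Br)"
  if "!!i. i \<in> {1..<length w} ==> \<rho> i \<in> word_gens A 2" for k \<rho>
  by (rule TB.Tr.finsum_closed) (rule Pi_I, rule TB.Tr.sgn_elt_closed[OF TB.tr_closed[OF wd_closed[OF that]]])
 let ?x = "\<Oplus>\<^bsub>Tr A Br\<^esub>i\<in>{1..<length w}. sgn_elt (Tr A Br) (int (i * (length w - 2))) (tb (wd (cyclic_word i w)))"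
 let ?y = "\<Oplus>\<^bsub>Tr A Br\<^esub>i\<in>{1..<length w}. sgn_elt (Tr A Br) (int (i * (length w - 2))) (tb (wd (split_first (cyclic_word i w))))"
 have xy: "?x \<in> carrier (Tr A Br)" "?y \<in> carrier (Tr A Br)" by (rule c, erule r)+
 have "Tpsi ?x = chat (alt p) w" "Tpsi ?y = chat (alt (%w. p (split_first w))) w"
  unfolding chat_alt[OF p_closed wl] by (rule Tpsi_signed_sum, erule r)+
 thus ?thesis unfolding connes_bar_tr[OF w] ahom_add[OF Tpsi_ahom xy] by (simp only:)
qed

text \<open>\<open>Eh\<close> accounts for replacing Delta' by gamma, \<open>null theta\<close> for
  the first half of Connes' operator and \<open>alt q2\<close> for its second half.\<close>

definition "Hh z = Eh z \<ominus>\<^sub>T (ch (null theta) z \<oplus>\<^sub>T ch (alt q2) z)"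

lemma mfun_nt: "mfun (- 1) (null theta)"
 by (rule mfun_null[OF mfun_theta]) (rule theta_closed)

lemma d_null_theta: "valid m w ==> d (null theta m w) = theta m w \<oplus>\<^sub>P fsum (null theta) m w"
 by (rule d_null[OF mfun_theta]) (rule theta_closed)

lemmas mfun_aq = mfun_alt[OF wfun_q2]
lemmas TBg = TB.ag_Tr

lemma Hh_ahom: "Hh \<in> ahom (Tr A Br) (Tr A P)"
 unfolding Hh_def[abs_def] a_minus_def
 by (intro ahom_plus[OF TBg TPg] ahom_uminus[OF TBg TPg] Eh_ahom ch_ahom[OF mfun_nt] ch_ahom[OF mfun_aq])

text \<open>The traces of \<open>phi gam\<close> and \<open>K1\<close> occur both in
  \<open>connes_Tpsi\<close> and in the boundary of \<open>chat (null theta)\<close>; subtracting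
  the two relations removes them and leaves the two halves of Connes' operator.\<close>

lemma connes_homotopy_word:
 assumes w: "w \<in> word_gens A 2"
 shows "connes (Tpsi (tb (wd w))) \<oplus>\<^sub>T Hh (tb (diff Br (wd w)))
  = Tpsi (connes_bar K A (tb (wd w))) \<oplus>\<^sub>T dT (Hh (tb (wd w)))"
proof -
 note wl = gens_lists[OF w]
 note wc = wd_closed[OF w]
 note dc = diff_Br_closed[OF wc]
 define C where "C = connes (Tpsi (tb (wd w)))"
 define X where "X = hat phi (gam (wd w))"
 define k where "k = TP.tr (K1 (wd w))"
 define e where "e = dT (Eh (tb (wd w)))"
 define b where "b = Eh (tb (diff Br (wd w)))"
 define Nd where "Nd = chB (null theta) (diff Br (wd w))"
 define ad where "ad = chB (alt q2) (diff Br (wd w))"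
 define T1 where "T1 = chat (alt p) w"
 define T2 where "T2 = chat (alt (%w. p (split_first w))) w"
 note mc = mfun_closed[OF mfun_nt] mfun_closed[OF mfun_aq] mfun_closed[OF mfun_theta]
 have sc: "alt (%w. p (split_first w)) m v \<in> carrier P" for m v by (simp add: alt_def cutoff_def)
 note pc = mfun_closed[OF mfun_alt[OF wfun_p]] mfun_closed[OF mfun_th1] mfun_closed[OF mfun_th3]
 note tc = TB.tr_closed[OF wc] TB.tr_closed[OF dc]
 have cl: "C \<in> carrier (Tr A P)" "X \<in> carrier (Tr A P)" "k \<in> carrier (Tr A P)" "e \<in> carrier (Tr A P)" "b \<in> carrier (Tr A P)"
  "Nd \<in> carrier (Tr A P)" "ad \<in> carrier (Tr A P)" "T1 \<in> carrier (Tr A P)" "T2 \<in> carrier (Tr A P)"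
  unfolding C_def X_def k_def e_def b_def Nd_def ad_def T1_def T2_def
  by (rule connes_closed[OF ahom_closed[OF Tpsi_ahom tc(1)]] ahom_closed[OF hat_ahom[OF phi_hom] gam_closed[OF wc]]
   TP.tr_closed[OF K1_closed[OF wc]] ahom_closed[OF dT_ahom ahom_closed[OF Eh_ahom tc(1)]] ahom_closed[OF Eh_ahom tc(2)]
   ahom_closed[OF chB_ahom[OF mfun_nt] dc] ahom_closed[OF chB_ahom[OF mfun_aq] dc] chat_closed[OF pc(1)] chat_closed[OF sc])+
 have a: "C \<oplus>\<^sub>T (X \<oplus>\<^sub>T k) = e \<ominus>\<^sub>T b"
  unfolding C_def X_def k_def e_def b_def by (rule connes_Tpsi[OF wc])
 have N: "dT (chat (null theta) w) = (X \<oplus>\<^sub>T (T1 \<oplus>\<^sub>T k)) \<oplus>\<^sub>T Nd"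
 proof -
  have c3: "alt p m v \<oplus>\<^sub>P th3 m v \<in> carrier P" for m v using pc by simp
  have ms: "msum (null theta) m v \<in> carrier P" for m v by (rule mfun_closed[OF mfun_msum[OF mfun_nt]])
  have dn: "d (null theta m v) \<in> carrier P" for m v using mc by simp
  have sm: "theta m v \<oplus>\<^sub>P msum (null theta) m v \<in> carrier P" for m v using mc ms by simp
  have "dT (chat (null theta) w) = chat (%m v. d (null theta m v)) w" by (rule chat_d[OF mc(1), symmetric])
  also have "... = chat (%m v. theta m v \<oplus>\<^sub>P msum (null theta) m v) w"
   by (rule chat_cong[OF wl dn sm]) (simp only: d_null_theta msum_fsum[OF validD(1) mfun_nt])
  also have "... = chat theta w \<oplus>\<^sub>T Nd"
   unfolding chat_plus[OF mc(3) ms] Nd_def chB_msum[OF mfun_nt w] ..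
  also have "chat theta w = X \<oplus>\<^sub>T (T1 \<oplus>\<^sub>T k)"
   unfolding theta_def[abs_def] chat_plus[OF pc(2) c3] chat_plus[OF pc(1,3)] chat_th1[OF w] chat_th3[OF w] X_def T1_def k_def ..
  finally show ?thesis .
 qed
 have al: "dT (chat (alt q2) w) = T2 \<oplus>\<^sub>T ad"
 proof -
  have ms: "msum (alt q2) m v \<in> carrier P" for m v by (rule mfun_closed[OF mfun_msum[OF mfun_aq]])
  have dn: "d (alt q2 m v) \<in> carrier P" for m v using mc by simp
  have s1: "d (alt q2 m v) \<oplus>\<^sub>P bd m v \<in> carrier P" for m v using dn bd_closed by simp
  have s2: "alt (%w. p (split_first w)) m v \<oplus>\<^sub>P msum (alt q2) m v \<in> carrier P" for m v using sc ms by simp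
  have "dT (chat (alt q2) w) \<oplus>\<^sub>T chat bd w = chat (%m v. d (alt q2 m v) \<oplus>\<^sub>P bd m v) w"
   unfolding chat_plus[OF dn bd_closed] chat_d[OF mc(2)] ..
  also have "... = chat (%m v. alt (%w. p (split_first w)) m v \<oplus>\<^sub>P msum (alt q2) m v) w"
   by (rule chat_cong[OF wl s1 s2]) (rule d_alt_q2)
  also have "... = T2 \<oplus>\<^sub>T ad"
   unfolding chat_plus[OF sc ms] ad_def T2_def chB_msum[OF mfun_aq w] ..
  finally show ?thesis unfolding chat_bd[OF w] using ahom_closed[OF dT_ahom chat_closed[OF mc(2)]] by simp
 qed
 have H1: "Hh (tb (diff Br (wd w))) = b \<ominus>\<^sub>T (Nd \<oplus>\<^sub>T ad)"
  unfolding Hh_def ch_tb[OF mfun_nt dc] ch_tb[OF mfun_aq dc] b_def Nd_def ad_def ..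
 have H2: "dT (Hh (tb (wd w))) = e \<ominus>\<^sub>T (dT (chat (null theta) w) \<oplus>\<^sub>T dT (chat (alt q2) w))"
  unfolding Hh_def ch_tb[OF mfun_nt wc] ch_tb[OF mfun_aq wc] chB_wd[OF mfun_nt w] chB_wd[OF mfun_aq w] e_def
  using ahom_closed[OF Eh_ahom tc(1)] chat_closed[OF mc(1)] chat_closed[OF mc(2)]
  by (simp only: ahom_minus[OF TPg TPg dT_ahom] ahom_add[OF dT_ahom] TP.Tr.a_closed)
 have eq: "e = (C \<oplus>\<^sub>T b) \<oplus>\<^sub>T (X \<oplus>\<^sub>T k)"
 proof -
  have "e = (e \<ominus>\<^sub>T b) \<oplus>\<^sub>T b" using cl by (simp add: a_minus_def TP.Tr.a_assoc TP.Tr.l_neg)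
  thus ?thesis unfolding a[symmetric] using cl by (simp add: TP.Tr.a_ac)
 qed
 have s: "dT (chat (null theta) w) \<oplus>\<^sub>T dT (chat (alt q2) w) = ((T1 \<oplus>\<^sub>T T2) \<oplus>\<^sub>T (X \<oplus>\<^sub>T k)) \<oplus>\<^sub>T (Nd \<oplus>\<^sub>T ad)"
  unfolding N al using cl by (simp add: TP.Tr.a_ac)
 have "(T1 \<oplus>\<^sub>T T2) \<oplus>\<^sub>T dT (Hh (tb (wd w))) = (C \<oplus>\<^sub>T b) \<ominus>\<^sub>T (Nd \<oplus>\<^sub>T ad)"
  unfolding H2 s unfolding eq by (rule TP.Tr.cancel_common) (use cl in simp_all)
 also have "... = C \<oplus>\<^sub>T Hh (tb (diff Br (wd w)))" unfolding H1 using cl by (simp add: a_minus_def TP.Tr.a_assoc)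
 finally show ?thesis unfolding Tpsi_connes_bar[OF w] C_def[symmetric] T1_def[symmetric] T2_def[symmetric] ..
qed

lemma tb_ahom: "(%u. tb u) \<in> ahom Br (Tr A Br)"
 by (rule TB.tr_ahom[OF A.one_closed])

lemma connes_homotopy:
 assumes u: "u \<in> carrier Br"
 shows "connes (Tpsi (tb u)) \<oplus>\<^sub>T Hh (tb (diff Br u)) = Tpsi (connes_bar K A (tb u)) \<oplus>\<^sub>T dT (Hh (tb u))"
proof -
 have "(%u. connes (Tpsi (tb u))) \<in> ahom Br (Tr A P)" by (rule ahom_comp[OF ahom_comp[OF tb_ahom Tpsi_ahom] connes_ahom])
 moreover have "(%u. Hh (tb (diff Br u))) \<in> ahom Br (Tr A P)" by (rule ahom_comp[OF ahom_comp[OF bimod_hom_ahom[OF diff_Bar_hom] tb_ahom] Hh_ahom])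
 moreover have "(%u. Tpsi (connes_bar K A (tb u))) \<in> ahom Br (Tr A P)" by (rule ahom_comp[OF ahom_comp[OF tb_ahom connes_bar_ahom] Tpsi_ahom])
 moreover have "(%u. dT (Hh (tb u))) \<in> ahom Br (Tr A P)" by (rule ahom_comp[OF ahom_comp[OF tb_ahom Hh_ahom] dT_ahom])
 ultimately show ?thesis
  by (intro Bar_hom_eq[where f = "%u. connes (Tpsi (tb u)) \<oplus>\<^sub>T Hh (tb (diff Br u))"
     and g = "%u. Tpsi (connes_bar K A (tb u)) \<oplus>\<^sub>T dT (Hh (tb u))", OF _ _ TPg connes_homotopy_word u]
    ahom_plus[OF Brg TPg])
qed

lemma chB_grade:
 assumes g: "mfun (- 1) g" and u: "u \<in> grade Br n" shows "chB g u \<in> Tr_grade A P (n + 2)"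
proof (rule grade_Bar_image[OF chB_ahom[OF g] TPg trace_grade_asubgroup _ u])
 fix w assume w: "w \<in> word_gens A 2" "int (length w) = n + 2"
 have "TP.tr (g m (cyclic_word i w)) \<in> Tr_grade A P (n + 2)" for m i
  unfolding trace_grade using mfun_grade[OF g, of m "cyclic_word i w"] w(2)
  by (intro imageI) (simp add: length_cyclic_word add.commute)
 thus "chB g (wd w) \<in> Tr_grade A P (n + 2)"
  unfolding chB_wd[OF g w(1)] chat_eq[OF mfun_closed[OF g]]
  by (intro TP.Tr.subgroup_finsum[OF trace_grade_asubgroup] TP.Tr.subgroup_sgn[OF trace_grade_asubgroup])
qed

lemma Hh_grade:
 assumes u: "u \<in> grade Br n" shows "Hh (tb u) \<in> Tr_grade A P (n + 2)"
proof -
 have uc: "u \<in> carrier Br" by (rule Br.asubgroup_carrier[OF grade_Bar_asubgroup u])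
 have "Eh (tb u) \<in> Tr_grade A P (n + 2)"
  unfolding Eh_tb[OF uc] using hat_grade[OF phi_hom deg_hom_grade[OF h1_hom u refl]] by (simp add: add.assoc)
 thus ?thesis
  unfolding Hh_def ch_tb[OF mfun_nt uc] ch_tb[OF mfun_aq uc] a_minus_def
  by (intro TP.Tr.subgroup_plus[OF trace_grade_asubgroup] TP.Tr.subgroup_minus[OF trace_grade_asubgroup] chB_grade[OF mfun_nt u] chB_grade[OF mfun_aq u])
qed

lemma Tr_diff_Bar_tb: "u \<in> carrier Br ==> Tr_diff A Br (tb u) = tb (diff Br u)"
 unfolding Tr_diff_def by (rule Tr_map_tr[OF TB.trace_group_axioms TB.trace_group_axioms diff_Bar_hom])

abbreviation "BdP == boundaries (Tr_grade A P) dT"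
abbreviation "BdB == boundaries (Tr_grade A Br) (Tr_diff A Br)"

lemma BdP_asubgroup: "asubgroup (BdP n) (Tr A P)"
 unfolding boundaries_def by (rule TP.Tr.image_subgroup[OF dT_ahom TPg trace_grade_asubgroup])

lemma grade_Br_closed: "u \<in> grade Br n ==> u \<in> carrier Br"
 by (rule Br.asubgroup_carrier[OF grade_Bar_asubgroup])

lemma Tr_grade_Bar_asubgroup: "asubgroup (Tr_grade A Br n) (Tr A Br)"
 unfolding Tr_grade_Bar by (rule TB.tr_image_subgroup[OF grade_Bar_asubgroup])

lemma Tr_diff_Bar_ahom: "Tr_diff A Br \<in> ahom (Tr A Br) (Tr A Br)"
 unfolding Tr_diff_def by (rule Tr_map_hom[OF TB.trace_group_axioms TB.trace_group_axioms diff_Bar_hom])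

lemma BdB_asubgroup: "asubgroup (BdB n) (Tr A Br)"
 unfolding boundaries_def by (rule TB.Tr.image_subgroup[OF Tr_diff_Bar_ahom TBg Tr_grade_Bar_asubgroup])

lemma Tpsi_boundary: assumes "z \<in> BdB n" shows "Tpsi z \<in> BdP n"
proof -
 obtain u where u: "u \<in> grade Br (n + 1)" "z = tb (diff Br u)"
  using assms unfolding boundaries_def Tr_grade_Bar by (auto simp: Tr_diff_Bar_tb grade_Br_closed)
 note uc = grade_Br_closed[OF u(1)]
 have "Tpsi z = dT (TP.tr (\<psi> u))"
  unfolding u(2) by (simp add: Tpsi_tb diff_Br_closed uc psi_d dT_tr psi_closed)
 moreover have "\<psi> u \<in> grade P (n + 1)" by (rule deg_hom_grade[OF psi_hom u(1)]) simp
 ultimately show ?thesis unfolding boundaries_def trace_grade by blast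
qed

lemma connes_boundary: "z \<in> BdP n ==> connes z \<in> BdP (n + 1)"
 using connes_induces unfolding induces_on_homology_def boundaries_shift dT_def[symmetric] by blast

text \<open>The chosen representative differs from a homogeneous cycle by a boundary and is thus
  again the trace of a homogeneous element. The element itself need not be a cycle; only the trace
  of its boundary vanishes.\<close>

lemma homology_class:
 assumes "X \<in> carrier (HH K A n)"
 obtains u where "u \<in> grade Br n" "tb (diff Br u) = \<zero>\<^bsub>Tr A Br\<^esub>" "(SOME z. z \<in> X) = tb u"
proof -
 let ?cyc = "cycles (Tr A Br) (Tr_grade A Br) (Tr_diff A Br) n"
 obtain z0 where z0: "z0 \<in> ?cyc" "X = (\<Union>b\<in>BdB n. {b \<oplus>\<^bsub>Tr A Br\<^esub> z0})"
  using assms unfolding HH_def Tr_homology_def homology_def FactGroup_def RCOSETS_def r_coset_def by auto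
 have "\<zero>\<^bsub>Tr A Br\<^esub> \<in> BdB n" by (rule TB.Tr.subgroup_zero[OF BdB_asubgroup])
 hence "X ~= {}" unfolding z0(2) by blast
 hence "(SOME z. z \<in> X) \<in> X" by (rule some_in_eq[THEN iffD2])
 then obtain b where b: "b \<in> BdB n" "(SOME z. z \<in> X) = b \<oplus>\<^bsub>Tr A Br\<^esub> z0" unfolding z0(2) by blast
 obtain v where v: "v \<in> grade Br (n + 1)" "b = tb (diff Br v)"
  using b(1) unfolding boundaries_def Tr_grade_Bar by (auto simp: Tr_diff_Bar_tb grade_Br_closed)
 obtain u0 where u0: "u0 \<in> grade Br n" "z0 = tb u0" "Tr_diff A Br (tb u0) = \<zero>\<^bsub>Tr A Br\<^esub>"
  using z0(1) unfolding cycles_def Tr_grade_Bar by auto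
 note c = grade_Br_closed[OF v(1)] grade_Br_closed[OF u0(1)]
 let ?u = "diff Br v \<oplus>\<^bsub>Br\<^esub> u0"
 have "?u \<in> grade Br n"
  using diff_Bar_grade[OF v(1)] u0(1) by (intro Br.subgroup_plus[OF grade_Bar_asubgroup]) simp_all
 moreover have "tb (diff Br ?u) = \<zero>\<^bsub>Tr A Br\<^esub>"
  using c u0(3) by (simp add: ahom_add[OF bimod_hom_ahom[OF diff_Bar_hom]] diff_Br_closed diff_diff_Bar Tr_diff_Bar_tb)
 moreover have "(SOME z. z \<in> X) = tb ?u"
  unfolding b(2) v(2) u0(2) using c by (simp add: TB.tr_add diff_Br_closed)
 ultimately show ?thesis by (rule that)
qed

theorem connes_homology:
 assumes X: "X \<in> carrier (HH K A n)"
 shows "Tr_homology_map A (shift 1 P) n connes (Tr_homology_map A P n Tpsi X) = Tr_homology_map A P (n + 1) Tpsi (connes_HH K A n X)"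
proof -
 obtain u where u: "u \<in> grade Br n" "tb (diff Br u) = \<zero>\<^bsub>Tr A Br\<^esub>" "(SOME z. z \<in> X) = tb u"
  using homology_class[OF X] .
 note uc = grade_Br_closed[OF u(1)]
 note tc = TB.tr_closed[OF uc]
 have Tu: "Tpsi (tb u) \<in> carrier (Tr A P)" by (rule ahom_closed[OF Tpsi_ahom tc])
 have Bu: "connes_bar K A (tb u) \<in> carrier (Tr A Br)" by (rule ahom_closed[OF connes_bar_ahom tc])
 \<comment> \<open>Each side applies two induced maps in succession, and the second one starts from
   a new choice of representative. The choices change the result by the boundaries b1 and b2, which
   the final coset absorbs.\<close>
 obtain b1 where b1: "b1 \<in> BdP n" "(SOME z. z \<in> BdP n +>\<^bsub>Tr A P\<^esub> Tpsi (tb u)) = b1 \<oplus>\<^sub>T Tpsi (tb u)"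
  using TP.Tr.coset_representative[OF BdP_asubgroup] .
 obtain b2 where b2: "b2 \<in> BdB (n + 1)" "(SOME z. z \<in> BdB (n + 1) +>\<^bsub>Tr A Br\<^esub> connes_bar K A (tb u)) = b2 \<oplus>\<^bsub>Tr A Br\<^esub> connes_bar K A (tb u)"
  using TB.Tr.coset_representative[OF BdB_asubgroup] .
 note b1c = TP.Tr.asubgroup_carrier[OF BdP_asubgroup b1(1)] and b2c = TB.Tr.asubgroup_carrier[OF BdB_asubgroup b2(1)]
 have "Tr_homology_map A (shift 1 P) n connes (Tr_homology_map A P n Tpsi X)
   = BdP (n + 1) +>\<^bsub>Tr A P\<^esub> (connes b1 \<oplus>\<^sub>T connes (Tpsi (tb u)))"
  unfolding Tr_homology_map_def homology_map_def boundaries_shift Tr_shift(1) dT_def[symmetric] u(3) b1(2) ahom_add[OF connes_ahom b1c Tu] ..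
 also have "... = BdP (n + 1) +>\<^bsub>Tr A P\<^esub> connes (Tpsi (tb u))"
  by (rule TP.Tr.coset_absorb[OF BdP_asubgroup connes_boundary[OF b1(1)] connes_closed[OF Tu]])
 \<comment> \<open>On a cycle the homotopy term at the boundary drops out, leaving equality up to a
   boundary.\<close>
 also have "connes (Tpsi (tb u)) = dT (Hh (tb u)) \<oplus>\<^sub>T Tpsi (connes_bar K A (tb u))"
  using connes_homotopy[OF uc] connes_closed[OF Tu] ahom_closed[OF Tpsi_ahom Bu] ahom_closed[OF dT_ahom ahom_closed[OF Hh_ahom tc]]
  unfolding u(2) ahom_zero[OF TBg TPg Hh_ahom] by (simp add: TP.Tr.a_comm)
 also have "BdP (n + 1) +>\<^bsub>Tr A P\<^esub> (dT (Hh (tb u)) \<oplus>\<^sub>T Tpsi (connes_bar K A (tb u))) = BdP (n + 1) +>\<^bsub>Tr A P\<^esub> Tpsi (connes_bar K A (tb u))"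
 proof (rule TP.Tr.coset_absorb[OF BdP_asubgroup _ ahom_closed[OF Tpsi_ahom Bu]])
  show "dT (Hh (tb u)) \<in> BdP (n + 1)" unfolding boundaries_def using Hh_grade[OF u(1)] by (simp add: add.assoc)
 qed
 also have "... = BdP (n + 1) +>\<^bsub>Tr A P\<^esub> (Tpsi b2 \<oplus>\<^sub>T Tpsi (connes_bar K A (tb u)))"
  by (rule TP.Tr.coset_absorb[OF BdP_asubgroup Tpsi_boundary[OF b2(1)] ahom_closed[OF Tpsi_ahom Bu], symmetric])
 also have "... = Tr_homology_map A P (n + 1) Tpsi (connes_HH K A n X)"
  unfolding connes_HH_def Tr_homology_map_def homology_map_def dT_def[symmetric] u(3) b2(2) ahom_add[OF Tpsi_ahom b2c Bu] ..
 finally show ?thesis .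
qed

end

text \<open>The induced map is evaluated at a chosen representative, so the first conjunct is what
  gives it meaning. In the second, the identification with Hochschild homology runs through every
  comparison map instead of a fixed one, which also covers independence of that choice.\<close>

theorem corollary15:
  fixes K :: "'k ring" and A :: "('k, 'a) module" and P :: "('a, 'p) bimodule_complex"
    and \<mu> :: "'p \<Rightarrow> 'a" and t :: "'p \<Rightarrow> 'p" and \<eta> :: "'a \<Rightarrow> 'p"
    and \<iota> :: "'p \<Rightarrow> ('a \<times> 'p \<Rightarrow>\<^sub>0 int) set"
  assumes "assoc_algebra K A"
    and "projective_resolution K A P \<mu>"
    and "left_contracting_homotopy A P \<mu> t \<eta>"
    and "\<iota> \<in> bimod_hom A P (tensorK K A (regular A) P)"
    and "\<forall>n. \<iota> ` grade P n \<subseteq> grade (tensorK K A (regular A) P) n"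
    and "\<forall>x \<in> carrier P. act_map P (\<iota> x) = x"
  shows "induces_on_homology
           (Tr A P) (Tr_grade A P) (Tr_diff A P)
           (Tr A (shift 1 P)) (Tr_grade A (shift 1 P)) (Tr_diff A (shift 1 P))
           (trace_connes K A P \<mu> t \<eta> \<iota>) \<and>
         (\<forall>\<phi>. comparison_map A (Bar K A) (bar_aug A) P \<mu> \<phi> \<longrightarrow>
           (\<forall>n :: int. \<forall>X \<in> carrier (HH K A n).
              Tr_homology_map A (shift 1 P) n (trace_connes K A P \<mu> t \<eta> \<iota>)
                (Tr_homology_map A P n (Tr_map A P \<phi>) X) =
              Tr_homology_map A P (n + 1) (Tr_map A P \<phi>) (connes_HH K A n X)))"
proof -
  interpret contraction K A P \<mu> t \<eta> \<iota>
    by (intro contraction.intro contraction_axioms.intro assms)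
  show ?thesis
  proof (intro conjI allI impI ballI)
    fix \<phi> n X
    assume "comparison_map A (Bar K A) (bar_aug A) P \<mu> \<phi>"
    then interpret comparison K A P \<mu> t \<eta> \<iota> \<phi> by unfold_locales
    show "Tr_homology_map A (shift 1 P) n (trace_connes K A P \<mu> t \<eta> \<iota>) (Tr_homology_map A P n (Tr_map A P \<phi>) X) =
        Tr_homology_map A P (n + 1) (Tr_map A P \<phi>) (connes_HH K A n X)"
      if "X \<in> carrier (HH K A n)" by (rule connes_homology[OF that])
  qed (rule connes_induces)
qed

end
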